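(* Let $u(t,x)$ be the solution to $\mathrm{i}\varepsilon\,\partial_t u+\frac{\varepsilon^2}{2}\Delta u=\varepsilon\lambda|u|^2u$ on $\mathbb{T}^d$ with initial data $u(0,x)=\sum_{m=1}^M a_m^0(x)\,\mathrm{e}^{\mathrm{i}\kappa_m\cdot x/\varepsilon}$, with wave vectors $\kappa_m$ for which Assumptions 1 and 2 of the context are fulfilled. Then, with the notation $\kappa_r,\omega_r$ $(r=1,\dots,R)$, $\mathcal{N}$, $\kappa_\nu,\omega_\nu,\omega_\nu^\star,\delta_\nu$ $(\nu\in\mathcal{N})$ of the context, $u$ admits a modulated Fourier expansion $u(t,x)=u_{\mathrm{MFE}}(t,x)+e(t,x)$, where $$u_{\mathrm{MFE}}(t,x)=\sum_{r=1}^R a_r(t,x)\,\mathrm{e}^{\mathrm{i}(\kappa_r\cdot x-\omega_rt)/\varepsilon}+\varepsilon\lambda\sum_{\nu\in\mathcal{N}}b_\nu^\star(t,x)\,\mathrm{e}^{\mathrm{i}(\kappa_\nu\cdot x-\omega_\nu^\star t)/\varepsilon}+\varepsilon\lambda\sum_{\nu\in\mathcal{N}}b_\nu(t,x)\,\mathrm{e}^{\mathrm{i}(\kappa_\nu\cdot x-\omega_\nu t)/\varepsilon},$$ with the following modulation functions. The functions $a_r$ solve the system of advected nonlinear Schrödinger equations $$\partial_ta_r+\kappa_r\cdot\nabla_xa_r-\tfrac12\mathrm{i}\varepsilon\Delta_xa_r=-\mathrm{i}\lambda\sum_{\substack{i,j,k=1,\dots,R:\\ \kappa_i-\kappa_j+\kappa_k=\kappa_r}}a_i\bar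 a_ja_k-2\mathrm{i}\varepsilon\lambda^2\sum_{\substack{\nu\in\mathcal{N},\ p,q=1,\dots,R:\\ \kappa_\nu-\kappa_p+\kappa_q=\kappa_r}}b_\nu\bar a_pa_q-\mathrm{i}\varepsilon\lambda^2\sum_{\substack{\nu\in\mathcal{N},\ p,q=1,\dots,R:\\ \kappa_p-\kappa_\nu+\kappa_q=\kappa_r}}a_p\bar b_\nu a_q,$$ $a_r(0,x)=a_r^0(x)$, where the initial data $a_r^0$ are the given ones for $r=1,\dots,M$ and are zero for $r=M+1,\dots,R$. The functions $b_\nu$ for $\nu=(i,j,k)\in\mathcal{N}$ are defined by $$b_\nu(t,x)=\frac1{\delta_\nu}(a_i\bar a_ja_k)(t,x),$$ which turns the system for the $a_r$ into a quintic nonlinear Schrödinger system. The function $b_\nu$ is an $\mathcal{O}(\varepsilon)$ approximation to the solution of the advected linear Schrödinger equation obtained by replacing $b_\nu$ with the unknown $b$ in $$\partial_tb+\kappa_\nu\cdot\nabla_xb-\tfrac12\mathrm{i}\varepsilon\Delta_xb-\frac{\mathrm{i}\delta_\nu}{\varepsilon}b=-\frac{\mathrm{i}}{\varepsilon}a_i\bar a_ja_k,\qquad b(0,x)=\frac1{\delta_\nu}(a_i\bar a_ja_k)(0,x).$$ The function $b_\nu^\star$ is the solution of $$\partial_tb_\nu^\star+\kappa_\nu\cdot\nabla_xb_\nu^\star-\tfrac12\mathrm{i}\varepsilon\Delta_xb_\nu^\star=-2\mathrm{i}\lambda\sum_{r=1}^R|a_r|^2\,b_\nu^\star,\qquad b_\nu^\star(0,x)=-b_\nu(0,x).$$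 The modulation functions $a_r$, $b_\nu$, $b_\nu^\star$ are smooth in the sense that the functions and all their partial derivatives of arbitrary order are bounded independently of $\varepsilon$ and $(t,x)\in[0,T]\times\mathbb{T}^d$, for a time $T>0$ on which a solution $(a_1,\dots,a_R)$ exists of the initial value problem $$\partial_ta_r+\kappa_r\cdot\nabla_xa_r-\tfrac12\mathrm{i}\varepsilon\Delta_xa_r=-\mathrm{i}\lambda\sum_{\substack{i,j,k=1,\dots,R:\\ \kappa_i-\kappa_j+\kappa_k=\kappa_r}}a_i\bar a_ja_k-2\mathrm{i}\varepsilon\lambda^2\sum_{\substack{\nu\in\mathcal{N},\ p,q=1,\dots,R:\\ \kappa_\nu-\kappa_p+\kappa_q=\kappa_r}}b_\nu\bar a_pa_q-\mathrm{i}\varepsilon\lambda^2\sum_{\substack{\nu\in\mathcal{N},\ p,q=1,\dots,R:\\ \kappa_p-\kappa_\nu+\kappa_q=\kappa_r}}a_p\bar b_\nu a_q,\qquad a_r(0,x)=a_r^0(x),\qquad r=1,\dots,R$$ (with the formula $b_\nu=\frac1{\delta_\nu}a_i\bar a_ja_k$ for $\nu=(i,j,k)\in\mathcal{N}$ inserted). With these functions, the error is bounded by $$\|e\|_{C([0,T]\times\mathbb{T}^d)}\le C\varepsilon^2.$$ Both $T$ and $C$ are independent of $\varepsilon\in(0,\varepsilon_0)$ for some $\varepsilon_0>0$, but they depend on the given wave vectors $\kappa_m$, and $C$ depends on $T$.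
   Context: Setting. $\mathbb{T}^d=(\mathbb{R}/2\pi\mathbb{Z})^d$, $\lambda$ is a fixed nonzero real number, $0<\varepsilon\ll1$ takes only values for which $\kappa_m/\varepsilon\in\mathbb{Z}^d$ for all $m$ (so that the initial data are $2\pi$-periodic). The wave vectors $\kappa_1,\dots,\kappa_M\in\mathbb{R}^d\setminus\{0\}$ are fixed and pairwise different, with $\omega_m=\tfrac12|\kappa_m|^2$ ($|\cdot|$ Euclidean norm). The profiles $a_m^0:\mathbb{T}^d\to\mathbb{C}$ are smooth, i.e. have arbitrarily many derivatives bounded independently of $\varepsilon$. Resonance. Given wave vectors $\kappa_1,\dots,\kappa_R$ with $\omega_r=\tfrac12|\kappa_r|^2$ and a multi-index $\mu=(m_0,\dots,m_{2l})$ of indices in $\{1,\dots,R\}$, put $\kappa_\mu=\sum_{i=0}^{2l}(-1)^i\kappa_{m_i}$ and $\omega_\mu=\sum_{i=0}^{2l}(-1)^i\omega_{m_i}$. The multi-index $\mu$ is called resonant if $\omega_\mu=\tfrac12|\kappa_\mu|^2$, and nonresonant otherwise. For a triple $\mu=(i,j,k)$ and indices $p,q$, $(\mu,p,q)$ and $(p,\mu,q)$ denote the concatenated multi-indices of length 5, so $\kappa_{(\mu,p,q)}=\kappa_\mu-\kappa_p+\kappa_q$, $\omega_{(\mu,p,q)}=\omega_\mu-\omega_p+\omega_q$, and $\kappa_{(p,\mu,q)}=\kappa_p-\kappa_\mu+\kappa_q$, $\omega_{(p,\mu,q)}=\omega_p-\omega_\mu+\omega_q$. Augmentation. Given a finite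 set $K=\{\kappa_1,\dots,\kappa_R\}$ with $\omega_r=\tfrac12|\kappa_r|^2$, the set $\widehat K\supseteq K$ is obtained by adding, for all $\mu=(i,j,k)\in\{1,\dots,R\}^3$ and $p,q\in\{1,\dots,R\}$: (i) $\kappa_\mu$, if $\mu$ is resonant and $\kappa_\mu\notin K$; (ii) $\kappa_{(\mu,p,q)}$, if $\mu$ is nonresonant, $(\mu,p,q)$ is resonant and $\kappa_{(\mu,p,q)}\notin K$; and $\kappa_{(p,\mu,q)}$, if $\mu$ is nonresonant, $(p,\mu,q)$ is resonant and $\kappa_{(p,\mu,q)}\notin K$. To every element $\kappa_r$ of $\widehat K$ one associates $\omega_r=\tfrac12|\kappa_r|^2$. Set $K_0=\{\kappa_1,\dots,\kappa_M\}$ and $K_{k+1}=\widehat{K_k}$. Assumption 1 (saturation). There is an integer $k_\star\ge0$ with $K_{k_\star+1}=K_{k_\star}$. Then write $K=K_{k_\star}=\{\kappa_1,\dots,\kappa_M,\kappa_{M+1},\dots,\kappa_R\}$ with $\omega_r=\tfrac12|\kappa_r|^2$ for $r=1,\dots,R$. Let $\mathcal{N}$ be the set of all nonresonant triples $\nu=(i,j,k)\in\{1,\dots,R\}^3$. For $\nu=(i,j,k)\in\mathcal{N}$, $\kappa_\nu=\kappa_i-\kappa_j+\kappa_k$, $\omega_\nu=\omega_i-\omega_j+\omega_k$, $\omega_\nu^\star=\tfrac12|\kappa_\nu|^2$, and $\delta_\nu=\omega_\nu-\omega_\nu^\star\neq0$. Assumption 2 (nonresonance). For all $\nu\in\mathcal{N}$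 and all $p,q,r=1,\dots,R$ with $q\ne r$, $$\omega_\nu^\star-\omega_q+\omega_r\neq\tfrac12|\kappa_\nu-\kappa_q+\kappa_r|^2\quad\text{and}\quad\omega_p-\omega_\nu^\star+\omega_r\neq\tfrac12|\kappa_p-\kappa_\nu+\kappa_r|^2.$$
   Formalization: In the two quintic sums only those (ν,p,q) resp. (p,ν,q) that are also resonant are kept (with all of them the error can be of size ε); "a time T on which a solution exists" means existence for all small ε with a common bound on |a_r|, and such a T is shown to exist. *)

theory Defs
  imports "HOL-Analysis.Analysis"
begin

section \<open>Wave vectors, resonance, saturation\<close>

definition omega :: "real^'d \<Rightarrow> real" where
  "omega k = (1/2) * (norm k)\<^sup>2"

text \<open>A multi-index \<open>(m\<^sub>0,\<dots>,m\<^sub>2\<^sub>l)\<close> is represented by the list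
  \<open>[\<kappa> m\<^sub>0, \<dots>, \<kappa> m\<^sub>2\<^sub>l]\<close> of its wave vectors, on which everything below depends.
  The concatenations \<open>(\<mu>,p,q)\<close> and \<open>(p,\<mu>,q)\<close> of the triple \<open>\<mu> = (i,j,k)\<close> are
  \<open>[\<kappa> i, \<kappa> j, \<kappa> k, \<kappa> p, \<kappa> q]\<close> and \<open>[\<kappa> p, \<kappa> i, \<kappa> j, \<kappa> k, \<kappa> q]\<close>.\<close>

definition wave_sum :: "(real^'d) list \<Rightarrow> real^'d" where
  "wave_sum ks = (\<Sum>i<length ks. (-1)^i *\<^sub>R (ks ! i))"

definition freq_sum :: "(real^'d) list \<Rightarrow> real" where
  "freq_sum ks = (\<Sum>i<length ks. (-1)^i * omega (ks ! i))"

definition resonant :: "(real^'d) list \<Rightarrow> bool" where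
  "resonant ks \<longleftrightarrow> freq_sum ks = omega (wave_sum ks)"

definition augment :: "(real^'d) set \<Rightarrow> (real^'d) set" where
  "augment K = K
     \<union> {wave_sum [x, y, z] | x y z. {x, y, z} \<subseteq> K \<and> resonant [x, y, z]}
     \<union> {wave_sum [x, y, z, p, q] | x y z p q. {x, y, z, p, q} \<subseteq> K
          \<and> \<not> resonant [x, y, z] \<and> resonant [x, y, z, p, q]}
     \<union> {wave_sum [p, x, y, z, q] | x y z p q. {x, y, z, p, q} \<subseteq> K
          \<and> \<not> resonant [x, y, z] \<and> resonant [p, x, y, z, q]}"

definition saturated :: "(nat \<Rightarrow> real^'d) \<Rightarrow> nat \<Rightarrow> nat \<Rightarrow> bool" where
  "saturated \<kappa> M R \<longleftrightarrow>
     (\<exists>k. (augment ^^ Suc k) (\<kappa> ` {1..M}) = (augment ^^ k) (\<kappa> ` {1..M})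
        \<and> \<kappa> ` {1..R} = (augment ^^ k) (\<kappa> ` {1..M}))"

type_synonym triple = "nat \<times> nat \<times> nat"

definition nonres :: "(nat \<Rightarrow> real^'d) \<Rightarrow> nat \<Rightarrow> triple set" where
  "nonres \<kappa> R =
     {(i, j, k). i \<in> {1..R} \<and> j \<in> {1..R} \<and> k \<in> {1..R} \<and> \<not> resonant [\<kappa> i, \<kappa> j, \<kappa> k]}"

fun waves :: "(nat \<Rightarrow> real^'d) \<Rightarrow> triple \<Rightarrow> (real^'d) list" where
  "waves \<kappa> (i, j, k) = [\<kappa> i, \<kappa> j, \<kappa> k]"

definition kap :: "(nat \<Rightarrow> real^'d) \<Rightarrow> triple \<Rightarrow> real^'d" where
  "kap \<kappa> \<nu> = wave_sum (waves \<kappa> \<nu>)"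

definition omeg :: "(nat \<Rightarrow> real^'d) \<Rightarrow> triple \<Rightarrow> real" where
  "omeg \<kappa> \<nu> = freq_sum (waves \<kappa> \<nu>)"

definition omeg_star :: "(nat \<Rightarrow> real^'d) \<Rightarrow> triple \<Rightarrow> real" where
  "omeg_star \<kappa> \<nu> = omega (kap \<kappa> \<nu>)"

definition delta :: "(nat \<Rightarrow> real^'d) \<Rightarrow> triple \<Rightarrow> real" where
  "delta \<kappa> \<nu> = omeg \<kappa> \<nu> - omeg_star \<kappa> \<nu>"

definition nonresonance :: "(nat \<Rightarrow> real^'d) \<Rightarrow> nat \<Rightarrow> bool" where
  "nonresonance \<kappa> R \<longleftrightarrow>
     (\<forall>\<nu>\<in>nonres \<kappa> R. \<forall>p\<in>{1..R}. \<forall>q\<in>{1..R}. \<forall>r\<in>{1..R}. q \<noteq> r \<longrightarrow>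
        omeg_star \<kappa> \<nu> - omega (\<kappa> q) + omega (\<kappa> r) \<noteq> omega (kap \<kappa> \<nu> - \<kappa> q + \<kappa> r) \<and>
        omega (\<kappa> p) - omeg_star \<kappa> \<nu> + omega (\<kappa> r) \<noteq> omega (\<kappa> p - kap \<kappa> \<nu> + \<kappa> r))"

text \<open>The values of \<open>\<epsilon>\<close> below \<open>\<epsilon>0\<close> for which the initial data are \<open>2\<pi>\<close>-periodic.\<close>

definition eps_set :: "(nat \<Rightarrow> real^'d) \<Rightarrow> nat \<Rightarrow> real \<Rightarrow> real set" where
  "eps_set \<kappa> M \<epsilon>0 = {\<epsilon>. 0 < \<epsilon> \<and> \<epsilon> < \<epsilon>0 \<and> (\<forall>m\<in>{1..M}. \<forall>j. (\<kappa> m $ j) / \<epsilon> \<in> \<int>)}"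


section \<open>Periodic smooth functions\<close>

text \<open>Functions on the torus are \<open>2\<pi>\<close>-periodic functions on \<open>\<real>\<^sup>d\<close>.\<close>

definition periodic :: "(real^'d \<Rightarrow> complex) \<Rightarrow> bool" where
  "periodic f \<longleftrightarrow> (\<forall>x j. f (x + axis j (2*pi)) = f x)"

text \<open>Partial derivative in a coordinate direction, taken relative to the domain \<open>S\<close>;
  on \<open>[0,T] \<times> \<real>\<^sup>d\<close> the time derivatives at \<open>0\<close> and \<open>T\<close> are thus one-sided.\<close>

definition partial :: "'v::euclidean_space set \<Rightarrow> 'v \<Rightarrow> ('v \<Rightarrow> complex) \<Rightarrow> 'v \<Rightarrow> complex" where
  "partial S v f z = vector_derivative (\<lambda>h. f (z + h *\<^sub>R v)) (at 0 within {h. z + h *\<^sub>R v \<in> S})"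

definition has_partial :: "'v::euclidean_space set \<Rightarrow> 'v \<Rightarrow> ('v \<Rightarrow> complex) \<Rightarrow> 'v \<Rightarrow> bool" where
  "has_partial S v f z \<longleftrightarrow> (\<lambda>h. f (z + h *\<^sub>R v)) differentiable (at 0 within {h. z + h *\<^sub>R v \<in> S})"

primrec partials :: "'v::euclidean_space set \<Rightarrow> 'v list \<Rightarrow> ('v \<Rightarrow> complex) \<Rightarrow> 'v \<Rightarrow> complex" where
  "partials S [] f = f"
| "partials S (v # vs) f = partial S v (partials S vs f)"

definition smooth_on :: "'v::euclidean_space set \<Rightarrow> ('v \<Rightarrow> complex) \<Rightarrow> bool" where
  "smooth_on S f \<longleftrightarrow> (\<forall>vs. set vs \<subseteq> Basis \<longrightarrow>
     continuous_on S (partials S vs f) \<and> (\<forall>v\<in>Basis. \<forall>z\<in>S. has_partial S v (partials S vs f) z))"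

definition uniformly_smooth ::
  "real set \<Rightarrow> 'v::euclidean_space set \<Rightarrow> (real \<Rightarrow> 'v \<Rightarrow> complex) \<Rightarrow> bool" where
  "uniformly_smooth E S f \<longleftrightarrow> (\<forall>\<epsilon>\<in>E. smooth_on S (f \<epsilon>)) \<and>
     (\<forall>vs. set vs \<subseteq> Basis \<longrightarrow> (\<exists>C. \<forall>\<epsilon>\<in>E. \<forall>z\<in>S. norm (partials S vs (f \<epsilon>) z) \<le> C))"

definition slab :: "real \<Rightarrow> (real \<times> (real^'d)) set" where
  "slab T = {0..T} \<times> UNIV"

definition smooth_periodic :: "real \<Rightarrow> (real \<times> (real^'d) \<Rightarrow> complex) \<Rightarrow> bool" where
  "smooth_periodic T f \<longleftrightarrow> smooth_on (slab T) f \<and> (\<forall>t\<in>{0..T}. periodic (\<lambda>x. f (t, x)))"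

abbreviation dt :: "real \<Rightarrow> (real \<times> (real^'d) \<Rightarrow> complex) \<Rightarrow> real \<times> (real^'d) \<Rightarrow> complex" where
  "dt T \<equiv> partial (slab T) (1, 0)"

abbreviation dx :: "real \<Rightarrow> 'd \<Rightarrow> (real \<times> (real^'d) \<Rightarrow> complex) \<Rightarrow> real \<times> (real^'d) \<Rightarrow> complex" where
  "dx T j \<equiv> partial (slab T) (0, axis j 1)"

definition laplace :: "real \<Rightarrow> (real \<times> (real^'d) \<Rightarrow> complex) \<Rightarrow> real \<times> (real^'d) \<Rightarrow> complex" where
  "laplace T f z = (\<Sum>j\<in>UNIV. dx T j (dx T j f) z)"


section \<open>The equations\<close>

definition wave :: "real \<Rightarrow> real^'d \<Rightarrow> real \<Rightarrow> real \<times> (real^'d) \<Rightarrow> complex" where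
  "wave \<epsilon> k w z = cis ((k \<bullet> snd z - w * fst z) / \<epsilon>)"

definition nls_solution ::
  "real \<Rightarrow> real \<Rightarrow> real \<Rightarrow> (real^'d \<Rightarrow> complex) \<Rightarrow> (real \<times> (real^'d) \<Rightarrow> complex) \<Rightarrow> bool" where
  "nls_solution lam \<epsilon> T u0 u \<longleftrightarrow> smooth_periodic T u \<and> (\<forall>x. u (0, x) = u0 x) \<and>
     (\<forall>z\<in>slab T. \<i> * of_real \<epsilon> * dt T u z + of_real (\<epsilon>\<^sup>2 / 2) * laplace T u z
        = of_real (\<epsilon> * lam * (cmod (u z))\<^sup>2) * u z)"

definition initial_wave ::
  "(nat \<Rightarrow> real^'d) \<Rightarrow> nat \<Rightarrow> real \<Rightarrow> (nat \<Rightarrow> real^'d \<Rightarrow> complex) \<Rightarrow> real^'d \<Rightarrow> complex" where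
  "initial_wave \<kappa> M \<epsilon> a0 x = (\<Sum>m\<in>{1..M}. a0 m x * cis ((\<kappa> m \<bullet> x) / \<epsilon>))"

text \<open>The advected Schroedinger operator
  \<open>\<partial>\<^sub>t f + k \<cdot> \<nabla>\<^sub>x f - \<onehalf> i \<epsilon> \<Delta>\<^sub>x f\<close>.\<close>

definition advected ::
  "real \<Rightarrow> real \<Rightarrow> real^'d \<Rightarrow> (real \<times> (real^'d) \<Rightarrow> complex) \<Rightarrow> real \<times> (real^'d) \<Rightarrow> complex" where
  "advected T \<epsilon> k f z =
     dt T f z + (\<Sum>j\<in>UNIV. of_real (k $ j) * dx T j f z) - (1/2) * \<i> * of_real \<epsilon> * laplace T f z"

fun cubic :: "(nat \<Rightarrow> real \<times> (real^'d) \<Rightarrow> complex) \<Rightarrow> triple \<Rightarrow> real \<times> (real^'d) \<Rightarrow> complex" where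
  "cubic a (i, j, k) z = a i z * cnj (a j z) * a k z"

definition b_mod ::
  "(nat \<Rightarrow> real^'d) \<Rightarrow> (nat \<Rightarrow> real \<times> (real^'d) \<Rightarrow> complex) \<Rightarrow> triple \<Rightarrow> real \<times> (real^'d) \<Rightarrow> complex" where
  "b_mod \<kappa> a \<nu> z = of_real (1 / delta \<kappa> \<nu>) * cubic a \<nu> z"

text \<open>The quintic sums collect the terms oscillating like \<open>wave \<epsilon> (\<kappa> r) (omega (\<kappa> r))\<close>.
  A multi-index \<open>(\<nu>,p,q)\<close> or \<open>(p,\<nu>,q)\<close> contributes if its wave vector is \<open>\<kappa> r\<close> and it is
  resonant, so that its frequency is \<open>omega (\<kappa> r)\<close>. The wave vector alone does not determine the
  frequency: for \<open>d = 1\<close> and the wave vectors \<open>-14, 12, -19, 5, 8, -34\<close>, which satisfy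
  \<^const>\<open>saturated\<close> (with \<open>R = M = 6\<close>) and \<^const>\<open>nonresonance\<close>, we have
  \<open>(-14) - 5 + 12 - 8 + (-19) = -34\<close>, but this multi-index is not resonant; with such a term in
  the equation the error would be of size \<open>\<epsilon>\<close> only. In the cubic sum no such condition is needed,
  because \<^const>\<open>nonresonance\<close> implies that \<open>kap \<kappa> \<nu>\<close> is none of the \<open>\<kappa> r\<close>.\<close>

definition cubic_set :: "(nat \<Rightarrow> real^'d) \<Rightarrow> nat \<Rightarrow> nat \<Rightarrow> triple set" where
  "cubic_set \<kappa> R r = {(i, j, k). i \<in> {1..R} \<and> j \<in> {1..R} \<and> k \<in> {1..R} \<and>
     \<kappa> i - \<kappa> j + \<kappa> k = \<kappa> r}"

definition quintic_set1 :: "(nat \<Rightarrow> real^'d) \<Rightarrow> nat \<Rightarrow> nat \<Rightarrow> (triple \<times> nat \<times> nat) set" where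
  "quintic_set1 \<kappa> R r = {(\<nu>, p, q). \<nu> \<in> nonres \<kappa> R \<and> p \<in> {1..R} \<and> q \<in> {1..R} \<and>
     kap \<kappa> \<nu> - \<kappa> p + \<kappa> q = \<kappa> r \<and> resonant (waves \<kappa> \<nu> @ [\<kappa> p, \<kappa> q])}"

definition quintic_set2 :: "(nat \<Rightarrow> real^'d) \<Rightarrow> nat \<Rightarrow> nat \<Rightarrow> (triple \<times> nat \<times> nat) set" where
  "quintic_set2 \<kappa> R r = {(\<nu>, p, q). \<nu> \<in> nonres \<kappa> R \<and> p \<in> {1..R} \<and> q \<in> {1..R} \<and>
     \<kappa> p - kap \<kappa> \<nu> + \<kappa> q = \<kappa> r \<and> resonant ([\<kappa> p] @ waves \<kappa> \<nu> @ [\<kappa> q])}"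

definition a_solution ::
  "real \<Rightarrow> (nat \<Rightarrow> real^'d) \<Rightarrow> nat \<Rightarrow> nat \<Rightarrow> real \<Rightarrow> real \<Rightarrow> (nat \<Rightarrow> real^'d \<Rightarrow> complex)
     \<Rightarrow> (nat \<Rightarrow> real \<times> (real^'d) \<Rightarrow> complex) \<Rightarrow> bool" where
  "a_solution lam \<kappa> M R \<epsilon> T a0 a \<longleftrightarrow> (\<forall>r\<in>{1..R}. smooth_periodic T (a r) \<and>
     (\<forall>x. a r (0, x) = (if r \<le> M then a0 r x else 0)) \<and>
     (\<forall>z\<in>slab T. advected T \<epsilon> (\<kappa> r) (a r) z =
        - \<i> * of_real lam * (\<Sum>\<mu>\<in>cubic_set \<kappa> R r. cubic a \<mu> z)
        - 2 * \<i> * of_real (\<epsilon> * lam\<^sup>2) *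
            (\<Sum>(\<nu>, p, q)\<in>quintic_set1 \<kappa> R r. b_mod \<kappa> a \<nu> z * cnj (a p z) * a q z)
        - \<i> * of_real (\<epsilon> * lam\<^sup>2) *
            (\<Sum>(\<nu>, p, q)\<in>quintic_set2 \<kappa> R r. a p z * cnj (b_mod \<kappa> a \<nu> z) * a q z)))"

definition b_star_solution ::
  "real \<Rightarrow> (nat \<Rightarrow> real^'d) \<Rightarrow> nat \<Rightarrow> real \<Rightarrow> real \<Rightarrow> (nat \<Rightarrow> real \<times> (real^'d) \<Rightarrow> complex) \<Rightarrow> triple
     \<Rightarrow> (real \<times> (real^'d) \<Rightarrow> complex) \<Rightarrow> bool" where
  "b_star_solution lam \<kappa> R \<epsilon> T a \<nu> bs \<longleftrightarrow> smooth_periodic T bs \<and>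
     (\<forall>x. bs (0, x) = - b_mod \<kappa> a \<nu> (0, x)) \<and>
     (\<forall>z\<in>slab T. advected T \<epsilon> (kap \<kappa> \<nu>) bs z =
        - 2 * \<i> * of_real lam * (\<Sum>r\<in>{1..R}. of_real ((cmod (a r z))\<^sup>2)) * bs z)"

definition b_linear_solution ::
  "(nat \<Rightarrow> real^'d) \<Rightarrow> real \<Rightarrow> real \<Rightarrow> (nat \<Rightarrow> real \<times> (real^'d) \<Rightarrow> complex) \<Rightarrow> triple
     \<Rightarrow> (real \<times> (real^'d) \<Rightarrow> complex) \<Rightarrow> bool" where
  "b_linear_solution \<kappa> \<epsilon> T a \<nu> b \<longleftrightarrow> smooth_periodic T b \<and>
     (\<forall>x. b (0, x) = of_real (1 / delta \<kappa> \<nu>) * cubic a \<nu> (0, x)) \<and>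
     (\<forall>z\<in>slab T. advected T \<epsilon> (kap \<kappa> \<nu>) b z - \<i> * of_real (delta \<kappa> \<nu> / \<epsilon>) * b z =
        - (\<i> / of_real \<epsilon>) * cubic a \<nu> z)"

definition u_mfe ::
  "real \<Rightarrow> (nat \<Rightarrow> real^'d) \<Rightarrow> nat \<Rightarrow> real \<Rightarrow> (nat \<Rightarrow> real \<times> (real^'d) \<Rightarrow> complex)
     \<Rightarrow> (triple \<Rightarrow> real \<times> (real^'d) \<Rightarrow> complex) \<Rightarrow> real \<times> (real^'d) \<Rightarrow> complex" where
  "u_mfe lam \<kappa> R \<epsilon> a bs z =
     (\<Sum>r\<in>{1..R}. a r z * wave \<epsilon> (\<kappa> r) (omega (\<kappa> r)) z)
     + of_real (\<epsilon> * lam) * (\<Sum>\<nu>\<in>nonres \<kappa> R. bs \<nu> z * wave \<epsilon> (kap \<kappa> \<nu>) (omeg_star \<kappa> \<nu>) z)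
     + of_real (\<epsilon> * lam) * (\<Sum>\<nu>\<in>nonres \<kappa> R. b_mod \<kappa> a \<nu> z * wave \<epsilon> (kap \<kappa> \<nu>) (omeg \<kappa> \<nu>) z)"

text \<open>\<open>u\<close> satisfies \<open>P\<close>, and is on \<open>[0,T] \<times> \<real>\<^sup>d\<close> the only function that does.\<close>

definition unique_solution ::
  "real \<Rightarrow> ((real \<times> (real^'d) \<Rightarrow> complex) \<Rightarrow> bool) \<Rightarrow> (real \<times> (real^'d) \<Rightarrow> complex) \<Rightarrow> bool" where
  "unique_solution T P u \<longleftrightarrow> P u \<and> (\<forall>v. P v \<longrightarrow> (\<forall>z\<in>slab T. v z = u z))"

text \<open>\<open>T\<close> is a time, independent of \<open>\<epsilon>\<close>, on which solutions of the modulation system exist for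
  all small \<open>\<epsilon>\<close>. That they exist uniformly in \<open>\<epsilon>\<close> includes a common bound on their absolute values
  (not on derivatives): without it, the limit system for \<open>\<epsilon> \<longrightarrow> 0\<close> need not have a solution
  on \<open>[0,T]\<close>.\<close>

definition existence_time ::
  "real \<Rightarrow> (nat \<Rightarrow> real^'d) \<Rightarrow> nat \<Rightarrow> nat \<Rightarrow> (real \<Rightarrow> nat \<Rightarrow> real^'d \<Rightarrow> complex) \<Rightarrow> real \<Rightarrow> bool" where
  "existence_time lam \<kappa> M R a0 T \<longleftrightarrow> 0 < T \<and> (\<exists>\<epsilon>0>0. \<exists>B. \<forall>\<epsilon>\<in>eps_set \<kappa> M \<epsilon>0.
     \<exists>a. a_solution lam \<kappa> M R \<epsilon> T (a0 \<epsilon>) a \<and> (\<forall>r\<in>{1..R}. \<forall>z\<in>slab T. cmod (a r z) \<le> B))"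

end

(* On the torus the equations are solved in the algebra of absolutely convergent Fourier series, where
   products are bounded and the Schroedinger flows are isometries. The weights (1 + |n|)^s give tame
   estimates, so that polynomial systems truncated at a fixed radius have global solutions with bounds
   in all weighted norms that do not depend on eps.

   A common bound on the absolute values of the a_r controls these norms: the solution of a system
   truncated at a large radius satisfies, with the Laplacian and the quintic terms treated as a forcing
   of size eps, a transport equation, and along its characteristics the spatial derivatives are bounded
   one after the other, because the cubic term is linear in the derivative of highest order. For small
   eps the truncation is therefore never active.

   Inserting the expansion into the equation, the cubic terms of order one cancel. Of the terms of order
   eps, those on the dispersion relation cancel by the quintic sums and by the equation for b_star, using
   saturation and nonresonance; all others oscillate off the dispersion relation and are removed by a
   corrector of size eps^2. The expansion thus satisfies the equation up to a defect of size eps^2, and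
   Gronwall's inequality for the truncated equation gives existence on [0,T] and the error bound. *)

theory Submission
  imports Defs
begin

text \<open>The hypothesis on \<open>T\<close> bounds only the absolute values of the amplitudes,
  and a sup bound is not propagated by the Schroedinger flows; the Wiener norm is propagated, but
  the sup norm does not control it. The bridge is to treat \<open>eps\<close> times the Laplacian as
  a perturbation. That costs two derivatives and so presupposes bounds on derivatives. The order of
  the choices avoids the circle: the truncation radius comes from a chain of constants that sees
  only the sup bound and the data; the truncated solution then has all weighted norms bounded in
  terms of this radius; only afterwards is \<open>eps\<close> taken so small that the perturbation
  is at most one in the norms that the chain uses. The truncation multiplies by a factor at most
  one. It increases no weighted norm, so a truncated polynomial grows at most linearly in the higher
  norms. The carrier waves oscillate at scale \<open>eps\<close>, so in the error analysis only the
  unweighted norm is bounded uniformly in \<open>eps\<close>; it dominates the sup norm of the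
  error.\<close>

section \<open>Dominated convergence for series\<close>

text \<open>A finite set of indices carries the sum of \<open>g\<close> up to \<open>e/4\<close>. On
  it the limit is taken term by term, and the domination by \<open>g\<close> makes the remaining
  part small for all \<open>h\<close> at once.\<close>

lemma summable_dominated_tendsto_0:
  fixes f :: "'h \<Rightarrow> 'i \<Rightarrow> real"
  assumes lim: "\<And>n. ((\<lambda>h. f h n) \<longlongrightarrow> 0) F"
    and dom: "eventually (\<lambda>h. \<forall>n. 0 \<le> f h n \<and> f h n \<le> g n) F"
    and g: "g summable_on UNIV"
  shows "((\<lambda>h. infsum (f h) UNIV) \<longlongrightarrow> 0) F"
proof (rule tendstoI)
  fix e :: real assume e: "e > 0"
  obtain A where A: "finite A" and close: "dist (sum g A) (infsum g UNIV) \<le> e/4"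
    using infsum_finite_approximation[OF g, of "e/4"] e by auto
  have "((\<lambda>h. \<Sum>n\<in>A. f h n) \<longlongrightarrow> (\<Sum>n\<in>A. 0)) F"
    by (intro tendsto_sum lim)
  then have "eventually (\<lambda>h. dist (\<Sum>n\<in>A. f h n) 0 < e/2) F"
    using tendstoD[of "\<lambda>h. \<Sum>n\<in>A. f h n" 0 F "e/2"] e by simp
  then show "eventually (\<lambda>h. dist (infsum (f h) UNIV) 0 < e) F"
    using dom
  proof eventually_elim
    case (elim h)
    have gA: "g summable_on (-A)" and fs: "f h summable_on UNIV"
      using summable_on_subset_banach[OF g] summable_on_comparison_test[OF g, of "f h"] elim by auto
    have fA: "f h summable_on (-A)" using summable_on_subset_banach[OF fs] by auto
    have "infsum g UNIV = infsum g A + infsum g (-A)"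
      using infsum_Un_disjoint[of g A "-A"] A gA by (simp add: Compl_partition)
    then have "infsum g (-A) \<le> e/4" using close A by (auto simp: dist_real_def)
    moreover have "infsum (f h) (-A) \<le> infsum g (-A)"
      using infsum_mono[OF fA gA] elim by auto
    moreover have "infsum (f h) UNIV = infsum (f h) A + infsum (f h) (-A)"
      using infsum_Un_disjoint[of "f h" A "-A"] A fA by (simp add: Compl_partition)
    moreover have "infsum (f h) UNIV \<ge> 0" using elim by (intro infsum_nonneg) auto
    ultimately show ?case using elim(1) A e by (auto simp: dist_real_def)
  qed
qed

section \<open>The Wiener algebra\<close>

text \<open>The elements are coefficient families and not functions: multipliers then act diagonally
  and equations can be checked one coefficient at a time. The function belonging to an element is
  \<open>synth\<close>.\<close>

typedef (overloaded) 'd::finite wien = "{c :: int^'d \<Rightarrow> complex. (\<lambda>n. norm (c n)) summable_on UNIV}"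
  morphisms coef Wien
  by (rule exI[of _ "\<lambda>_. 0"]) simp

lemma coef_summable: "(\<lambda>n. norm (coef x n)) summable_on UNIV"
  using coef[of x] by simp

lemma wien_eqI: "(\<And>n. coef x n = coef y n) ==> x = y"
  by (simp add: coef_inject[symmetric] fun_eq_iff)

lemma coef_Wien: "(\<lambda>n. norm (c n)) summable_on UNIV ==> coef (Wien c) = c"
  by (simp add: Wien_inverse)

lemma coef_Wien_le:
  assumes "g summable_on UNIV" "\<And>n. norm (c n) \<le> (g n :: real)"
  shows "coef (Wien c) = c"
  by (rule coef_Wien) (rule summable_on_comparison_test[OF assms(1)], use assms in auto)

instantiation wien :: (finite) real_vector
begin

definition zero_wien where "(0::'a wien) = Wien (\<lambda>_. 0)"
definition plus_wien where "(x::'a wien) + y = Wien (\<lambda>n. coef x n + coef y n)"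
definition minus_wien where "(x::'a wien) - y = Wien (\<lambda>n. coef x n - coef y n)"
definition uminus_wien where "- (x::'a wien) = Wien (\<lambda>n. - coef x n)"
definition scaleR_wien where "scaleR r (x::'a wien) = Wien (\<lambda>n. r *\<^sub>R coef x n)"

lemma coef_zero [simp]: "coef (0::'a wien) n = 0"
  by (simp add: zero_wien_def coef_Wien)

lemma coef_plus [simp]: "coef (x + y :: 'a wien) n = coef x n + coef y n"
  unfolding plus_wien_def
  by (subst coef_Wien_le[OF summable_on_add[OF coef_summable[of x] coef_summable[of y]]])
     (auto intro: norm_triangle_ineq)

lemma coef_minus [simp]: "coef (x - y :: 'a wien) n = coef x n - coef y n"
  unfolding minus_wien_def
  by (subst coef_Wien_le[OF summable_on_add[OF coef_summable[of x] coef_summable[of y]]])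
     (auto intro: norm_triangle_ineq4)

lemma coef_uminus [simp]: "coef (- x :: 'a wien) n = - coef x n"
  unfolding uminus_wien_def
  by (subst coef_Wien) (auto intro: coef_summable)

lemma coef_scaleR [simp]: "coef (r *\<^sub>R x :: 'a wien) n = r *\<^sub>R coef x n"
  unfolding scaleR_wien_def
  by (subst coef_Wien_le[OF summable_on_cmult_right[OF coef_summable[of x], of "\<bar>r\<bar>"]]) auto

instance
  by standard (auto intro!: wien_eqI simp: algebra_simps)

end

instantiation wien :: (finite) real_normed_vector
begin

definition norm_wien where "norm (x::'a wien) = infsum (\<lambda>n. norm (coef x n)) UNIV"
definition sgn_wien where "sgn (x::'a wien) = inverse (norm x) *\<^sub>R x"
definition dist_wien where "dist (x::'a wien) y = norm (x - y)"
definition uniformity_wien where "(uniformity :: ('a wien \<times> 'a wien) filter) = (INF e\<in>{0<..}. principal {(x, y). dist x y < e})"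
definition open_wien where "open (S :: 'a wien set) \<longleftrightarrow> (\<forall>x\<in>S. \<forall>\<^sub>F (x', y) in uniformity. x' = x \<longrightarrow> y \<in> S)"

instance
proof
  fix x y :: "'a wien" and r :: real
  show "sgn x = x /\<^sub>R norm x" by (rule sgn_wien_def)
  show "dist x y = norm (x - y)" by (rule dist_wien_def)
  show "(uniformity :: ('a wien \<times> 'a wien) filter) = (INF e\<in>{0<..}. principal {(x, y). dist x y < e})"
    by (rule uniformity_wien_def)
  show "open S \<longleftrightarrow> (\<forall>x\<in>S. \<forall>\<^sub>F (x', y) in uniformity. x' = x \<longrightarrow> y \<in> S)" for S :: "'a wien set"
    by (rule open_wien_def)
  show "norm x = 0 \<longleftrightarrow> x = 0"
  proof
    assume "norm x = 0"
    then have "norm (coef x n) = 0" for n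
      using nonneg_infsum_le_0D[OF _ coef_summable[of x], of n] by (simp add: norm_wien_def)
    then show "x = 0" by (intro wien_eqI) simp
  qed (simp add: norm_wien_def)
  show "norm (x + y) \<le> norm x + norm y"
  proof -
    have "infsum (\<lambda>n. norm (coef (x + y) n)) UNIV \<le> infsum (\<lambda>n. norm (coef x n) + norm (coef y n)) UNIV"
      by (intro infsum_mono coef_summable summable_on_add) (simp add: norm_triangle_ineq)
    also have "\<dots> = norm x + norm y"
      unfolding norm_wien_def by (intro infsum_add coef_summable)
    finally show ?thesis by (simp add: norm_wien_def)
  qed
  show "norm (r *\<^sub>R x) = \<bar>r\<bar> * norm x"
    unfolding norm_wien_def coef_scaleR norm_scaleR by (rule infsum_cmult_right')
qed

end

lemma coef_sum [simp]: "coef (sum f A) n = (\<Sum>a\<in>A. coef (f a) n)"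
  by (induction A rule: infinite_finite_induct) auto

lemma sum_coef_le_norm: "finite A ==> (\<Sum>n\<in>A. norm (coef x n)) \<le> norm x"
  unfolding norm_wien_def by (intro finite_sum_le_infsum coef_summable) auto

lemma coef_le_norm: "norm (coef x n) \<le> norm x"
  using sum_coef_le_norm[of "{n}" x] by simp

lemma norm_wien_le: "(\<And>A. finite A ==> (\<Sum>n\<in>A. norm (coef x n)) \<le> B) ==> norm x \<le> B"
  unfolding norm_wien_def by (rule infsum_le_finite_sums[OF coef_summable]) auto

text \<open>One bound on all finite partial sums gives both that the family is summable and that its
  norm obeys the bound. Shifts, conjugation and limits are introduced in this way.\<close>

lemma Wien_finite_sums:
  assumes "\<And>A. finite A ==> (\<Sum>n\<in>A. norm (c n)) \<le> B"
  shows "coef (Wien c) = c" "norm (Wien c) \<le> B"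
proof -
  have "(\<lambda>n. norm (c n)) summable_on UNIV"
    by (rule nonneg_bdd_above_summable_on) (auto intro!: bdd_aboveI2[of _ _ B] assms)
  then show "coef (Wien c) = c" by (rule coef_Wien)
  then show "norm (Wien c) \<le> B" by (intro norm_wien_le) (simp add: assms)
qed

lemma bounded_linear_coef: "bounded_linear (\<lambda>x. coef x n)"
  by (rule bounded_linear_intro[of _ 1]) (auto simp: coef_le_norm)

instance wien :: (finite) banach
proof
  fix X :: "nat \<Rightarrow> 'a wien"
  assume X: "Cauchy X"
  have "Cauchy (\<lambda>k. coef (X k) n)" for n
    using bounded_linear.Cauchy[OF bounded_linear_coef X] .
  then have conv: "convergent (\<lambda>k. coef (X k) n)" for n by (rule Cauchy_convergent)
  define c where "c n = lim (\<lambda>k. coef (X k) n)" for n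
  have c: "(\<lambda>k. coef (X k) n) \<longlonglongrightarrow> c n" for n
    using conv unfolding c_def by (simp add: convergent_LIMSEQ_iff)
  \<comment> \<open>The Cauchy bound holds for every finite partial sum and passes there to the
    limit, so the coefficientwise limit is a limit in norm.\<close>
  have close: "\<exists>N. \<forall>k\<ge>N. \<forall>A. finite A \<longrightarrow> (\<Sum>n\<in>A. norm (c n - coef (X k) n)) \<le> e" if e: "e > 0" for e :: real
  proof -
    obtain N where N: "\<And>k m. k \<ge> N ==> m \<ge> N ==> norm (X k - X m) < e"
      using CauchyD[OF X e] by blast
    show ?thesis
    proof (intro exI allI impI)
      fix k and A :: "(int^'a) set" assume k: "k \<ge> N" and A: "finite A"
      have "(\<lambda>m. \<Sum>n\<in>A. norm (coef (X m) n - coef (X k) n)) \<longlonglongrightarrow> (\<Sum>n\<in>A. norm (c n - coef (X k) n))"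
        by (intro tendsto_intros c)
      then show "(\<Sum>n\<in>A. norm (c n - coef (X k) n)) \<le> e"
      proof (rule LIMSEQ_le_const2)
        show "\<exists>N. \<forall>m\<ge>N. (\<Sum>n\<in>A. norm (coef (X m) n - coef (X k) n)) \<le> e"
          using N[OF _ k] sum_coef_le_norm[OF A, of "X m - X k" for m]
          by (intro exI[of _ N]) (fastforce intro: order.trans less_imp_le)
      qed
    qed
  qed
  obtain N where N: "\<And>A. finite A ==> (\<Sum>n\<in>A. norm (c n - coef (X N) n)) \<le> 1"
    using close[of 1] by auto
  have cW: "coef (Wien c) = c"
  proof (rule Wien_finite_sums)
    fix A :: "(int^'a) set" assume A: "finite A"
    have "(\<Sum>n\<in>A. norm (c n)) \<le> (\<Sum>n\<in>A. norm (c n - coef (X N) n) + norm (coef (X N) n))"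
      by (intro sum_mono) (metis diff_add_cancel norm_triangle_ineq)
    also have "\<dots> \<le> 1 + norm (X N)"
      using N[OF A] sum_coef_le_norm[OF A, of "X N"] by (simp add: sum.distrib)
    finally show "(\<Sum>n\<in>A. norm (c n)) \<le> 1 + norm (X N)" .
  qed
  have "X \<longlonglongrightarrow> Wien c"
  proof (rule LIMSEQ_I)
    fix r :: real assume r: "0 < r"
    then obtain N where N: "\<And>k A. k \<ge> N ==> finite A ==> (\<Sum>n\<in>A. norm (c n - coef (X k) n)) \<le> r/2"
      using close[of "r/2"] by auto
    have "norm (X k - Wien c) < r" if "k \<ge> N" for k
    proof -
      have "norm (X k - Wien c) \<le> r/2"
        using N[OF that] by (intro norm_wien_le) (simp add: cW norm_minus_commute)
      then show ?thesis using r by simp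
    qed
    then show "\<exists>no. \<forall>n\<ge>no. norm (X n - Wien c) < r" by blast
  qed
  then show "convergent X" by (auto simp: convergent_def)
qed

definition single :: "int^'d \<Rightarrow> complex \<Rightarrow> 'd::finite wien" where
  "single m c = Wien (\<lambda>n. if n = m then c else 0)"

lemma
  fixes m :: "int^'d::finite"
  shows coef_single: "coef (single m c) n = (if n = m then c else 0)"
    and norm_single_le: "norm (single m c) \<le> norm c"
proof -
  have *: "(\<Sum>n\<in>A. norm (if n = m then c else 0)) \<le> norm c" if "finite A" for A :: "(int^'d) set"
  proof -
    have "(\<Sum>n\<in>A. norm (if n = m then c else 0)) = (\<Sum>n\<in>A. if m = n then norm c else 0)"
      by (intro sum.cong) auto
    also have "\<dots> \<le> norm c" using that by (subst sum.delta') auto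
    finally show ?thesis .
  qed
  show "coef (single m c) n = (if n = m then c else 0)"
    unfolding single_def by (subst Wien_finite_sums(1)[OF *]) auto
  show "norm (single m c) \<le> norm c"
    unfolding single_def by (rule Wien_finite_sums(2)[OF *])
qed

lemma norm_single [simp]: "norm (single m c) = norm c"
  using norm_single_le[of m c] coef_le_norm[of "single m c" m] by (simp add: coef_single)

lemma single_add: "single m (c + d) = single m c + single m d"
  by (rule wien_eqI) (simp add: coef_single)

lemma single_0 [simp]: "single m 0 = 0"
  by (rule wien_eqI) (simp add: coef_single)

lemma single_summable: "(\<lambda>n. single n (coef x n)) summable_on UNIV"
  by (rule abs_summable_summable) (simp add: coef_summable)

lemma infsum_single: "infsum (\<lambda>n. single n (coef x n)) UNIV = x"
proof (rule wien_eqI)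
  fix m
  have "coef (infsum (\<lambda>n. single n (coef x n)) UNIV) m = infsum (\<lambda>n. coef (single n (coef x n)) m) UNIV"
    using has_sum_bounded_linear[OF bounded_linear_coef[of m] has_sum_infsum[OF single_summable[of x]]]
    by (simp add: infsumI)
  also have "\<dots> = infsum (\<lambda>n. coef x m) {m}"
    by (rule infsum_cong_neutral) (auto simp: coef_single)
  finally show "coef (infsum (\<lambda>n. single n (coef x n)) UNIV) m = coef x m" by simp
qed

text \<open>Finitely supported sequences are dense, so a continuous linear identity need only be
  checked on single modes.\<close>

lemma bounded_linear_wien_eq:
  fixes f g :: "'d::finite wien \<Rightarrow> 'b::banach"
  assumes "bounded_linear f" "bounded_linear g" "\<And>n c. f (single n c) = g (single n c)"
  shows "f x = g x"
proof -
  have *: "h x = infsum (\<lambda>n. h (single n (coef x n))) UNIV" if "bounded_linear h" for h :: "'d wien \<Rightarrow> 'b"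
    using has_sum_bounded_linear[OF that has_sum_infsum[OF single_summable[of x]]]
    by (simp add: infsumI infsum_single)
  show ?thesis using *[OF assms(1)] *[OF assms(2)] assms(3) by simp
qed

subsection \<open>Multiplication\<close>

definition shift :: "int^'d \<Rightarrow> complex \<Rightarrow> 'd::finite wien \<Rightarrow> 'd wien" where
  "shift m c x = Wien (\<lambda>n. c * coef x (n - m))"

lemma
  fixes m :: "int^'d::finite"
  shows coef_shift: "coef (shift m c x) n = c * coef x (n - m)"
    and norm_shift_le: "norm (shift m c x) \<le> norm c * norm x"
proof -
  have *: "(\<Sum>n\<in>A. norm (c * coef x (n - m))) \<le> norm c * norm x" if "finite A" for A :: "(int^'d) set"
  proof -
    have "(\<Sum>n\<in>A. norm (c * coef x (n - m))) = norm c * (\<Sum>n\<in>(\<lambda>n. n - m) ` A. norm (coef x n))"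
      by (subst sum.reindex) (auto simp: inj_on_def norm_mult sum_distrib_left)
    then show ?thesis using sum_coef_le_norm[of "(\<lambda>n. n - m) ` A" x] that
      by (simp add: mult_left_mono)
  qed
  show "coef (shift m c x) n = c * coef x (n - m)"
    unfolding shift_def by (subst Wien_finite_sums(1)[OF *]) auto
  show "norm (shift m c x) \<le> norm c * norm x"
    unfolding shift_def by (rule Wien_finite_sums(2)[OF *])
qed

lemma shift_single [simp]: "shift m c (single n d) = single (m + n) (c * d)"
  by (rule wien_eqI) (auto simp: coef_shift coef_single)

text \<open>The convolution is written as an absolutely convergent series of shifted copies of
  \<open>y\<close> in the Banach space, so that linearity and the norm estimate come from general
  facts on such series.\<close>

definition conv :: "'d::finite wien \<Rightarrow> 'd wien \<Rightarrow> 'd wien" where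
  "conv x y = infsum (\<lambda>n. shift n (coef x n) y) UNIV"

lemma conv_abs_summable: "(\<lambda>n. norm (shift n (coef x n) y)) summable_on UNIV"
  by (rule summable_on_comparison_test[OF summable_on_cmult_left[OF coef_summable[of x], of "norm y"]])
     (auto simp: norm_shift_le)

lemma conv_summable: "(\<lambda>n. shift n (coef x n) y) summable_on UNIV"
  by (rule abs_summable_summable[OF conv_abs_summable])

lemma norm_conv_le: "norm (conv x y) \<le> norm x * norm y"
proof -
  have "norm (conv x y) \<le> infsum (\<lambda>n. norm (shift n (coef x n) y)) UNIV"
    unfolding conv_def by (rule norm_infsum_bound[OF conv_abs_summable])
  also have "\<dots> \<le> infsum (\<lambda>n. norm (coef x n) * norm y) UNIV"
    by (intro infsum_mono conv_abs_summable summable_on_cmult_left coef_summable norm_shift_le)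
  also have "\<dots> = norm x * norm y"
    unfolding norm_wien_def by (intro infsum_cmult_left coef_summable)
  finally show ?thesis .
qed

lemma bounded_bilinear_conv: "bounded_bilinear conv"
proof
  fix a a' b b' :: "'d::finite wien" and r :: real
  show "conv (a + a') b = conv a b + conv a' b"
    unfolding conv_def
    by (subst infsum_add[OF conv_summable conv_summable, symmetric])
       (rule infsum_cong, rule wien_eqI, simp add: coef_shift algebra_simps)
  show "conv a (b + b') = conv a b + conv a b'"
    unfolding conv_def
    by (subst infsum_add[OF conv_summable conv_summable, symmetric])
       (rule infsum_cong, rule wien_eqI, simp add: coef_shift algebra_simps)
  show "conv (r *\<^sub>R a) b = r *\<^sub>R conv a b"
    unfolding conv_def
    by (subst infsum_scaleR_right[symmetric]) (rule infsum_cong, rule wien_eqI, simp add: coef_shift)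
  show "conv a (r *\<^sub>R b) = r *\<^sub>R conv a b"
    unfolding conv_def
    by (subst infsum_scaleR_right[symmetric]) (rule infsum_cong, rule wien_eqI, simp add: coef_shift)
next
  show "\<exists>K. \<forall>(a::'d::finite wien) b. norm (conv a b) \<le> norm a * norm b * K"
    by (rule exI[of _ 1]) (auto simp: norm_conv_le)
qed

lemma conv_single [simp]: "conv (single m c) x = shift m c x"
proof -
  have "conv (single m c) x = infsum (\<lambda>n. shift m c x) {m}"
    unfolding conv_def
    by (rule infsum_cong_neutral) (auto intro!: wien_eqI simp: coef_single coef_shift)
  then show ?thesis by simp
qed

text \<open>Both sides are continuous and linear in each factor, so single modes may be inserted one
  factor at a time. For three modes the claim is associativity of adding frequencies and multiplying
  amplitudes.\<close>

lemma conv_assoc: "conv (conv x y) z = conv x (conv y z)"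
proof -
  note L = bounded_bilinear.bounded_linear_left[OF bounded_bilinear_conv]
  note R = bounded_bilinear.bounded_linear_right[OF bounded_bilinear_conv]
  have 1: "conv (conv (single m c) (single n d)) z = conv (single m c) (conv (single n d) z)" for m n c d and z :: "'a wien"
    by (rule bounded_linear_wien_eq[OF R bounded_linear_compose[OF R R]]) (simp add: add.assoc mult.assoc)
  have 2: "conv (conv (single m c) y) z = conv (single m c) (conv y z)" for m c and y z :: "'a wien"
    by (rule bounded_linear_wien_eq[OF bounded_linear_compose[OF L R] bounded_linear_compose[OF R L], where x = y])
       (rule 1)
  show ?thesis
    by (rule bounded_linear_wien_eq[OF bounded_linear_compose[OF L L] L, where x = x]) (rule 2)
qed

lemma conv_commute: "conv x y = conv y x"
proof -
  note L = bounded_bilinear.bounded_linear_left[OF bounded_bilinear_conv]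
  note R = bounded_bilinear.bounded_linear_right[OF bounded_bilinear_conv]
  have 1: "conv (single m c) y = conv y (single m c)" for m c and y :: "'a wien"
    by (rule bounded_linear_wien_eq[OF R L]) (simp add: ac_simps)
  show ?thesis by (rule bounded_linear_wien_eq[OF L R, where x = x]) (rule 1)
qed

instantiation wien :: (finite) "{comm_ring_1, real_normed_algebra_1}"
begin

definition times_wien :: "'a wien \<Rightarrow> 'a wien \<Rightarrow> 'a wien" where "times_wien = conv"
definition one_wien :: "'a wien" where "one_wien = single 0 1"

instance
proof
  fix a b c :: "'a wien" and r :: real
  interpret bounded_bilinear "conv :: 'a wien \<Rightarrow> _" by (rule bounded_bilinear_conv)
  show "a * b * c = a * (b * c)" by (simp add: times_wien_def conv_assoc)
  show "a * b = b * a" by (simp add: times_wien_def conv_commute)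
  show "1 * a = a" by (auto intro!: wien_eqI simp: times_wien_def one_wien_def coef_shift)
  show "(a + b) * c = a * c + b * c" by (simp add: times_wien_def add_left)
  show "a * (b + c) = a * b + a * c" by (simp add: times_wien_def add_right)
  show "a * 1 = a"
    by (subst times_wien_def, subst conv_commute) (auto intro!: wien_eqI simp: one_wien_def coef_shift)
  show "r *\<^sub>R a * b = r *\<^sub>R (a * b)" by (simp add: times_wien_def scaleR_left)
  show "a * r *\<^sub>R b = r *\<^sub>R (a * b)" by (simp add: times_wien_def scaleR_right)
  show "norm (a * b) \<le> norm a * norm b" by (simp add: times_wien_def norm_conv_le)
  show "norm (1 :: 'a wien) = 1" by (simp add: one_wien_def)
  then show "(0 :: 'a wien) \<noteq> 1" by (metis norm_zero zero_neq_one)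
qed

end

lemma single_mult: "single m c * single n d = single (m + n) (c * d)"
  by (simp add: times_wien_def)

lemma coef_single_mult: "coef (single m c * x) n = c * coef x (n - m)"
  by (simp add: times_wien_def coef_shift)

definition cst :: "complex \<Rightarrow> 'd::finite wien" where "cst z = single 0 z"

lemma cst_0 [simp]: "cst 0 = 0" and cst_1 [simp]: "cst 1 = 1"
  and cst_add: "cst (a + b) = cst a + cst b"
  and cst_mult: "cst (a * b) = cst a * cst b"
  and norm_cst [simp]: "norm (cst a) = norm a"
  by (auto simp: cst_def one_wien_def single_add single_mult)

lemma cst_uminus: "cst (- a) = - cst a"
  using cst_add[of a "- a"] by (simp add: eq_neg_iff_add_eq_0 add.commute)

lemma cst_diff: "cst (a - b) = cst a - cst b"
  using cst_add[of a "- b"] by (simp add: cst_uminus)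

lemma coef_cst_mult [simp]: "coef (cst c * x) n = c * coef x n"
  by (simp add: cst_def coef_single_mult)

lemma scaleR_eq_cst: "r *\<^sub>R (x::'d::finite wien) = cst (of_real r) * x"
  by (rule wien_eqI) (simp only: coef_scaleR coef_cst_mult, simp add: scaleR_conv_of_real)

subsection \<open>Conjugation\<close>

text \<open>These are the Fourier coefficients of the complex conjugate function, whence the
  reflection of the index.\<close>

definition star :: "'d::finite wien \<Rightarrow> 'd wien" where
  "star x = Wien (\<lambda>n. cnj (coef x (- n)))"

lemma
  fixes x :: "'d::finite wien"
  shows coef_star: "coef (star x) n = cnj (coef x (- n))"
    and norm_star_le: "norm (star x) \<le> norm x"
proof -
  have *: "(\<Sum>n\<in>A. norm (cnj (coef x (- n)))) \<le> norm x" if "finite A" for A :: "(int^'d) set"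
  proof -
    have "(\<Sum>n\<in>A. norm (cnj (coef x (- n)))) = (\<Sum>n\<in>uminus ` A. norm (coef x n))"
      by (subst sum.reindex) auto
    then show ?thesis using sum_coef_le_norm[of "uminus ` A" x] that by simp
  qed
  show "coef (star x) n = cnj (coef x (- n))"
    unfolding star_def by (subst Wien_finite_sums(1)[OF *]) auto
  show "norm (star x) \<le> norm x"
    unfolding star_def by (rule Wien_finite_sums(2)[OF *])
qed

lemma star_star [simp]: "star (star x) = x"
  by (rule wien_eqI) (simp add: coef_star)

lemma norm_star [simp]: "norm (star x) = norm x"
  using norm_star_le[of x] norm_star_le[of "star x"] by simp

lemma star_add: "star (x + y) = star x + star y"
  and star_diff: "star (x - y) = star x - star y"
  and star_0 [simp]: "star 0 = 0"
  and star_scaleR: "star (r *\<^sub>R x) = r *\<^sub>R star x"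
  by (auto intro!: wien_eqI simp: coef_star)

lemma star_single: "star (single m c) = single (- m) (cnj c)"
proof (rule wien_eqI)
  fix n
  have "- n = m \<longleftrightarrow> n = - m" by (metis minus_minus)
  then show "coef (star (single m c)) n = coef (single (- m) (cnj c)) n"
    by (simp add: coef_star coef_single)
qed

lemma star_cst [simp]: "star (cst c) = cst (cnj c)"
  by (simp add: cst_def star_single)

lemma star_sum: "star (sum f A) = (\<Sum>a\<in>A. star (f a))"
  by (induction A rule: infinite_finite_induct) (auto simp: star_add)

lemma bounded_linear_star: "bounded_linear star"
  by (rule bounded_linear_intro[of _ 1]) (auto simp: star_add star_scaleR)

lemma star_mult: "star (x * y) = star x * star y"
proof -
  have 1: "star (single m c * y) = star (single m c) * star y" for m c and y :: "'a wien"
    by (rule bounded_linear_wien_eq[OF bounded_linear_compose[OF bounded_linear_star bounded_linear_mult_right]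
          bounded_linear_compose[OF bounded_linear_mult_right bounded_linear_star]])
       (simp add: single_mult star_single)
  show ?thesis
    by (rule bounded_linear_wien_eq[OF bounded_linear_compose[OF bounded_linear_star bounded_linear_mult_left]
          bounded_linear_compose[OF bounded_linear_mult_left bounded_linear_star], where x = x])
       (rule 1)
qed

subsection \<open>Synthesis\<close>

definition dotp :: "int^'d \<Rightarrow> real^'d \<Rightarrow> real" where
  "dotp n p = (\<Sum>j\<in>UNIV. of_int (n $ j) * p $ j)"

lemma dotp_add: "dotp (m + n) p = dotp m p + dotp n p"
  and dotp_minus: "dotp (- n) p = - dotp n p"
  and dotp_0 [simp]: "dotp 0 p = 0"
  and dotp_add_right: "dotp n (p + q) = dotp n p + dotp n q"
  and dotp_scaleR_right: "dotp n (r *\<^sub>R p) = r * dotp n p"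
  by (auto simp: dotp_def ring_distribs sum.distrib sum_negf sum_distrib_left mult.left_commute)

lemma dotp_diff: "dotp (m - n) p = dotp m p - dotp n p"
  using dotp_add[of m "- n" p] by (simp add: dotp_minus)

lemma dotp_axis [simp]: "dotp n (axis j h) = of_int (n $ j) * h"
  unfolding dotp_def
  by (subst sum.remove[of _ j]) (auto simp: axis_def)

definition synth :: "'d::finite wien \<Rightarrow> real^'d \<Rightarrow> complex" where
  "synth x p = infsum (\<lambda>n. coef x n * cis (dotp n p)) UNIV"

lemma synth_abs_summable: "(\<lambda>n. norm (coef x n * cis (dotp n p))) summable_on UNIV"
  by (simp add: norm_mult coef_summable)

lemma norm_synth_le: "norm (synth x p) \<le> norm x"
  unfolding synth_def norm_wien_def
  using norm_infsum_bound[OF synth_abs_summable[of x p]] by (simp add: norm_mult)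

lemma bounded_linear_synth: "bounded_linear (\<lambda>x. synth x p)"
proof (rule bounded_linear_intro[of _ 1])
  note S = abs_summable_summable[OF synth_abs_summable]
  show "synth (x + y) p = synth x p + synth y p" for x y :: "'a wien"
    unfolding synth_def by (subst infsum_add[symmetric, OF S S]) (simp add: algebra_simps)
  show "synth (r *\<^sub>R x) p = r *\<^sub>R synth x p" for r and x :: "'a wien"
    unfolding synth_def by (subst infsum_scaleR_right[symmetric]) simp
qed (auto simp: norm_synth_le)

lemmas synth_add = bounded_linear.linear[OF bounded_linear_synth, THEN linear_add]
lemmas synth_diff = bounded_linear.linear[OF bounded_linear_synth, THEN linear_diff]
lemmas synth_sum = bounded_linear.linear[OF bounded_linear_synth, THEN linear_sum]
lemmas synth_0 [simp] = bounded_linear.linear[OF bounded_linear_synth, THEN linear_0]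

lemma synth_single: "synth (single m c) p = c * cis (dotp m p)"
proof -
  have "synth (single m c) p = infsum (\<lambda>n. c * cis (dotp m p)) {m}"
    unfolding synth_def by (rule infsum_cong_neutral) (auto simp: coef_single)
  then show ?thesis by simp
qed

lemma synth_cst [simp]: "synth (cst c) p = c"
  by (simp add: cst_def synth_single)

lemma synth_mult: "synth (x * y) p = synth x p * synth y p"
proof -
  have 1: "synth (single m c * y) p = synth (single m c) p * synth y p" for m c and y :: "'a wien"
    by (rule bounded_linear_wien_eq[OF bounded_linear_compose[OF bounded_linear_synth bounded_linear_mult_right]
          bounded_linear_compose[OF bounded_linear_mult_right bounded_linear_synth]])
       (simp add: single_mult synth_single dotp_add cis_mult[symmetric])
  show ?thesis
    by (rule bounded_linear_wien_eq[OF bounded_linear_compose[OF bounded_linear_synth bounded_linear_mult_left]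
          bounded_linear_compose[OF bounded_linear_mult_left bounded_linear_synth], where x = x])
       (rule 1)
qed

lemma synth_star: "synth (star x) p = cnj (synth x p)"
  by (rule bounded_linear_wien_eq[OF bounded_linear_compose[OF bounded_linear_synth bounded_linear_star]
          bounded_linear_compose[OF bounded_linear_cnj bounded_linear_synth]])
     (simp add: star_single synth_single dotp_minus cis_cnj)

section \<open>Weighted norms and multipliers\<close>

text \<open>The summand 1 makes every weight at least one, so that a larger exponent gives a
  stronger norm and the zero mode keeps its weight.\<close>

definition wt :: "int^'d \<Rightarrow> real" where
  "wt n = 1 + (\<Sum>j\<in>UNIV. \<bar>of_int (n $ j)\<bar>)"

lemma wt_ge_1: "1 \<le> wt n"
  by (simp add: wt_def sum_nonneg)

lemma wt_pos: "0 < wt n" and wt_nonneg: "0 \<le> wt n"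
  using wt_ge_1[of n] by auto

lemma wt_uminus [simp]: "wt (- n) = wt n"
  by (simp add: wt_def)

lemma wt_ge_component: "1 + \<bar>of_int (n $ j)\<bar> \<le> wt n"
  unfolding wt_def
  using member_le_sum[of j UNIV "\<lambda>j. \<bar>real_of_int (n $ j)\<bar>"] by simp

lemma wt_add: "wt (m + n) \<le> wt m + wt n"
proof -
  have "(\<Sum>j\<in>UNIV. \<bar>real_of_int ((m + n) $ j)\<bar>) \<le> (\<Sum>j\<in>UNIV. \<bar>real_of_int (m $ j)\<bar> + \<bar>of_int (n $ j)\<bar>)"
    by (intro sum_mono) auto
  then show ?thesis by (simp add: wt_def sum.distrib)
qed

lemma add_power_le: "(a + b) ^ s \<le> 2 ^ s * (a ^ s + b ^ s)" if "0 \<le> a" "0 \<le> (b::real)"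
proof -
  have "(a + b) ^ s \<le> (2 * max a b) ^ s" using that by (intro power_mono) auto
  also have "\<dots> = 2 ^ s * max a b ^ s" by (simp add: power_mult_distrib)
  also have "\<dots> \<le> 2 ^ s * (a ^ s + b ^ s)" using that by (auto simp: max_def)
  finally show ?thesis .
qed

lemma wt_power_add: "wt (m + n) ^ s \<le> 2 ^ s * (wt m ^ s + wt n ^ s)"
  using power_mono[OF wt_add, of m n s] add_power_le[of "wt m" "wt n" s] wt_nonneg
  by (metis order_trans)

lemma wt_power_mono: "r \<le> s ==> wt n ^ r \<le> wt n ^ s"
  by (rule power_increasing) (auto simp: wt_ge_1)

lemma sum_inverse_squares_int_le:
  obtains C :: real where "0 \<le> C" "\<And>N. (\<Sum>k\<in>{-N..N}. 1 / (1 + \<bar>real_of_int k\<bar>)\<^sup>2) \<le> C"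
proof
  define S :: real where "S = (\<Sum>n. 1 / (1 + real n)\<^sup>2)"
  have sm: "summable (\<lambda>n. 1 / (1 + real n)\<^sup>2)"
    using inverse_power_summable[of 2, where 'a=real]
      summable_Suc_iff[of "\<lambda>n. inverse ((of_nat n)::real) ^ 2"]
    by (simp add: divide_inverse add_ac power_inverse)
  show "0 \<le> 2 * S" unfolding S_def by (intro mult_nonneg_nonneg suminf_nonneg sm) auto
  fix N :: int
  let ?f = "\<lambda>k::int. 1 / (1 + \<bar>real_of_int k\<bar>)\<^sup>2"
  have part: "(\<Sum>n\<in>{..nat N}. 1 / (1 + real n)\<^sup>2) \<le> S"
    unfolding S_def by (intro sum_le_suminf sm) auto
  have "k \<in> int ` {..nat N} \<union> (\<lambda>n. - int n) ` {..nat N}" if "k \<in> {-N..N}" for k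
  proof (cases "0 \<le> k")
    case True then show ?thesis using that by (intro UnI1 image_eqI[of _ _ "nat k"]) auto
  next
    case False then show ?thesis using that by (intro UnI2 image_eqI[of _ _ "nat (- k)"]) auto
  qed
  then have "{-N..N} \<subseteq> int ` {..nat N} \<union> (\<lambda>n. - int n) ` {..nat N}" by blast
  then have "(\<Sum>k\<in>{-N..N}. ?f k) \<le> (\<Sum>k\<in>int ` {..nat N} \<union> (\<lambda>n. - int n) ` {..nat N}. ?f k)"
    by (rule sum_mono2[rotated]) auto
  also have "\<dots> \<le> (\<Sum>k\<in>int ` {..nat N}. ?f k) + (\<Sum>k\<in>(\<lambda>n. - int n) ` {..nat N}. ?f k)"
    by (subst sum.union_inter[symmetric]) (auto intro!: sum_nonneg)
  also have "\<dots> = (\<Sum>n\<in>{..nat N}. 1 / (1 + real n)\<^sup>2) + (\<Sum>n\<in>{..nat N}. 1 / (1 + real n)\<^sup>2)"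
    by (subst (1 2) sum.reindex) (auto simp: inj_on_def)
  also have "\<dots> \<le> 2 * S" using part by simp
  finally show "(\<Sum>k\<in>{-N..N}. ?f k) \<le> 2 * S" .
qed

lemma prod_wt_le: "(\<Prod>j\<in>UNIV. (1 + \<bar>real_of_int (n $ j)\<bar>)\<^sup>2) \<le> wt (n :: int^'d) ^ (2 * CARD('d))"
proof -
  have "(\<Prod>j\<in>UNIV. (1 + \<bar>real_of_int (n $ j)\<bar>)\<^sup>2) \<le> (\<Prod>j\<in>(UNIV::'d set). (wt n)\<^sup>2)"
    by (intro prod_mono) (auto intro!: power_mono wt_ge_component)
  then show ?thesis by (simp add: power_mult)
qed

text \<open>The power \<open>2 * CARD('d)\<close> of the weight dominates the product of the squares
  \<open>(1 + |n_j|)^2\<close> over the coordinates. The lattice sum therefore factorizes into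
  convergent one-dimensional sums.\<close>

lemma wt_inverse_summable:
  obtains C :: real where "0 < C"
    "\<And>A. finite A ==> (\<Sum>n\<in>A. 1 / wt (n :: int^'d) ^ (2 * CARD('d))) \<le> C"
proof -
  obtain C where C: "0 \<le> C" "\<And>N. (\<Sum>k\<in>{-N..N}. 1 / (1 + \<bar>real_of_int k\<bar>)\<^sup>2) \<le> C"
    using sum_inverse_squares_int_le by blast
  have "(\<Sum>n\<in>A. 1 / wt n ^ (2 * CARD('d))) \<le> C ^ CARD('d) + 1" if A: "finite A" for A :: "(int^'d) set"
  proof -
    define N where "N = (\<Sum>n\<in>A. \<Sum>j\<in>UNIV. \<bar>n $ j\<bar>)"
    have N: "\<bar>n $ j\<bar> \<le> N" if "n \<in> A" for n j
    proof -
      have "\<bar>n $ j\<bar> \<le> (\<Sum>j\<in>UNIV. \<bar>n $ j\<bar>)" by (rule member_le_sum) auto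
      also have "\<dots> \<le> N" unfolding N_def using A that by (intro member_le_sum) (auto intro: sum_nonneg)
      finally show ?thesis .
    qed
    let ?f = "\<lambda>k::int. 1 / (1 + \<bar>real_of_int k\<bar>)\<^sup>2"
    have "(\<Sum>n\<in>A. 1 / wt n ^ (2 * CARD('d))) \<le> (\<Sum>n\<in>A. \<Prod>j\<in>UNIV. ?f (n $ j))"
    proof (rule sum_mono)
      fix n :: "int^'d"
      have "0 < (\<Prod>j\<in>UNIV. (1 + \<bar>real_of_int (n $ j)\<bar>)\<^sup>2)"
        by (intro prod_pos ballI zero_less_power add_pos_nonneg) auto
      then show "1 / wt n ^ (2 * CARD('d)) \<le> (\<Prod>j\<in>UNIV. ?f (n $ j))"
        using prod_wt_le[of n] by (simp add: prod_dividef frac_le)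
    qed
    also have "\<dots> = (\<Sum>g\<in>($) ` A. \<Prod>j\<in>UNIV. ?f (g j))"
      by (subst sum.reindex) (auto simp: inj_on_def vec_eq_iff fun_eq_iff)
    also have "\<dots> \<le> (\<Sum>g\<in>PiE (UNIV::'d set) (\<lambda>_. {-N..N}). \<Prod>j\<in>UNIV. ?f (g j))"
    proof (intro sum_mono2)
      show "($) ` A \<subseteq> PiE UNIV (\<lambda>_. {-N..N})"
      proof (intro image_subsetI PiE_I)
        fix n j assume "n \<in> A"
        then show "n $ j \<in> {-N..N}" using N[of n j] by auto
      qed auto
    qed (auto intro!: finite_PiE prod_nonneg)
    also have "\<dots> = (\<Prod>j\<in>(UNIV::'d set). \<Sum>k\<in>{-N..N}. ?f k)"
      by (rule prod_sum_PiE[symmetric]) auto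
    also have "\<dots> \<le> (\<Prod>j\<in>(UNIV::'d set). C)"
      by (intro prod_mono) (auto intro!: C sum_nonneg)
    finally show ?thesis by simp
  qed
  then show thesis using that[of "C ^ CARD('d) + 1"] C(1) by (simp add: add_nonneg_pos)
qed

lemma wt_inverse_summable_on: "(\<lambda>n. 1 / wt (n :: int^'d) ^ (2 * CARD('d))) summable_on UNIV"
proof -
  obtain C where "\<And>A. finite A ==> (\<Sum>n\<in>A. 1 / wt (n :: int^'d) ^ (2 * CARD('d))) \<le> C"
    using wt_inverse_summable by blast
  then show ?thesis
    by (intro nonneg_bdd_above_summable_on) (auto intro!: bdd_aboveI2 simp: wt_nonneg)
qed

text \<open>The weighted norm of order \<open>s\<close> is at most \<open>B\<close>. A predicate on
  finite sums is used instead of a norm because an element of the algebra may have infinite weighted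
  norm.\<close>

definition wle :: "nat \<Rightarrow> 'd::finite wien \<Rightarrow> real \<Rightarrow> bool" where
  "wle s x B \<longleftrightarrow> (\<forall>A. finite A \<longrightarrow> (\<Sum>n\<in>A. wt n ^ s * norm (coef x n)) \<le> B)"

lemma wleI: "(\<And>A. finite A ==> (\<Sum>n\<in>A. wt n ^ s * norm (coef x n)) \<le> B) ==> wle s x B"
  and wleD: "wle s x B ==> finite A ==> (\<Sum>n\<in>A. wt n ^ s * norm (coef x n)) \<le> B"
  by (auto simp: wle_def)

lemma wle_nonneg: "wle s x B ==> 0 \<le> B"
  using wleD[of s x B "{}"] by simp

lemma wle_mono: "wle s x B ==> B \<le> C ==> wle s x C"
  unfolding wle_def by (meson order_trans)

lemma wle_antimono: "wle s x B ==> r \<le> s ==> wle r x B"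
  unfolding wle_def
  by (meson mult_right_mono norm_ge_zero order_trans sum_mono wt_power_mono)

lemma wle_0_iff: "wle 0 x B \<longleftrightarrow> norm x \<le> B"
  unfolding wle_def using sum_coef_le_norm[of _ x] norm_wien_le[of x B] by (auto intro: order_trans)

lemma wle_norm: "wle s x B ==> norm x \<le> B"
  using wle_antimono[of s x B 0] by (simp add: wle_0_iff)

lemma wle_coef: "wle s x B ==> wt n ^ s * norm (coef x n) \<le> B"
  using wleD[of s x B "{n}"] by simp

lemma wle_coef_summable: "wle s x B ==> (\<lambda>n. wt n ^ s * norm (coef x n)) summable_on UNIV"
  by (rule nonneg_bdd_above_summable_on) (auto intro!: bdd_aboveI2[of _ _ B] wleD simp: wt_nonneg)

lemma wle_infsum: "wle s x B ==> infsum (\<lambda>n. wt n ^ s * norm (coef x n)) UNIV \<le> B"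
  by (rule infsum_le_finite_sums[OF wle_coef_summable]) (auto simp: wle_def)

text \<open>Pointwise decay with \<open>2 * CARD('d)\<close> extra powers of the weight is summable.
  The constant is common to all \<open>s\<close>, \<open>x\<close> and \<open>B\<close>, so bounds
  that are uniform over a family stay uniform.\<close>

lemma wle_of_coef_bound:
  fixes x :: "'d::finite wien"
  obtains K where "0 < K"
    "\<And>s (x :: 'd wien) B. 0 \<le> B ==> (\<And>n. wt n ^ (s + 2 * CARD('d)) * norm (coef x n) \<le> B) ==> wle s x (K * B)"
proof -
  obtain C where C: "0 < C" "\<And>A. finite A ==> (\<Sum>n\<in>A. 1 / wt (n :: int^'d) ^ (2 * CARD('d))) \<le> C"
    using wt_inverse_summable by blast
  have "wle s x (C * B)" if "0 \<le> B" "\<And>n. wt n ^ (s + 2 * CARD('d)) * norm (coef x n) \<le> B"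
    for s B and x :: "'d wien"
  proof (rule wleI)
    fix A :: "(int^'d) set" assume A: "finite A"
    have "(\<Sum>n\<in>A. wt n ^ s * norm (coef x n)) \<le> (\<Sum>n\<in>A. 1 / wt n ^ (2 * CARD('d)) * B)"
      using that(2) by (intro sum_mono) (simp add: field_simps power_add wt_pos)
    also have "\<dots> = (\<Sum>n\<in>A. 1 / wt n ^ (2 * CARD('d))) * B" by (rule sum_distrib_right[symmetric])
    also have "\<dots> \<le> C * B" using C(2)[OF A] that(1) by (rule mult_right_mono)
    finally show "(\<Sum>n\<in>A. wt n ^ s * norm (coef x n)) \<le> C * B" .
  qed
  then show thesis using that C(1) by blast
qed

lemma wle_coef_le:
  assumes "wle s x B" "\<And>n. norm (coef y n) \<le> c * norm (coef x n)" "0 \<le> c"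
  shows "wle s y (c * B)"
proof (rule wleI)
  fix A :: "(int^'a) set" assume A: "finite A"
  have "(\<Sum>n\<in>A. wt n ^ s * norm (coef y n)) \<le> (\<Sum>n\<in>A. c * (wt n ^ s * norm (coef x n)))"
    by (intro sum_mono order_trans[OF mult_left_mono[OF assms(2)]]) (simp_all add: mult_ac wt_nonneg)
  also have "\<dots> \<le> c * B" using wleD[OF assms(1) A] assms(3)
    by (simp add: sum_distrib_left[symmetric] mult_left_mono)
  finally show "(\<Sum>n\<in>A. wt n ^ s * norm (coef y n)) \<le> c * B" .
qed

lemma wle_add:
  assumes "wle s x B" "wle s y C"
  shows "wle s (x + y) (B + C)"
proof (rule wleI)
  fix A :: "(int^'a) set" assume A: "finite A"
  have "(\<Sum>n\<in>A. wt n ^ s * norm (coef (x + y) n)) \<le> (\<Sum>n\<in>A. wt n ^ s * norm (coef x n) + wt n ^ s * norm (coef y n))"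
    by (intro sum_mono) (simp add: distrib_left[symmetric] mult_left_mono wt_nonneg norm_triangle_ineq)
  then show "(\<Sum>n\<in>A. wt n ^ s * norm (coef (x + y) n)) \<le> B + C"
    using wleD[OF assms(1) A] wleD[OF assms(2) A] by (simp add: sum.distrib)
qed

lemma wle_zero [simp]: "0 \<le> B ==> wle s 0 B"
  by (rule wleI) simp

lemma wle_uminus: "wle s x B ==> wle s (- x) B"
  by (simp add: wle_def)

lemma wle_diff: "wle s x B ==> wle s y C ==> wle s (x - y) (B + C)"
  using wle_add[of s x B "- y" C] wle_uminus[of s y C] by simp

lemma wle_star: "wle s x B ==> wle s (star x) B"
proof (rule wleI)
  fix A :: "(int^'a) set" assume x: "wle s x B" and A: "finite A"
  have "(\<Sum>n\<in>A. wt n ^ s * norm (coef (star x) n)) = (\<Sum>n\<in>uminus ` A. wt n ^ s * norm (coef x n))"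
    by (subst sum.reindex) (auto simp: coef_star)
  then show "(\<Sum>n\<in>A. wt n ^ s * norm (coef (star x) n)) \<le> B"
    using wleD[OF x, of "uminus ` A"] A by simp
qed

lemma wle_single: "wle s (single m c) (wt m ^ s * norm c)"
proof (rule wleI)
  fix A :: "(int^'a) set" assume A: "finite A"
  have "(\<Sum>n\<in>A. wt n ^ s * norm (coef (single m c) n)) = (\<Sum>n\<in>A. if n = m then wt m ^ s * norm c else 0)"
    by (intro sum.cong) (auto simp: coef_single)
  also have "\<dots> \<le> wt m ^ s * norm c" using A by (subst sum.delta) (auto simp: wt_nonneg)
  finally show "(\<Sum>n\<in>A. wt n ^ s * norm (coef (single m c) n)) \<le> wt m ^ s * norm c" .
qed

text \<open>A weighted bound survives convergence in the unweighted norm, because it only speaks of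
  finite sums and these converge. This lets the bounds of Picard iterates pass to the
  solution.\<close>

lemma wle_closed:
  assumes "(f \<longlongrightarrow> x) F" "\<And>k. wle s (f k) B" "F \<noteq> bot"
  shows "wle s x B"
proof (rule wleI)
  fix A :: "(int^'b) set" assume A: "finite A"
  have "((\<lambda>k. \<Sum>n\<in>A. wt n ^ s * norm (coef (f k) n)) \<longlongrightarrow> (\<Sum>n\<in>A. wt n ^ s * norm (coef x n))) F"
    by (intro tendsto_intros bounded_linear.tendsto[OF bounded_linear_coef] assms)
  then show "(\<Sum>n\<in>A. wt n ^ s * norm (coef x n)) \<le> B"
    by (rule tendsto_upperbound) (auto intro!: always_eventually wleD assms A)
qed

lemma coef_mult: "coef (x * y) k = infsum (\<lambda>n. coef x n * coef y (k - n)) UNIV"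
  unfolding times_wien_def conv_def
  using has_sum_bounded_linear[OF bounded_linear_coef[of k] has_sum_infsum[OF conv_summable[of x y]]]
  by (simp add: infsumI coef_shift)

lemma has_sum_finite_sum:
  fixes f :: "'k \<Rightarrow> 'i \<Rightarrow> 'a::{topological_comm_monoid_add}"
  shows "(\<And>k. k \<in> A ==> (f k has_sum F k) B) ==> ((\<lambda>n. \<Sum>k\<in>A. f k n) has_sum (\<Sum>k\<in>A. F k)) B"
  by (induction A rule: infinite_finite_induct) (auto intro: has_sum_add)

text \<open>The weight of a sum of frequencies splits into two terms by \<open>wt_power_add\<close>,
  each placing the full weight on one factor and none on the other. Hence the estimate is linear in
  the high norms, which is what excludes blow-up of high norms once the low norm is truncated. Since
  \<open>A\<close> is finite, the two summations can be exchanged.\<close>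

lemma wle_mult:
  fixes x y :: "'d::finite wien"
  assumes x: "wle s x B" and y: "wle s y C"
  shows "wle s (x * y) (2 ^ s * (B * norm y + norm x * C))"
proof (rule wleI)
  fix A :: "(int^'d) set" assume A: "finite A"
  let ?h = "\<lambda>n. 2 ^ s * (wt n ^ s * norm (coef x n) * norm y + norm (coef x n) * C)"
  have C0: "0 \<le> C" using wle_nonneg[OF y] .
  have sm: "(\<lambda>n. norm (coef x n * coef y (k - n))) summable_on UNIV" for k
    by (rule summable_on_comparison_test[OF summable_on_cmult_left[OF coef_summable[of x], of "norm y"]])
       (auto simp: norm_mult coef_le_norm mult_left_mono)
  have hs: "?h summable_on UNIV"
    by (intro summable_on_cmult_right summable_on_add summable_on_cmult_left wle_coef_summable[OF x] coef_summable)
  have sm2: "(\<lambda>n. wt k ^ s * norm (coef x n * coef y (k - n))) summable_on UNIV" for k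
    by (intro summable_on_cmult_right sm)
  have "(\<Sum>k\<in>A. wt k ^ s * norm (coef (x * y) k))
      \<le> (\<Sum>k\<in>A. infsum (\<lambda>n. wt k ^ s * norm (coef x n * coef y (k - n))) UNIV)"
  proof (rule sum_mono)
    fix k
    have "norm (coef (x * y) k) \<le> infsum (\<lambda>n. norm (coef x n * coef y (k - n))) UNIV"
      unfolding coef_mult by (rule norm_infsum_bound[OF sm])
    then show "wt k ^ s * norm (coef (x * y) k) \<le> infsum (\<lambda>n. wt k ^ s * norm (coef x n * coef y (k - n))) UNIV"
      by (subst infsum_cmult_right[OF sm]) (simp add: mult_left_mono wt_nonneg)
  qed
  also have "\<dots> = infsum (\<lambda>n. \<Sum>k\<in>A. wt k ^ s * norm (coef x n * coef y (k - n))) UNIV"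
    by (rule infsumI[symmetric], rule has_sum_finite_sum, rule has_sum_infsum) (rule sm2)
  also have "\<dots> \<le> infsum ?h UNIV"
  proof (rule infsum_mono[OF _ hs])
    show "(\<lambda>n. \<Sum>k\<in>A. wt k ^ s * norm (coef x n * coef y (k - n))) summable_on UNIV"
      by (rule has_sum_imp_summable, rule has_sum_finite_sum, rule has_sum_infsum) (rule sm2)
    fix n
    have 1: "(\<Sum>k\<in>A. norm (coef y (k - n))) \<le> norm y"
      using sum_coef_le_norm[of "(\<lambda>k. k - n) ` A" y] A
      by (simp add: sum.reindex inj_on_def)
    have 2: "(\<Sum>k\<in>A. wt (k - n) ^ s * norm (coef y (k - n))) \<le> C"
      using wleD[OF y, of "(\<lambda>k. k - n) ` A"] A
      by (simp add: sum.reindex inj_on_def)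
    have "(\<Sum>k\<in>A. wt k ^ s * norm (coef x n * coef y (k - n)))
       \<le> (\<Sum>k\<in>A. 2 ^ s * (wt n ^ s + wt (k - n) ^ s) * (norm (coef x n) * norm (coef y (k - n))))"
      using wt_power_add[of n "k - n" s for k]
      by (intro sum_mono) (auto intro!: mult_right_mono simp: norm_mult)
    also have "\<dots> = 2 ^ s * (wt n ^ s * norm (coef x n) * (\<Sum>k\<in>A. norm (coef y (k - n)))
        + norm (coef x n) * (\<Sum>k\<in>A. wt (k - n) ^ s * norm (coef y (k - n))))"
      by (simp add: sum_distrib_left sum.distrib algebra_simps)
    also have "\<dots> \<le> ?h n"
      using 1 2 by (intro mult_left_mono add_mono) (auto simp: wt_nonneg)
    finally show "(\<Sum>k\<in>A. wt k ^ s * norm (coef x n * coef y (k - n))) \<le> ?h n" .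
  qed
  also have "\<dots> = 2 ^ s * (infsum (\<lambda>n. wt n ^ s * norm (coef x n)) UNIV * norm y + norm x * C)"
    unfolding norm_wien_def[of x]
    by (simp add: infsum_cmult_right infsum_cmult_left infsum_add summable_on_add summable_on_cmult_left
        wle_coef_summable[OF x] coef_summable)
  also have "\<dots> \<le> 2 ^ s * (B * norm y + norm x * C)"
    using wle_infsum[OF x] by (intro mult_left_mono add_mono mult_right_mono) auto
  finally show "(\<Sum>k\<in>A. wt k ^ s * norm (coef (x * y) k)) \<le> 2 ^ s * (B * norm y + norm x * C)" .
qed

lemma wle_mult': "wle s x B ==> wle s y C ==> wle s (x * y) (2 ^ s * (2 * B * C))"
proof (rule wle_mono[OF wle_mult])
  assume x: "wle s x B" and y: "wle s y C"
  have "B * norm y \<le> B * C" "norm x * C \<le> B * C"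
    using wle_norm[OF x] wle_norm[OF y] wle_nonneg[OF x] wle_nonneg[OF y]
    by (auto intro: mult_left_mono mult_right_mono)
  then show "2 ^ s * (B * norm y + norm x * C) \<le> 2 ^ s * (2 * B * C)"
    by simp
qed

subsection \<open>Multipliers and phases\<close>

text \<open>\<open>Wien\<close> is unspecified on families that are not summable. The coefficients
  of \<open>mulop m x\<close> are therefore only known under a growth condition on \<open>m\<close>
  that is matched by decay of \<open>x\<close>.\<close>

definition mulop :: "(int^'d \<Rightarrow> complex) \<Rightarrow> 'd::finite wien \<Rightarrow> 'd wien" where
  "mulop m x = Wien (\<lambda>n. m n * coef x n)"

lemma
  fixes x :: "'d::finite wien"
  assumes m: "\<And>n. norm (m n) \<le> c * wt n ^ r" and x: "wle (s + r) x B" and c: "0 \<le> c"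
  shows coef_mulop_wle: "coef (mulop m x) n = m n * coef x n"
    and wle_mulop: "wle s (mulop m x) (c * B)"
proof -
  have *: "(\<Sum>n\<in>A. wt n ^ s * norm (m n * coef x n)) \<le> c * B" if A: "finite A" for A
  proof -
    have "(\<Sum>n\<in>A. wt n ^ s * norm (m n * coef x n)) \<le> (\<Sum>n\<in>A. wt n ^ s * (c * wt n ^ r * norm (coef x n)))"
      using m by (intro sum_mono mult_left_mono) (auto simp: norm_mult wt_nonneg mult_right_mono)
    also have "\<dots> = c * (\<Sum>n\<in>A. wt n ^ (s + r) * norm (coef x n))"
      by (simp add: sum_distrib_left power_add mult_ac)
    also have "\<dots> \<le> c * B" using wleD[OF x A] c by (rule mult_left_mono)
    finally show ?thesis .
  qed
  have "(\<Sum>n\<in>A. norm (m n * coef x n)) \<le> c * B" if A: "finite A" for A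
  proof (rule order_trans[OF sum_mono *[OF A]])
    fix n
    show "norm (m n * coef x n) \<le> wt n ^ s * norm (m n * coef x n)"
      using mult_right_mono[OF one_le_power[OF wt_ge_1[of n], of s] norm_ge_zero[of "m n * coef x n"]] by simp
  qed
  from Wien_finite_sums(1)[OF this] have **: "coef (mulop m x) = (\<lambda>n. m n * coef x n)" by (simp add: mulop_def)
  then show "coef (mulop m x) n = m n * coef x n" by simp
  show "wle s (mulop m x) (c * B)" by (rule wleI) (use * in \<open>simp add: **\<close>)
qed

text \<open>These are the coefficient families of smooth functions.\<close>

definition smoothw :: "'d::finite wien \<Rightarrow> bool" where
  "smoothw x \<longleftrightarrow> (\<forall>s. \<exists>B. wle s x B)"

lemma wle_imp_smoothw: "(\<And>s. wle s x (B s)) ==> smoothw x"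
  by (auto simp: smoothw_def)

lemma smoothw_add: "smoothw x ==> smoothw y ==> smoothw (x + y)"
  unfolding smoothw_def by (meson wle_add)

lemma smoothw_0 [simp]: "smoothw 0"
  unfolding smoothw_def using wle_zero by blast

lemma smoothw_single: "smoothw (single m c)"
  unfolding smoothw_def using wle_single by blast

lemma smoothw_diff: "smoothw x ==> smoothw y ==> smoothw (x - y)"
  unfolding smoothw_def by (meson wle_diff)

lemma smoothw_mult: "smoothw x ==> smoothw y ==> smoothw (x * y)"
  unfolding smoothw_def by (meson wle_mult)

lemma smoothw_star: "smoothw x ==> smoothw (star x)"
  unfolding smoothw_def by (meson wle_star)

definition pbdd :: "(int^'d \<Rightarrow> complex) \<Rightarrow> bool" where
  "pbdd m \<longleftrightarrow> (\<exists>c r. 0 \<le> c \<and> (\<forall>n. norm (m n) \<le> c * wt n ^ r))"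

lemma pbddI: "(\<And>n. norm (m n) \<le> c * wt n ^ r) ==> 0 \<le> c ==> pbdd m"
  by (auto simp: pbdd_def)

lemma coef_mulop:
  assumes "pbdd m" "smoothw x"
  shows "coef (mulop m x) n = m n * coef x n"
proof -
  obtain c r where "0 \<le> c" "\<And>n. norm (m n) \<le> c * wt n ^ r" using assms(1) by (auto simp: pbdd_def)
  moreover obtain B where "wle (0 + r) x B" using assms(2) by (auto simp: smoothw_def)
  ultimately show ?thesis using coef_mulop_wle[of m c r 0 x B n] by blast
qed

lemma smoothw_mulop:
  assumes "pbdd m" "smoothw x"
  shows "smoothw (mulop m x)"
proof -
  obtain c r where "0 \<le> c" "\<And>n. norm (m n) \<le> c * wt n ^ r" using assms(1) by (auto simp: pbdd_def)
  then have "\<exists>B. wle s (mulop m x) B" for s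
    using assms(2) wle_mulop[of m c r s x] by (metis smoothw_def)
  then show ?thesis by (auto simp: smoothw_def)
qed

lemma mulop_add:
  "pbdd m ==> smoothw x ==> smoothw y ==> mulop m (x + y) = mulop m x + mulop m y"
  by (rule wien_eqI) (simp add: coef_mulop smoothw_add algebra_simps)

lemma mulop_diff:
  "pbdd m ==> smoothw x ==> smoothw y ==> mulop m (x - y) = mulop m x - mulop m y"
  by (rule wien_eqI) (simp add: coef_mulop smoothw_diff algebra_simps)

text \<open>The group generated by the multiplier \<open>i psi\<close>. It preserves every weighted
  norm whatever the growth of \<open>psi\<close>. Besides the Schroedinger flows it describes
  translations in space, for symbols linear in \<open>n\<close>.\<close>

definition phase :: "(int^'d \<Rightarrow> real) \<Rightarrow> real \<Rightarrow> 'd::finite wien \<Rightarrow> 'd wien" where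
  "phase \<psi> t x = Wien (\<lambda>n. cis (\<psi> n * t) * coef x n)"

lemma coef_phase [simp]: "coef (phase \<psi> t x) n = cis (\<psi> n * t) * coef x n"
  unfolding phase_def by (subst coef_Wien) (auto simp: norm_mult coef_summable)

lemma wle_phase [simp]: "wle s (phase \<psi> t x) B \<longleftrightarrow> wle s x B"
  by (simp add: wle_def norm_mult)

lemma norm_phase [simp]: "norm (phase \<psi> t x) = norm x"
  by (simp add: norm_wien_def norm_mult)

lemma phase_phase: "phase \<psi> t (phase \<psi> s x) = phase \<psi> (t + s) x"
  by (rule wien_eqI) (simp add: mult.assoc[symmetric] cis_mult ring_distribs)

lemma phase_0 [simp]: "phase \<psi> 0 x = x"
  by (rule wien_eqI) simp

lemma phase_uminus: "phase (\<lambda>n. - \<psi> n) t x = phase \<psi> (- t) x"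
  by (rule wien_eqI) simp

lemma bounded_linear_phase: "bounded_linear (phase \<psi> t)"
  by (rule bounded_linear_intro[of _ 1]) (auto intro!: wien_eqI simp: algebra_simps)

lemma phase_diff: "phase \<psi> t (x - y) = phase \<psi> t x - phase \<psi> t y"
  by (rule wien_eqI) (simp add: algebra_simps)

section \<open>Limits and derivatives in the coefficient space\<close>

lemma wien_tendstoI:
  assumes lim: "\<And>n. ((\<lambda>h. coef (c h) n) \<longlongrightarrow> coef c0 n) F"
    and dom: "eventually (\<lambda>h. \<forall>n. norm (coef (c h) n - coef c0 n) \<le> g n) F"
    and g: "g summable_on UNIV"
  shows "(c \<longlongrightarrow> c0) F"
proof -
  have "((\<lambda>h. infsum (\<lambda>n. norm (coef (c h) n - coef c0 n)) UNIV) \<longlongrightarrow> 0) F"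
    by (rule summable_dominated_tendsto_0[OF tendsto_norm_zero[OF LIM_zero[OF lim]] _ g])
       (rule eventually_mono[OF dom], simp)
  then have "((\<lambda>h. norm (c h - c0)) \<longlongrightarrow> 0) F"
    by (simp add: norm_wien_def)
  then show ?thesis
    by (rule LIM_zero_cancel[OF tendsto_norm_zero_cancel])
qed

text \<open>The group is strongly continuous but in general not continuous in operator norm. The
  change of the argument is handled by the isometry, the change of time at the fixed element
  \<open>z0\<close> by dominated convergence.\<close>

lemma phase_tendsto:
  assumes t: "(t \<longlongrightarrow> t0) F" and z: "(z \<longlongrightarrow> z0) F"
  shows "((\<lambda>h. phase \<psi> (t h) (z h)) \<longlongrightarrow> phase \<psi> t0 z0) F"
proof -
  have 1: "((\<lambda>h. phase \<psi> (t h) z0) \<longlongrightarrow> phase \<psi> t0 z0) F"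
  proof (rule wien_tendstoI)
    show "(\<lambda>n. 2 * norm (coef z0 n)) summable_on UNIV"
      by (intro summable_on_cmult_right coef_summable)
    show "\<forall>\<^sub>F h in F. \<forall>n. norm (coef (phase \<psi> (t h) z0) n - coef (phase \<psi> t0 z0) n) \<le> 2 * norm (coef z0 n)"
      by (intro always_eventually allI order_trans[OF norm_triangle_ineq4]) (simp add: norm_mult)
    show "((\<lambda>h. coef (phase \<psi> (t h) z0) n) \<longlongrightarrow> coef (phase \<psi> t0 z0) n) F" for n
      unfolding coef_phase by (intro tendsto_intros t)
  qed
  have "((\<lambda>h. norm (phase \<psi> (t h) (z h - z0))) \<longlongrightarrow> 0) F"
    unfolding norm_phase by (rule tendsto_norm_zero[OF LIM_zero[OF z]])
  then have 2: "((\<lambda>h. phase \<psi> (t h) (z h - z0)) \<longlongrightarrow> 0) F"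
    by (rule tendsto_norm_zero_cancel)
  show ?thesis using tendsto_add[OF 2 1] by (simp add: phase_diff)
qed

lemma has_vector_derivative_iff_quotient:
  "(f has_vector_derivative d) (at t within S) \<longleftrightarrow> ((\<lambda>\<tau>. (f \<tau> - f t) /\<^sub>R (\<tau> - t)) \<longlongrightarrow> d) (at t within S)"
proof -
  have ev: "eventually (\<lambda>\<tau>. norm ((f \<tau> - f t) - (\<tau> - t) *\<^sub>R d) / norm (\<tau> - t) = norm ((f \<tau> - f t) /\<^sub>R (\<tau> - t) - d)) (at t within S)"
  proof (rule eventually_at_filter[THEN iffD2], rule always_eventually, safe)
    fix \<tau> assume "\<tau> \<noteq> t"
    then have "(f \<tau> - f t) /\<^sub>R (\<tau> - t) - d = ((f \<tau> - f t) - (\<tau> - t) *\<^sub>R d) /\<^sub>R (\<tau> - t)"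
      by (simp add: scaleR_diff_right)
    then show "norm ((f \<tau> - f t) - (\<tau> - t) *\<^sub>R d) / norm (\<tau> - t) = norm ((f \<tau> - f t) /\<^sub>R (\<tau> - t) - d)"
      by (simp add: divide_inverse abs_inverse mult.commute)
  qed
  have "(f has_vector_derivative d) (at t within S) \<longleftrightarrow>
      ((\<lambda>\<tau>. norm ((f \<tau> - f t) - (\<tau> - t) *\<^sub>R d) / norm (\<tau> - t)) \<longlongrightarrow> 0) (at t within S)"
    unfolding has_vector_derivative_def has_derivative_iff_norm
    by (simp add: bounded_linear_scaleR_left)
  also have "\<dots> \<longleftrightarrow> ((\<lambda>\<tau>. norm ((f \<tau> - f t) /\<^sub>R (\<tau> - t) - d)) \<longlongrightarrow> 0) (at t within S)"
    by (rule tendsto_cong[OF ev])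
  also have "\<dots> \<longleftrightarrow> ((\<lambda>\<tau>. (f \<tau> - f t) /\<^sub>R (\<tau> - t)) \<longlongrightarrow> d) (at t within S)"
    by (subst tendsto_norm_zero_iff) (rule LIM_zero_iff)
  finally show ?thesis .
qed

text \<open>Lipschitz bounds with summable constants majorize the difference quotients, so the
  coefficientwise derivatives form a derivative in norm.\<close>

lemma wien_has_vector_derivativeI:
  assumes d: "\<And>n. ((\<lambda>\<tau>. coef (c \<tau>) n) has_vector_derivative coef c' n) (at t within S)"
    and g: "g summable_on UNIV"
    and lip: "\<And>\<tau> n. \<tau> \<in> S ==> norm (coef (c \<tau>) n - coef (c t) n) \<le> g n * \<bar>\<tau> - t\<bar>"
    and c': "\<And>n. norm (coef c' n) \<le> g n"
  shows "(c has_vector_derivative c') (at t within S)"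
  unfolding has_vector_derivative_iff_quotient
proof (rule wien_tendstoI)
  show "((\<lambda>\<tau>. coef ((c \<tau> - c t) /\<^sub>R (\<tau> - t)) n) \<longlongrightarrow> coef c' n) (at t within S)" for n
    using d[of n] unfolding has_vector_derivative_iff_quotient by simp
  show "(\<lambda>n. 2 * g n) summable_on UNIV" by (intro summable_on_cmult_right g)
  have *: "norm (coef ((c \<tau> - c t) /\<^sub>R (\<tau> - t)) n - coef c' n) \<le> 2 * g n"
    if "\<tau> \<in> S" "\<tau> \<noteq> t" for \<tau> n
  proof -
    have "norm (coef ((c \<tau> - c t) /\<^sub>R (\<tau> - t)) n) \<le> g n"
      using lip[OF that(1), of n] that(2) by (simp add: abs_inverse) (simp add: field_simps)
    then show ?thesis using c'[of n] by (intro order_trans[OF norm_triangle_ineq4]) simp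
  qed
  then show "\<forall>\<^sub>F \<tau> in at t within S. \<forall>n. norm (coef ((c \<tau> - c t) /\<^sub>R (\<tau> - t)) n - coef c' n) \<le> 2 * g n"
    by (intro eventually_at_filter[THEN iffD2] always_eventually) auto
qed

lemma norm_cis_diff_le: "norm (cis a - cis b) \<le> \<bar>a - b\<bar>"
proof -
  have "norm (cis a - cis b) = norm (cis b * (cis (a - b) - 1))"
    by (simp add: right_diff_distrib cis_mult)
  also have "\<dots> = norm (cis (a - b) - 1)" by (simp add: norm_mult)
  also have "\<dots> \<le> \<bar>a - b\<bar>"
    using dist_exp_i_1[of "a - b"] abs_sin_x_le_abs_x[of "(a - b) / 2"] by (simp add: cis_conv_exp)
  finally show ?thesis .
qed

lemma phase_has_vector_derivative_0:
  assumes \<psi>: "pbdd (\<lambda>n. of_real (\<psi> n))" and x: "smoothw x"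
  shows "((\<lambda>t. phase \<psi> t x) has_vector_derivative mulop (\<lambda>n. \<i> * of_real (\<psi> n)) x) (at 0 within S)"
proof -
  obtain c r where c: "0 \<le> c" "\<And>n. \<bar>\<psi> n\<bar> \<le> c * wt n ^ r" using \<psi> by (auto simp: pbdd_def)
  then have i: "pbdd (\<lambda>n. \<i> * of_real (\<psi> n))" by (intro pbddI[of _ c r]) (auto simp: norm_mult)
  obtain B where B: "wle r x B" using x by (auto simp: smoothw_def)
  let ?g = "\<lambda>n. c * (wt n ^ r * norm (coef x n))"
  have g: "?g summable_on UNIV" by (intro summable_on_cmult_right wle_coef_summable[OF B])
  have le: "\<bar>\<psi> n\<bar> * norm (coef x n) \<le> ?g n" for n
    using mult_right_mono[OF c(2)[of n], of "norm (coef x n)"] by (simp add: mult_ac)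
  have 1: "norm (coef (mulop (\<lambda>n. \<i> * of_real (\<psi> n)) x) n) \<le> ?g n" for n
    using le[of n] by (simp add: coef_mulop[OF i x] norm_mult)
  have 2: "norm (coef (phase \<psi> \<tau> x) n - coef (phase \<psi> 0 x) n) \<le> ?g n * \<bar>\<tau> - 0\<bar>" for \<tau> n
  proof -
    have "norm (coef (phase \<psi> \<tau> x) n - coef (phase \<psi> 0 x) n) = norm (cis (\<psi> n * \<tau>) - cis 0) * norm (coef x n)"
      by (simp add: norm_mult[symmetric] left_diff_distrib)
    also have "\<dots> \<le> \<bar>\<psi> n * \<tau> - 0\<bar> * norm (coef x n)"
      by (intro mult_right_mono norm_cis_diff_le) simp
    also have "\<dots> = \<bar>\<tau>\<bar> * (\<bar>\<psi> n\<bar> * norm (coef x n))" by (simp add: abs_mult)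
    also have "\<dots> \<le> \<bar>\<tau>\<bar> * ?g n" by (intro mult_left_mono le) simp
    finally show ?thesis by (simp add: mult.commute)
  qed
  have 3: "((\<lambda>\<tau>. coef (phase \<psi> \<tau> x) n) has_vector_derivative coef (mulop (\<lambda>n. \<i> * of_real (\<psi> n)) x) n) (at 0 within S)" for n
  proof -
    have "((\<lambda>z. exp (\<i> * (of_real (\<psi> n) * z)) * coef x n) has_field_derivative \<i> * of_real (\<psi> n) * coef x n) (at (of_real 0))"
      by (auto intro!: derivative_eq_intros)
    from has_vector_derivative_real_field[OF this, of S]
    show ?thesis by (simp add: coef_mulop[OF i x] cis_conv_exp)
  qed
  show ?thesis by (rule wien_has_vector_derivativeI[OF 3 g 2 1])
qed

text \<open>A product rule for a generator that may be unbounded. By the group property the flow is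
  factored through time \<open>t\<close>; what remains is the derivative of the group at time zero
  on the smooth element \<open>z t\<close>, and strong continuity applied to the difference quotient
  of \<open>z\<close>.\<close>

lemma phase_has_vector_derivative:
  assumes \<psi>: "pbdd (\<lambda>n. of_real (\<psi> n))" and x: "smoothw (z t)"
    and z: "(z has_vector_derivative z') (at t within S)"
  shows "((\<lambda>\<tau>. phase \<psi> \<tau> (z \<tau>)) has_vector_derivative
     phase \<psi> t (z' + mulop (\<lambda>n. \<i> * of_real (\<psi> n)) (z t))) (at t within S)"
proof -
  let ?D = "mulop (\<lambda>n. \<i> * of_real (\<psi> n)) (z t)"
  have lin: "((\<lambda>\<tau>. \<tau> - t) \<longlongrightarrow> 0) (at t within S)"
    by (rule LIM_zero[OF tendsto_ident_at])
  have 0: "((\<lambda>h. (phase \<psi> h (z t) - z t) /\<^sub>R h) \<longlongrightarrow> ?D) (at 0)"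
    using phase_has_vector_derivative_0[OF \<psi> x, of UNIV]
    unfolding has_vector_derivative_iff_quotient by simp
  have "filterlim (\<lambda>\<tau>. \<tau> - t) (at 0) (at t within S)"
    unfolding filterlim_at by (intro conjI lin) (simp add: eventually_at_filter)
  from filterlim_compose[OF 0 this]
  have 1: "((\<lambda>\<tau>. (phase \<psi> (\<tau> - t) (z t) - z t) /\<^sub>R (\<tau> - t)) \<longlongrightarrow> ?D) (at t within S)" .
  have 2: "((\<lambda>\<tau>. phase \<psi> (\<tau> - t) ((z \<tau> - z t) /\<^sub>R (\<tau> - t))) \<longlongrightarrow> z') (at t within S)"
    using phase_tendsto[OF lin z[unfolded has_vector_derivative_iff_quotient], of \<psi>] by simp
  have eq: "phase \<psi> (\<tau> - t) ((z \<tau> - z t) /\<^sub>R (\<tau> - t)) + (phase \<psi> (\<tau> - t) (z t) - z t) /\<^sub>R (\<tau> - t)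
       = (phase \<psi> (\<tau> - t) (z \<tau>) - z t) /\<^sub>R (\<tau> - t)" for \<tau>
    by (rule wien_eqI) (simp add: algebra_simps)
  have "((\<lambda>\<tau>. phase \<psi> (\<tau> - t) (z \<tau>)) has_vector_derivative z' + ?D) (at t within S)"
    using tendsto_add[OF 2 1] unfolding has_vector_derivative_iff_quotient by (simp add: eq)
  from bounded_linear.has_vector_derivative[OF bounded_linear_phase[of \<psi> t] this]
  show ?thesis by (simp add: phase_phase)
qed

section \<open>Fourier coefficients of periodic functions\<close>

lemma periodic_axis_int:
  fixes f :: "real^'d \<Rightarrow> complex"
  assumes "periodic f"
  shows "f (x + axis j (2 * pi * of_int k)) = f x"
proof -
  have nat: "f (x + axis j (2 * pi * of_nat n)) = f x" for n x
  proof (induction n)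
    case (Suc n)
    have "x + axis j (2 * pi * of_nat (Suc n)) = (x + axis j (2 * pi * of_nat n)) + axis j (2 * pi)"
      by (simp add: vec_eq_iff axis_def algebra_simps)
    then show ?case using assms Suc unfolding periodic_def by metis
  next
    case 0
    have z: "axis j 0 = (0 :: real^'d)" by (simp add: vec_eq_iff axis_def)
    show ?case by (simp only: of_nat_0 mult_zero_right z add_0_right)
  qed
  show ?thesis
  proof (cases "0 \<le> k")
    case True
    then show ?thesis using nat[of x "nat k"] by simp
  next
    case False
    have e: "(x + axis j (2 * pi * of_int k)) + axis j (2 * pi * of_nat (nat (- k))) = x"
      using False by (simp add: vec_eq_iff axis_def of_nat_nat)
    show ?thesis using nat[of "x + axis j (2 * pi * of_int k)" "nat (- k)"] unfolding e by simp
  qed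
qed

text \<open>A periodic function factors through the torus. Points with the same coordinates on the
  unit circles differ by integer multiples of the periods, which are removed one coordinate after
  the other.\<close>

lemma periodic_cis_eq:
  fixes f :: "real^'d \<Rightarrow> complex"
  assumes f: "periodic f" and eq: "\<And>j. cis (p $ j) = cis (q $ j)"
  shows "f p = f q"
proof -
  have "\<exists>k::int. p $ j = q $ j + 2 * pi * of_int k" for j
    using eq[of j] sin_cos_eq_iff[of "p $ j" "q $ j"] by (auto simp: complex_eq_iff)
  then obtain k :: "'d \<Rightarrow> int" where k: "\<And>j. p $ j = q $ j + 2 * pi * of_int (k j)" by metis
  have "f (q + (\<Sum>j\<in>J. axis j (2 * pi * of_int (k j)))) = f q" for J :: "'d set"
  proof (induction J rule: infinite_finite_induct)
    case (insert x F)
    then have "f (q + (\<Sum>j\<in>insert x F. axis j (2 * pi * of_int (k j))))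
      = f ((q + (\<Sum>j\<in>F. axis j (2 * pi * of_int (k j)))) + axis x (2 * pi * of_int (k x)))"
      by (simp add: ac_simps)
    then show ?case using insert by (simp only: periodic_axis_int[OF f])
  qed auto
  moreover have "(\<Sum>j\<in>UNIV. axis j (2 * pi * of_int (k j))) $ i = 2 * pi * of_int (k i)" for i
    by (subst sum_component, subst sum.remove[of _ i]) (auto simp: axis_def)
  then have "q + (\<Sum>j\<in>UNIV. axis j (2 * pi * of_int (k j))) = p"
    by (simp add: vec_eq_iff k)
  ultimately show ?thesis by metis
qed

lemma synth_scaleR: "synth (r *\<^sub>R x) p = r *\<^sub>R synth x p"
  by (rule linear_scale[OF bounded_linear.linear[OF bounded_linear_synth]])

lemma synth_tendsto:
  assumes x: "(x \<longlongrightarrow> x0) F" and p: "(p \<longlongrightarrow> p0) F"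
  shows "((\<lambda>h. synth (x h) (p h)) \<longlongrightarrow> synth x0 p0) F"
proof -
  let ?T = "\<lambda>p. phase (\<lambda>n. dotp n p) 1 x0"
  have dotp: "((\<lambda>h. dotp n (p h)) \<longlongrightarrow> dotp n p0) F" for n
    unfolding dotp_def by (intro tendsto_intros p)
  have "((\<lambda>h. ?T (p h)) \<longlongrightarrow> ?T p0) F"
  proof (rule wien_tendstoI)
    show "(\<lambda>n. 2 * norm (coef x0 n)) summable_on UNIV"
      by (intro summable_on_cmult_right coef_summable)
    show "\<forall>\<^sub>F h in F. \<forall>n. norm (coef (?T (p h)) n - coef (?T p0) n) \<le> 2 * norm (coef x0 n)"
      by (intro always_eventually allI order_trans[OF norm_triangle_ineq4]) (simp add: norm_mult)
    show "((\<lambda>h. coef (?T (p h)) n) \<longlongrightarrow> coef (?T p0) n) F" for n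
      unfolding coef_phase by (intro tendsto_intros dotp)
  qed
  from bounded_linear.tendsto[OF bounded_linear_synth[of 0] this]
  have 1: "((\<lambda>h. synth x0 (p h)) \<longlongrightarrow> synth x0 p0) F"
    by (simp add: synth_def dotp_def mult.commute)
  have "((\<lambda>h. norm (x h - x0)) \<longlongrightarrow> 0) F" by (rule tendsto_norm_zero[OF LIM_zero[OF x]])
  then have 2: "((\<lambda>h. synth (x h - x0) (p h)) \<longlongrightarrow> 0) F"
    by (rule Lim_null_comparison[rotated]) (simp add: norm_synth_le)
  show ?thesis using tendsto_add[OF 2 1] by (simp add: synth_diff)
qed

lemma continuous_on_synth [continuous_intros]:
  "continuous_on S x ==> continuous_on S p ==> continuous_on S (\<lambda>z. synth (x z) (p z))"
  unfolding continuous_on_def by (auto intro: synth_tendsto)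

lemma periodic_synth: "periodic (synth x)"
proof -
  have "cis (dotp n (p + axis j (2 * pi))) = cis (dotp n p)" for n :: "int^'a" and p j
    by (simp add: dotp_add_right cis_mult[symmetric]) (metis cis_multiple_2pi Ints_of_int mult.commute)
  then show ?thesis by (simp add: periodic_def synth_def)
qed

definition cube :: "(real^'d) set" where "cube = cbox 0 (\<chi> j. 2 * pi)"

definition hat :: "(real^'d \<Rightarrow> complex) \<Rightarrow> int^'d \<Rightarrow> complex" where
  "hat f n = integral cube (\<lambda>p. f p * cis (- dotp n p)) /\<^sub>R measure lborel (cube :: (real^'d) set)"

lemma content_cube_pos: "0 < measure lborel (cube :: (real^'d) set)"
  unfolding cube_def by (rule content_pos_lt) (auto simp: Basis_vec_def inner_axis)

lemma continuous_dotp [continuous_intros]: "continuous_on S g ==> continuous_on S (\<lambda>x. dotp n (g x))"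
  unfolding dotp_def by (intro continuous_intros)

lemma continuous_on_cis' [continuous_intros]: "continuous_on S g ==> continuous_on S (\<lambda>x. cis (g x))"
  unfolding cis_conv_exp by (intro continuous_intros)

lemma integrable_cube: "continuous_on UNIV f ==> f integrable_on (cube :: (real^'d) set)"
  for f :: "real^'d \<Rightarrow> 'b::banach"
  unfolding cube_def by (rule integrable_continuous) (rule continuous_on_subset, auto)

lemma hat_integrable: "continuous_on UNIV f ==> (\<lambda>p. f p * cis (- dotp n p)) integrable_on (cube :: (real^'d) set)"
  by (intro integrable_cube continuous_intros)

lemma hat_add: "continuous_on UNIV f ==> continuous_on UNIV g ==> hat (\<lambda>p. f p + g p) n = hat f n + hat g n"
  unfolding hat_def by (simp add: distrib_right integral_add hat_integrable scaleR_add_right)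

lemma hat_diff: "continuous_on UNIV f ==> continuous_on UNIV g ==> hat (\<lambda>p. f p - g p) n = hat f n - hat g n"
  unfolding hat_def by (simp add: left_diff_distrib integral_diff hat_integrable scaleR_diff_right)

lemma hat_scaleR: "hat (\<lambda>p. r *\<^sub>R f p) n = r *\<^sub>R hat f n"
  unfolding hat_def by simp

lemma norm_hat_le:
  fixes f :: "real^'d \<Rightarrow> complex"
  assumes "continuous_on UNIV f" "\<And>p. norm (f p) \<le> B"
  shows "norm (hat f n) \<le> B"
proof -
  have "norm (integral cube (\<lambda>p. f p * cis (- dotp n p))) \<le> B * measure lborel (cube :: (real^'d) set)"
    unfolding cube_def
    by (rule integrable_bound) (use assms hat_integrable[OF assms(1)] order_trans[OF norm_ge_zero assms(2)] in \<open>auto simp: norm_mult cube_def\<close>)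
  then show ?thesis using content_cube_pos[where 'd='d]
    by (simp add: hat_def field_simps)
qed

text \<open>The cube, elongated by \<open>h\<close> in direction \<open>j\<close>, is cut once at
  height \<open>h\<close> and once at height \<open>2 * pi\<close>. The first cut leaves the shifted
  cube, the second the original one; the other two pieces are translates of each other by a
  period.\<close>

lemma integral_cube_shift:
  fixes f :: "real^'d \<Rightarrow> complex"
  assumes f: "continuous_on UNIV f" "periodic f" and h: "0 \<le> h"
  shows "integral cube (\<lambda>p. f (p + axis j h)) = integral cube f"
proof -
  define b :: "real^'d" where "b = (\<chi> i. 2 * pi)"
  define L where "L = cbox 0 (\<chi> i. if i = j then h else 2 * pi)"
  let ?Q = "cbox 0 (b + axis j h)"
  have int: "f integrable_on cbox u v" for u v
    by (rule integrable_continuous) (rule continuous_on_subset[OF f(1)], auto)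
  have j: "axis j 1 \<in> (Basis :: (real^'d) set)" "\<And>x :: real^'d. x \<bullet> axis j 1 = x $ j" by (auto simp: Basis_vec_def Basis_real_def inner_axis)
  have bj: "b $ i = 2 * pi" for i by (simp add: b_def)
  have 1: "integral ?Q f = integral (?Q \<inter> {x. x $ j \<le> h}) f + integral (?Q \<inter> {x. x $ j \<ge> h}) f"
    using integral_split[OF int j(1), where c = h] by (simp add: j(2))
  have 2: "integral ?Q f = integral (?Q \<inter> {x. x $ j \<le> 2 * pi}) f + integral (?Q \<inter> {x. x $ j \<ge> 2 * pi}) f"
    using integral_split[OF int j(1), where c = "2 * pi"] by (simp add: j(2))
  have "?Q \<inter> {x. x $ j \<le> h} = L"
    unfolding L_def using h pi_gt_zero
    by (auto simp: mem_box_cart bj axis_def split: if_splits) (smt (verit) pi_gt_zero)+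
  moreover have "?Q \<inter> {x. x $ j \<ge> h} = cbox (0 + axis j h) (b + axis j h)"
    using h by (auto simp: mem_box_cart bj axis_def split: if_splits) (metis order_trans)+
  moreover have "?Q \<inter> {x. x $ j \<le> 2 * pi} = cbox 0 b"
    using h by (auto simp: mem_box_cart bj axis_def split: if_splits) (smt (verit))+
  moreover have "?Q \<inter> {x. x $ j \<ge> 2 * pi} = cbox (0 + axis j (2 * pi)) ((\<chi> i. if i = j then h else 2 * pi) + axis j (2 * pi))"
    using h pi_gt_zero by (auto simp: mem_box_cart bj axis_def split: if_splits) (smt (verit) pi_gt_zero)+
  moreover have "integral (cbox (0 + axis j (2 * pi)) ((\<chi> i. if i = j then h else 2 * pi) + axis j (2 * pi))) f = integral L f"
    unfolding L_def integral_shift_cbox_plus[symmetric] using f(2) by (simp add: o_def periodic_def add.commute)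
  moreover have "integral (cbox (0 + axis j h) (b + axis j h)) f = integral (cbox 0 b) (\<lambda>p. f (p + axis j h))"
    unfolding integral_shift_cbox_plus[symmetric] by (simp add: o_def add.commute)
  ultimately show ?thesis using 1 2 by (simp add: cube_def b_def)
qed

lemma hat_synth:
  fixes x :: "'d::finite wien"
  shows "hat (synth x) n = coef x n"
proof -
  have cont: "continuous_on UNIV (synth y)" for y :: "'d wien" by (intro continuous_intros)
  have "bounded_linear (\<lambda>x :: 'd wien. hat (synth x) n)"
  proof (rule bounded_linear_intro[of _ 1])
    fix x y :: "'d wien" and r :: real
    show "hat (synth (x + y)) n = hat (synth x) n + hat (synth y) n"
      using hat_add[OF cont cont, of x y n] by (simp add: synth_add[abs_def])
    show "hat (synth (r *\<^sub>R x)) n = r *\<^sub>R hat (synth x) n"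
    proof -
      have "synth (r *\<^sub>R x) = (\<lambda>p. r *\<^sub>R synth x p)" by (rule ext) (rule synth_scaleR)
      then show ?thesis by (simp only: hat_scaleR)
    qed
    show "norm (hat (synth x) n) \<le> norm x * 1"
      using norm_hat_le[OF cont norm_synth_le] by simp
  qed
  then show ?thesis
  proof (rule bounded_linear_wien_eq[OF _ bounded_linear_coef])
    fix m c
    show "hat (synth (single m c)) n = coef (single m c) n"
    proof (cases "m = n")
      case True
      then show ?thesis using content_cube_pos[where 'd='d]
        by (simp add: hat_def synth_single mult.assoc cis_mult coef_single)
           (simp add: cube_def scaleR_conv_of_real)
    next
      case False
      then obtain j where j: "(m - n) $ j \<noteq> 0" by (auto simp: vec_eq_iff)
      define g where "g = (\<lambda>p. c * cis (dotp (m - n) p))"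
      have g: "g = synth (single (m - n) c)" by (auto simp: g_def synth_single)
      \<comment> \<open>A shift by half a period in a coordinate where \<open>m\<close> and
        \<open>n\<close> differ reverses the sign of the integrand but keeps the integral, which is
        thus zero.\<close>
      define h where "h = pi / \<bar>of_int ((m - n) $ j)\<bar>"
      have "of_int ((m - n) $ j) * h = pi \<or> of_int ((m - n) $ j) * h = - pi"
        using j unfolding h_def by (cases "(m - n) $ j > 0") (auto simp del: vector_minus_component)
      then have "cis (of_int ((m - n) $ j) * h) = - 1"
        by (auto simp: complex_eq_iff)
      then have "g (p + axis j h) = - g p" for p
        by (simp add: g_def dotp_add_right cis_mult[symmetric])
      moreover have "integral cube (\<lambda>p. g (p + axis j h)) = integral cube g"
        by (rule integral_cube_shift) (auto simp: g periodic_synth h_def intro: cont)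
      ultimately have "integral cube g = 0" by simp
      moreover have "synth (single m c) p * cis (- dotp n p) = g p" for p
        by (simp add: g_def synth_single mult.assoc cis_mult dotp_diff)
      ultimately show ?thesis using False by (simp add: hat_def coef_single)
    qed
  qed
qed

lemma synth_inject: "synth x = synth y ==> x = y"
  by (rule wien_eqI) (metis hat_synth)

section \<open>Trigonometric approximation and injectivity of the Fourier coefficients\<close>

text \<open>Stone-Weierstrass on the torus, realized as the compact set \<open>S\<close> of vectors
  with unimodular entries. The algebra consists of the functions whose pullback along
  \<open>tor\<close> is the synthesis of an element; real and imaginary parts of the entries
  separate the points.\<close>

lemma periodic_approx_real:
  fixes f :: "real^'d \<Rightarrow> complex"
  assumes f: "continuous_on UNIV f" "periodic f" and e: "0 < e" and real: "\<And>p. f p = of_real (Re (f p))"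
  obtains x where "\<And>p. norm (f p - synth x p) < e"
proof -
  define tor where "tor p = (\<chi> j. cis (p $ j))" for p :: "real^'d"
  define S where "S = {z :: complex^'d. \<forall>j. norm (z $ j) = 1}"
  define ar where "ar z = (\<chi> j. Arg (z $ j))" for z :: "complex^'d"
  have tor_S: "tor p \<in> S" for p by (simp add: tor_def S_def)
  have cis_Arg': "cis (Arg z) = z" if "norm z = 1" for z :: complex
    using that cis_Arg[of z] by (cases "z = 0") (auto simp: sgn_div_norm)
  have tor_ar: "tor (ar z) = z" if "z \<in> S" for z
    using that by (simp add: S_def tor_def ar_def vec_eq_iff cis_Arg')
  have f_eq: "f p = f q" if "tor p = tor q" for p q
    using periodic_cis_eq[OF f(2), of p q] that by (simp add: tor_def vec_eq_iff)
  define F where "F z = Re (f (ar z))" for z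
  have F_tor: "F (tor p) = Re (f p)" for p
    unfolding F_def using f_eq[of "ar (tor p)" p] tor_ar[OF tor_S] by simp
  have "closed S"
  proof -
    have "S = (\<Inter>j. {z. norm (z $ j) = 1})" by (auto simp: S_def)
    then show ?thesis
      by (simp only:) (intro closed_INT ballI closed_Collect_eq continuous_intros)
  qed
  moreover have "bounded S"
  proof (rule boundedI)
    fix z assume "z \<in> S"
    then show "norm z \<le> real CARD('d)"
      using norm_le_l1_cart[of "0::real^'d"] L2_set_le_sum[of UNIV "\<lambda>j. norm (z $ j)"]
      by (simp add: S_def norm_vec_def)
  qed
  ultimately have "compact S" by (simp add: compact_eq_bounded_closed)
  have contF: "continuous_on S F"
    unfolding continuous_on_def
  proof
    fix z0 assume z0: "z0 \<in> S"
    \<comment> \<open>\<open>Arg\<close> jumps on the negative axis. Dividing by the entries of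
      \<open>z0\<close> moves the jump away from \<open>z0\<close>, so \<open>q\<close> is a lift to
      the covering space that is continuous at \<open>z0\<close>.\<close>
    define q where "q z = (\<chi> j. Arg (z0 $ j) + Arg (z $ j / z0 $ j))" for z :: "complex^'d"
    have nz: "z0 $ j \<noteq> 0" for j using z0 by (auto simp: S_def) (metis norm_zero zero_neq_one)
    have "tor (q z) = z" if "z \<in> S" for z
      using that z0 nz by (simp add: S_def tor_def q_def vec_eq_iff cis_mult[symmetric] cis_Arg' norm_divide)
    then have Fq: "F z = Re (f (q z))" if "z \<in> S" for z
      using that F_tor[of "q z"] by simp
    have "((\<lambda>z. Arg (z $ j / z0 $ j)) \<longlongrightarrow> Arg (z0 $ j / z0 $ j)) (at z0 within S)" for j
    proof (rule isCont_tendsto_compose[OF continuous_at_Arg])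
      show "z0 $ j / z0 $ j \<notin> \<real>\<^sub>\<le>\<^sub>0" using nz by simp
    qed (intro tendsto_intros nz)
    then have "(q \<longlongrightarrow> q z0) (at z0 within S)"
      unfolding q_def by (intro tendsto_vec_lambda tendsto_add tendsto_const)
    then have "((\<lambda>z. Re (f (q z))) \<longlongrightarrow> Re (f (q z0))) (at z0 within S)"
      by (intro tendsto_Re continuous_on_tendsto_compose[OF f(1)]) auto
    then show "(F \<longlongrightarrow> F z0) (at z0 within S)"
      unfolding Fq[OF z0]
      by (rule Lim_transform_within[OF _ zero_less_one]) (simp add: Fq)
  qed
  define P where "P G \<longleftrightarrow> continuous_on S G \<and> (\<exists>x. \<forall>p. synth x p = of_real (G (tor p)))" for G :: "complex^'d \<Rightarrow> real"
  have "\<exists>g. P g \<and> (\<forall>z\<in>S. \<bar>F z - g z\<bar> < e)"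
  proof (rule Stone_Weierstrass_HOL[OF \<open>compact S\<close> _ _ _ _ _ contF e])
    show "P (\<lambda>x. c)" for c unfolding P_def by (auto intro!: exI[of _ "cst (of_real c)"])
    show "continuous_on S g" if "P g" for g using that by (simp add: P_def)
    show "P (\<lambda>x. g x + h x)" if "P g \<and> P h" for g h
      using that unfolding P_def by (auto intro!: continuous_intros) (metis synth_add)
    show "P (\<lambda>x. g x * h x)" if "P g \<and> P h" for g h
      using that unfolding P_def by (auto intro!: continuous_intros) (metis synth_mult)
    fix z w assume zw: "z \<in> S \<and> w \<in> S \<and> z \<noteq> w"
    then obtain j where j: "z $ j \<noteq> w $ j" by (auto simp: vec_eq_iff)
    have "P (\<lambda>z. Re (z $ j))"
      unfolding P_def
    proof (intro conjI exI allI)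
      show "synth (single (axis j 1) (1/2) + single (- axis j 1) (1/2)) p = of_real (Re (tor p $ j))" for p
      proof -
        have "dotp (axis j 1) p = p $ j"
          unfolding dotp_def by (subst sum.remove[of _ j]) (auto simp: axis_def)
        then show ?thesis by (simp add: synth_add synth_single dotp_minus tor_def complex_eq_iff)
      qed
    qed (intro continuous_intros)
    moreover have "P (\<lambda>z. Im (z $ j))"
      unfolding P_def
    proof (intro conjI exI allI)
      show "synth (single (axis j 1) (-\<i>/2) + single (- axis j 1) (\<i>/2)) p = of_real (Im (tor p $ j))" for p
      proof -
        have "dotp (axis j 1) p = p $ j"
          unfolding dotp_def by (subst sum.remove[of _ j]) (auto simp: axis_def)
        then show ?thesis by (simp add: synth_add synth_single dotp_minus tor_def complex_eq_iff)
      qed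
    qed (intro continuous_intros)
    ultimately show "\<exists>g. P g \<and> g z \<noteq> g w" using j complex_eq_iff by blast
  qed
  then obtain g x where g: "\<And>z. z \<in> S ==> \<bar>F z - g z\<bar> < e" and x: "\<And>p. synth x p = of_real (g (tor p))"
    by (auto simp: P_def)
  have "norm (f p - synth x p) < e" for p
  proof -
    have "f p - synth x p = of_real (Re (f p) - g (tor p))" by (subst real) (simp add: x)
    then show ?thesis using g[OF tor_S[of p]] by (simp only: norm_of_real F_tor)
  qed
  then show thesis using that by blast
qed

lemma periodic_approx:
  fixes f :: "real^'d \<Rightarrow> complex"
  assumes f: "continuous_on UNIV f" "periodic f" and e: "0 < e"
  obtains x where "\<And>p. norm (f p - synth x p) < e"
proof -
  obtain x where x: "\<And>p. norm (of_real (Re (f p)) - synth x p) < e / 2"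
  proof (rule periodic_approx_real[of "\<lambda>p. of_real (Re (f p))" "e / 2"])
    show "continuous_on UNIV (\<lambda>p. complex_of_real (Re (f p)))" by (intro continuous_intros f)
  qed (use f e in \<open>auto simp: periodic_def\<close>)
  obtain y where y: "\<And>p. norm (of_real (Im (f p)) - synth y p) < e / 2"
  proof (rule periodic_approx_real[of "\<lambda>p. of_real (Im (f p))" "e / 2"])
    show "continuous_on UNIV (\<lambda>p. complex_of_real (Im (f p)))" by (intro continuous_intros f)
  qed (use f e in \<open>auto simp: periodic_def\<close>)
  have "norm (f p - synth (x + cst \<i> * y) p) < e" for p
  proof -
    have "f p - synth (x + cst \<i> * y) p = (of_real (Re (f p)) - synth x p) + \<i> * (of_real (Im (f p)) - synth y p)"
      by (simp add: synth_add synth_mult complex_eq_iff)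
    also have "norm \<dots> \<le> norm (of_real (Re (f p)) - synth x p) + norm (\<i> * (of_real (Im (f p)) - synth y p))"
      by (rule norm_triangle_ineq)
    also have "\<dots> < e" using x[of p] y[of p] by (simp add: norm_mult)
    finally show ?thesis .
  qed
  then show thesis using that by blast
qed

text \<open>For a synthesis the effect of a translation on the coefficients is explicit, and a
  general continuous periodic function is a uniform limit of such functions.\<close>

lemma hat_shift:
  fixes f :: "real^'d \<Rightarrow> complex"
  assumes f: "continuous_on UNIV f" "periodic f"
  shows "hat (\<lambda>p. f (p + v)) n = cis (dotp n v) * hat f n"
proof -
  have "norm (hat (\<lambda>p. f (p + v)) n - cis (dotp n v) * hat f n) \<le> 0 + e" if e: "0 < e" for e
  proof -
    obtain x where x: "\<And>p. norm (f p - synth x p) < e / 2"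
      using periodic_approx[OF f half_gt_zero[OF e]] by blast
    let ?y = "phase (\<lambda>n. dotp n v) 1 x"
    have cont: "continuous_on UNIV (synth x)" "continuous_on UNIV (\<lambda>p. f (p + v))" "continuous_on UNIV (synth ?y)"
      by (intro continuous_intros continuous_on_compose2[OF f(1)]; simp)+
    have y: "synth ?y p = synth x (p + v)" for p
      by (simp add: synth_def dotp_add_right cis_mult[symmetric] mult_ac)
    have "norm (hat (\<lambda>p. f (p + v)) n - hat (synth ?y) n) \<le> e / 2"
      unfolding hat_diff[OF cont(2,3), symmetric]
      using x by (intro norm_hat_le continuous_intros cont) (simp add: y less_imp_le)
    moreover have "norm (hat (synth x) n - hat f n) \<le> e / 2"
      unfolding hat_diff[OF cont(1) f(1), symmetric]
      using x by (intro norm_hat_le continuous_intros cont f) (simp add: norm_minus_commute less_imp_le)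
    then have "norm (hat (synth ?y) n - cis (dotp n v) * hat f n) \<le> e / 2"
      by (simp add: hat_synth right_diff_distrib[symmetric] norm_mult)
    ultimately show ?thesis
      using norm_triangle_ineq[of "hat (\<lambda>p. f (p + v)) n - hat (synth ?y) n" "hat (synth ?y) n - cis (dotp n v) * hat f n"]
      by simp
  qed
  then have "norm (hat (\<lambda>p. f (p + v)) n - cis (dotp n v) * hat f n) \<le> 0"
    by (rule field_le_epsilon)
  then show ?thesis by simp
qed

text \<open>Vanishing coefficients make \<open>f\<close> orthogonal to every synthesis.
  Approximating \<open>f\<close> uniformly by one of them shows that the integral of its squared
  modulus over the cube vanishes; periodicity carries the conclusion to all points.\<close>

lemma hat_eq_0_imp_eq_0:
  fixes f :: "real^'d \<Rightarrow> complex"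
  assumes f: "continuous_on UNIV f" "periodic f" and 0: "\<And>n. hat f n = 0"
  shows "f p = 0"
proof -
  have cf: "continuous_on UNIV (\<lambda>p. f p * cnj (synth y p))" for y
    by (intro continuous_intros f)
  have bl: "bounded_linear (\<lambda>y. integral cube (\<lambda>p. f p * cnj (synth y p)))"
  proof -
    have "compact (cube :: (real^'d) set)" by (simp add: cube_def)
    then have "bounded (f ` cube)"
      by (intro compact_imp_bounded compact_continuous_image continuous_on_subset[OF f(1)]) auto
    then obtain B where B: "\<And>p. p \<in> cube ==> norm (f p) \<le> B" by (auto simp: bounded_iff)
    have B0: "0 \<le> B" using order_trans[OF norm_ge_zero B[of 0]] by (simp add: cube_def mem_box_cart)
    show ?thesis
    proof (rule bounded_linear_intro[of _ "B * measure lborel (cube :: (real^'d) set)"])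
      fix x y :: "'d wien" and r :: real
      show "integral cube (\<lambda>p. f p * cnj (synth (x + y) p)) =
        integral cube (\<lambda>p. f p * cnj (synth x p)) + integral cube (\<lambda>p. f p * cnj (synth y p))"
        by (simp add: synth_add distrib_left integral_add integrable_cube cf)
      show "integral cube (\<lambda>p. f p * cnj (synth (r *\<^sub>R x) p)) = r *\<^sub>R integral cube (\<lambda>p. f p * cnj (synth x p))"
      proof -
        have "synth (r *\<^sub>R x) p = of_real r * synth x p" for p
          by (subst synth_scaleR) (rule scaleR_conv_of_real)
        then have "(\<lambda>p. f p * cnj (synth (r *\<^sub>R x) p)) = (\<lambda>p. r *\<^sub>R (f p * cnj (synth x p)))"
          by (simp add: scaleR_conv_of_real fun_eq_iff)
        then show ?thesis by simp
      qed
      have "norm (integral cube (\<lambda>p. f p * cnj (synth x p))) \<le> (B * norm x) * measure lborel (cube :: (real^'d) set)"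
        unfolding cube_def
      proof (rule integrable_bound)
        show "norm (f p * cnj (synth x p)) \<le> B * norm x" if "p \<in> cbox 0 (\<chi> j. 2 * pi)" for p
          using B[of p] that norm_synth_le[of x p] B0 by (auto simp: norm_mult cube_def intro!: mult_mono)
      qed (use B0 integrable_cube[OF cf] in \<open>auto simp: cube_def\<close>)
      then show "norm (integral cube (\<lambda>p. f p * cnj (synth x p))) \<le> norm x * (B * measure lborel (cube :: (real^'d) set))"
        by (simp add: mult_ac)
    qed
  qed
  have orth: "integral cube (\<lambda>p. f p * cnj (synth y p)) = 0" for y
  proof (rule bounded_linear_wien_eq[OF bl bounded_linear_zero])
    fix n c
    have "integral cube (\<lambda>p. f p * cis (- dotp n p)) = 0"
      using 0[of n] content_cube_pos[where 'd='d] by (simp add: hat_def)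
    moreover have "(\<lambda>p. f p * cnj (synth (single n c) p)) = (\<lambda>p. cnj c * (f p * cis (- dotp n p)))"
      by (rule ext) (simp add: synth_single cis_cnj mult_ac)
    ultimately show "integral cube (\<lambda>p. f p * cnj (synth (single n c) p)) = 0"
      by (simp only: integral_mult_right mult_zero_right)
  qed
  obtain B where B: "\<And>p. p \<in> cube ==> norm (f p) \<le> B" and B0: "0 \<le> B"
  proof -
    have "compact (cube :: (real^'d) set)" by (simp add: cube_def)
    then have "bounded (f ` cube)"
      by (intro compact_imp_bounded compact_continuous_image continuous_on_subset[OF f(1)]) auto
    then obtain B where B: "\<And>p. p \<in> cube ==> norm (f p) \<le> B" by (auto simp: bounded_iff)
    then show thesis using that[of B] order_trans[OF norm_ge_zero B[of 0]] by (auto simp: cube_def mem_box_cart)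
  qed
  let ?I = "integral (cube :: (real^'d) set) (\<lambda>p. (norm (f p))\<^sup>2)"
  have c2: "continuous_on UNIV (\<lambda>p. (norm (f p))\<^sup>2)" by (intro continuous_intros f)
  have "?I \<le> 0 + e" if e: "0 < e" for e
  proof -
    \<comment> \<open>An error \<open>d\<close> in the approximation changes the integral by at most
      \<open>B * d\<close> times the volume of the cube, which this choice keeps below
      \<open>e\<close>; \<open>B + 1\<close> avoids a division by zero.\<close>
    define d where "d = e / ((B + 1) * measure lborel (cube :: (real^'d) set))"
    have d: "0 < d" using e B0 content_cube_pos[where 'd='d] by (simp add: d_def)
    obtain y where y: "\<And>p. norm (f p - synth y p) < d" using periodic_approx[OF f d] by blast
    have "of_real ?I = integral cube (\<lambda>p. f p * cnj (f p))"
      using integral_linear[OF integrable_cube[OF c2] bounded_linear_of_real[where 'a=complex], symmetric]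
      unfolding o_def complex_norm_square .
    also have "\<dots> = integral cube (\<lambda>p. f p * cnj (f p)) - integral cube (\<lambda>p. f p * cnj (synth y p))"
      by (simp add: orth)
    also have "\<dots> = integral cube (\<lambda>p. f p * cnj (f p) - f p * cnj (synth y p))"
      by (rule integral_diff[symmetric]) (intro integrable_cube continuous_intros f)+
    finally have "norm (complex_of_real ?I) = norm (integral cube (\<lambda>p. f p * cnj (f p) - f p * cnj (synth y p)))"
      by simp
    also have "\<dots> \<le> (B * d) * measure lborel (cube :: (real^'d) set)"
      unfolding cube_def
    proof (rule integrable_bound)
      show "(\<lambda>p. f p * cnj (f p) - f p * cnj (synth y p)) integrable_on cbox 0 (\<chi> j. 2 * pi)"
        unfolding cube_def[symmetric] by (intro integrable_cube continuous_intros f)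
      show "norm (f p * cnj (f p) - f p * cnj (synth y p)) \<le> B * d" if "p \<in> cbox 0 (\<chi> j. 2 * pi)" for p
      proof -
        have "norm (f p * cnj (f p) - f p * cnj (synth y p)) = norm (f p) * norm (f p - synth y p)"
          by (metis complex_cnj_diff complex_mod_cnj norm_mult right_diff_distrib)
        then show ?thesis using B[of p] that less_imp_le[OF y[of p]] B0 by (auto simp: cube_def intro!: mult_mono)
      qed
    qed (use B0 d in simp)
    also have "\<dots> = e * (B / (B + 1))"
      using content_cube_pos[where 'd='d] B0 by (simp add: d_def)
    also have "\<dots> \<le> e * 1"
      using B0 e by (intro mult_left_mono) auto
    also have "e * 1 = e" by simp
    finally show ?thesis by simp
  qed
  then have "?I \<le> 0" by (rule field_le_epsilon)
  moreover have "0 \<le> ?I" by (rule integral_nonneg[OF integrable_cube[OF c2]]) simp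
  ultimately have I0: "?I = 0" by simp
  have z: "f q = 0" if "q \<in> cube" for q
  proof -
    have "(norm (f q))\<^sup>2 = 0"
      using that unfolding cube_def
    proof (rule has_integral_0_cbox_imp_0[rotated -1])
      show "((\<lambda>p. (norm (f p))\<^sup>2) has_integral 0) (cbox 0 (\<chi> j. 2 * pi))"
        using integrable_integral[OF integrable_cube[OF c2]] I0 by (simp add: cube_def)
      show "continuous_on (cbox 0 (\<chi> j. 2 * pi)) (\<lambda>p. (norm (f p))\<^sup>2)"
        using continuous_on_subset[OF c2] by blast
      show "box (0::real^'d) (\<chi> j. 2 * pi) \<noteq> {}"
        by (simp add: box_ne_empty Basis_vec_def inner_axis)
    qed auto
    then show ?thesis by simp
  qed
  define q :: "real^'d" where "q = (\<chi> j. Arg2pi (cis (p $ j)))"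
  have "q \<in> cube"
    using Arg2pi_ge_0 Arg2pi_lt_2pi by (simp add: q_def cube_def mem_box_cart less_imp_le)
  moreover have "f p = f q"
  proof (rule periodic_cis_eq[OF f(2)])
    fix j
    show "cis (p $ j) = cis (q $ j)"
      using Arg2pi_eq[of "cis (p $ j)"] by (simp add: q_def cis_conv_exp mult.commute)
  qed
  ultimately show ?thesis using z by simp
qed

lemma synth_Wien_hat:
  fixes f :: "real^'d \<Rightarrow> complex"
  assumes f: "continuous_on UNIV f" "periodic f" and x: "\<And>n. coef x n = hat f n"
  shows "synth x = f"
proof
  fix p
  have c: "continuous_on UNIV (synth x)" by (intro continuous_intros)
  have "f p - synth x p = 0"
  proof (rule hat_eq_0_imp_eq_0[of "\<lambda>p. f p - synth x p"])
    show "continuous_on UNIV (\<lambda>p. f p - synth x p)" by (intro continuous_intros f)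
    show "periodic (\<lambda>p. f p - synth x p)" using f(2) periodic_synth[of x] by (simp add: periodic_def)
    show "hat (\<lambda>p. f p - synth x p) n = 0" for n by (simp add: hat_diff[OF f(1) c] hat_synth x)
  qed
  then show "synth x p = f p" by simp
qed

lemma hat_has_vector_derivative:
  fixes f f' :: "real \<Rightarrow> real^'d \<Rightarrow> complex"
  assumes d: "\<And>t p. t \<in> U ==> ((\<lambda>t. f t p) has_vector_derivative f' t p) (at t within U)"
    and c: "\<And>t. t \<in> U ==> continuous_on UNIV (f t)"
    and c': "continuous_on (U \<times> UNIV) (\<lambda>z. f' (fst z) (snd z))"
    and t: "t \<in> U" "convex U"
  shows "((\<lambda>t. hat (f t) n) has_vector_derivative hat (f' t) n) (at t within U)"
proof -
  have "((\<lambda>t. integral cube (\<lambda>p. f t p * cis (- dotp n p))) has_vector_derivative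
     integral cube (\<lambda>p. f' t p * cis (- dotp n p))) (at t within U)"
    unfolding cube_def
  proof (rule leibniz_rule_vector_derivative[OF _ _ _ t])
    fix t and p :: "real^'d" assume "t \<in> U"
    then show "((\<lambda>t. f t p * cis (- dotp n p)) has_vector_derivative f' t p * cis (- dotp n p)) (at t within U)"
      by (intro has_vector_derivative_mult_left d)
    show "(\<lambda>p. f t p * cis (- dotp n p)) integrable_on cbox 0 (\<chi> j. 2 * pi)"
      using hat_integrable[OF c[OF \<open>t \<in> U\<close>], of n] by (simp add: cube_def)
  next
    have "continuous_on (U \<times> cbox 0 (\<chi> j. 2 * pi)) (\<lambda>z. f' (fst z) (snd z) * cis (- dotp n (snd z)))"
      by (intro continuous_intros continuous_on_subset[OF c']) auto
    then show "continuous_on (U \<times> cbox 0 (\<chi> j. 2 * pi)) (\<lambda>(t, p). f' t p * cis (- dotp n p))"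
      by (simp add: case_prod_beta)
  qed
  then show ?thesis
    unfolding hat_def by (rule bounded_linear.has_vector_derivative[OF bounded_linear_scaleR_right])
qed

text \<open>The coefficients of the translates of \<open>f\<close> are differentiated at shift zero
  in two ways: under the integral, and by the explicit factor of \<open>hat_shift\<close>. This
  takes the place of an integration by parts.\<close>

lemma hat_derivative:
  fixes f f' :: "real^'d \<Rightarrow> complex"
  assumes f: "continuous_on UNIV f" "periodic f" and f': "continuous_on UNIV f'"
    and d: "\<And>p. ((\<lambda>h. f (p + axis j h)) has_vector_derivative f' p) (at 0)"
  shows "hat f' n = \<i> * of_int (n $ j) * hat f n"
proof -
  have ax: "axis j (a + b) = axis j a + (axis j b :: real^'d)" for a b by (simp add: vec_eq_iff axis_def)
  have d': "((\<lambda>h. f (p + axis j h)) has_vector_derivative f' (p + axis j h)) (at h)" for p h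
  proof -
    have 1: "((\<lambda>k. f ((p + axis j h) + axis j k)) has_vector_derivative f' (p + axis j h)) (at (h - h))"
      using d[of "p + axis j h"] by simp
    have "(((\<lambda>k. f ((p + axis j h) + axis j k)) \<circ> (\<lambda>s. s - h)) has_vector_derivative 1 *\<^sub>R f' (p + axis j h)) (at h)"
      by (rule vector_diff_chain_at[of "\<lambda>s. s - h" 1 h]) (use 1 in \<open>auto intro!: derivative_eq_intros\<close>)
    then show ?thesis by (simp add: o_def add.assoc ax[symmetric])
  qed
  have 1: "((\<lambda>h. hat (\<lambda>p. f (p + axis j h)) n) has_vector_derivative hat (\<lambda>p. f' (p + axis j 0)) n) (at 0 within UNIV)"
  proof (rule hat_has_vector_derivative)
    have "continuous_on UNIV (\<lambda>h. axis j h :: real^'d)"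
      unfolding axis_def
    proof (intro continuous_intros)
      show "continuous_on UNIV (\<lambda>h. if i = j then h else 0 :: real)" for i
        by (cases "i = j") auto
    qed
    then have cax: "continuous_on A g ==> continuous_on A (\<lambda>z. axis j (g z) :: real^'d)" for A and g :: "real \<times> (real^'d) \<Rightarrow> real"
      by (rule continuous_on_compose2) auto
    show "continuous_on (UNIV \<times> UNIV) (\<lambda>z. f' (snd z + axis j (fst z)))"
      by (rule continuous_on_compose2[OF f']) (auto intro!: continuous_intros cax)
    show "continuous_on UNIV (\<lambda>p. f (p + axis j h))" for h
      by (rule continuous_on_compose2[OF f(1)]) (auto intro!: continuous_intros)
  qed (auto intro: d')
  have 2: "(\<lambda>h. hat (\<lambda>p. f (p + axis j h)) n) = (\<lambda>h. cis (of_int (n $ j) * h) * hat f n)"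
    by (simp add: hat_shift[OF f] fun_eq_iff)
  have 3: "((\<lambda>h. cis (of_int (n $ j) * h) * hat f n) has_vector_derivative \<i> * of_int (n $ j) * hat f n) (at 0)"
  proof -
    have "((\<lambda>z. exp (\<i> * (of_int (n $ j) * z)) * hat f n) has_field_derivative \<i> * of_int (n $ j) * hat f n) (at (of_real 0))"
      by (auto intro!: derivative_eq_intros)
    from has_vector_derivative_real_field[OF this, of UNIV]
    show ?thesis by (simp add: cis_conv_exp)
  qed
  have 4: "axis j 0 = (0 :: real^'d)" by (simp add: vec_eq_iff axis_def)
  have "((\<lambda>h. cis (of_int (n $ j) * h) * hat f n) has_vector_derivative hat f' n) (at 0)"
    using 1 by (simp only: 2 4 add_0_right)
  then show ?thesis by (rule vector_derivative_unique_at[OF _ 3])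
qed

section \<open>Smooth families and their coefficients\<close>

lemma has_vector_derivative_bound:
  fixes f :: "real \<Rightarrow> 'a::real_normed_vector"
  assumes "\<And>t. t \<in> {a..b} ==> (f has_vector_derivative f' t) (at t within {a..b})"
    and "\<And>t. t \<in> {a..b} ==> norm (f' t) \<le> B" and "s \<in> {a..b}" "t \<in> {a..b}"
  shows "norm (f s - f t) \<le> B * \<bar>s - t\<bar>"
proof -
  have "norm (f s - f t) \<le> B * norm (s - t)"
  proof (rule differentiable_bound[of "{a..b}" f "\<lambda>t h. h *\<^sub>R f' t"])
    show "(f has_derivative (\<lambda>h. h *\<^sub>R f' t)) (at t within {a..b})" if "t \<in> {a..b}" for t
      using assms(1)[OF that] by (simp add: has_vector_derivative_def)
    show "onorm (\<lambda>h. h *\<^sub>R f' t) \<le> B" if "t \<in> {a..b}" for t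
    proof (rule onorm_bound)
      show "0 \<le> B" using order_trans[OF norm_ge_zero assms(2)[OF that]] .
      show "norm (h *\<^sub>R f' t) \<le> B * norm h" for h
        using mult_right_mono[OF assms(2)[OF that] abs_ge_zero[of h]] by (simp add: mult.commute)
    qed
  qed (use assms in auto)
  then show ?thesis by simp
qed

lemma has_vector_derivative_cong_within:
  assumes eq: "\<And>h. h \<in> S ==> f h = g h" and x: "x \<in> S"
  shows "(f has_vector_derivative d) (at x within S) \<longleftrightarrow> (g has_vector_derivative d) (at x within S)"
proof
  show "(g has_vector_derivative d) (at x within S)" if "(f has_vector_derivative d) (at x within S)"
    by (rule has_vector_derivative_transform[OF x _ that]) (simp add: eq)
  show "(f has_vector_derivative d) (at x within S)" if "(g has_vector_derivative d) (at x within S)"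
    by (rule has_vector_derivative_transform[OF x _ that]) (simp add: eq)
qed

text \<open>One bound serves all \<open>eps\<close> in \<open>E\<close> and all times. Since the
  weights account for all spatial derivatives, only the time derivatives have to be followed
  recursively, which is done by \<open>csm\<close>; \<open>smf\<close> demands all orders.\<close>

definition rd :: "real set \<Rightarrow> real \<Rightarrow> (real \<Rightarrow> real \<Rightarrow> 'd::finite wien) \<Rightarrow> bool" where
  "rd E T x \<longleftrightarrow> (\<forall>s. \<exists>C. \<forall>eps\<in>E. \<forall>t\<in>{0..T}. wle s (x eps t) C)"

primrec csm :: "nat \<Rightarrow> real set \<Rightarrow> real \<Rightarrow> (real \<Rightarrow> real \<Rightarrow> 'd::finite wien) \<Rightarrow> bool" where
  "csm 0 E T x \<longleftrightarrow> rd E T x"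
| "csm (Suc k) E T x \<longleftrightarrow> rd E T x \<and> (\<exists>x'. (\<forall>eps\<in>E. \<forall>t\<in>{0..T}.
      (x eps has_vector_derivative x' eps t) (at t within {0..T})) \<and> csm k E T x')"

definition smf :: "real set \<Rightarrow> real \<Rightarrow> (real \<Rightarrow> real \<Rightarrow> 'd::finite wien) \<Rightarrow> bool" where
  "smf E T x \<longleftrightarrow> (\<forall>k. csm k E T x)"

lemma rd_bound:
  assumes "rd E T x"
  shows "\<exists>C\<ge>0. \<forall>eps\<in>E. \<forall>t\<in>{0..T}. wle s (x eps t) C"
proof -
  obtain C where C: "\<And>eps t. eps \<in> E ==> t \<in> {0..T} ==> wle s (x eps t) C" using assms unfolding rd_def by blast
  show ?thesis by (rule exI[of _ "max C 0"]) (auto intro: wle_mono[OF C])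
qed

lemma rdI: "(\<And>s. \<exists>C. \<forall>eps\<in>E. \<forall>t\<in>{0..T}. wle s (x eps t) C) ==> rd E T x"
  by (simp add: rd_def)

lemma rd_smoothw: "rd E T x ==> eps \<in> E ==> t \<in> {0..T} ==> smoothw (x eps t)"
  unfolding rd_def smoothw_def by blast

lemma csm_rd: "csm k E T x ==> rd E T x" by (cases k) auto

lemma smf_rd: "smf E T x ==> rd E T x" by (auto simp: smf_def intro: csm_rd)

lemma csm_SucD: "csm (Suc k) E T x ==> csm k E T x"
  by (induction k arbitrary: x) auto

lemma rd_subset: "rd E T x ==> E' \<subseteq> E ==> rd E' T x"
  unfolding rd_def by (meson subsetD)

lemma csm_subset: "csm k E T x ==> E' \<subseteq> E ==> csm k E' T x"
proof (induction k arbitrary: x)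
  case (Suc k)
  then obtain x' where "csm k E T x'"
    "\<forall>eps\<in>E. \<forall>t\<in>{0..T}. (x eps has_vector_derivative x' eps t) (at t within {0..T})" by auto
  moreover from this Suc have "csm k E' T x'" by blast
  moreover have "rd E' T x" using Suc.prems csm_rd rd_subset by blast
  ultimately show ?case using Suc.prems(2) unfolding csm.simps by blast
qed (use rd_subset in \<open>unfold csm.simps, blast\<close>)

lemma smf_subset: "smf E T x ==> E' \<subseteq> E ==> smf E' T x"
  unfolding smf_def by (blast intro: csm_subset[of _ E])

lemma rd_cong: "(\<And>eps t. eps \<in> E ==> t \<in> {0..T} ==> x eps t = y eps t) ==> rd E T x \<longleftrightarrow> rd E T y"
  by (simp add: rd_def)

lemma csm_cong: "(\<And>eps t. eps \<in> E ==> t \<in> {0..T} ==> x eps t = y eps t) ==> csm k E T x \<longleftrightarrow> csm k E T y"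
proof (cases k)
  case 0
  assume eq: "\<And>eps t. eps \<in> E ==> t \<in> {0..T} ==> x eps t = y eps t"
  show ?thesis unfolding 0 csm.simps by (rule rd_cong[OF eq])
next
  case (Suc n)
  assume eq: "\<And>eps t. eps \<in> E ==> t \<in> {0..T} ==> x eps t = y eps t"
  have "(x eps has_vector_derivative d) (at t within {0..T}) \<longleftrightarrow> (y eps has_vector_derivative d) (at t within {0..T})"
    if "eps \<in> E" "t \<in> {0..T}" for eps t d
    by (rule has_vector_derivative_cong_within) (use that eq in auto)
  then have "(\<forall>eps\<in>E. \<forall>t\<in>{0..T}. (x eps has_vector_derivative d eps t) (at t within {0..T})) \<longleftrightarrow>
      (\<forall>eps\<in>E. \<forall>t\<in>{0..T}. (y eps has_vector_derivative d eps t) (at t within {0..T}))" for d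
    by blast
  moreover have "rd E T x \<longleftrightarrow> rd E T y" by (rule rd_cong[OF eq])
  ultimately show ?thesis unfolding Suc csm.simps by simp
qed

lemma smf_cong: "(\<And>eps t. eps \<in> E ==> t \<in> {0..T} ==> x eps t = y eps t) ==> smf E T x \<longleftrightarrow> smf E T y"
  unfolding smf_def by (subst csm_cong) auto

lemma rd_add: "rd E T x ==> rd E T y ==> rd E T (\<lambda>eps t. x eps t + y eps t)"
  unfolding rd_def by (meson wle_add)

lemma rd_mult: "rd E T x ==> rd E T y ==> rd E T (\<lambda>eps t. x eps t * y eps t)"
  unfolding rd_def by (meson wle_mult')

lemma rd_star: "rd E T x ==> rd E T (\<lambda>eps t. star (x eps t))"
  unfolding rd_def by (meson wle_star)

lemma rd_cst: "(\<And>eps. eps \<in> E ==> norm (c eps) \<le> B) ==> rd E T (\<lambda>eps t. cst (c eps))"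
  unfolding rd_def cst_def
  by (intro allI exI[of _ B] ballI wle_mono[OF wle_single]) (simp add: wt_def)

lemma csm_add: "csm k E T x ==> csm k E T y ==> csm k E T (\<lambda>eps t. x eps t + y eps t)"
proof (induction k arbitrary: x y)
  case (Suc k)
  then obtain x' y' where "csm k E T x'" "csm k E T y'"
    "\<forall>eps\<in>E. \<forall>t\<in>{0..T}. (x eps has_vector_derivative x' eps t) (at t within {0..T})"
    "\<forall>eps\<in>E. \<forall>t\<in>{0..T}. (y eps has_vector_derivative y' eps t) (at t within {0..T})" by auto
  with Suc show ?case
    by (auto simp: rd_add intro!: exI[of _ "\<lambda>eps t. x' eps t + y' eps t"] has_vector_derivative_add)
qed (simp add: rd_add)

lemma csm_mult: "csm k E T x ==> csm k E T y ==> csm k E T (\<lambda>eps t. x eps t * y eps t)"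
proof (induction k arbitrary: x y)
  case (Suc k)
  then obtain x' y' where *: "csm k E T x'" "csm k E T y'"
    "\<forall>eps\<in>E. \<forall>t\<in>{0..T}. (x eps has_vector_derivative x' eps t) (at t within {0..T})"
    "\<forall>eps\<in>E. \<forall>t\<in>{0..T}. (y eps has_vector_derivative y' eps t) (at t within {0..T})" by auto
  have xy: "csm k E T x" "csm k E T y" using Suc.prems csm_SucD by blast+
  show ?case
    unfolding csm.simps
  proof (intro conjI exI ballI)
    show "rd E T (\<lambda>eps t. x eps t * y eps t)" using Suc.prems csm_rd rd_mult by blast
    show "csm k E T (\<lambda>eps t. x eps t * y' eps t + x' eps t * y eps t)"
      by (intro csm_add Suc.IH * xy)
    show "((\<lambda>t. x eps t * y eps t) has_vector_derivative x eps t * y' eps t + x' eps t * y eps t) (at t within {0..T})"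
      if "eps \<in> E" "t \<in> {0..T}" for eps t
      using * that by (intro has_vector_derivative_mult) auto
  qed
qed (simp add: rd_mult)

lemma csm_star: "csm k E T x ==> csm k E T (\<lambda>eps t. star (x eps t))"
proof (induction k arbitrary: x)
  case (Suc k)
  then obtain x' where "csm k E T x'"
    "\<forall>eps\<in>E. \<forall>t\<in>{0..T}. (x eps has_vector_derivative x' eps t) (at t within {0..T})" by auto
  with Suc show ?case
    by (auto simp: rd_star intro!: exI[of _ "\<lambda>eps t. star (x' eps t)"] bounded_linear.has_vector_derivative[OF bounded_linear_star])
qed (simp add: rd_star)

lemma csm_cst: "(\<And>eps. eps \<in> E ==> norm (c eps) \<le> B) ==> csm k E T (\<lambda>eps t. cst (c eps))"
proof (induction k arbitrary: c B)
  case (Suc k)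
  have "csm k E T (\<lambda>eps t. cst 0 :: 'a wien)" by (rule Suc.IH[of _ 0]) simp
  moreover have "rd E T (\<lambda>eps t. cst (c eps) :: 'a wien)" by (rule rd_cst[OF Suc.prems])
  ultimately show ?case by (auto intro!: exI[of _ "\<lambda>eps t. cst 0"])
next
  case 0
  then show ?case unfolding csm.simps by (rule rd_cst)
qed

lemma rd_mulop:
  assumes m: "\<And>eps n. eps \<in> E ==> norm (m eps n) \<le> c * wt n ^ r" "0 \<le> c" and x: "rd E T x"
  shows "rd E T (\<lambda>eps t. mulop (m eps) (x eps t))"
proof (rule rdI)
  fix s
  obtain C where "\<And>eps t. eps \<in> E ==> t \<in> {0..T} ==> wle (s + r) (x eps t) C" "0 \<le> C"
    using rd_bound[OF x, of "s + r"] by blast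
  then show "\<exists>C. \<forall>eps\<in>E. \<forall>t\<in>{0..T}. wle s (mulop (m eps) (x eps t)) C"
    using wle_mulop[of "m eps" c r s for eps] m by (intro exI[of _ "c * C"] ballI) auto
qed

text \<open>An unbounded multiplier can be taken under the time derivative because the derivative is
  bounded uniformly in time with \<open>r\<close> weights for the multiplier and
  \<open>2 * CARD('d)\<close> more, which make the coefficientwise mean value bounds
  summable.\<close>

lemma mulop_has_vector_derivative:
  fixes x x' :: "real \<Rightarrow> 'd::finite wien"
  assumes m: "\<And>n. norm (m n) \<le> c * wt n ^ r" and c: "0 \<le> c"
    and x: "\<And>t. t \<in> {0..T} ==> smoothw (x t)" "\<And>t. t \<in> {0..T} ==> smoothw (x' t)"
    and C: "\<And>t. t \<in> {0..T} ==> wle (r + 2 * CARD('d)) (x' t) C"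
    and d: "\<And>t. t \<in> {0..T} ==> (x has_vector_derivative x' t) (at t within {0..T})" and t: "t \<in> {0..T}"
  shows "((\<lambda>t. mulop m (x t)) has_vector_derivative mulop m (x' t)) (at t within {0..T})"
proof -
  have p: "pbdd m" using m c by (auto simp: pbdd_def)
  let ?g = "\<lambda>n :: int^'d. c * C * (1 / wt n ^ (2 * CARD('d)))"
  have b: "norm (m n) * norm (coef (x' s) n) \<le> ?g n" if "s \<in> {0..T}" for s n
  proof -
    have "norm (m n) * norm (coef (x' s) n) \<le> c * wt n ^ r * norm (coef (x' s) n)"
      using m by (intro mult_right_mono) auto
    also have "\<dots> = c * (wt n ^ (r + 2 * CARD('d)) * norm (coef (x' s) n)) * (1 / wt n ^ (2 * CARD('d)))"
      using wt_pos[of n] by (simp add: power_add)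
    also have "\<dots> \<le> c * C * (1 / wt n ^ (2 * CARD('d)))"
      using wle_coef[OF C[OF that]] c wt_pos[of n] by (intro mult_right_mono mult_left_mono) auto
    finally show ?thesis .
  qed
  have dn: "((\<lambda>t. coef (x t) n) has_vector_derivative coef (x' t) n) (at t within {0..T})" if "t \<in> {0..T}" for t n
    using bounded_linear.has_vector_derivative[OF bounded_linear_coef d[OF that]] .
  have co: "coef (mulop m (x s)) n = m n * coef (x s) n" "coef (mulop m (x' s)) n = m n * coef (x' s) n"
    if "s \<in> {0..T}" for s n
    using coef_mulop[OF p x(1)[OF that]] coef_mulop[OF p x(2)[OF that]] by auto
  have mdn: "((\<lambda>t. m n * coef (x t) n) has_vector_derivative m n * coef (x' t) n) (at t within {0..T})" if "t \<in> {0..T}" for t n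
    by (intro has_vector_derivative_mult_right dn that)
  show ?thesis
  proof (rule wien_has_vector_derivativeI)
    show "?g summable_on UNIV" by (intro summable_on_cmult_right wt_inverse_summable_on)
    show "norm (coef (mulop m (x' t)) n) \<le> ?g n" for n using b[OF t] by (simp add: co[OF t] norm_mult)
    show "((\<lambda>t. coef (mulop m (x t)) n) has_vector_derivative coef (mulop m (x' t)) n) (at t within {0..T})" for n
      unfolding co(2)[OF t] by (rule has_vector_derivative_transform[OF t _ mdn[OF t]]) (simp add: co)
    show "norm (coef (mulop m (x \<tau>)) n - coef (mulop m (x t)) n) \<le> ?g n * \<bar>\<tau> - t\<bar>" if "\<tau> \<in> {0..T}" for \<tau> n
      unfolding co[OF that] co[OF t]
      by (rule has_vector_derivative_bound[OF mdn]) (use b that t in \<open>auto simp: norm_mult\<close>)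
  qed
qed

lemma csm_mulop:
  fixes x :: "real \<Rightarrow> real \<Rightarrow> 'd::finite wien"
  assumes m: "\<And>eps n. eps \<in> E ==> norm (m eps n) \<le> c * wt n ^ r" "0 \<le> c"
  shows "csm k E T x ==> csm k E T (\<lambda>eps t. mulop (m eps) (x eps t))"
proof (induction k arbitrary: x)
  case (Suc k)
  then obtain x' where x': "csm k E T x'"
    "\<And>eps t. eps\<in>E ==> t\<in>{0..T} ==> (x eps has_vector_derivative x' eps t) (at t within {0..T})" by auto
  have rdx: "rd E T x" "rd E T x'" using Suc.prems x'(1) csm_rd by blast+
  obtain C where C: "\<And>eps t. eps \<in> E ==> t \<in> {0..T} ==> wle (r + 2 * CARD('d)) (x' eps t) C" and "0 \<le> C"
    using rd_bound[OF rdx(2), of "r + 2 * CARD('d)"] by blast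
  have "((\<lambda>t. mulop (m eps) (x eps t)) has_vector_derivative mulop (m eps) (x' eps t)) (at t within {0..T})"
    if eps: "eps \<in> E" and t: "t \<in> {0..T}" for eps t
    by (rule mulop_has_vector_derivative[where x = "x eps" and x' = "x' eps", OF m(1)[OF eps] m(2) rd_smoothw[OF rdx(1) eps]
          rd_smoothw[OF rdx(2) eps] C[OF eps] x'(2)[OF eps] t])
  moreover have "csm k E T (\<lambda>eps t. mulop (m eps) (x' eps t))" by (rule Suc.IH[OF x'(1)])
  moreover have "rd E T (\<lambda>eps t. mulop (m eps) (x eps t))" by (rule rd_mulop[of E m c r]) (use m rdx in auto)
  ultimately show ?case unfolding csm.simps
    by (intro conjI exI[of _ "\<lambda>eps t. mulop (m eps) (x' eps t)"]) auto
next
  case 0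
  then show ?case unfolding csm.simps by (intro rd_mulop[of E m c r]) (use m in auto)
qed

lemma smf_add: "smf E T x ==> smf E T y ==> smf E T (\<lambda>eps t. x eps t + y eps t)"
  and smf_mult: "smf E T x ==> smf E T y ==> smf E T (\<lambda>eps t. x eps t * y eps t)"
  and smf_star: "smf E T x ==> smf E T (\<lambda>eps t. star (x eps t))"
  and smf_cst: "(\<And>eps. eps \<in> E ==> norm (c eps) \<le> B) ==> smf E T (\<lambda>eps t. cst (c eps))"
  by (auto simp: smf_def intro: csm_add csm_mult csm_star csm_cst)

lemma smf_mulop:
  "(\<And>eps n. eps \<in> E ==> norm (m eps n) \<le> c * wt n ^ r) ==> 0 \<le> c ==> smf E T x ==>
     smf E T (\<lambda>eps t. mulop (m eps) (x eps t))"
  unfolding smf_def by (intro allI csm_mulop) auto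

lemma csm_0: "csm k E T (\<lambda>eps t. 0)"
  using csm_cst[of E "\<lambda>_. 0" 0 k T] by simp

lemma csm_sum: "(\<And>i. i \<in> I ==> csm k E T (x i)) ==> csm k E T (\<lambda>eps t. \<Sum>i\<in>I. x i eps t)"
  by (induction I rule: infinite_finite_induct) (auto intro: csm_add csm_0)

lemma smf_sum: "(\<And>i. i \<in> I ==> smf E T (x i)) ==> smf E T (\<lambda>eps t. \<Sum>i\<in>I. x i eps t)"
  unfolding smf_def by (intro allI csm_sum) auto

lemma smf_0: "smf E T (\<lambda>eps t. 0)" by (simp add: smf_def csm_0)

lemma smf_uminus: "smf E T x ==> smf E T (\<lambda>eps t. - x eps t)"
  using smf_mult[OF smf_cst[of E "\<lambda>_. -1" 1 T]] by (simp add: cst_uminus)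

lemma smf_diff: "smf E T x ==> smf E T y ==> smf E T (\<lambda>eps t. x eps t - y eps t)"
  using smf_add[of E T x "\<lambda>eps t. - y eps t"] smf_uminus[of E T y] by simp

text \<open>Each order \<open>k\<close> comes with its own witness for the derivative. On a
  nondegenerate interval derivatives are unique, so a single family serves all orders.\<close>

lemma smf_derivative:
  assumes x: "smf E T x" and T: "0 < T"
  obtains x' where "smf E T x'"
    "\<And>eps t. eps\<in>E ==> t\<in>{0..T} ==> (x eps has_vector_derivative x' eps t) (at t within {0..T})"
proof -
  obtain x' where x': "\<And>eps t. eps\<in>E ==> t\<in>{0..T} ==> (x eps has_vector_derivative x' eps t) (at t within {0..T})"
    using x[unfolded smf_def, rule_format, of "Suc 0"] unfolding csm.simps by blast
  have "csm k E T x'" for k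
  proof -
    obtain y where y: "csm k E T y" "\<And>eps t. eps\<in>E ==> t\<in>{0..T} ==> (x eps has_vector_derivative y eps t) (at t within {0..T})"
      using x[unfolded smf_def, rule_format, of "Suc k"] unfolding csm.simps by blast
    have "y eps t = x' eps t" if "eps \<in> E" "t \<in> {0..T}" for eps t
      using vector_derivative_unique_within_closed_interval[OF T, of t] x'[OF that] y(2)[OF that] that by auto
    then show ?thesis using y(1) csm_cong[of E T y x' k] by blast
  qed
  then show thesis using that x' by (auto simp: smf_def)
qed

lemma smf_continuous_on:
  assumes x: "smf E T x" and eps: "eps \<in> E"
  shows "continuous_on {0..T} (x eps)"
proof -
  obtain x' where "\<And>eps t. eps\<in>E ==> t\<in>{0..T} ==> (x eps has_vector_derivative x' eps t) (at t within {0..T})"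
    using x[unfolded smf_def, rule_format, of "Suc 0"] unfolding csm.simps by blast
  then show ?thesis
    unfolding continuous_on_eq_continuous_within using has_vector_derivative_continuous eps by blast
qed

subsection \<open>From coefficients to functions\<close>

lemma vector_derivative_cong_within:
  assumes eq: "\<And>h. h \<in> S ==> f h = g h" and x: "x \<in> S"
  shows "vector_derivative f (at x within S) = vector_derivative g (at x within S)"
  unfolding vector_derivative_def using has_vector_derivative_cong_within[OF eq x] by simp

lemma partial_cong:
  assumes "\<And>z. z \<in> S ==> f z = g z" "z \<in> S"
  shows "partial S v f z = partial S v g z"
  unfolding partial_def by (rule vector_derivative_cong_within) (use assms in auto)

lemma has_partial_cong:
  assumes "\<And>z. z \<in> S ==> f z = g z" "z \<in> S"
  shows "has_partial S v f z \<longleftrightarrow> has_partial S v g z"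
  unfolding has_partial_def
  using assms differentiable_transform_within[OF _ zero_less_one, of "\<lambda>h. f (z + h *\<^sub>R v)" 0 "{h. z + h *\<^sub>R v \<in> S}" "\<lambda>h. g (z + h *\<^sub>R v)"]
    differentiable_transform_within[OF _ zero_less_one, of "\<lambda>h. g (z + h *\<^sub>R v)" 0 "{h. z + h *\<^sub>R v \<in> S}" "\<lambda>h. f (z + h *\<^sub>R v)"]
  by auto

definition syn :: "(real \<Rightarrow> 'd::finite wien) \<Rightarrow> real \<times> (real^'d) \<Rightarrow> complex" where
  "syn x z = synth (x (fst z)) (snd z)"

definition ddx :: "'d \<Rightarrow> int^'d \<Rightarrow> complex" where "ddx j n = \<i> * of_int (n $ j)"

lemma ddx_bound: "norm (ddx j n) \<le> 1 * wt n ^ 1"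
  using wt_ge_component[of n j] by (simp add: ddx_def norm_mult)

lemma ddx_pbdd: "pbdd (ddx j)"
  using pbddI[of "ddx j" 1 1] ddx_bound by auto

lemma slab_time: "(t, p) \<in> slab T ==> {h. (t, p) + h *\<^sub>R (1, 0) \<in> slab T} = {-t..T-t}"
  and slab_space: "(t, p) \<in> slab T ==> {h. (t, p) + h *\<^sub>R (0, v) \<in> slab T} = UNIV"
  by (auto simp: slab_def)

lemma syn_has_dt:
  assumes x: "(x has_vector_derivative x') (at t within {0..T})" and t: "t \<in> {0..T}"
  shows "((\<lambda>h. syn x ((t, p) + h *\<^sub>R (1, 0))) has_vector_derivative synth x' p) (at 0 within {-t..T-t})"
proof -
  have "((\<lambda>\<tau>. synth (x \<tau>) p) has_vector_derivative synth x' p) (at t within {0..T})"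
    by (rule bounded_linear.has_vector_derivative[OF bounded_linear_synth x])
  then have 1: "((\<lambda>\<tau>. synth (x \<tau>) p) has_vector_derivative synth x' p) (at (0 + t) within (\<lambda>h. h + t) ` {-t..T-t})"
    by simp
  have "((\<lambda>\<tau>. synth (x \<tau>) p) \<circ> (\<lambda>h. h + t) has_vector_derivative 1 *\<^sub>R synth x' p) (at 0 within {-t..T-t})"
    by (rule vector_diff_chain_within[of "\<lambda>h. h + t"]) (use 1 in \<open>auto intro!: derivative_eq_intros\<close>)
  then show ?thesis by (simp add: syn_def o_def add.commute)
qed

lemma synth_phase_shift: "synth x (p + axis j h) = synth (phase (\<lambda>n. of_int (n $ j)) h x) p"
  by (simp add: synth_def dotp_add_right cis_mult[symmetric] mult_ac)

lemma pbdd_component: "pbdd (\<lambda>n. of_real (of_int (n $ j)))"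
proof (rule pbddI[of _ 1 1])
  show "norm (complex_of_real (of_int (n $ j))) \<le> 1 * wt n ^ 1" for n
    using wt_ge_component[of n j] by simp
qed simp

lemma syn_has_dx:
  assumes x: "smoothw (x t)"
  shows "((\<lambda>h. syn x ((t, p) + h *\<^sub>R (0, axis j 1))) has_vector_derivative synth (mulop (ddx j) (x t)) p) (at 0)"
proof -
  have ax: "h *\<^sub>R axis j 1 = (axis j h :: real^'a)" for h by (simp add: vec_eq_iff axis_def)
  have "((\<lambda>h. synth (phase (\<lambda>n. of_int (n $ j)) h (x t)) p) has_vector_derivative synth (mulop (ddx j) (x t)) p) (at 0)"
    using bounded_linear.has_vector_derivative[OF bounded_linear_synth phase_has_vector_derivative_0[OF pbdd_component x, of j UNIV], of p]
    by (simp add: ddx_def[abs_def])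
  then show ?thesis by (simp add: syn_def ax synth_phase_shift)
qed

lemma time_not_bot: "0 < T ==> t \<in> {0..T} ==> at (0::real) within {-t..T-t} \<noteq> bot"
  using trivial_limit_within[of 0 "{-t..T-t}"] islimpt_Icc[of "-t" "T-t" 0] by auto

lemma dt_syn:
  assumes "(x has_vector_derivative x') (at t within {0..T})" "t \<in> {0..T}" "0 < T"
  shows "dt T (syn x) (t, p) = synth x' p" "has_partial (slab T) (1, 0) (syn x) (t, p)"
proof -
  have s: "{h. (t, p) + h *\<^sub>R (1, 0) \<in> slab T} = {-t..T-t}" using slab_time assms by (simp add: slab_def)
  show "dt T (syn x) (t, p) = synth x' p"
    unfolding partial_def s
    by (rule vector_derivative_within[OF time_not_bot[OF assms(3,2)] syn_has_dt[OF assms(1,2)]])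
  show "has_partial (slab T) (1, 0) (syn x) (t, p)"
    unfolding has_partial_def s using syn_has_dt[OF assms(1,2)] by (rule differentiableI_vector)
qed

lemma dx_syn:
  assumes "smoothw (x t)" "t \<in> {0..T}"
  shows "dx T j (syn x) (t, p) = synth (mulop (ddx j) (x t)) p" "has_partial (slab T) (0, axis j 1) (syn x) (t, p)"
proof -
  have s: "{h. (t, p) + h *\<^sub>R (0, axis j 1) \<in> slab T} = UNIV" using slab_space assms by (simp add: slab_def)
  show "dx T j (syn x) (t, p) = synth (mulop (ddx j) (x t)) p"
    unfolding partial_def s by (rule vector_derivative_at[OF syn_has_dx[of x t, OF assms(1)]])
  show "has_partial (slab T) (0, axis j 1) (syn x) (t, p)"
    unfolding has_partial_def s using syn_has_dx[of x t, OF assms(1)] by (rule differentiableI_vector)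
qed

lemma time_Basis: "(1, 0) \<in> (Basis :: (real \<times> (real^'d)) set)"
  and axis_Basis: "axis j 1 \<in> (Basis :: (real^'d) set)"
  and space_Basis: "(0, axis j 1) \<in> (Basis :: (real \<times> (real^'d)) set)"
  by (auto simp: Basis_prod_def Basis_vec_def)

lemma Basis_cases:
  assumes "v \<in> (Basis :: (real \<times> (real^'d)) set)"
  obtains "v = (1, 0)" | j where "v = (0, axis j 1)"
  using assms by (auto simp: Basis_prod_def Basis_vec_def)

text \<open>The class of uniformly smooth coefficient families is stable under every basis
  direction, in time by differentiating the family and in space by the multiplier
  \<open>ddx\<close>. Iterated partial derivatives follow by induction on the list of
  directions.\<close>

lemma smf_partial:
  fixes x :: "real \<Rightarrow> real \<Rightarrow> 'd::finite wien"
  assumes x: "smf E T x" and T: "0 < T" and v: "v \<in> Basis"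
  shows "\<exists>y. smf E T y \<and> (\<forall>eps\<in>E. \<forall>z\<in>slab T. partial (slab T) v (syn (x eps)) z = syn (y eps) z
     \<and> has_partial (slab T) v (syn (x eps)) z)"
  using v
proof (cases v rule: Basis_cases)
  case 1
  obtain x' where "smf E T x'"
    "\<And>eps t. eps\<in>E ==> t\<in>{0..T} ==> (x eps has_vector_derivative x' eps t) (at t within {0..T})"
    using smf_derivative[OF x T] by blast
  moreover from this have "partial (slab T) v (syn (x eps)) z = syn (x' eps) z \<and> has_partial (slab T) v (syn (x eps)) z"
    if "eps \<in> E" "z \<in> slab T" for eps z
    using dt_syn[of "x eps" "x' eps (fst z)" "fst z" T "snd z"] that T 1 by (auto simp: slab_def syn_def)
  ultimately show ?thesis by blast
next
  case (2 j)
  have "smf E T (\<lambda>eps t. mulop (ddx j) (x eps t))"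
    by (rule smf_mulop[OF ddx_bound _ x]) simp
  moreover have "partial (slab T) v (syn (x eps)) z = syn (\<lambda>t. mulop (ddx j) (x eps t)) z \<and> has_partial (slab T) v (syn (x eps)) z"
    if "eps \<in> E" "z \<in> slab T" for eps z
    using dx_syn[of "x eps" "fst z" T j "snd z"] rd_smoothw[OF smf_rd[OF x] that(1), of "fst z"] that 2
    by (auto simp: slab_def syn_def)
  ultimately show ?thesis by blast
qed

lemma smf_partials:
  fixes x :: "real \<Rightarrow> real \<Rightarrow> 'd::finite wien"
  assumes x: "smf E T x" and T: "0 < T"
  shows "set vs \<subseteq> Basis ==> \<exists>y. smf E T y \<and> (\<forall>eps\<in>E. \<forall>z\<in>slab T. partials (slab T) vs (syn (x eps)) z = syn (y eps) z)"
proof (induction vs)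
  case (Cons v vs)
  then obtain y where y: "smf E T y" "\<And>eps z. eps\<in>E ==> z\<in>slab T ==> partials (slab T) vs (syn (x eps)) z = syn (y eps) z" by auto
  obtain w where w: "smf E T w" "\<And>eps z. eps\<in>E ==> z\<in>slab T ==> partial (slab T) v (syn (y eps)) z = syn (w eps) z"
    using smf_partial[OF y(1) T, of v] Cons.prems by auto
  show ?case
    using w partial_cong[of "slab T" "partials (slab T) vs (syn (x eps))" "syn (y eps)" for eps] y(2)
    by (intro exI[of _ w]) auto
qed (use x in auto)

theorem smf_uniformly_smooth:
  fixes x :: "real \<Rightarrow> real \<Rightarrow> 'd::finite wien"
  assumes x: "smf E T x" and T: "0 < T"
  shows "uniformly_smooth E (slab T) (\<lambda>eps. syn (x eps))"
  unfolding uniformly_smooth_def smooth_on_def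
proof (intro conjI ballI allI impI)
  fix vs :: "(real \<times> (real^'d)) list" assume vs: "set vs \<subseteq> Basis"
  obtain y where y: "smf E T y" "\<And>eps z. eps\<in>E ==> z\<in>slab T ==> partials (slab T) vs (syn (x eps)) z = syn (y eps) z"
    using smf_partials[OF x T vs] by blast
  { fix eps assume eps: "eps \<in> E"
    have "continuous_on (slab T) (syn (y eps))"
      unfolding syn_def
      by (intro continuous_intros continuous_on_compose2[OF smf_continuous_on[OF y(1) eps]]) (auto simp: slab_def)
    then show "continuous_on (slab T) (partials (slab T) vs (syn (x eps)))"
      using y(2)[OF eps] by (simp cong: continuous_on_cong)
    fix v z :: "real \<times> (real^'d)" assume v: "v \<in> Basis" and z: "z \<in> slab T"
    have "has_partial (slab T) v (syn (y eps)) z" using smf_partial[OF y(1) T v] eps z by blast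
    then show "has_partial (slab T) v (partials (slab T) vs (syn (x eps))) z"
      using has_partial_cong[of "slab T" "partials (slab T) vs (syn (x eps))" "syn (y eps)" z v] y(2)[OF eps] z by blast
  }
  obtain C where C: "\<And>eps t. eps \<in> E ==> t \<in> {0..T} ==> wle 0 (y eps t) C" "0 \<le> C"
    using rd_bound[OF smf_rd[OF y(1)], of 0] by blast
  have "norm (partials (slab T) vs (syn (x eps)) z) \<le> C" if "eps \<in> E" "z \<in> slab T" for eps z
  proof -
    have "fst z \<in> {0..T}" using that(2) by (auto simp: slab_def)
    then have "norm (y eps (fst z)) \<le> C" using C(1)[OF that(1)] by (simp add: wle_0_iff)
    then show ?thesis unfolding y(2)[OF that] syn_def by (rule order_trans[OF norm_synth_le])
  qed
  then show "\<exists>C. \<forall>eps\<in>E. \<forall>z\<in>slab T. norm (partials (slab T) vs (syn (x eps)) z) \<le> C" by blast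
qed

lemma smf_smooth_periodic:
  fixes x :: "real \<Rightarrow> 'd::finite wien"
  assumes x: "smf {eps} T (\<lambda>_. x)" and T: "0 < T"
  shows "smooth_periodic T (syn x)"
  using smf_uniformly_smooth[OF x T] periodic_synth
  by (auto simp: smooth_periodic_def uniformly_smooth_def syn_def)

subsection \<open>From functions to coefficients\<close>

lemma wt_le_max: "\<exists>j. wt (n :: int^'d) \<le> real (1 + CARD('d)) * max 1 \<bar>of_int (n $ j)\<bar>"
proof -
  obtain j where j: "\<And>i. \<bar>n $ i\<bar> \<le> \<bar>n $ j\<bar>"
  proof -
    have "finite (range (\<lambda>i. \<bar>n $ i\<bar>))" "range (\<lambda>i. \<bar>n $ i\<bar>) \<noteq> {}" by auto
    from Max_in[OF this] obtain j where "Max (range (\<lambda>i. \<bar>n $ i\<bar>)) = \<bar>n $ j\<bar>" by blast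
    then show thesis using that[of j] Max_ge[of "range (\<lambda>i. \<bar>n $ i\<bar>)"] by auto
  qed
  have "\<bar>real_of_int (n $ i)\<bar> \<le> max 1 \<bar>real_of_int (n $ j)\<bar>" for i
    using j[of i] by (simp add: le_max_iff_disj flip: of_int_abs)
  then have "(\<Sum>i\<in>UNIV. \<bar>real_of_int (n $ i)\<bar>) \<le> of_nat (card (UNIV :: 'd set)) * max 1 \<bar>of_int (n $ j)\<bar>"
    by (intro sum_bounded_above) auto
  then have "wt n \<le> real (1 + CARD('d)) * max 1 \<bar>of_int (n $ j)\<bar>" by (simp add: wt_def distrib_right)
  then show ?thesis by blast
qed

text \<open>\<open>F j k\<close> stands for the \<open>k\<close>-th derivative in direction
  \<open>j\<close>. It suffices to differentiate in the one coordinate where the frequency is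
  largest, because the weight is comparable to that coordinate; frequency zero is covered by the
  bound on \<open>g\<close> itself.\<close>

lemma hat_decay:
  fixes F :: "'d \<Rightarrow> nat \<Rightarrow> real^'d \<Rightarrow> complex"
  assumes F0: "\<And>j. F j 0 = g"
    and c: "\<And>j k. k \<le> s ==> continuous_on UNIV (F j k)" and p: "\<And>j k. k \<le> s ==> periodic (F j k)"
    and d: "\<And>j k p. k < s ==> ((\<lambda>h. F j k (p + axis j h)) has_vector_derivative F j (Suc k) p) (at 0)"
    and B: "\<And>p. norm (g p) \<le> B" "\<And>j p. norm (F j s p) \<le> B"
  shows "wt n ^ s * norm (hat g n) \<le> real (1 + CARD('d)) ^ s * B"
proof -
  have h: "k \<le> s ==> hat (F j k) n = (\<i> * of_int (n $ j)) ^ k * hat g n" for j k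
  proof (induction k)
    case (Suc k)
    then show ?case using hat_derivative[OF c[of k j] p[of k j] c[of "Suc k" j] d[of k j]] by (simp add: mult_ac)
  qed (simp add: F0)
  obtain j where j: "wt n \<le> real (1 + CARD('d)) * max 1 \<bar>of_int (n $ j)\<bar>" using wt_le_max by blast
  have "(max 1 \<bar>of_int (n $ j)\<bar>) ^ s * norm (hat g n) \<le> B"
  proof (cases "1 \<le> \<bar>real_of_int (n $ j)\<bar>")
    case True
    have "norm (hat (F j s) n) \<le> B" by (rule norm_hat_le) (use c B in auto)
    with True show ?thesis by (simp add: h norm_mult norm_power max_def)
  next
    case False
    have "norm (hat g n) \<le> B" by (rule norm_hat_le) (use c[of 0] B F0 in auto)
    moreover have "max 1 \<bar>real_of_int (n $ j)\<bar> = 1" using False by simp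
    ultimately show ?thesis by simp
  qed
  moreover have "wt n ^ s \<le> real (1 + CARD('d)) ^ s * (max 1 \<bar>of_int (n $ j)\<bar>) ^ s"
    using power_mono[OF j wt_nonneg] by (simp add: power_mult_distrib)
  ultimately have "wt n ^ s * norm (hat g n) \<le> (real (1 + CARD('d)) ^ s * (max 1 \<bar>of_int (n $ j)\<bar>) ^ s) * norm (hat g n)"
    by (intro mult_right_mono) auto
  also have "\<dots> = real (1 + CARD('d)) ^ s * ((max 1 \<bar>of_int (n $ j)\<bar>) ^ s * norm (hat g n))" by (simp add: mult.assoc)
  also have "\<dots> \<le> real (1 + CARD('d)) ^ s * B"
    using \<open>(max 1 \<bar>of_int (n $ j)\<bar>) ^ s * norm (hat g n) \<le> B\<close> by (intro mult_left_mono) auto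
  finally show ?thesis .
qed

lemma coef_Wien_decay:
  assumes "\<And>n. wt (n :: int^'d) ^ (2 * CARD('d)) * norm (c n) \<le> B"
  shows "coef (Wien c) n = c n"
proof -
  have "norm (c n) \<le> B * (1 / wt n ^ (2 * CARD('d)))" for n
    using assms[of n] wt_pos[of n] by (simp add: field_simps)
  then have "coef (Wien c) = c"
    by (rule coef_Wien_le[OF summable_on_cmult_right[OF wt_inverse_summable_on]])
  then show ?thesis by simp
qed

lemma partials_append: "partials S (vs @ ws) f = partials S vs (partials S ws f)"
  by (induction vs) auto

lemma smooth_on_partial: "smooth_on S f ==> v \<in> Basis ==> smooth_on S (partial S v f)"
  unfolding smooth_on_def using partials_append[of S _ "[v]" f]
  by (metis Un_subset_iff empty_subsetI insert_subset list.simps(15) partials.simps set_append set_empty2)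

lemma smooth_on_has_partial: "smooth_on S f ==> v \<in> Basis ==> z \<in> S ==> has_partial S v f z"
  unfolding smooth_on_def by (metis empty_subsetI partials.simps(1) set_empty2)

lemma smooth_on_continuous: "smooth_on S f ==> continuous_on S f"
  unfolding smooth_on_def by (metis empty_subsetI partials.simps(1) set_empty2)

lemma smooth_periodic_partial:
  fixes f :: "real \<times> (real^'d) \<Rightarrow> complex"
  assumes f: "smooth_periodic T f" and v: "v \<in> Basis"
  shows "smooth_periodic T (partial (slab T) v f)"
  unfolding smooth_periodic_def
proof (intro conjI ballI)
  show "smooth_on (slab T) (partial (slab T) v f)"
    using f v by (simp add: smooth_periodic_def smooth_on_partial)
  fix t assume t: "t \<in> {0..T}"
  show "periodic (\<lambda>x. partial (slab T) v f (t, x))"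
    unfolding periodic_def
  proof (intro allI)
    fix x :: "real^'d" and j :: 'd
    let ?e = "axis j (2 * pi)"
    have S: "{h. (t, x + ?e) + h *\<^sub>R v \<in> slab T} = {h. (t, x) + h *\<^sub>R v \<in> slab T}"
      by (cases v) (auto simp: slab_def)
    have "f ((t, x + ?e) + h *\<^sub>R v) = f ((t, x) + h *\<^sub>R v)" if "(t, x) + h *\<^sub>R v \<in> slab T" for h
    proof -
      obtain a b where v: "v = (a, b)" by (cases v)
      have "t + h * a \<in> {0..T}" using that by (simp add: v slab_def)
      then have "f (t + h * a, (x + h *\<^sub>R b) + ?e) = f (t + h * a, x + h *\<^sub>R b)"
        using f by (simp add: smooth_periodic_def periodic_def)
      then show ?thesis by (simp add: v ac_simps)
    qed
    then show "partial (slab T) v f (t, x + ?e) = partial (slab T) v f (t, x)"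
      unfolding partial_def S using t by (intro vector_derivative_cong_within) (auto simp: slab_def)
  qed
qed

text \<open>The function is bounded on the compact set formed by the time interval and a period
  cube, and every point is equivalent to one of that cube.\<close>

lemma smooth_periodic_bounded:
  fixes f :: "real \<times> (real^'d) \<Rightarrow> complex"
  assumes f: "smooth_periodic T f"
  obtains B where "\<And>z. z \<in> slab T ==> norm (f z) \<le> B"
proof -
  have c: "continuous_on ({0..T} \<times> cube) f"
    using f by (auto simp: smooth_periodic_def slab_def intro: continuous_on_subset[OF smooth_on_continuous])
  have "compact ({0..T} \<times> (cube :: (real^'d) set))" by (intro compact_Times) (auto simp: cube_def)
  then have "bounded (f ` ({0..T} \<times> cube))" by (rule compact_imp_bounded[OF compact_continuous_image[OF c]])
  then obtain B where B: "\<And>z. z \<in> {0..T} \<times> cube ==> norm (f z) \<le> B" by (auto simp: bounded_iff)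
  have "norm (f (t, p)) \<le> B" if t: "t \<in> {0..T}" for t p
  proof -
    define q :: "real^'d" where "q = (\<chi> j. Arg2pi (cis (p $ j)))"
    have "q \<in> cube"
      using Arg2pi_ge_0 Arg2pi_lt_2pi by (simp add: q_def cube_def mem_box_cart less_imp_le)
    moreover have "f (t, p) = f (t, q)"
    proof (rule periodic_cis_eq[of "\<lambda>p. f (t, p)"])
      show "periodic (\<lambda>p. f (t, p))" using f t by (simp add: smooth_periodic_def)
      show "cis (p $ j) = cis (q $ j)" for j
        using Arg2pi_eq[of "cis (p $ j)"] by (simp add: q_def cis_conv_exp mult.commute)
    qed
    ultimately show ?thesis using B[of "(t, q)"] t by simp
  qed
  then show thesis using that[of B] by (auto simp: slab_def)
qed

definition fc :: "(real \<times> (real^'d) \<Rightarrow> complex) \<Rightarrow> real \<Rightarrow> 'd::finite wien" where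
  "fc f t = Wien (hat (\<lambda>p. f (t, p)))"

lemma has_partial_derivative: "has_partial S v f z ==>
   ((\<lambda>h. f (z + h *\<^sub>R v)) has_vector_derivative partial S v f z) (at 0 within {h. z + h *\<^sub>R v \<in> S})"
  unfolding has_partial_def partial_def by (simp add: vector_derivative_works)

lemma smooth_periodic_section:
  assumes f: "smooth_periodic T f" and t: "t \<in> {0..T}"
  shows "continuous_on UNIV (\<lambda>p. f (t, p))" "periodic (\<lambda>p. f (t, p))"
proof -
  show "periodic (\<lambda>p. f (t, p))" using assms by (simp add: smooth_periodic_def)
  show "continuous_on UNIV (\<lambda>p. f (t, p))"
    by (rule continuous_on_compose2[OF smooth_on_continuous[of "slab T" f]])
       (use f t in \<open>auto simp: smooth_periodic_def slab_def intro!: continuous_intros\<close>)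
qed

lemma smooth_periodic_has_dx:
  assumes f: "smooth_periodic T f" and t: "t \<in> {0..T}"
  shows "((\<lambda>h. f (t, p + axis j h)) has_vector_derivative dx T j f (t, p)) (at 0)"
proof -
  have ax: "h *\<^sub>R axis j 1 = (axis j h :: real^'a)" for h by (simp add: vec_eq_iff axis_def)
  have "has_partial (slab T) (0, axis j 1) f (t, p)"
    using f t by (intro smooth_on_has_partial space_Basis) (auto simp: smooth_periodic_def slab_def)
  from has_partial_derivative[OF this] show ?thesis
    using slab_space[of t p T "axis j 1"] t by (simp add: slab_def ax)
qed

lemma smooth_periodic_has_dt:
  assumes f: "smooth_periodic T f" and t: "t \<in> {0..T}"
  shows "((\<lambda>t. f (t, p)) has_vector_derivative dt T f (t, p)) (at t within {0..T})"
proof -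
  have "has_partial (slab T) (1, 0) f (t, p)"
    using f t by (intro smooth_on_has_partial time_Basis) (auto simp: smooth_periodic_def slab_def)
  from has_partial_derivative[OF this]
  have 1: "((\<lambda>h. f (t + h, p)) has_vector_derivative dt T f (t, p)) (at (t - t) within (\<lambda>s. s - t) ` {0..T})"
    using slab_time[of t p T] t by (simp add: slab_def)
  have "((\<lambda>h. f (t + h, p)) \<circ> (\<lambda>s. s - t) has_vector_derivative 1 *\<^sub>R dt T f (t, p)) (at t within {0..T})"
    by (rule vector_diff_chain_within[of "\<lambda>s. s - t"]) (use 1 in \<open>auto intro!: derivative_eq_intros\<close>)
  then show ?thesis by (simp add: o_def)
qed

lemma smooth_periodic_decay:
  fixes f :: "real \<times> (real^'d) \<Rightarrow> complex"
  assumes f: "smooth_periodic T f"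
  obtains C where "0 \<le> C" "\<And>t n. t \<in> {0..T} ==> wt n ^ s * norm (hat (\<lambda>p. f (t, p)) n) \<le> C"
proof -
  have sp: "smooth_periodic T (((dx T j) ^^ k) f)" for j k
    by (induction k) (auto intro!: smooth_periodic_partial f space_Basis)
  have "\<exists>B. \<forall>z\<in>slab T. norm (((dx T j) ^^ s) f z) \<le> B" for j
    by (rule smooth_periodic_bounded[OF sp[where j = j and k = s]]) blast
  then have "\<forall>j::'d. \<exists>B. \<forall>z\<in>slab T. norm (((dx T j) ^^ s) f z) \<le> B" by blast
  from choice[OF this] obtain B :: "'d \<Rightarrow> real"
    where B: "\<And>j z. z \<in> slab T ==> norm (((dx T j) ^^ s) f z) \<le> B j" by blast
  obtain B0 where B0: "\<And>z. z \<in> slab T ==> norm (f z) \<le> B0" using smooth_periodic_bounded[OF f] by blast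
  define A where "A = \<bar>B0\<bar> + (\<Sum>j\<in>UNIV. \<bar>B j\<bar>)"
  have A: "B0 \<le> A" "B j \<le> A" "0 \<le> A" for j :: 'd
  proof -
    have "\<bar>B j\<bar> \<le> (\<Sum>j\<in>UNIV. \<bar>B j\<bar>)" by (rule member_le_sum) auto
    moreover have "0 \<le> (\<Sum>j\<in>UNIV. \<bar>B j\<bar>)" by (rule sum_nonneg) auto
    ultimately show "B0 \<le> A" "B j \<le> A" "0 \<le> A" unfolding A_def by linarith+
  qed
  have "wt n ^ s * norm (hat (\<lambda>p. f (t, p)) n) \<le> real (1 + CARD('d)) ^ s * A" if t: "t \<in> {0..T}" for t n
  proof (rule hat_decay[where F = "\<lambda>j k p. ((dx T j) ^^ k) f (t, p)"])
    show "((\<lambda>h. (dx T j ^^ k) f (t, p + axis j h)) has_vector_derivative (dx T j ^^ Suc k) f (t, p)) (at 0)" for j k p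
      using smooth_periodic_has_dx[OF sp t] by simp
    show "norm (f (t, p)) \<le> A" for p using B0[of "(t, p)"] A t by (auto simp: slab_def intro: order_trans)
    show "norm ((dx T j ^^ s) f (t, p)) \<le> A" for j p
      using B[of "(t, p)" j] A(2)[of j] t by (auto simp: slab_def intro: order_trans)
  qed (use smooth_periodic_section[OF sp t] in auto)
  moreover have "0 \<le> real (1 + CARD('d)) ^ s * A" using A(3) by simp
  ultimately show thesis using that by blast
qed

lemma coef_fc:
  fixes f :: "real \<times> (real^'d) \<Rightarrow> complex"
  assumes f: "smooth_periodic T f" and t: "t \<in> {0..T}"
  shows "coef (fc f t) n = hat (\<lambda>p. f (t, p)) n"
proof -
  obtain C where "0 \<le> C" and C: "\<And>t n. t \<in> {0..T} ==> wt n ^ (2 * CARD('d)) * norm (hat (\<lambda>p. f (t, p)) n) \<le> C"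
    using smooth_periodic_decay[OF f] by blast
  show ?thesis unfolding fc_def by (rule coef_Wien_decay[OF C[OF t]])
qed

lemma syn_fc:
  assumes "smooth_periodic T f" "z \<in> slab T"
  shows "syn (fc f) z = f z"
proof -
  have t: "fst z \<in> {0..T}" using assms by (auto simp: slab_def)
  have "synth (fc f (fst z)) = (\<lambda>p. f (fst z, p))"
    by (rule synth_Wien_hat[OF smooth_periodic_section[OF assms(1) t]]) (rule coef_fc[OF assms(1) t])
  then show ?thesis by (simp add: syn_def)
qed

lemma fc_has_vector_derivative:
  fixes f :: "real \<times> (real^'d) \<Rightarrow> complex"
  assumes f: "smooth_periodic T f" and t: "t \<in> {0..T}"
  shows "(fc f has_vector_derivative fc (dt T f) t) (at t within {0..T})"
proof -
  have f': "smooth_periodic T (dt T f)"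
    by (rule smooth_periodic_partial[OF f time_Basis])
  obtain C where C: "0 \<le> C" "\<And>t n. t \<in> {0..T} ==> wt n ^ (2 * CARD('d)) * norm (hat (\<lambda>p. dt T f (t, p)) n) \<le> C"
    using smooth_periodic_decay[OF f'] by blast
  have d: "((\<lambda>t. hat (\<lambda>p. f (t, p)) n) has_vector_derivative hat (\<lambda>p. dt T f (t, p)) n) (at t within {0..T})"
    if "t \<in> {0..T}" for t n
  proof (rule hat_has_vector_derivative[OF smooth_periodic_has_dt[OF f] smooth_periodic_section(1)[OF f] _ that])
    show "continuous_on ({0..T} \<times> UNIV) (\<lambda>z. dt T f (fst z, snd z))"
      using f' by (simp add: smooth_periodic_def slab_def smooth_on_continuous)
  qed auto
  let ?g = "\<lambda>n :: int^'d. C * (1 / wt n ^ (2 * CARD('d)))"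
  have g: "norm (hat (\<lambda>p. dt T f (t, p)) n) \<le> ?g n" if "t \<in> {0..T}" for t n
    using C(2)[OF that, of n] wt_pos[of n] by (simp add: field_simps)
  show ?thesis
  proof (rule wien_has_vector_derivativeI)
    show "?g summable_on UNIV" by (intro summable_on_cmult_right wt_inverse_summable_on)
    show "norm (coef (fc (dt T f) t) n) \<le> ?g n" for n using g[OF t] by (simp add: coef_fc[OF f' t])
    show "((\<lambda>t. coef (fc f t) n) has_vector_derivative coef (fc (dt T f) t) n) (at t within {0..T})" for n
      unfolding coef_fc[OF f' t]
      by (rule has_vector_derivative_transform[OF t _ d[OF t]]) (simp add: coef_fc[OF f])
    show "norm (coef (fc f \<tau>) n - coef (fc f t) n) \<le> ?g n * \<bar>\<tau> - t\<bar>" if "\<tau> \<in> {0..T}" for \<tau> n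
      unfolding coef_fc[OF f that] coef_fc[OF f t]
      by (rule has_vector_derivative_bound[OF d g]) (use that t in auto)
  qed
qed

text \<open>Together with \<open>smf_smooth_periodic\<close> this identifies smooth periodic
  functions with smooth curves of coefficients. Uniqueness shown for coefficients thereby covers
  every smooth periodic competitor.\<close>

theorem smooth_periodic_smf:
  fixes f :: "real \<times> (real^'d) \<Rightarrow> complex"
  assumes f: "smooth_periodic T f"
  shows "smf E T (\<lambda>eps. fc f)"
proof -
  have rd: "rd E T (\<lambda>eps. fc f)" if f: "smooth_periodic T f" for f :: "real \<times> (real^'d) \<Rightarrow> complex"
  proof (rule rdI)
    fix s
    obtain K where K: "0 < K" "\<And>s (x :: 'd wien) B. 0 \<le> B ==> (\<And>n. wt n ^ (s + 2 * CARD('d)) * norm (coef x n) \<le> B) ==> wle s x (K * B)"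
      using wle_of_coef_bound by blast
    obtain C where "0 \<le> C" "\<And>t n. t \<in> {0..T} ==> wt n ^ (s + 2 * CARD('d)) * norm (hat (\<lambda>p. f (t, p)) n) \<le> C"
      using smooth_periodic_decay[OF f] by blast
    then show "\<exists>C. \<forall>eps\<in>E. \<forall>t\<in>{0..T}. wle s (fc f t) C"
      by (intro exI[of _ "K * C"] ballI K) (simp_all add: coef_fc[OF f])
  qed
  have "csm k E T (\<lambda>eps. fc f)" for k
    using f
  proof (induction k arbitrary: f)
    case (Suc k)
    have "smooth_periodic T (dt T f)"
      by (rule smooth_periodic_partial[OF Suc.prems time_Basis])
    then show ?case using Suc rd fc_has_vector_derivative[OF Suc.prems] unfolding csm.simps
      by (intro conjI exI[of _ "\<lambda>eps. fc (dt T f)"]) auto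
  qed (simp add: rd)
  then show ?thesis by (simp add: smf_def)
qed

lemma uniformly_smooth_data:
  fixes a :: "real \<Rightarrow> real^'d \<Rightarrow> complex"
  assumes a: "uniformly_smooth E UNIV a" and per: "\<forall>eps\<in>E. periodic (a eps)"
  obtains x :: "real \<Rightarrow> 'd wien" where "\<And>eps. eps \<in> E ==> synth (x eps) = a eps"
    "\<And>s. \<exists>C. \<forall>eps\<in>E. wle s (x eps) C"
proof -
  let ?D = "\<lambda>j k eps. partials UNIV (replicate k (axis j 1)) (a eps)"
  have ax: "h *\<^sub>R axis j 1 = (axis j h :: real^'d)" for h j by (simp add: vec_eq_iff axis_def)
  have Basis: "set (replicate k (axis j 1 :: real^'d)) \<subseteq> Basis" for j k
    by (auto simp: axis_Basis)
  have cont: "continuous_on UNIV (?D j k eps)" if "eps \<in> E" for j k eps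
    using a that Basis unfolding uniformly_smooth_def smooth_on_def by blast
  have der: "((\<lambda>h. ?D j k eps (p + axis j h)) has_vector_derivative ?D j (Suc k) eps p) (at 0)" if "eps \<in> E" for j k eps p
  proof -
    have "has_partial UNIV (axis j 1) (?D j k eps) p"
      using a that Basis axis_Basis unfolding uniformly_smooth_def smooth_on_def by blast
    from has_partial_derivative[OF this] show ?thesis by (simp add: ax)
  qed
  have perD: "periodic (?D j k eps)" if "eps \<in> E" for j k eps
  proof (induction k)
    case (Suc k)
    then have "?D j k eps (x + axis i (2 * pi) + h *\<^sub>R axis j 1) = ?D j k eps (x + h *\<^sub>R axis j 1)" for x i h
    proof -
      have e: "x + axis i (2 * pi) + h *\<^sub>R axis j 1 = (x + h *\<^sub>R axis j 1) + axis i (2 * pi)" by (simp add: ac_simps)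
      show ?thesis unfolding e using Suc unfolding periodic_def by blast
    qed
    then show ?case by (simp add: periodic_def partial_def)
  qed (use per that in simp)
  have bd: "\<exists>C. \<forall>eps\<in>E. \<forall>p. norm (?D j k eps p) \<le> C" for j k
    using a Basis unfolding uniformly_smooth_def by blast
  have decay: "\<exists>C\<ge>0. \<forall>eps\<in>E. \<forall>n. wt n ^ s * norm (hat (a eps) n) \<le> C" for s
  proof -
    have "\<forall>j::'d. \<exists>C. \<forall>eps\<in>E. \<forall>p. norm (?D j s eps p) \<le> C" using bd[where k = s] by blast
    from choice[OF this] obtain B :: "'d \<Rightarrow> real" where B: "\<And>j eps p. eps \<in> E ==> norm (?D j s eps p) \<le> B j" by blast
    obtain B0 where B0: "\<And>eps p. eps \<in> E ==> norm (a eps p) \<le> B0" using bd[where k = 0 and j = undefined] by auto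
    define A where "A = \<bar>B0\<bar> + (\<Sum>j\<in>UNIV. \<bar>B j\<bar>)"
    have A: "B0 \<le> A" "B j \<le> A" "0 \<le> A" for j :: 'd
    proof -
      have "\<bar>B j\<bar> \<le> (\<Sum>j\<in>UNIV. \<bar>B j\<bar>)" by (rule member_le_sum) auto
      moreover have "0 \<le> (\<Sum>j\<in>UNIV. \<bar>B j\<bar>)" by (rule sum_nonneg) auto
      ultimately show "B0 \<le> A" "B j \<le> A" "0 \<le> A" unfolding A_def by linarith+
    qed
    have "wt n ^ s * norm (hat (a eps) n) \<le> real (1 + CARD('d)) ^ s * A" if eps: "eps \<in> E" for eps n
    proof (rule hat_decay[where F = "\<lambda>j k. ?D j k eps"])
      show "norm (a eps p) \<le> A" for p using B0[OF eps, of p] A(1) by linarith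
      show "norm (?D j s eps p) \<le> A" for j p using B[OF eps, of j p] A(2)[of j] by linarith
    qed (use cont[OF eps] perD[OF eps] der[OF eps] in simp_all)
    then show ?thesis using A(3) by (intro exI[of _ "real (1 + CARD('d)) ^ s * A"]) auto
  qed
  define x :: "real \<Rightarrow> 'd wien" where "x eps = Wien (hat (a eps))" for eps
  have co: "coef (x eps) n = hat (a eps) n" if "eps \<in> E" for eps n
  proof -
    obtain C where C: "\<forall>eps\<in>E. \<forall>n. wt n ^ (2 * CARD('d)) * norm (hat (a eps) n) \<le> C"
      using decay[of "2 * CARD('d)"] by blast
    show ?thesis unfolding x_def by (rule coef_Wien_decay[of _ C]) (use C that in blast)
  qed
  show thesis
  proof (rule that)
    show "synth (x eps) = a eps" if "eps \<in> E" for eps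
      by (rule synth_Wien_hat) (use cont[OF that, of 0] per that co in auto)
    fix s
    obtain K where K: "0 < K" "\<And>s (x :: 'd wien) B. 0 \<le> B ==> (\<And>n. wt n ^ (s + 2 * CARD('d)) * norm (coef x n) \<le> B) ==> wle s x (K * B)"
      using wle_of_coef_bound by blast
    obtain C where "0 \<le> C" "\<And>eps n. eps \<in> E ==> wt n ^ (s + 2 * CARD('d)) * norm (hat (a eps) n) \<le> C"
      using decay by blast
    then show "\<exists>C. \<forall>eps\<in>E. wle s (x eps) C"
      by (intro exI[of _ "K * C"] ballI K) (simp_all add: co)
  qed
qed

section \<open>Evolution equations\<close>

lemma exp_primitive: "((\<lambda>s. K * exp (b * s) + D * s) has_vector_derivative (K * b) * exp (b * x) + D) (at x)"
  for K b D x :: real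
  unfolding has_real_derivative_iff_has_vector_derivative[symmetric]
  by (auto intro!: derivative_eq_intros)

lemma has_vector_derivative_imp_continuous_on:
  assumes "\<And>t. t \<in> S ==> (f has_vector_derivative f' t) (at t within S)"
  shows "continuous_on S f"
  unfolding continuous_on_eq_continuous_within using has_vector_derivative_continuous[OF assms] by simp

text \<open>The differential inequality is only required relative to a common bound for the whole family,
  so that no supremum over the family has to be differentiated.\<close>

lemma gronwall_family:
  fixes y y' :: "'i \<Rightarrow> real \<Rightarrow> 'a::real_normed_vector"
  assumes d: "\<And>i t. i \<in> I ==> t \<in> {0..T} ==> (y i has_vector_derivative y' i t) (at t within {0..T})"
    and H: "\<And>i t. i \<in> I ==> t \<in> {0..T} ==> norm (y i t) \<le> H"
    and A: "\<And>i. i \<in> I ==> norm (y i 0) \<le> A"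
    and c: "\<And>i t V. i \<in> I ==> t \<in> {0..T} ==> (\<And>j. j \<in> I ==> norm (y j t) \<le> V) ==> norm (y' i t) \<le> c * V + D"
    and pos: "0 \<le> c" "0 \<le> D" "0 \<le> A" and i: "i \<in> I" and t: "t \<in> {0..T}"
  shows "norm (y i t) \<le> 2 * (A + D * T) * exp ((2 * c + 1) * t)"
proof -
  \<comment> \<open>The rate is chosen with \<open>c / l\<close> at most \<open>1/2\<close>:
    inserting a bound \<open>theta * exp (l * s)\<close> into the inequality reproduces it with
    \<open>theta / 2\<close> plus the data, so iteration drives the crude bound \<open>H\<close> to
    twice the data.\<close>
  define l where "l = 2 * c + 1"
  have l: "0 < l" using pos by (simp add: l_def)
  define A' where "A' = A + D * T"
  have A'0: "0 \<le> A'" using pos t by (simp add: A'_def)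
  have H0: "0 \<le> H" using H[OF i t] norm_ge_zero order_trans by blast
  have step: "norm (y i t) \<le> (A' + \<theta> / 2) * exp (l * t)"
    if \<theta>: "\<And>j s. j \<in> I ==> s \<in> {0..T} ==> norm (y j s) \<le> \<theta> * exp (l * s)" and i: "i \<in> I" and t: "t \<in> {0..T}" for \<theta> i t
  proof -
    have \<theta>0: "0 \<le> \<theta>"
      using order_trans[OF norm_ge_zero \<theta>[OF i, of 0]] t by simp
    define \<phi> where "\<phi> = (\<lambda>s. (c * \<theta> / l) * exp (l * s) + D * s)"
    have yt: "norm (y i t - y i 0) \<le> \<phi> t - \<phi> 0"
    proof (cases "t = 0")
      case False
      then have t0: "0 < t" using t by simp
      show ?thesis
      proof (rule differentiable_bound_general[OF t0])
        show "continuous_on {0..t} (y i)"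
          by (rule continuous_on_subset[OF has_vector_derivative_imp_continuous_on[OF d[OF i]]]) (use t in auto)
        show "continuous_on {0..t} \<phi>" unfolding \<phi>_def by (intro continuous_intros)
        fix x assume x: "0 < x" "x < t"
        show "(y i has_vector_derivative y' i x) (at x)"
          using d[OF i, of x] x t at_within_Icc_at[of 0 x T] by simp
        show "(\<phi> has_vector_derivative (c * \<theta> / l * l) * exp (l * x) + D) (at x)"
          unfolding \<phi>_def by (rule exp_primitive)
        have "norm (y' i x) \<le> c * (\<theta> * exp (l * x)) + D"
          by (rule c[OF i]) (use \<theta> x t in auto)
        then show "norm (y' i x) \<le> (c * \<theta> / l * l) * exp (l * x) + D" using l by simp
      qed
    qed simp
    have "norm (y i t) \<le> norm (y i 0) + norm (y i t - y i 0)"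
      using norm_triangle_ineq[of "y i 0" "y i t - y i 0"] by simp
    also have "\<dots> \<le> A + (c * \<theta> / l) * exp (l * t) + D * T"
    proof -
      have "\<phi> t - \<phi> 0 \<le> (c * \<theta> / l) * exp (l * t) + D * t"
        using pos \<theta>0 l by (simp add: \<phi>_def)
      moreover have "D * t \<le> D * T" using t pos by (intro mult_left_mono) auto
      ultimately show ?thesis using A[OF i] yt by linarith
    qed
    also have "\<dots> \<le> (A' + \<theta> / 2) * exp (l * t)"
    proof -
      have "c / l \<le> 1 / 2" using pos l by (simp add: l_def field_simps)
      then have "c * \<theta> / l \<le> \<theta> / 2" using mult_right_mono[of "c / l" "1 / 2" \<theta>] \<theta>0 by simp
      then have 1: "(c * \<theta> / l) * exp (l * t) \<le> \<theta> / 2 * exp (l * t)" by (intro mult_right_mono) auto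
      have "A' * 1 \<le> A' * exp (l * t)" using A'0 l t by (intro mult_left_mono) auto
      with 1 show ?thesis unfolding distrib_right using A'_def by linarith
    qed
    finally show ?thesis .
  qed
  have it: "norm (y i t) \<le> (2 * A' + H / 2 ^ n) * exp (l * t)" if i: "i \<in> I" and t: "t \<in> {0..T}" for n i t
    using i t
  proof (induction n arbitrary: i t)
    case 0
    have "H * 1 \<le> (2 * A' + H) * exp (l * t)"
      using A'0 H0 l 0 by (intro mult_mono) auto
    then show ?case using H[OF 0] by simp
  next
    case (Suc n)
    have "norm (y i t) \<le> (A' + (2 * A' + H / 2 ^ n) / 2) * exp (l * t)"
      by (rule step[OF Suc.IH Suc.prems])
    then show ?case by (simp add: add_divide_distrib mult.commute)
  qed
  have "(\<lambda>n. (2 * A' + H * (1/2) ^ n) * exp (l * t)) \<longlonglongrightarrow> (2 * A' + H * 0) * exp (l * t)"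
    by (intro tendsto_intros) auto
  moreover have "norm (y i t) \<le> (2 * A' + H * (1/2) ^ n) * exp (l * t)" for n
    using it[OF i t, of n] by (simp add: power_one_over)
  ultimately have "norm (y i t) \<le> (2 * A' + H * 0) * exp (l * t)"
    by (intro LIMSEQ_le_const[of _ _ "norm (y i t)"]) blast+
  then show ?thesis by (simp add: A'_def l_def)
qed

text \<open>The generator of \<open>phase psi\<close>.\<close>

definition gen :: "(int^'d \<Rightarrow> real) \<Rightarrow> 'd::finite wien \<Rightarrow> 'd wien" where
  "gen \<psi> = mulop (\<lambda>n. \<i> * of_real (\<psi> n))"

lemma pbdd_i: "pbdd (\<lambda>n. of_real (\<psi> n)) ==> pbdd (\<lambda>n. \<i> * of_real (\<psi> n))"
  by (simp add: pbdd_def norm_mult)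

lemma coef_gen: "pbdd (\<lambda>n. of_real (\<psi> n)) ==> smoothw x ==> coef (gen \<psi> x) n = \<i> * of_real (\<psi> n) * coef x n"
  unfolding gen_def by (rule coef_mulop[OF pbdd_i])

lemma smoothw_phase [simp]: "smoothw (phase \<psi> t x) \<longleftrightarrow> smoothw x"
  by (simp add: smoothw_def)

text \<open>Undoing the free flow removes the unbounded operator from the equation and leaves all
  norms unchanged.\<close>

lemma interaction_picture:
  assumes \<psi>: "pbdd (\<lambda>n. of_real (\<psi> n))" and x: "smoothw (x t)"
    and d: "(x has_vector_derivative gen \<psi> (x t) + g) (at t within S)"
  shows "((\<lambda>t. phase \<psi> (- t) (x t)) has_vector_derivative phase \<psi> (- t) g) (at t within S)"
proof -
  have n: "pbdd (\<lambda>n. of_real (- \<psi> n))" using \<psi> by (simp add: pbdd_def)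
  have "gen \<psi> (x t) + g + mulop (\<lambda>n. \<i> * of_real (- \<psi> n)) (x t) = g"
  proof (rule wien_eqI)
    fix m
    have "coef (mulop (\<lambda>n. \<i> * of_real (- \<psi> n)) (x t)) m = \<i> * of_real (- \<psi> m) * coef (x t) m"
      by (rule coef_mulop[OF pbdd_i[OF n] x])
    then show "coef (gen \<psi> (x t) + g + mulop (\<lambda>n. \<i> * of_real (- \<psi> n)) (x t)) m = coef g m"
      unfolding coef_plus coef_gen[OF \<psi> x] by simp
  qed
  from phase_has_vector_derivative[OF n x d, unfolded this phase_uminus] show ?thesis .
qed

text \<open>The free flow is an isometry, so that only the forcing enters the estimate.\<close>

lemma energy_estimate:
  fixes x :: "'i \<Rightarrow> real \<Rightarrow> 'd::finite wien"
  assumes I: "finite I" and \<psi>: "\<And>i. i \<in> I ==> pbdd (\<lambda>n. of_real (\<psi> i n))"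
    and sm: "\<And>i t. i \<in> I ==> t \<in> {0..T} ==> smoothw (x i t)"
    and d: "\<And>i t. i \<in> I ==> t \<in> {0..T} ==> (x i has_vector_derivative gen (\<psi> i) (x i t) + g i t) (at t within {0..T})"
    and A: "\<And>i. i \<in> I ==> norm (x i 0) \<le> A"
    and c: "\<And>i t V. i \<in> I ==> t \<in> {0..T} ==> (\<And>j. j \<in> I ==> norm (x j t) \<le> V) ==> norm (g i t) \<le> c * V + D"
    and pos: "0 \<le> c" "0 \<le> D" "0 \<le> A" and i: "i \<in> I" and t: "t \<in> {0..T}"
  shows "norm (x i t) \<le> 2 * (A + D * T) * exp ((2 * c + 1) * t)"
proof -
  have "\<exists>H. \<forall>t\<in>{0..T}. norm (x i t) \<le> H" if "i \<in> I" for i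
  proof -
    have "continuous_on {0..T} (x i)"
      by (rule has_vector_derivative_imp_continuous_on[OF d[OF that]])
    then have "bounded (x i ` {0..T})" by (intro compact_imp_bounded compact_continuous_image) auto
    then show ?thesis by (auto simp: bounded_iff)
  qed
  then obtain H where H: "\<And>i t. i \<in> I ==> t \<in> {0..T} ==> norm (x i t) \<le> H i" by metis
  have H': "norm (x i t) \<le> (\<Sum>i\<in>I. \<bar>H i\<bar>)" if "i \<in> I" "t \<in> {0..T}" for i t
  proof -
    have "\<bar>H i\<bar> \<le> (\<Sum>i\<in>I. \<bar>H i\<bar>)" by (rule member_le_sum) (use I that in auto)
    then show ?thesis using H[OF that] by linarith
  qed
  have "norm (phase (\<psi> i) (- t) (x i t)) \<le> 2 * (A + D * T) * exp ((2 * c + 1) * t)"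
  proof (rule gronwall_family[where I = I and y = "\<lambda>i t. phase (\<psi> i) (- t) (x i t)" and y' = "\<lambda>i t. phase (\<psi> i) (- t) (g i t)"])
    show "((\<lambda>t. phase (\<psi> i) (- t) (x i t)) has_vector_derivative phase (\<psi> i) (- t) (g i t)) (at t within {0..T})"
      if "i \<in> I" "t \<in> {0..T}" for i t
      by (rule interaction_picture[OF \<psi>[OF that(1)] sm[OF that] d[OF that]])
    show "norm (phase (\<psi> i) (- t) (x i t)) \<le> (\<Sum>i\<in>I. \<bar>H i\<bar>)" if "i \<in> I" "t \<in> {0..T}" for i t
      using H'[OF that] by simp
    show "norm (phase (\<psi> i) (- t) (g i t)) \<le> c * V + D"
      if "i \<in> I" "t \<in> {0..T}" "\<And>j. j \<in> I ==> norm (phase (\<psi> j) (- t) (x j t)) \<le> V" for i t V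
      using c[OF that(1,2), of V] that(3) by simp
  qed (use A pos i t in auto)
  then show ?thesis by simp
qed

lemma wle_integral:
  fixes g :: "real \<Rightarrow> 'd::finite wien"
  assumes g: "continuous_on {0..t} g" and v: "continuous_on {0..t} v"
    and le: "\<And>r. r \<in> {0..t} ==> wle s (g r) (v r)"
  shows "wle s (integral {0..t} g) (integral {0..t} v)"
proof (rule wleI)
  fix A :: "(int^'d) set" assume A: "finite A"
  have gi: "g integrable_on {0..t}" by (rule integrable_continuous_real[OF g])
  have cg: "continuous_on {0..t} (\<lambda>r. coef (g r) n)" for n
    by (rule bounded_linear.continuous_on[OF bounded_linear_coef g])
  have ni: "(\<lambda>r. norm (coef (g r) n)) integrable_on {0..t}" for n
    by (intro integrable_continuous_real continuous_on_norm cg)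
  have "norm (coef (integral {0..t} g) n) \<le> integral {0..t} (\<lambda>r. norm (coef (g r) n))" for n
  proof -
    have "coef (integral {0..t} g) n = integral {0..t} (\<lambda>r. coef (g r) n)"
      using integral_linear[OF gi bounded_linear_coef[of n]] by (simp add: o_def)
    then show ?thesis
      using integral_norm_bound_integral[OF integrable_continuous_real[OF cg[of n]] ni[of n]] by simp
  qed
  then have "(\<Sum>n\<in>A. wt n ^ s * norm (coef (integral {0..t} g) n))
     \<le> (\<Sum>n\<in>A. wt n ^ s * integral {0..t} (\<lambda>r. norm (coef (g r) n)))"
    by (intro sum_mono mult_left_mono) (auto simp: wt_nonneg)
  also have "\<dots> = (\<Sum>n\<in>A. integral {0..t} (\<lambda>r. wt n ^ s * norm (coef (g r) n)))"
    by simp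
  also have "\<dots> = integral {0..t} (\<lambda>r. \<Sum>n\<in>A. wt n ^ s * norm (coef (g r) n))"
    by (rule integral_sum[symmetric]) (auto intro!: A integrable_continuous_real continuous_intros cg)
  also have "\<dots> \<le> integral {0..t} v"
    by (rule integral_le)
       (auto intro!: integrable_continuous_real continuous_intros cg v wleD[OF le] A)
  finally show "(\<Sum>n\<in>A. wt n ^ s * norm (coef (integral {0..t} g) n)) \<le> integral {0..t} v" .
qed

lemma continuous_on_phase:
  "continuous_on S f ==> continuous_on S z ==> continuous_on S (\<lambda>h. phase \<psi> (f h) (z h))"
  unfolding continuous_on_def by (blast intro: phase_tendsto)

text \<open>Picard iteration in the interaction picture; the weighted bounds of the iterates grow at most
  exponentially and survive the limit.\<close>

theorem system_existence:
  fixes \<psi> :: "'i \<Rightarrow> int^'d \<Rightarrow> real" and F :: "real \<Rightarrow> ('i \<Rightarrow> 'd::finite wien) \<Rightarrow> 'i \<Rightarrow> 'd wien"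
  assumes I: "finite I" and T: "0 \<le> T" and \<psi>: "\<And>r. r \<in> I ==> pbdd (\<lambda>n. of_real (\<psi> r n))"
    and Lip: "\<And>t x y r B. t \<in> {0..T} ==> r \<in> I ==> (\<And>i. i \<in> I ==> norm (x i - y i) \<le> B) ==>
      norm (F t x r - F t y r) \<le> L * B" and L: "0 \<le> L"
    and cont: "\<And>x r. r \<in> I ==> (\<And>i. i \<in> I ==> continuous_on {0..T} (x i)) ==>
      continuous_on {0..T} (\<lambda>t. F t (\<lambda>i. x i t) r)"
    and tame: "\<And>s V t x r. 0 \<le> V ==> t \<in> {0..T} ==> r \<in> I ==> (\<And>i. i \<in> I ==> wle s (x i) V) ==>
      wle s (F t x r) (C s * (1 + V))" and C: "\<And>s. 0 \<le> C s"
    and init: "\<And>r s. r \<in> I ==> wle s (x0 r) (A s)"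
  shows "\<exists>x. \<forall>r\<in>I. x r 0 = x0 r \<and> (\<forall>t\<in>{0..T}. (\<forall>s. wle s (x r t) ((1 + A s) * exp (C s * t))) \<and>
      (x r has_vector_derivative gen (\<psi> r) (x r t) + F t (\<lambda>i. x i t) r) (at t within {0..T}))"
proof -
  \<comment> \<open>The nonlinearity seen from the interaction picture. It inherits the Lipschitz
    constant and the weighted bounds of \<open>F\<close> since the phases are isometries for all
    weights.\<close>
  define G where "G r t y = phase (\<psi> r) (- t) (F t (\<lambda>i. phase (\<psi> i) t (y i)) r)" for r t and y :: "'i \<Rightarrow> 'd wien"
  have GLip: "norm (G r t x - G r t y) \<le> L * B"
    if "t \<in> {0..T}" "r \<in> I" "\<And>i. i \<in> I ==> norm (x i - y i) \<le> B" for r t x y B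
    unfolding G_def phase_diff[symmetric] norm_phase
    by (rule Lip[OF that(1,2)]) (simp add: phase_diff[symmetric] that(3))
  have Gcont: "continuous_on {0..T} (\<lambda>t. G r t (\<lambda>i. y i t))"
    if "r \<in> I" "\<And>i. i \<in> I ==> continuous_on {0..T} (y i)" for r and y :: "'i \<Rightarrow> real \<Rightarrow> 'd wien"
    unfolding G_def
    by (intro continuous_on_phase continuous_intros cont that)
  define Y where "Y = rec_nat (\<lambda>r t. x0 r) (\<lambda>_ y r t. x0 r + integral {0..t} (\<lambda>s. G r s (\<lambda>i. y i s)))"
  have Y0: "Y 0 = (\<lambda>r t. x0 r)" and YS: "Y (Suc k) = (\<lambda>r t. x0 r + integral {0..t} (\<lambda>s. G r s (\<lambda>i. Y k i s)))" for k
    by (simp_all add: Y_def)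
  have dint: "((\<lambda>t. x0 r + integral {0..t} (\<lambda>s. G r s (\<lambda>i. y i s))) has_vector_derivative G r t (\<lambda>i. y i t)) (at t within {0..T})"
    if "r \<in> I" "\<And>i. i \<in> I ==> continuous_on {0..T} (y i)" "t \<in> {0..T}" for r y t
  proof -
    have "continuous_on {0..T} (\<lambda>s. G r s (\<lambda>i. y i s))" by (rule Gcont[OF that(1)]) (rule that(2))
    from has_vector_derivative_add[OF has_vector_derivative_const integral_has_vector_derivative[OF this that(3)]]
    show ?thesis by simp
  qed
  have cd: "continuous_on {0..T} f" if "\<And>t. t \<in> {0..T} ==> (f has_vector_derivative f' t) (at t within {0..T})" for f :: "real \<Rightarrow> 'd wien" and f'
    by (rule has_vector_derivative_imp_continuous_on[OF that])
  have Yc: "continuous_on {0..T} (Y k r)" if "r \<in> I" for k r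
    using that
  proof (induction k arbitrary: r)
    case (Suc k)
    show ?case unfolding YS by (rule cd, rule dint[OF Suc.prems Suc.IH])
  qed (simp add: Y0)
  have Yd: "(Y (Suc k) r has_vector_derivative G r t (\<lambda>i. Y k i t)) (at t within {0..T})"
    if "r \<in> I" "t \<in> {0..T}" for k r t
    unfolding YS by (rule dint[OF that(1) _ that(2)]) (rule Yc)
  have Yinit: "Y k r 0 = x0 r" for k r by (cases k) (simp_all add: Y0 YS)
  obtain M where M: "\<And>r t. r \<in> I ==> t \<in> {0..T} ==> norm (Y 1 r t - Y 0 r t) \<le> M" and M0: "0 \<le> M"
  proof -
    have "\<exists>H. \<forall>t\<in>{0..T}. norm (Y 1 r t - Y 0 r t) \<le> H" if "r \<in> I" for r
    proof -
      have "bounded ((\<lambda>t. Y 1 r t - Y 0 r t) ` {0..T})"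
        by (intro compact_imp_bounded compact_continuous_image continuous_intros Yc that) auto
      then show ?thesis by (auto simp: bounded_iff)
    qed
    then obtain H where H: "\<And>r t. r \<in> I ==> t \<in> {0..T} ==> norm (Y 1 r t - Y 0 r t) \<le> H r" by metis
    have "norm (Y 1 r t - Y 0 r t) \<le> (\<Sum>r\<in>I. \<bar>H r\<bar>)" if "r \<in> I" "t \<in> {0..T}" for r t
    proof -
      have "\<bar>H r\<bar> \<le> (\<Sum>r\<in>I. \<bar>H r\<bar>)" by (rule member_le_sum) (use I that in auto)
      then show ?thesis using H[OF that] by linarith
    qed
    then show thesis by (rule that[of "\<Sum>r\<in>I. \<bar>H r\<bar>"]) (auto intro: sum_nonneg)
  qed
  \<comment> \<open>In the norm weighted by \<open>exp (- l * t)\<close> the Picard map contracts by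
    the factor \<open>1/2\<close>, so the iterates converge on the whole interval in one go.\<close>
  define l where "l = 2 * L + 1"
  have l: "0 < l" using L by (simp add: l_def)
  have diff: "norm (Y (Suc k) r t - Y k r t) \<le> (M / 2 ^ k) * exp (l * t)" if "r \<in> I" "t \<in> {0..T}" for k r t
    using that
  proof (induction k arbitrary: r t)
    case 0
    have "M * 1 \<le> M * exp (l * t)" using M0 l 0 by (intro mult_left_mono) auto
    then show ?case using M[OF 0] by simp
  next
    case (Suc k)
    define \<phi> where "\<phi> = (\<lambda>s. (L * (M / 2 ^ k) / l) * exp (l * s) + 0 * s)"
    have "norm ((Y (Suc (Suc k)) r t - Y (Suc k) r t) - (Y (Suc (Suc k)) r 0 - Y (Suc k) r 0)) \<le> \<phi> t - \<phi> 0"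
    proof (cases "t = 0")
      case False
      then have t0: "0 < t" using Suc.prems by simp
      show ?thesis
      proof (rule differentiable_bound_general[OF t0])
        show "continuous_on {0..t} (\<lambda>t. Y (Suc (Suc k)) r t - Y (Suc k) r t)"
          by (rule continuous_on_subset[of "{0..T}"], intro continuous_on_diff Yc Suc.prems) (use Suc.prems in auto)
        show "continuous_on {0..t} \<phi>" unfolding \<phi>_def by (intro continuous_intros)
        fix x assume x: "0 < x" "x < t"
        have xT: "x \<in> {0..T}" using x Suc.prems by auto
        have "((\<lambda>t. Y (Suc (Suc k)) r t - Y (Suc k) r t) has_vector_derivative G r x (\<lambda>i. Y (Suc k) i x) - G r x (\<lambda>i. Y k i x)) (at x within {0..T})"
          by (rule has_vector_derivative_diff[OF Yd[OF Suc.prems(1) xT] Yd[OF Suc.prems(1) xT]])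
        then show "((\<lambda>t. Y (Suc (Suc k)) r t - Y (Suc k) r t) has_vector_derivative G r x (\<lambda>i. Y (Suc k) i x) - G r x (\<lambda>i. Y k i x)) (at x)"
          using x Suc.prems at_within_Icc_at[of 0 x T] by simp
        show "(\<phi> has_vector_derivative (L * (M / 2 ^ k) / l * l) * exp (l * x) + 0) (at x)"
          unfolding \<phi>_def by (rule exp_primitive)
        have "norm (G r x (\<lambda>i. Y (Suc k) i x) - G r x (\<lambda>i. Y k i x)) \<le> L * ((M / 2 ^ k) * exp (l * x))"
          by (rule GLip[OF xT Suc.prems(1)]) (rule Suc.IH[OF _ xT])
        then show "norm (G r x (\<lambda>i. Y (Suc k) i x) - G r x (\<lambda>i. Y k i x)) \<le> (L * (M / 2 ^ k) / l * l) * exp (l * x) + 0"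
          using l by simp
      qed
    qed simp
    also have "\<phi> t - \<phi> 0 \<le> (L * (M / 2 ^ k) / l) * exp (l * t)"
      using L M0 l by (simp add: \<phi>_def)
    also have "\<dots> \<le> (M / 2 ^ Suc k) * exp (l * t)"
    proof (rule mult_right_mono)
      have "L / l \<le> 1 / 2" using L l by (simp add: l_def field_simps)
      then have "(L / l) * (M / 2 ^ k) \<le> (1 / 2) * (M / 2 ^ k)" using M0 by (intro mult_right_mono) auto
      then show "L * (M / 2 ^ k) / l \<le> M / 2 ^ Suc k" by (simp add: mult.commute)
    qed simp
    finally show ?case by (simp add: Yinit)
  qed
  define y where "y r t = Y 0 r t + (\<Sum>k. Y (Suc k) r t - Y k r t)" for r t
  have ul: "uniform_limit {0..T} (\<lambda>n. Y n r) (y r) sequentially" if r: "r \<in> I" for r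
  proof -
    have "uniform_limit {0..T} (\<lambda>n t. \<Sum>k<n. Y (Suc k) r t - Y k r t) (\<lambda>t. \<Sum>k. Y (Suc k) r t - Y k r t) sequentially"
    proof (rule Weierstrass_m_test)
      show "norm (Y (Suc k) r t - Y k r t) \<le> (M * exp (l * T)) * (1/2) ^ k" if "t \<in> {0..T}" for k t
      proof -
        have "M / 2 ^ k * exp (l * t) \<le> M / 2 ^ k * exp (l * T)"
          using that l M0 by (intro mult_left_mono) auto
        moreover have "(M * exp (l * T)) * (1/2) ^ k = M / 2 ^ k * exp (l * T)" by (simp add: power_one_over)
        ultimately show ?thesis using diff[OF r that, of k] by linarith
      qed
      show "summable (\<lambda>k. (M * exp (l * T)) * (1/2) ^ k)" by (intro summable_mult summable_geometric) auto
    qed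
    then have "uniform_limit {0..T} (\<lambda>n t. Y 0 r t + (\<Sum>k<n. Y (Suc k) r t - Y k r t))
        (\<lambda>t. Y 0 r t + (\<Sum>k. Y (Suc k) r t - Y k r t)) sequentially"
      by (intro uniform_limit_add uniform_limit_const)
    moreover have "Y 0 r t + (\<Sum>k<n. Y (Suc k) r t - Y k r t) = Y n r t" for n t
      using sum_lessThan_telescope[of "\<lambda>k. Y k r t" n] by simp
    ultimately show ?thesis by (simp only: y_def[abs_def])
  qed
  have yc: "continuous_on {0..T} (y r)" if "r \<in> I" for r
    by (rule uniform_limit_theorem[OF _ ul[OF that]]) (auto intro!: always_eventually Yc that)
  have lim: "(\<lambda>n. Y n r t) \<longlonglongrightarrow> y r t" if "r \<in> I" "t \<in> {0..T}" for r t
    by (rule tendsto_uniform_limitI[OF ul[OF that(1)] that(2)])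
  have fix_eq: "y r t = x0 r + integral {0..t} (\<lambda>s. G r s (\<lambda>i. y i s))" if r: "r \<in> I" and t: "t \<in> {0..T}" for r t
  proof -
    have "(\<lambda>n. Y (Suc n) r t) \<longlonglongrightarrow> x0 r + integral {0..t} (\<lambda>s. G r s (\<lambda>i. y i s))"
    proof (rule LIMSEQ_I)
      fix e :: real assume e: "0 < e"
      define d where "d = e / (2 * (L * T + 1))"
      have LT: "0 \<le> L * T" using L T by simp
      have d: "0 < d" using e LT by (simp add: d_def)
      have "\<forall>\<^sub>F n in sequentially. \<forall>i\<in>I. \<forall>s\<in>{0..T}. dist (Y n i s) (y i s) < d"
        using I ul d by (intro eventually_ball_finite) (auto simp: uniform_limit_iff)
      then obtain N where N: "\<And>n i s. n \<ge> N ==> i \<in> I ==> s \<in> {0..T} ==> dist (Y n i s) (y i s) < d"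
        unfolding eventually_sequentially by blast
      have "norm (Y (Suc n) r t - (x0 r + integral {0..t} (\<lambda>s. G r s (\<lambda>i. y i s)))) < e" if n: "n \<ge> N" for n
      proof -
        have sub: "{0..t} \<subseteq> {0..T}" using t by auto
        have i1: "(\<lambda>s. G r s (\<lambda>i. Y n i s)) integrable_on {0..t}" "(\<lambda>s. G r s (\<lambda>i. y i s)) integrable_on {0..t}"
          by (rule integrable_continuous_real, rule continuous_on_subset[OF Gcont[OF r] sub], rule Yc yc, assumption)+
        have "norm (integral {0..t} (\<lambda>s. G r s (\<lambda>i. Y n i s) - G r s (\<lambda>i. y i s))) \<le> (L * d) * measure lborel (cbox 0 t)"
          unfolding box_real(2)[symmetric]
        proof (rule integrable_bound)
          show "(\<lambda>s. G r s (\<lambda>i. Y n i s) - G r s (\<lambda>i. y i s)) integrable_on cbox 0 t"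
            using integrable_diff[OF i1] by simp
          show "norm (G r s (\<lambda>i. Y n i s) - G r s (\<lambda>i. y i s)) \<le> L * d" if "s \<in> cbox 0 t" for s
            by (rule GLip) (use that t r N[OF n] in \<open>auto simp: dist_norm intro: less_imp_le\<close>)
        qed (use L d in simp)
        also have "\<dots> \<le> (L * T) * d" using t L d by (auto simp: mult_ac intro!: mult_left_mono)
        also have "\<dots> < e"
        proof -
          have "(L * T) * d \<le> (L * T + 1) * d" using d by (intro mult_right_mono) auto
          also have "\<dots> = e / 2"
          proof -
            define q where "q = L * T + 1"
            have "q \<noteq> 0" using LT unfolding q_def by linarith
            then show ?thesis unfolding d_def q_def[symmetric] by simp
          qed
          finally show ?thesis using e by simp
        qed
        finally show ?thesis by (simp add: YS integral_diff[OF i1])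
      qed
      then show "\<exists>no. \<forall>n\<ge>no. norm (Y (Suc n) r t - (x0 r + integral {0..t} (\<lambda>s. G r s (\<lambda>i. y i s)))) < e" by blast
    qed
    then show ?thesis using LIMSEQ_unique[OF LIMSEQ_Suc[OF lim[OF r t]]] by blast
  qed
  have yd: "(y r has_vector_derivative G r t (\<lambda>i. y i t)) (at t within {0..T})" if "r \<in> I" "t \<in> {0..T}" for r t
  proof (rule has_vector_derivative_transform[OF that(2)])
    show "((\<lambda>t. x0 r + integral {0..t} (\<lambda>s. G r s (\<lambda>i. y i s))) has_vector_derivative G r t (\<lambda>i. y i t)) (at t within {0..T})"
      by (rule dint[OF that(1) _ that(2)]) (rule yc)
  qed (rule fix_eq[OF that(1)])
  have A0: "0 \<le> A s" if "r \<in> I" for r s using wle_nonneg[OF init[OF that]] .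
  \<comment> \<open>The subtracted 1 makes the bound reproduce itself: with \<open>V\<close> equal
    to it, \<open>C s * (1 + V)\<close> is exactly the derivative of
    \<open>(1 + A s) * exp (C s * t)\<close>.\<close>
  have Yw: "wle s (Y k r t) ((1 + A s) * exp (C s * t) - 1)" if "r \<in> I" "t \<in> {0..T}" for k r t s
    using that
  proof (induction k arbitrary: r t)
    case 0
    have "(1 + A s) * 1 \<le> (1 + A s) * exp (C s * t)"
      using A0[OF 0(1), of s] C[of s] 0 by (intro mult_left_mono) auto
    then show ?case using init[OF 0(1), of s] by (auto simp: Y0 intro: wle_mono)
  next
    case (Suc k)
    let ?v = "\<lambda>r. C s * ((1 + A s) * exp (C s * r))"
    have "wle s (integral {0..t} (\<lambda>r'. G r r' (\<lambda>i. Y k i r'))) (integral {0..t} ?v)"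
    proof (rule wle_integral)
      show "continuous_on {0..t} (\<lambda>r'. G r r' (\<lambda>i. Y k i r'))"
        by (rule continuous_on_subset[OF Gcont[OF Suc.prems(1)]]) (use Suc.prems Yc in auto)
      show "continuous_on {0..t} ?v" by (intro continuous_intros)
      fix r' assume r': "r' \<in> {0..t}"
      then have r'T: "r' \<in> {0..T}" using Suc.prems by auto
      have V0: "0 \<le> (1 + A s) * exp (C s * r') - 1" using wle_nonneg[OF Suc.IH[OF Suc.prems(1) r'T]] .
      have "wle s (F r' (\<lambda>i. phase (\<psi> i) r' (Y k i r')) r) (C s * (1 + ((1 + A s) * exp (C s * r') - 1)))"
        by (rule tame[OF V0 r'T Suc.prems(1)]) (simp add: Suc.IH[OF _ r'T])
      then show "wle s (G r r' (\<lambda>i. Y k i r')) (?v r')" by (simp add: G_def)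
    qed
    moreover have "integral {0..t} ?v = (1 + A s) * exp (C s * t) - (1 + A s) * exp (C s * 0)"
    proof (rule integral_unique, rule fundamental_theorem_of_calculus)
      show "0 \<le> t" using Suc.prems by simp
      show "((\<lambda>r. (1 + A s) * exp (C s * r)) has_vector_derivative ?v r) (at r within {0..t})" for r
        unfolding has_real_derivative_iff_has_vector_derivative[symmetric]
        by (auto intro!: derivative_eq_intros)
    qed
    ultimately have "wle s (Y (Suc k) r t) (A s + ((1 + A s) * exp (C s * t) - (1 + A s) * exp (C s * 0)))"
      unfolding YS by (intro wle_add init Suc.prems) simp
    then show ?case by (simp add: algebra_simps)
  qed
  have yw: "wle s (y r t) ((1 + A s) * exp (C s * t))" if "r \<in> I" "t \<in> {0..T}" for r t s
    by (rule wle_closed[OF lim[OF that]]) (auto intro!: wle_mono[OF Yw[OF that]])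
  have ysm: "smoothw (y r t)" if "r \<in> I" "t \<in> {0..T}" for r t
    by (rule wle_imp_smoothw[OF yw[OF that]])
  show ?thesis
  proof (intro exI[of _ "\<lambda>r t. phase (\<psi> r) t (y r t)"] ballI conjI allI)
    fix r assume r: "r \<in> I"
    show "phase (\<psi> r) 0 (y r 0) = x0 r" using fix_eq[OF r, of 0] T by simp
    fix t assume t: "t \<in> {0..T}"
    show "wle s (phase (\<psi> r) t (y r t)) ((1 + A s) * exp (C s * t))" for s using yw[OF r t] by simp
    have eq: "phase (\<psi> r) t (G r t (\<lambda>i. y i t) + mulop (\<lambda>n. \<i> * of_real (\<psi> r n)) (y r t)) =
      gen (\<psi> r) (phase (\<psi> r) t (y r t)) + F t (\<lambda>i. phase (\<psi> i) t (y i t)) r"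
    proof (rule wien_eqI)
      fix n
      have cc: "cis (\<psi> r n * t) * cis (- (\<psi> r n * t)) = 1" by (simp add: cis_mult)
      show "coef (phase (\<psi> r) t (G r t (\<lambda>i. y i t) + mulop (\<lambda>n. \<i> * of_real (\<psi> r n)) (y r t))) n =
        coef (gen (\<psi> r) (phase (\<psi> r) t (y r t)) + F t (\<lambda>i. phase (\<psi> i) t (y i t)) r) n"
        using cc by (simp add: G_def coef_gen[OF \<psi>[OF r]] coef_mulop[OF pbdd_i[OF \<psi>[OF r]]] ysm[OF r t]
            distrib_left mult.assoc[symmetric])
    qed
    show "((\<lambda>t. phase (\<psi> r) t (y r t)) has_vector_derivative
       gen (\<psi> r) (phase (\<psi> r) t (y r t)) + F t (\<lambda>i. phase (\<psi> i) t (y i t)) r) (at t within {0..T})"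
      using phase_has_vector_derivative[of "\<psi> r" "y r" t, OF \<psi>[OF r] ysm[OF r t] yd[OF r t]] unfolding eq .
  qed
qed

section \<open>Truncated polynomial nonlinearities\<close>

definition rho :: "real \<Rightarrow> 'a::real_normed_vector \<Rightarrow> 'a" where
  "rho M x = (if norm x \<le> M then x else (M / norm x) *\<^sub>R x)"

lemma rho_id: "norm x \<le> M ==> rho M x = x"
  by (simp add: rho_def)

lemma norm_rho_le: "0 < M ==> norm (rho M x) \<le> M"
  by (auto simp: rho_def)

lemma rho_lipschitz:
  assumes M: "0 < M"
  shows "norm (rho M x - rho M y) \<le> 2 * norm (x - y)"
proof -
  \<comment> \<open>Moving the outer point to the sphere costs \<open>norm x - M\<close>, which is
    at most the distance of the two points because the other one lies in the ball.\<close>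
  have mixed: "norm (rho M x - rho M y) \<le> 2 * norm (x - y)" if x: "\<not> norm x \<le> M" and y: "norm y \<le> M" for x y :: 'a
  proof -
    have x0: "0 < norm x" using x M by linarith
    have "rho M x - rho M y = (x - y) - (1 - M / norm x) *\<^sub>R x"
      using x y by (simp add: rho_def algebra_simps)
    then have "norm (rho M x - rho M y) \<le> norm (x - y) + norm ((1 - M / norm x) *\<^sub>R x)"
      by (simp only: norm_triangle_ineq4)
    also have "norm ((1 - M / norm x) *\<^sub>R x) = norm x - M"
    proof -
      have "M / norm x \<le> 1" using x x0 by simp
      then have "norm ((1 - M / norm x) *\<^sub>R x) = (1 - M / norm x) * norm x" by simp
      also have "\<dots> = norm x - M" using x0 by (simp add: left_diff_distrib)
      finally show ?thesis .
    qed
    also have "norm x - M \<le> norm (x - y)"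
      using norm_triangle_ineq2[of x y] y by linarith
    finally show ?thesis by simp
  qed
  show ?thesis
  proof (cases "norm x \<le> M"; cases "norm y \<le> M")
    assume "norm x \<le> M" "norm y \<le> M"
    then show ?thesis by (simp add: rho_def)
  next
    assume "\<not> norm x \<le> M" "norm y \<le> M"
    then show ?thesis by (rule mixed)
  next
    assume "norm x \<le> M" "\<not> norm y \<le> M"
    then show ?thesis using mixed[of y x] by (simp add: norm_minus_commute)
  next
    assume x: "\<not> norm x \<le> M" and y: "\<not> norm y \<le> M"
    have x0: "0 < norm x" "0 < norm y" using x y M by linarith+
    have "rho M x - rho M y = (M / norm x) *\<^sub>R (x - y) + (M / norm x - M / norm y) *\<^sub>R y"
      using x y by (simp add: rho_def algebra_simps)
    then have "norm (rho M x - rho M y) \<le> (M / norm x) * norm (x - y) + \<bar>M / norm x - M / norm y\<bar> * norm y"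
      using norm_triangle_ineq[of "(M / norm x) *\<^sub>R (x - y)" "(M / norm x - M / norm y) *\<^sub>R y"] M x0 by simp
    also have "\<bar>M / norm x - M / norm y\<bar> * norm y = (M / norm x) * \<bar>norm y - norm x\<bar>"
    proof -
      have "(M / norm x - M / norm y) * norm y = (M / norm x) * (norm y - norm x)"
        using x0 by (simp add: field_simps)
      then have "\<bar>(M / norm x - M / norm y) * norm y\<bar> = \<bar>(M / norm x) * (norm y - norm x)\<bar>" by simp
      then show ?thesis using M x0 by (simp add: abs_mult)
    qed
    also have "\<dots> \<le> (M / norm x) * norm (x - y)"
      using M x0 norm_triangle_ineq3[of y x] by (intro mult_left_mono) (auto simp: norm_minus_commute)
    also have "(M / norm x) * norm (x - y) + (M / norm x) * norm (x - y) = (M / norm x) * (2 * norm (x - y))" by simp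
    also have "\<dots> \<le> 1 * (2 * norm (x - y))"
      using x x0 by (intro mult_right_mono) auto
    finally show ?thesis by simp
  qed
qed

lemma wle_rho:
  fixes x :: "'d::finite wien"
  assumes M: "0 < M" and x: "wle s x V"
  shows "wle s (rho M x) V"
proof (cases "norm x \<le> M")
  case False
  then have "0 < norm x" using M by linarith
  then have c: "M / norm x \<le> 1" "0 \<le> M / norm x" using M False by auto
  have "wle s (rho M x) (1 * V)"
  proof (rule wle_coef_le[OF x])
    fix n
    have "norm (coef (rho M x) n) = (M / norm x) * norm (coef x n)"
      using False M by (simp add: rho_def)
    also have "\<dots> \<le> 1 * norm (coef x n)" using c by (intro mult_right_mono) auto
    finally show "norm (coef (rho M x) n) \<le> 1 * norm (coef x n)" .
  qed simp
  then show ?thesis by simp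
qed (use x in \<open>simp add: rho_def\<close>)

text \<open>Boundedness is part of the notion because it makes the other two properties stable under
  products: one factor is estimated by its bound while the other carries the difference or the
  weight. All constants are common to the parameters \<open>p\<close> in \<open>E\<close>.\<close>

definition tame_with where
  "tame_with E I P B L C \<longleftrightarrow> 0 \<le> B \<and> 0 \<le> L \<and> (\<forall>s. 0 \<le> C s) \<and> (\<forall>p\<in>E. \<forall>x. norm (P p x) \<le> B) \<and>
    (\<forall>p\<in>E. \<forall>x y b. 0 \<le> b \<longrightarrow> (\<forall>i\<in>I. norm (x i - y i) \<le> b) \<longrightarrow> norm (P p x - P p y) \<le> L * b) \<and>
    (\<forall>s. \<forall>p\<in>E. \<forall>x V. 0 \<le> V \<longrightarrow> (\<forall>i\<in>I. wle s (x i) V) \<longrightarrow> wle s (P p x) (C s * (1 + V)))"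

definition tame :: "'p set \<Rightarrow> 'i set \<Rightarrow> ('p \<Rightarrow> ('i \<Rightarrow> 'd::finite wien) \<Rightarrow> 'd wien) \<Rightarrow> bool" where
  "tame E I P \<longleftrightarrow> (\<exists>B L C. tame_with E I P B L C)"

lemma tameI:
  assumes "0 \<le> B" "\<And>p x. p \<in> E ==> norm (P p x) \<le> B"
    and "0 \<le> L" "\<And>p x y b. p \<in> E ==> 0 \<le> b ==> (\<And>i. i \<in> I ==> norm (x i - y i) \<le> b) ==> norm (P p x - P p y) \<le> L * b"
    and "\<And>s. 0 \<le> C s" "\<And>s p x V. p \<in> E ==> 0 \<le> V ==> (\<And>i. i \<in> I ==> wle s (x i) V) ==> wle s (P p x) (C s * (1 + V))"
  shows "tame E I P"
  unfolding tame_def tame_with_def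
  by (intro exI[of _ B] exI[of _ L] exI[of _ C]) (simp add: assms)

lemma tame_withD:
  assumes "tame_with E I P B L C"
  shows "0 \<le> B" "\<And>p x. p \<in> E ==> norm (P p x) \<le> B" "0 \<le> L"
    "\<And>p x y b. p \<in> E ==> 0 \<le> b ==> (\<And>i. i \<in> I ==> norm (x i - y i) \<le> b) ==> norm (P p x - P p y) \<le> L * b"
    "\<And>s. 0 \<le> C s" "\<And>s p x V. p \<in> E ==> 0 \<le> V ==> (\<And>i. i \<in> I ==> wle s (x i) V) ==> wle s (P p x) (C s * (1 + V))"
  using assms unfolding tame_with_def by simp_all

lemma tame_add:
  assumes "tame E I P" "tame E I Q"
  shows "tame E I (\<lambda>p x. P p x + Q p x)"
proof -
  obtain B L C where "tame_with E I P B L C" using assms(1) unfolding tame_def by (elim exE)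
  note P = tame_withD[OF this]
  obtain B' L' C' where "tame_with E I Q B' L' C'" using assms(2) unfolding tame_def by (elim exE)
  note Q = tame_withD[OF this]
  show ?thesis
  proof (rule tameI[of "B + B'" _ _ "L + L'" _ "\<lambda>s. C s + C' s"])
    show "norm (P p x + Q p x) \<le> B + B'" if "p \<in> E" for p x
      by (rule norm_triangle_mono[OF P(2)[OF that] Q(2)[OF that]])
    show "norm ((P p x + Q p x) - (P p y + Q p y)) \<le> (L + L') * b"
      if "p \<in> E" "0 \<le> b" "\<And>i. i \<in> I ==> norm (x i - y i) \<le> b" for p x y b
      unfolding distrib_right add_diff_add by (rule norm_triangle_mono[OF P(4)[OF that] Q(4)[OF that]])
    show "wle s (P p x + Q p x) ((C s + C' s) * (1 + V))"
      if "p \<in> E" "0 \<le> V" "\<And>i. i \<in> I ==> wle s (x i) V" for s p x V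
      unfolding distrib_right[of "C s"] by (rule wle_add[OF P(6)[OF that] Q(6)[OF that]])
  qed (simp_all add: P(1,3,5) Q(1,3,5))
qed

lemma tame_mult:
  assumes "tame E I P" "tame E I Q"
  shows "tame E I (\<lambda>p x. P p x * Q p x)"
proof -
  obtain B L C where "tame_with E I P B L C" using assms(1) unfolding tame_def by (elim exE)
  note P = tame_withD[OF this]
  obtain B' L' C' where "tame_with E I Q B' L' C'" using assms(2) unfolding tame_def by (elim exE)
  note Q = tame_withD[OF this]
  show ?thesis
  proof (rule tameI[of "B * B'" _ _ "L * B' + B * L'" _ "\<lambda>s. 2 ^ s * (C s * B' + B * C' s)"])
    show "norm (P p x * Q p x) \<le> B * B'" if "p \<in> E" for p x
      by (rule order_trans[OF norm_mult_ineq mult_mono[OF P(2)[OF that] Q(2)[OF that] P(1) norm_ge_zero]])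
    show "norm (P p x * Q p x - P p y * Q p y) \<le> (L * B' + B * L') * b"
      if h: "p \<in> E" "0 \<le> b" "\<And>i. i \<in> I ==> norm (x i - y i) \<le> b" for p x y b
    proof -
      have "P p x * Q p x - P p y * Q p y = (P p x - P p y) * Q p x + P p y * (Q p x - Q p y)"
        by (simp add: algebra_simps)
      also have "norm \<dots> \<le> (L * b) * B' + B * (L' * b)"
      proof (rule norm_triangle_mono)
        show "norm ((P p x - P p y) * Q p x) \<le> (L * b) * B'"
          by (rule order_trans[OF norm_mult_ineq mult_mono[OF P(4)[OF h] Q(2)[OF h(1)] _ norm_ge_zero]])
             (simp_all add: P(3) h(2))
        show "norm (P p y * (Q p x - Q p y)) \<le> B * (L' * b)"
          by (rule order_trans[OF norm_mult_ineq mult_mono[OF P(2)[OF h(1)] Q(4)[OF h] P(1) norm_ge_zero]])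
      qed
      finally show ?thesis by (simp add: algebra_simps)
    qed
    show "wle s (P p x * Q p x) (2 ^ s * (C s * B' + B * C' s) * (1 + V))"
      if h: "p \<in> E" "0 \<le> V" "\<And>i. i \<in> I ==> wle s (x i) V" for s p x V
    proof (rule wle_mono[OF wle_mult[OF P(6)[OF h] Q(6)[OF h]]])
      have "C s * (1 + V) * norm (Q p x) \<le> C s * (1 + V) * B'"
        using P(5)[of s] h(2) by (intro mult_left_mono Q(2)[OF h(1)]) simp
      moreover have "norm (P p x) * (C' s * (1 + V)) \<le> B * (C' s * (1 + V))"
        using Q(5)[of s] h(2) by (intro mult_right_mono P(2)[OF h(1)]) simp
      ultimately have "C s * (1 + V) * norm (Q p x) + norm (P p x) * (C' s * (1 + V)) \<le> (C s * B' + B * C' s) * (1 + V)"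
        by (simp add: algebra_simps)
      then show "2 ^ s * (C s * (1 + V) * norm (Q p x) + norm (P p x) * (C' s * (1 + V)))
         \<le> 2 ^ s * (C s * B' + B * C' s) * (1 + V)"
        by (simp add: mult.assoc)
    qed
  qed (simp_all add: P(1,3,5) Q(1,3,5))
qed

lemma tame_star:
  assumes "tame E I P"
  shows "tame E I (\<lambda>p x. star (P p x))"
proof -
  obtain B L C where "tame_with E I P B L C" using assms(1) unfolding tame_def by (elim exE)
  note P = tame_withD[OF this]
  show ?thesis
    by (rule tameI[of B _ _ L _ C]) (simp_all add: star_diff[symmetric] P wle_star)
qed

lemma tame_cst:
  assumes c: "\<And>p. p \<in> E ==> norm (c p) \<le> B"
  shows "tame E I (\<lambda>p x. cst (c p) :: 'a::finite wien)"
proof (rule tameI[of "\<bar>B\<bar>" _ _ 0 _ "\<lambda>_. \<bar>B\<bar>"])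
  show "wle s (cst (c p) :: 'a wien) (\<bar>B\<bar> * (1 + V))" if "p \<in> E" "0 \<le> V" for s p V
  proof (rule wle_mono)
    show "wle s (cst (c p) :: 'a wien) (wt (0 :: int^'a) ^ s * norm (c p))" unfolding cst_def by (rule wle_single)
    have "norm (c p) \<le> \<bar>B\<bar> * 1" using c[OF that(1)] by simp
    also have "\<dots> \<le> \<bar>B\<bar> * (1 + V)" using that by (intro mult_left_mono) auto
    finally show "wt (0 :: int^'a) ^ s * norm (c p) \<le> \<bar>B\<bar> * (1 + V)" by (simp add: wt_def)
  qed
  show "norm (cst (c p) :: 'a wien) \<le> \<bar>B\<bar>" if "p \<in> E" for p using c[OF that] by simp
qed simp_all

lemma tame_rho:
  assumes M: "0 < M" and i: "i \<in> I"
  shows "tame E I (\<lambda>p x. rho M (x i))"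
proof (rule tameI[of M _ _ 2 _ "\<lambda>_. 1"])
  show "norm (rho M (x i) - rho M (y i)) \<le> 2 * b" if "\<And>i. i \<in> I ==> norm (x i - y i) \<le> b" for x y b
    using rho_lipschitz[OF M, of "x i" "y i"] that[OF i] by linarith
  show "wle s (rho M (x i)) (1 * (1 + V))" if "\<And>i. i \<in> I ==> wle s (x i) V" for s x V
    by (rule wle_mono[OF wle_rho[OF M that[OF i]]]) simp
qed (use M norm_rho_le[OF M] in simp_all)

lemma tame_continuous:
  assumes P: "tame E I P" and p: "p \<in> E" and I: "finite I" and x: "\<And>i. i \<in> I ==> continuous_on S (x i)"
  shows "continuous_on S (\<lambda>t. P p (\<lambda>i. x i t))"
  unfolding continuous_on_def
proof (intro ballI tendstoI)
  fix t and e :: real assume t: "t \<in> S" and e: "0 < e"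
  obtain B L C where "tame_with E I P B L C" using P unfolding tame_def by (elim exE)
  note L = tame_withD(3,4)[OF this]
  define d where "d = e / (2 * (L + 1))"
  have d: "0 < d" using e L by (simp add: d_def)
  have "\<forall>\<^sub>F s in at t within S. \<forall>i\<in>I. dist (x i s) (x i t) < d"
    using x t by (intro eventually_ball_finite I ballI tendstoD[OF _ d]) (simp add: continuous_on_def)
  then show "\<forall>\<^sub>F s in at t within S. dist (P p (\<lambda>i. x i s)) (P p (\<lambda>i. x i t)) < e"
  proof eventually_elim
    case (elim s)
    have "norm (P p (\<lambda>i. x i s) - P p (\<lambda>i. x i t)) \<le> L * d"
      by (rule L(2)[OF p less_imp_le[OF d]]) (use elim in \<open>simp add: dist_norm less_imp_le\<close>)
    also have "L * d \<le> (L + 1) * d" using d by (intro mult_right_mono) auto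
    also have "\<dots> = e / 2" unfolding d_def using L(1) by (simp add: field_simps)
    finally show ?case using e by (simp add: dist_norm)
  qed
qed

text \<open>The bound \<open>B\<close> on the nonlinearity is fixed before the time
  \<open>T\<close>, so that a time of existence can be chosen in terms of it. The bounds
  \<open>W\<close> depend on \<open>T\<close> but not on the parameter.\<close>

lemma tame_system:
  fixes \<psi> :: "'p \<Rightarrow> 'i \<Rightarrow> int^'d \<Rightarrow> real" and P :: "'i \<Rightarrow> 'p \<Rightarrow> ('i \<Rightarrow> 'd::finite wien) \<Rightarrow> 'd wien"
  assumes I: "finite I" and P: "\<And>r. r \<in> I ==> tame E I (P r)"
    and \<psi>: "\<And>p r. p \<in> E ==> r \<in> I ==> pbdd (\<lambda>n. of_real (\<psi> p r n))"
    and init: "\<And>p r s. p \<in> E ==> r \<in> I ==> wle s (x0 p r) (A s)"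
  shows "\<exists>B\<ge>0. \<forall>T\<ge>0. \<exists>W x. \<forall>p\<in>E. \<forall>r\<in>I. (\<forall>y. norm (P r p y) \<le> B) \<and> x p r 0 = x0 p r \<and> (\<forall>t\<in>{0..T}. (\<forall>s. wle s (x p r t) (W s)) \<and>
      (x p r has_vector_derivative gen (\<psi> p r) (x p r t) + P r p (\<lambda>i. x p i t)) (at t within {0..T}))"
proof -
  have "\<forall>r. \<exists>B. \<exists>L C. r \<in> I \<longrightarrow> tame_with E I (P r) B L C" using P unfolding tame_def by blast
  from choice[OF this] obtain B where "\<forall>r. \<exists>L. \<exists>C. r \<in> I \<longrightarrow> tame_with E I (P r) (B r) L C" by (elim exE)
  from choice[OF this] obtain L where "\<forall>r. \<exists>C. r \<in> I \<longrightarrow> tame_with E I (P r) (B r) (L r) C" by (elim exE)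
  from choice[OF this] obtain C where tw: "\<forall>r. r \<in> I \<longrightarrow> tame_with E I (P r) (B r) (L r) (C r)" by (elim exE)
  note * = tame_withD[OF tw[rule_format]]
  define B' L' C' where "B' = (\<Sum>r\<in>I. B r)" and "L' = (\<Sum>r\<in>I. L r)" and "C' s = (\<Sum>r\<in>I. C r s)" for s
  have le: "B r \<le> B'" "L r \<le> L'" "C r s \<le> C' s" if "r \<in> I" for r s
    unfolding B'_def L'_def C'_def
    by (rule member_le_sum; use that I *(1,3,5) in simp)+
  have ge: "0 \<le> B'" "0 \<le> L'" "0 \<le> C' s" for s
    unfolding B'_def L'_def C'_def by (rule sum_nonneg, rule *(1,3,5), assumption)+
  have Pb: "norm (P r p y) \<le> B'" if "p \<in> E" "r \<in> I" for p r y
    using *(2)[OF that(2,1)] le(1)[OF that(2)] by (rule order_trans)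
  show ?thesis
  proof (intro exI[of _ B'] conjI allI impI ge)
    fix T :: real assume T: "0 \<le> T"
    have sol: "\<exists>x. \<forall>r\<in>I. x r 0 = x0 p r \<and> (\<forall>t\<in>{0..T}. (\<forall>s. wle s (x r t) ((1 + A s) * exp (C' s * t))) \<and>
      (x r has_vector_derivative gen (\<psi> p r) (x r t) + P r p (\<lambda>i. x i t)) (at t within {0..T}))" if p: "p \<in> E" for p
    proof (rule system_existence[where F = "\<lambda>t x r. P r p x", OF I T \<psi>[OF p] _ ge(2) _ _ ge(3) init[OF p]])
      show "norm (P r p x - P r p y) \<le> L' * b" if r: "r \<in> I" and b: "\<And>i. i \<in> I ==> norm (x i - y i) \<le> b" for x y r b
      proof -
        have b0: "0 \<le> b" using order_trans[OF norm_ge_zero b[OF r]] .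
        have "norm (P r p x - P r p y) \<le> L r * b" by (rule *(4)[OF r p b0 b])
        also have "\<dots> \<le> L' * b" by (intro mult_right_mono le(2)[OF r] b0)
        finally show ?thesis .
      qed
      show "continuous_on {0..T} (\<lambda>t. P r p (\<lambda>i. x i t))" if "r \<in> I" "\<And>i. i \<in> I ==> continuous_on {0..T} (x i)" for x r
        by (rule tame_continuous[OF P[OF that(1)] p I that(2)])
      show "wle s (P r p x) (C' s * (1 + V))" if V: "0 \<le> V" and r: "r \<in> I" and x: "\<And>i. i \<in> I ==> wle s (x i) V" for s V x r
      proof -
        have "wle s (P r p x) (C r s * (1 + V))" by (rule *(6)[OF r p V x])
        then show ?thesis by (rule wle_mono) (use le(3)[OF r] V in \<open>intro mult_right_mono; simp\<close>)
      qed
    qed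
    then have "\<forall>p. \<exists>x. p \<in> E \<longrightarrow> (\<forall>r\<in>I. x r 0 = x0 p r \<and> (\<forall>t\<in>{0..T}. (\<forall>s. wle s (x r t) ((1 + A s) * exp (C' s * t))) \<and>
      (x r has_vector_derivative gen (\<psi> p r) (x r t) + P r p (\<lambda>i. x i t)) (at t within {0..T})))" by simp
    from choice[OF this] obtain x where x: "\<forall>p. p \<in> E \<longrightarrow> (\<forall>r\<in>I. x p r 0 = x0 p r \<and> (\<forall>t\<in>{0..T}. (\<forall>s. wle s (x p r t) ((1 + A s) * exp (C' s * t))) \<and>
      (x p r has_vector_derivative gen (\<psi> p r) (x p r t) + P r p (\<lambda>i. x p i t)) (at t within {0..T})))" by (elim exE)
    show "\<exists>W x. \<forall>p\<in>E. \<forall>r\<in>I. (\<forall>y. norm (P r p y) \<le> B') \<and> x p r 0 = x0 p r \<and> (\<forall>t\<in>{0..T}. (\<forall>s. wle s (x p r t) (W s)) \<and>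
      (x p r has_vector_derivative gen (\<psi> p r) (x p r t) + P r p (\<lambda>i. x p i t)) (at t within {0..T}))"
    proof (intro exI[of _ "\<lambda>s. (1 + A s) * exp (C' s * T)"] exI[of _ x] ballI conjI allI)
      fix p r assume p: "p \<in> E" and r: "r \<in> I"
      show "norm (P r p y) \<le> B'" for y by (rule Pb[OF p r])
      show "x p r 0 = x0 p r" using x p r by simp
      fix t assume t: "t \<in> {0..T}"
      show "(x p r has_vector_derivative gen (\<psi> p r) (x p r t) + P r p (\<lambda>i. x p i t)) (at t within {0..T})"
        using x p r t by simp
      fix s
      have A0: "0 \<le> A s" using wle_nonneg[OF init[OF p r]] .
      have "wle s (x p r t) ((1 + A s) * exp (C' s * t))" using x p r t by simp
      then show "wle s (x p r t) ((1 + A s) * exp (C' s * T))"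
        by (rule wle_mono) (use A0 ge(3)[of s] t in \<open>intro mult_left_mono; simp add: mult_left_mono\<close>)
    qed
  qed
qed

text \<open>The equation expresses a time derivative by the state with some weights spent on the
  symbol. As all weighted bounds are available, each use of the equation gains one order in time,
  uniformly in \<open>eps\<close>.\<close>

lemma smf_bootstrap:
  fixes x :: "'i \<Rightarrow> real \<Rightarrow> real \<Rightarrow> 'd::finite wien"
  assumes rd: "\<And>r. r \<in> I ==> rd E T (x r)"
    and d: "\<And>r eps t. r \<in> I ==> eps \<in> E ==> t \<in> {0..T} ==>
      (x r eps has_vector_derivative gen (\<psi> r eps) (x r eps t) + g r eps t) (at t within {0..T})"
    and \<psi>: "\<And>r. r \<in> I ==> \<exists>c\<ge>0. \<exists>m. \<forall>eps\<in>E. \<forall>n. \<bar>\<psi> r eps n\<bar> \<le> c * wt n ^ m"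
    and g: "\<And>k r. r \<in> I ==> (\<And>i. i \<in> I ==> csm k E T (x i)) ==> csm k E T (g r)"
    and r: "r \<in> I"
  shows "smf E T (x r)"
proof -
  have "csm k E T (x r)" if "r \<in> I" for k r
    using that
  proof (induction k arbitrary: r)
    case (Suc k)
    obtain c m where c: "0 \<le> c" and m: "\<forall>eps\<in>E. \<forall>n. \<bar>\<psi> r eps n\<bar> \<le> c * wt n ^ m"
      using \<psi>[OF Suc.prems] by (elim exE conjE)
    have "csm k E T (\<lambda>eps t. gen (\<psi> r eps) (x r eps t))"
      unfolding gen_def
      by (rule csm_mulop[where r = m, OF _ c Suc.IH[OF Suc.prems]]) (use m in \<open>simp add: norm_mult\<close>)
    moreover have "csm k E T (g r)" by (rule g[OF Suc.prems Suc.IH])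
    ultimately have "csm k E T (\<lambda>eps t. gen (\<psi> r eps) (x r eps t) + g r eps t)" by (rule csm_add)
    then show ?case unfolding csm.simps using rd[OF Suc.prems] d[OF Suc.prems]
      by (intro conjI exI[of _ "\<lambda>eps t. gen (\<psi> r eps) (x r eps t) + g r eps t"]) simp_all
  qed (simp add: rd)
  then show ?thesis using r by (simp add: smf_def)
qed

subsection \<open>The advected operator on coefficients\<close>

definition sq :: "int^'d \<Rightarrow> real" where "sq n = (\<Sum>j\<in>UNIV. (of_int (n $ j))\<^sup>2)"

text \<open>With the factor \<open>i\<close> supplied by \<open>gen\<close> this is the symbol of
  \<open>- k . grad + (i eps / 2) Laplacian\<close>, the part of the advected operator that is moved
  to the right-hand side.\<close>

definition psi :: "real^'d \<Rightarrow> real \<Rightarrow> int^'d \<Rightarrow> real" where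
  "psi k eps n = - (dotp n k + eps * sq n / 2)"

lemma sq_nonneg: "0 \<le> sq n" by (simp add: sq_def sum_nonneg)

lemma sq_le: "sq (n :: int^'d) \<le> CARD('d) * wt n ^ 2"
proof -
  have "sq n \<le> of_nat (card (UNIV :: 'd set)) * wt n ^ 2"
    unfolding sq_def
  proof (rule sum_bounded_above)
    fix j :: 'd
    have "\<bar>real_of_int (n $ j)\<bar>\<^sup>2 \<le> wt n ^ 2"
      using wt_ge_component[of n j] by (intro power_mono) auto
    then show "(real_of_int (n $ j))\<^sup>2 \<le> (wt n)\<^sup>2" by simp
  qed
  then show ?thesis by simp
qed

lemma dotp_le: "\<bar>dotp n k\<bar> \<le> (\<Sum>j\<in>UNIV. \<bar>k $ j\<bar>) * wt n"
proof -
  have "\<bar>dotp n k\<bar> \<le> (\<Sum>j\<in>UNIV. \<bar>of_int (n $ j) * k $ j\<bar>)" unfolding dotp_def by (rule sum_abs)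
  also have "\<dots> \<le> (\<Sum>j\<in>UNIV. wt n * \<bar>k $ j\<bar>)"
  proof (rule sum_mono)
    fix j
    have "\<bar>real_of_int (n $ j)\<bar> \<le> wt n" using wt_ge_component[of n j] by linarith
    then show "\<bar>of_int (n $ j) * k $ j\<bar> \<le> wt n * \<bar>k $ j\<bar>" by (simp add: abs_mult mult_right_mono)
  qed
  finally show ?thesis by (simp add: sum_distrib_left mult.commute)
qed

definition psic :: "real^'d \<Rightarrow> real" where "psic k = (\<Sum>j\<in>UNIV. \<bar>k $ j\<bar>) + CARD('d)"

lemma psic_nonneg: "0 \<le> psic k" by (simp add: psic_def sum_nonneg)

text \<open>The bound is uniform in \<open>eps\<close> up to 1, as the bootstrap for families
  requires; \<open>psi_pbdd\<close> treats a single positive \<open>eps\<close>.\<close>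

lemma psi_le:
  assumes "0 \<le> eps" "eps \<le> 1"
  shows "\<bar>psi (k :: real^'d) eps n\<bar> \<le> psic k * wt n ^ 2"
proof -
  have "\<bar>psi k eps n\<bar> \<le> \<bar>dotp n k\<bar> + eps * sq n / 2"
    using assms sq_nonneg[of n] abs_triangle_ineq[of "dotp n k" "eps * sq n / 2"] by (simp add: psi_def abs_mult)
  also have "\<dots> \<le> (\<Sum>j\<in>UNIV. \<bar>k $ j\<bar>) * wt n ^ 2 + CARD('d) * wt n ^ 2"
  proof (rule add_mono)
    have "wt n \<le> wt n ^ 2" using wt_ge_1[of n] by (simp add: power2_eq_square)
    then have "(\<Sum>j\<in>UNIV. \<bar>k $ j\<bar>) * wt n \<le> (\<Sum>j\<in>UNIV. \<bar>k $ j\<bar>) * wt n ^ 2"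
      by (intro mult_left_mono) (auto intro: sum_nonneg)
    then show "\<bar>dotp n k\<bar> \<le> (\<Sum>j\<in>UNIV. \<bar>k $ j\<bar>) * wt n ^ 2" using dotp_le[of n k] by linarith
    have "eps * sq n \<le> 1 * sq n" using assms sq_nonneg[of n] by (intro mult_right_mono) auto
    then show "eps * sq n / 2 \<le> CARD('d) * wt n ^ 2" using sq_le[of n] sq_nonneg[of n] by simp
  qed
  finally show ?thesis by (simp add: psic_def distrib_right)
qed

lemma psi_pbdd: "0 < eps ==> pbdd (\<lambda>n. of_real (psi k eps n))"
proof -
  assume e: "0 < eps"
  have "\<bar>psi k eps n\<bar> \<le> ((\<Sum>j\<in>UNIV. \<bar>k $ j\<bar>) + eps * CARD('a)) * wt n ^ 2" for n
  proof -
    have "\<bar>psi k eps n\<bar> \<le> \<bar>dotp n k\<bar> + eps * sq n / 2"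
      using e sq_nonneg[of n] abs_triangle_ineq[of "dotp n k" "eps * sq n / 2"] by (simp add: psi_def abs_mult)
    moreover have "wt n \<le> wt n ^ 2" using wt_ge_1[of n] by (simp add: power2_eq_square)
    then have "(\<Sum>j\<in>UNIV. \<bar>k $ j\<bar>) * wt n \<le> (\<Sum>j\<in>UNIV. \<bar>k $ j\<bar>) * wt n ^ 2"
      by (intro mult_left_mono) (auto intro: sum_nonneg)
    moreover have "eps * sq n \<le> eps * (CARD('a) * wt n ^ 2)" using e sq_le[of n] by (intro mult_left_mono) auto
    moreover have "0 \<le> eps * sq n" using e sq_nonneg[of n] by simp
    ultimately show ?thesis using dotp_le[of n k] unfolding distrib_right by (simp add: mult.assoc)
  qed
  then show ?thesis
    by (intro pbddI[of _ "(\<Sum>j\<in>UNIV. \<bar>k $ j\<bar>) + eps * CARD('a)" 2]) (use e in \<open>auto intro!: add_nonneg_nonneg sum_nonneg\<close>)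
qed

lemma advected_syn:
  fixes x :: "real \<Rightarrow> 'd::finite wien"
  assumes x: "\<And>t. t \<in> {0..T} ==> smoothw (x t)" and T: "0 < T" and eps: "0 < eps" and t: "t \<in> {0..T}"
    and d: "(x has_vector_derivative x') (at t within {0..T})"
  shows "advected T eps k (syn x) (t, p) = synth (x' - gen (psi k eps) (x t)) p"
proof -
  note sm = x[OF t]
  have D: "smoothw (mulop (ddx j) y)" if "smoothw y" for j and y :: "'d wien"
    by (rule smoothw_mulop[OF ddx_pbdd that])
  have dxx: "dx T j (dx T j (syn x)) (t, p) = synth (mulop (ddx j) (mulop (ddx j) (x t))) p" for j
  proof -
    have "dx T j (dx T j (syn x)) (t, p) = dx T j (syn (\<lambda>t. mulop (ddx j) (x t))) (t, p)"
    proof (rule partial_cong)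
      show "dx T j (syn x) z = syn (\<lambda>t. mulop (ddx j) (x t)) z" if "z \<in> slab T" for z
        using that dx_syn(1)[of x "fst z" T j "snd z"] x[of "fst z"] by (auto simp: slab_def syn_def)
    qed (use t in \<open>simp add: slab_def\<close>)
    then show ?thesis using dx_syn(1)[of "\<lambda>t. mulop (ddx j) (x t)" t T j p] D[OF sm] t by simp
  qed
  define z where "z = x' + (\<Sum>j\<in>UNIV. cst (of_real (k $ j)) * mulop (ddx j) (x t))
     - cst (\<i> * of_real eps / 2) * (\<Sum>j\<in>UNIV. mulop (ddx j) (mulop (ddx j) (x t)))"
  have "advected T eps k (syn x) (t, p) = synth z p"
    unfolding advected_def laplace_def dt_syn(1)[OF d t T] dx_syn(1)[of x t, OF sm t] dxx z_def
    by (simp add: synth_add synth_diff synth_sum synth_mult)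
  moreover have "z = x' - gen (psi k eps) (x t)"
  proof (rule wien_eqI)
    fix n
    have "coef z n = coef x' n + (\<Sum>j\<in>UNIV. of_real (k $ j) * (ddx j n * coef (x t) n))
      - (\<i> * of_real eps / 2) * (\<Sum>j\<in>UNIV. ddx j n * (ddx j n * coef (x t) n))"
      by (simp add: z_def coef_mulop[OF ddx_pbdd] sm D)
    also have "(\<Sum>j\<in>UNIV. of_real (k $ j) * (ddx j n * coef (x t) n)) = \<i> * of_real (dotp n k) * coef (x t) n"
      by (simp add: dotp_def ddx_def sum_distrib_left sum_distrib_right mult_ac)
    also have "(\<Sum>j\<in>UNIV. ddx j n * (ddx j n * coef (x t) n)) = - of_real (sq n) * coef (x t) n"
      by (simp add: sq_def ddx_def sum_distrib_left sum_negf power2_eq_square mult_ac)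
    also have "coef x' n + \<i> * of_real (dotp n k) * coef (x t) n - (\<i> * of_real eps / 2) * (- of_real (sq n) * coef (x t) n)
      = coef (x' - gen (psi k eps) (x t)) n"
      by (simp add: coef_gen[OF psi_pbdd[OF eps] sm] psi_def algebra_simps)
    finally show "coef z n = coef (x' - gen (psi k eps) (x t)) n" .
  qed
  ultimately show ?thesis by simp
qed

lemma advected_cong:
  assumes eq: "\<And>z. z \<in> slab T ==> f z = g z" and z: "z \<in> slab T"
  shows "advected T eps k f z = advected T eps k g z"
proof -
  have 1: "partial (slab T) v f w = partial (slab T) v g w" if "w \<in> slab T" for v w
    by (rule partial_cong[OF eq that])
  have 2: "partial (slab T) v (partial (slab T) v f) z = partial (slab T) v (partial (slab T) v g) z" for v
    by (rule partial_cong[OF 1 z])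
  show ?thesis unfolding advected_def laplace_def 2 1[OF z] ..
qed

text \<open>The pointwise equation says that two elements have the same synthesis, and synthesis is
  injective.\<close>

lemma pde_to_coef:
  assumes f: "smooth_periodic T f" and T: "0 < T" and eps: "0 < eps"
    and eq: "\<And>z. z \<in> slab T ==> advected T eps k f z = synth (g (fst z)) (snd z)" and t: "t \<in> {0..T}"
  shows "(fc f has_vector_derivative gen (psi k eps) (fc f t) + g t) (at t within {0..T})"
proof -
  have smf: "smf UNIV T (\<lambda>_. fc f)" by (rule smooth_periodic_smf[OF f])
  have sm: "smoothw (fc f t)" if "t \<in> {0..T}" for t using rd_smoothw[OF smf_rd[OF smf] UNIV_I that] .
  note d = fc_has_vector_derivative[OF f t]
  have "synth (fc (dt T f) t - gen (psi k eps) (fc f t)) p = synth (g t) p" for p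
  proof -
    have z: "(t, p) \<in> slab T" using t by (simp add: slab_def)
    have "synth (fc (dt T f) t - gen (psi k eps) (fc f t)) p = advected T eps k (syn (fc f)) (t, p)"
      by (rule advected_syn[OF sm T eps t d, symmetric])
    also have "\<dots> = advected T eps k f (t, p)"
      by (rule advected_cong[OF syn_fc[OF f] z])
    finally show ?thesis using eq[OF z] by simp
  qed
  then have "fc (dt T f) t - gen (psi k eps) (fc f t) = g t" by (intro synth_inject ext)
  then have "fc (dt T f) t = gen (psi k eps) (fc f t) + g t" by (simp add: diff_eq_eq add.commute)
  then show ?thesis using d by simp
qed

lemma coef_to_pde:
  assumes x: "\<And>t. t \<in> {0..T} ==> smoothw (x t)" and T: "0 < T" and eps: "0 < eps"
    and d: "\<And>t. t \<in> {0..T} ==> (x has_vector_derivative gen (psi k eps) (x t) + g t) (at t within {0..T})"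
    and z: "z \<in> slab T"
  shows "advected T eps k (syn x) z = synth (g (fst z)) (snd z)"
proof -
  have t: "fst z \<in> {0..T}" using z by (auto simp: slab_def)
  show ?thesis using advected_syn[OF x T eps t d[OF t], of k "snd z"] by simp
qed

section \<open>The modulation system\<close>

definition cubx :: "(nat \<Rightarrow> 'd::finite wien) \<Rightarrow> triple \<Rightarrow> 'd wien" where
  "cubx x \<mu> = (case \<mu> of (i, j, k) \<Rightarrow> x i * star (x j) * x k)"

definition bx :: "(nat \<Rightarrow> real^'d) \<Rightarrow> (nat \<Rightarrow> 'd::finite wien) \<Rightarrow> triple \<Rightarrow> 'd wien" where
  "bx kp x \<nu> = cst (of_real (1 / delta kp \<nu>)) * cubx x \<nu>"

definition cubic_part where
  "cubic_part lam kp R r x = - (cst (\<i> * of_real lam) * (\<Sum>\<mu>\<in>cubic_set kp R r. cubx x \<mu>))"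

definition quintic_part where
  "quintic_part lam kp R r x =
     - (cst (2 * \<i> * of_real (lam\<^sup>2)) * (\<Sum>a\<in>quintic_set1 kp R r. bx kp x (fst a) * star (x (fst (snd a))) * x (snd (snd a))))
     - cst (\<i> * of_real (lam\<^sup>2)) * (\<Sum>a\<in>quintic_set2 kp R r. x (fst (snd a)) * star (bx kp x (fst a)) * x (snd (snd a)))"

text \<open>The quintic terms are kept apart from the cubic ones because the uniform bounds treat
  them as a small forcing.\<close>

definition nlx where
  "nlx lam kp R r eps x = cubic_part lam kp R r x + cst (of_real eps) * quintic_part lam kp R r x"

definition T3 :: "nat \<Rightarrow> triple set" where "T3 R = {1..R} \<times> {1..R} \<times> {1..R}"

lemma finite_T3: "finite (T3 R)" by (simp add: T3_def)

lemma nonres_T3: "nonres kp R \<subseteq> T3 R" and cubic_set_T3: "cubic_set kp R r \<subseteq> T3 R"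
  and quintic_set1_sub: "quintic_set1 kp R r \<subseteq> T3 R \<times> {1..R} \<times> {1..R}"
  and quintic_set2_sub: "quintic_set2 kp R r \<subseteq> T3 R \<times> {1..R} \<times> {1..R}"
  by (auto simp: nonres_def cubic_set_def T3_def quintic_set1_def quintic_set2_def)

text \<open>All the nonlinear expressions are polynomials in the amplitudes and their conjugates; the following
  closure argument is used for tameness, smoothness of families, and dependence on finitely many amplitudes.\<close>

lemma cubx_closed:
  assumes "\<mu> \<in> T3 R" "\<And>i. i \<in> {1..R} ==> Q (X i)" "\<And>f g. Q f ==> Q g ==> Q (\<lambda>a. f a * g a)" "\<And>f. Q f ==> Q (\<lambda>a. star (f a))"
  shows "Q (\<lambda>a. cubx (\<lambda>i. X i a) \<mu>)"
proof -
  obtain i j k where \<mu>: "\<mu> = (i, j, k)" "i \<in> {1..R}" "j \<in> {1..R}" "k \<in> {1..R}" using assms(1) by (auto simp: T3_def)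
  show ?thesis unfolding cubx_def \<mu>(1) prod.case
    by (rule assms(3)[OF assms(3)[OF assms(2)[OF \<mu>(2)] assms(4)[OF assms(2)[OF \<mu>(3)]]] assms(2)[OF \<mu>(4)]])
qed

lemma parts_closed:
  assumes X: "\<And>i. i \<in> {1..R} ==> Q (X i)" and mult: "\<And>f g. Q f ==> Q g ==> Q (\<lambda>a. f a * g a)"
    and star: "\<And>f. Q f ==> Q (\<lambda>a. star (f a))" and cst: "\<And>c. Q (\<lambda>a. cst c)"
    and add: "\<And>f g. Q f ==> Q g ==> Q (\<lambda>a. f a + g a)"
  shows "Q (\<lambda>a. cubic_part lam kp R r (\<lambda>i. X i a))" "Q (\<lambda>a. quintic_part lam kp R r (\<lambda>i. X i a))"
    "\<nu> \<in> T3 R ==> Q (\<lambda>a. bx kp (\<lambda>i. X i a) \<nu>)"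
proof -
  have sum: "Q (\<lambda>a. \<Sum>b\<in>S. f b a)" if "\<And>b. b \<in> S ==> Q (f b)" for S and f :: "'q \<Rightarrow> _"
    using that
  proof (induction S rule: infinite_finite_induct)
    case (insert b S)
    have "Q (\<lambda>a. f b a + (\<Sum>b\<in>S. f b a))"
      by (rule add[OF insert.prems insert.IH]) (use insert.prems in auto)
    then show ?case using insert.hyps by simp
  qed (use cst[of 0] in simp_all)
  have minus: "Q (\<lambda>a. - f a)" if "Q f" for f
    using mult[OF cst[of "-1"] that] by (simp add: cst_uminus)
  have diff: "Q (\<lambda>a. f a - g a)" if "Q f" "Q g" for f g
    using add[OF that(1) minus[OF that(2)]] by simp
  have cub: "Q (\<lambda>a. cubx (\<lambda>i. X i a) \<mu>)" if "\<mu> \<in> T3 R" for \<mu>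
    by (rule cubx_closed[where Q = Q and X = X, OF that X mult star])
  have b: "Q (\<lambda>a. bx kp (\<lambda>i. X i a) \<nu>)" if "\<nu> \<in> T3 R" for \<nu>
    unfolding bx_def by (rule mult[of "\<lambda>a. cst _" "\<lambda>a. cubx (\<lambda>i. X i a) \<nu>", OF cst cub[OF that]])
  show "\<nu> \<in> T3 R ==> Q (\<lambda>a. bx kp (\<lambda>i. X i a) \<nu>)" by (rule b)
  show "Q (\<lambda>a. cubic_part lam kp R r (\<lambda>i. X i a))"
    unfolding cubic_part_def
    by (rule minus, rule mult[OF cst], rule sum, rule cub) (use cubic_set_T3 in blast)
  have 1: "Q (\<lambda>a. bx kp (\<lambda>i. X i a) (fst b) * star (X (fst (snd b)) a) * X (snd (snd b)) a)"
    "Q (\<lambda>a. X (fst (snd b)) a * star (bx kp (\<lambda>i. X i a) (fst b)) * X (snd (snd b)) a)"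
    if "b \<in> T3 R \<times> {1..R} \<times> {1..R}" for b
  proof -
    have "fst b \<in> T3 R" "fst (snd b) \<in> {1..R}" "snd (snd b) \<in> {1..R}" using that by auto
    note B = b[OF this(1)] X[OF this(2)] X[OF this(3)]
    show "Q (\<lambda>a. bx kp (\<lambda>i. X i a) (fst b) * star (X (fst (snd b)) a) * X (snd (snd b)) a)"
      by (rule mult[OF mult[OF B(1) star[OF B(2)]] B(3)])
    show "Q (\<lambda>a. X (fst (snd b)) a * star (bx kp (\<lambda>i. X i a) (fst b)) * X (snd (snd b)) a)"
      by (rule mult[OF mult[OF B(2) star[OF B(1)]] B(3)])
  qed
  show "Q (\<lambda>a. quintic_part lam kp R r (\<lambda>i. X i a))"
    unfolding quintic_part_def
  proof (rule diff, rule minus)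
    show "Q (\<lambda>a. cst (2 * \<i> * of_real (lam\<^sup>2)) * (\<Sum>b\<in>quintic_set1 kp R r. bx kp (\<lambda>i. X i a) (fst b) * star (X (fst (snd b)) a) * X (snd (snd b)) a))"
      by (rule mult[OF cst], rule sum, rule 1(1)) (use quintic_set1_sub in blast)
    show "Q (\<lambda>a. cst (\<i> * of_real (lam\<^sup>2)) * (\<Sum>b\<in>quintic_set2 kp R r. X (fst (snd b)) a * star (bx kp (\<lambda>i. X i a) (fst b)) * X (snd (snd b)) a))"
      by (rule mult[OF cst], rule sum, rule 1(2)) (use quintic_set2_sub in blast)
  qed
qed

lemma tame_parts:
  assumes "\<And>i. i \<in> {1..R} ==> tame E I (P i)"
  shows "tame E I (\<lambda>p x. cubic_part lam kp R r (\<lambda>i. P i p x))" "tame E I (\<lambda>p x. quintic_part lam kp R r (\<lambda>i. P i p x))"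
proof -
  let ?Q = "\<lambda>f. tame E I (\<lambda>p x. f (p, x))"
  have c: "?Q (\<lambda>a. cst c)" for c by (rule tame_cst[of E "\<lambda>_. c" "norm c"]) simp
  note pc = parts_closed[where Q = ?Q and X = "\<lambda>i (p, x). P i p x", OF _ tame_mult tame_star c tame_add]
  show "tame E I (\<lambda>p x. cubic_part lam kp R r (\<lambda>i. P i p x))" using pc(1)[of R lam kp r] assms by simp
  show "tame E I (\<lambda>p x. quintic_part lam kp R r (\<lambda>i. P i p x))" using pc(2)[of R lam kp r] assms by simp
qed

lemma tame_nlx:
  assumes "\<And>i. i \<in> {1..R} ==> tame E I (P i)" "\<And>eps. eps \<in> E ==> \<bar>eps\<bar> \<le> 1"
  shows "tame E I (\<lambda>eps x. nlx lam kp R r eps (\<lambda>i. P i eps x))"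
  unfolding nlx_def
  by (rule tame_add[OF tame_parts(1) tame_mult[OF tame_cst[of _ _ 1] tame_parts(2)]]) (use assms in simp_all)

lemma csm_parts:
  assumes "\<And>i. i \<in> {1..R} ==> csm k E T (x i)"
  shows "csm k E T (\<lambda>eps t. cubic_part lam kp R r (\<lambda>i. x i eps t))" "csm k E T (\<lambda>eps t. quintic_part lam kp R r (\<lambda>i. x i eps t))"
    "\<nu> \<in> T3 R ==> csm k E T (\<lambda>eps t. bx kp (\<lambda>i. x i eps t) \<nu>)" "\<mu> \<in> T3 R ==> csm k E T (\<lambda>eps t. cubx (\<lambda>i. x i eps t) \<mu>)"
proof -
  let ?Q = "\<lambda>f. csm k E T (\<lambda>eps t. f (eps, t))"
  have c: "?Q (\<lambda>a. cst c)" for c by (rule csm_cst[of E "\<lambda>_. c" "norm c"]) simp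
  note pc = parts_closed[where Q = ?Q and X = "\<lambda>i (eps, t). x i eps t", OF _ csm_mult csm_star c csm_add]
  show "csm k E T (\<lambda>eps t. cubic_part lam kp R r (\<lambda>i. x i eps t))" using pc(1)[of R lam kp r] assms by simp
  show "csm k E T (\<lambda>eps t. quintic_part lam kp R r (\<lambda>i. x i eps t))" using pc(2)[of R lam kp r] assms by simp
  show "\<nu> \<in> T3 R ==> csm k E T (\<lambda>eps t. bx kp (\<lambda>i. x i eps t) \<nu>)" using pc(3)[of R \<nu> kp] assms by simp
  show "\<mu> \<in> T3 R ==> csm k E T (\<lambda>eps t. cubx (\<lambda>i. x i eps t) \<mu>)"
    using cubx_closed[where Q = ?Q and X = "\<lambda>i (eps, t). x i eps t", OF _ _ csm_mult csm_star, of \<mu> R] assms by simp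
qed

lemma csm_nlx:
  assumes "\<And>i. i \<in> {1..R} ==> csm k E T (x i)" "\<And>eps. eps \<in> E ==> \<bar>eps\<bar> \<le> 1"
  shows "csm k E T (\<lambda>eps t. nlx lam kp R r eps (\<lambda>i. x i eps t))"
  unfolding nlx_def
  by (rule csm_add[OF csm_parts(1) csm_mult[OF csm_cst[of _ _ 1] csm_parts(2)]]) (use assms in simp_all)

text \<open>The closure argument is applied to functions of a Boolean that selects \<open>x\<close>
  or \<open>y\<close>; the closed property is to take the same value at both.\<close>

lemma parts_cong:
  assumes "\<And>i. i \<in> {1..R} ==> x i = y i"
  shows "cubic_part lam kp R r x = cubic_part lam kp R r y" "quintic_part lam kp R r x = quintic_part lam kp R r y"
    "\<nu> \<in> T3 R ==> bx kp x \<nu> = bx kp y \<nu>"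
proof -
  let ?Q = "\<lambda>f. f True = f False"
  note pc = parts_closed[where Q = ?Q and X = "\<lambda>i b. if b then x i else y i"]
  show "cubic_part lam kp R r x = cubic_part lam kp R r y" using pc(1)[of R lam kp r] assms by simp
  show "quintic_part lam kp R r x = quintic_part lam kp R r y" using pc(2)[of R lam kp r] assms by simp
  show "\<nu> \<in> T3 R ==> bx kp x \<nu> = bx kp y \<nu>" using pc(3)[of R \<nu> kp] assms by simp
qed

lemma nlx_cong: "(\<And>i. i \<in> {1..R} ==> x i = y i) ==> nlx lam kp R r eps x = nlx lam kp R r eps y"
  unfolding nlx_def using parts_cong(1,2)[of R x y] by metis

lemma synth_cubx:
  assumes "\<And>i. i \<in> {1..R} ==> a i z = synth (y i) (snd z)" "\<mu> \<in> T3 R"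
  shows "cubic a \<mu> z = synth (cubx y \<mu>) (snd z)"
  using assms by (auto simp: T3_def cubx_def synth_mult synth_star)

lemma synth_bx:
  assumes "\<And>i. i \<in> {1..R} ==> a i z = synth (y i) (snd z)" "\<nu> \<in> T3 R"
  shows "b_mod kp a \<nu> z = synth (bx kp y \<nu>) (snd z)"
  unfolding b_mod_def bx_def synth_mult synth_cst by (subst synth_cubx[where a = a and y = y and z = z and R = R, OF assms]) simp_all

lemma synth_nlx:
  assumes a: "\<And>i. i \<in> {1..R} ==> a i z = synth (y i) (snd z)"
  shows "- \<i> * of_real lam * (\<Sum>\<mu>\<in>cubic_set kp R r. cubic a \<mu> z)
        - 2 * \<i> * of_real (eps * lam\<^sup>2) *
            (\<Sum>(\<nu>, p, q)\<in>quintic_set1 kp R r. b_mod kp a \<nu> z * cnj (a p z) * a q z)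
        - \<i> * of_real (eps * lam\<^sup>2) *
            (\<Sum>(\<nu>, p, q)\<in>quintic_set2 kp R r. a p z * cnj (b_mod kp a \<nu> z) * a q z)
     = synth (nlx lam kp R r eps y) (snd z)"
proof -
  have 1: "(\<Sum>\<mu>\<in>cubic_set kp R r. cubic a \<mu> z) = synth (\<Sum>\<mu>\<in>cubic_set kp R r. cubx y \<mu>) (snd z)"
    unfolding synth_sum by (rule sum.cong[OF refl], rule synth_cubx[where a = a and y = y and z = z and R = R, OF a]) (use cubic_set_T3 in blast)+
  have 2: "(\<Sum>(\<nu>, p, q)\<in>quintic_set1 kp R r. b_mod kp a \<nu> z * cnj (a p z) * a q z)
    = synth (\<Sum>b\<in>quintic_set1 kp R r. bx kp y (fst b) * star (y (fst (snd b))) * y (snd (snd b))) (snd z)"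
    unfolding synth_sum
  proof (rule sum.cong[OF refl])
    fix b assume "b \<in> quintic_set1 kp R r"
    then have "b \<in> T3 R \<times> {1..R} \<times> {1..R}" using quintic_set1_sub by blast
    then obtain \<nu> p q where b: "b = (\<nu>, p, q)" "\<nu> \<in> T3 R" "p \<in> {1..R}" "q \<in> {1..R}" by auto
    show "(case b of (\<nu>, p, q) \<Rightarrow> b_mod kp a \<nu> z * cnj (a p z) * a q z)
       = synth (bx kp y (fst b) * star (y (fst (snd b))) * y (snd (snd b))) (snd z)"
      using synth_bx[of R a z y \<nu> kp, OF a b(2)] a[OF b(3)] a[OF b(4)] by (simp add: b(1) synth_mult synth_star)
  qed
  have 3: "(\<Sum>(\<nu>, p, q)\<in>quintic_set2 kp R r. a p z * cnj (b_mod kp a \<nu> z) * a q z)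
    = synth (\<Sum>b\<in>quintic_set2 kp R r. y (fst (snd b)) * star (bx kp y (fst b)) * y (snd (snd b))) (snd z)"
    unfolding synth_sum
  proof (rule sum.cong[OF refl])
    fix b assume "b \<in> quintic_set2 kp R r"
    then have "b \<in> T3 R \<times> {1..R} \<times> {1..R}" using quintic_set2_sub by blast
    then obtain \<nu> p q where b: "b = (\<nu>, p, q)" "\<nu> \<in> T3 R" "p \<in> {1..R}" "q \<in> {1..R}" by auto
    show "(case b of (\<nu>, p, q) \<Rightarrow> a p z * cnj (b_mod kp a \<nu> z) * a q z)
       = synth (y (fst (snd b)) * star (bx kp y (fst b)) * y (snd (snd b))) (snd z)"
      using synth_bx[of R a z y \<nu> kp, OF a b(2)] a[OF b(3)] a[OF b(4)] by (simp add: b(1) synth_mult synth_star)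
  qed
  have um: "synth (- x) p = - synth x p" for x :: "'a wien" and p
    using synth_diff[of 0 x p] by simp
  show ?thesis unfolding 1 2 3 nlx_def cubic_part_def quintic_part_def
    by (simp add: synth_add synth_diff synth_mult um algebra_simps)
qed

lemma a_solution_to_coef:
  fixes a :: "nat \<Rightarrow> real \<times> (real^'d) \<Rightarrow> complex"
  assumes a: "a_solution lam kp M R eps T a0 a" and T: "0 < T" and eps: "0 < eps" and r: "r \<in> {1..R}"
  shows "smooth_periodic T (a r)" "synth (fc (a r) 0) = (\<lambda>p. if r \<le> M then a0 r p else 0)"
    "\<And>t. t \<in> {0..T} ==> (fc (a r) has_vector_derivative gen (psi (kp r) eps) (fc (a r) t) + nlx lam kp R r eps (\<lambda>i. fc (a i) t)) (at t within {0..T})"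
proof -
  have sp: "smooth_periodic T (a i)" if "i \<in> {1..R}" for i using a that by (simp add: a_solution_def)
  show "smooth_periodic T (a r)" by (rule sp[OF r])
  have eq: "syn (fc (a i)) z = a i z" if "i \<in> {1..R}" "z \<in> slab T" for i z by (rule syn_fc[OF sp[OF that(1)] that(2)])
  show "synth (fc (a r) 0) = (\<lambda>p. if r \<le> M then a0 r p else 0)"
  proof
    fix p :: "real^'d"
    have "(0, p) \<in> slab T" using T by (simp add: slab_def)
    then have "synth (fc (a r) 0) p = a r (0, p)" using eq[OF r, of "(0, p)"] by (simp add: syn_def)
    then show "synth (fc (a r) 0) p = (if r \<le> M then a0 r p else 0)" using a r by (simp add: a_solution_def)
  qed
  show "(fc (a r) has_vector_derivative gen (psi (kp r) eps) (fc (a r) t) + nlx lam kp R r eps (\<lambda>i. fc (a i) t)) (at t within {0..T})" if "t \<in> {0..T}" for t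
  proof (rule pde_to_coef[OF sp[OF r] T eps _ that])
    fix z :: "real \<times> (real^'d)" assume z: "z \<in> slab T"
    have "a i z = synth (fc (a i) (fst z)) (snd z)" if "i \<in> {1..R}" for i using eq[OF that z] by (simp add: syn_def)
    from synth_nlx[of R a z, OF this] show "advected T eps (kp r) (a r) z = synth (nlx lam kp R r eps (\<lambda>i. fc (a i) (fst z))) (snd z)"
      using a r z unfolding a_solution_def by simp
  qed
qed

lemma coef_to_a_solution:
  fixes y :: "nat \<Rightarrow> real \<Rightarrow> 'd::finite wien"
  assumes sm: "\<And>r. r \<in> {1..R} ==> smf {eps} T (\<lambda>_. y r)" and T: "0 < T" and eps: "0 < eps"
    and init: "\<And>r. r \<in> {1..R} ==> synth (y r 0) = (\<lambda>p. if r \<le> M then a0 r p else 0)"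
    and d: "\<And>r t. r \<in> {1..R} ==> t \<in> {0..T} ==> (y r has_vector_derivative gen (psi (kp r) eps) (y r t) + nlx lam kp R r eps (\<lambda>i. y i t)) (at t within {0..T})"
  shows "a_solution lam kp M R eps T a0 (\<lambda>r. syn (y r))"
  unfolding a_solution_def
proof (intro ballI conjI allI)
  fix r assume r: "r \<in> {1..R}"
  show "smooth_periodic T (syn (y r))" by (rule smf_smooth_periodic[OF sm[OF r] T])
  show "syn (y r) (0, x) = (if r \<le> M then a0 r x else 0)" for x using init[OF r] by (simp add: syn_def)
  fix z :: "real \<times> (real^'d)" assume z: "z \<in> slab T"
  have "smoothw (y r t)" if "t \<in> {0..T}" for t using rd_smoothw[OF smf_rd[OF sm[OF r]] _ that] by simp
  from coef_to_pde[OF this T eps d[OF r] z]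
  have 1: "advected T eps (kp r) (syn (y r)) z = synth (nlx lam kp R r eps (\<lambda>i. y i (fst z))) (snd z)" .
  show "advected T eps (kp r) (syn (y r)) z =
        - \<i> * of_real lam * (\<Sum>\<mu>\<in>cubic_set kp R r. cubic (\<lambda>r. syn (y r)) \<mu> z)
        - 2 * \<i> * of_real (eps * lam\<^sup>2) *
            (\<Sum>(\<nu>, p, q)\<in>quintic_set1 kp R r. b_mod kp (\<lambda>r. syn (y r)) \<nu> z * cnj (syn (y p) z) * syn (y q) z)
        - \<i> * of_real (eps * lam\<^sup>2) *
            (\<Sum>(\<nu>, p, q)\<in>quintic_set2 kp R r. syn (y p) z * cnj (b_mod kp (\<lambda>r. syn (y r)) \<nu> z) * syn (y q) z)"
    unfolding 1 by (rule synth_nlx[symmetric]) (simp add: syn_def)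
qed

section \<open>Uniqueness and short-time existence for the modulation system\<close>

text \<open>Both solutions are bounded on the compact interval, so both solve the system truncated
  at a common radius. That system is Lipschitz, and the energy estimate with zero data applies to
  the difference.\<close>

lemma poly_unique:
  fixes x y :: "'i \<Rightarrow> real \<Rightarrow> 'd::finite wien"
  assumes I: "finite I" and tame: "\<And>m r. 0 < m ==> r \<in> I ==> tame {()} I (\<lambda>_ u. N r (\<lambda>i. rho m (u i)))"
    and cong: "\<And>r u v. r \<in> I ==> (\<And>i. i \<in> I ==> u i = v i) ==> N r u = N r v"
    and \<psi>: "\<And>r. r \<in> I ==> pbdd (\<lambda>n. of_real (\<psi> r n))"
    and sm: "\<And>r t. r \<in> I ==> t \<in> {0..T} ==> smoothw (x r t)" "\<And>r t. r \<in> I ==> t \<in> {0..T} ==> smoothw (y r t)"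
    and d: "\<And>r t. r \<in> I ==> t \<in> {0..T} ==> (x r has_vector_derivative gen (\<psi> r) (x r t) + N r (\<lambda>i. x i t)) (at t within {0..T})"
      "\<And>r t. r \<in> I ==> t \<in> {0..T} ==> (y r has_vector_derivative gen (\<psi> r) (y r t) + N r (\<lambda>i. y i t)) (at t within {0..T})"
    and init: "\<And>r. r \<in> I ==> x r 0 = y r 0" and r: "r \<in> I" and t: "t \<in> {0..T}"
  shows "x r t = y r t"
proof -
  have "\<forall>r. \<exists>H. r \<in> I \<longrightarrow> (\<forall>t\<in>{0..T}. norm (x r t) \<le> H \<and> norm (y r t) \<le> H)"
  proof (intro allI)
    fix r
    show "\<exists>H. r \<in> I \<longrightarrow> (\<forall>t\<in>{0..T}. norm (x r t) \<le> H \<and> norm (y r t) \<le> H)"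
    proof (cases "r \<in> I")
      case True
      have "bounded (x r ` {0..T})"
        by (rule compact_imp_bounded[OF compact_continuous_image[OF has_vector_derivative_imp_continuous_on[OF d(1)[OF True]] compact_Icc]])
      then obtain H where H: "\<forall>u\<in>x r ` {0..T}. norm u \<le> H" unfolding bounded_iff by blast
      have "bounded (y r ` {0..T})"
        by (rule compact_imp_bounded[OF compact_continuous_image[OF has_vector_derivative_imp_continuous_on[OF d(2)[OF True]] compact_Icc]])
      then obtain H' where H': "\<forall>u\<in>y r ` {0..T}. norm u \<le> H'" unfolding bounded_iff by blast
      from H H' have "\<And>t. t \<in> {0..T} ==> norm (x r t) \<le> H" "\<And>t. t \<in> {0..T} ==> norm (y r t) \<le> H'" by blast+
      then show ?thesis by (intro exI[of _ "max H H'"]) (auto intro: max.coboundedI1 max.coboundedI2)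
    qed simp
  qed
  from choice[OF this] obtain H where H: "\<And>r t. r \<in> I ==> t \<in> {0..T} ==> norm (x r t) \<le> H r \<and> norm (y r t) \<le> H r" by blast
  define m where "m = (\<Sum>r\<in>I. \<bar>H r\<bar>) + 1"
  have Hm: "\<bar>H r\<bar> \<le> m" if "r \<in> I" for r
    using member_le_sum[OF that, of "\<lambda>r. \<bar>H r\<bar>"] I by (simp add: m_def)
  have m0: "0 < m" by (simp add: m_def add_nonneg_pos sum_nonneg)
  have xm: "norm (x r t) \<le> m" "norm (y r t) \<le> m" if "r \<in> I" "t \<in> {0..T}" for r t
    using H[OF that] Hm[OF that(1)] by linarith+
  have "\<forall>r. \<exists>L. r \<in> I \<longrightarrow> (\<exists>B C. tame_with {()} I (\<lambda>_ u. N r (\<lambda>i. rho m (u i))) B L C)"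
    using tame[OF m0] unfolding tame_def by blast
  from choice[OF this] obtain L where L: "\<And>r. r \<in> I ==> \<exists>B C. tame_with {()} I (\<lambda>_ u. N r (\<lambda>i. rho m (u i))) B (L r) C" by blast
  have L0: "0 \<le> L r" if "r \<in> I" for r using L[OF that] tame_withD(3) by blast
  define L' where "L' = (\<Sum>r\<in>I. L r)"
  have L': "L r \<le> L'" if "r \<in> I" for r unfolding L'_def by (rule member_le_sum) (use that I L0 in auto)
  have L'0: "0 \<le> L'" unfolding L'_def by (rule sum_nonneg) (rule L0)
  have Nrho: "N r (\<lambda>i. rho m (x i t)) = N r (\<lambda>i. x i t)" "N r (\<lambda>i. rho m (y i t)) = N r (\<lambda>i. y i t)" if "r \<in> I" "t \<in> {0..T}" for r t
    by (rule cong[OF that(1)], rule rho_id, rule xm, assumption, rule that)+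
  have "norm (x r t - y r t) \<le> 2 * (0 + 0 * T) * exp ((2 * L' + 1) * t)"
  proof (rule energy_estimate[where x = "\<lambda>r t. x r t - y r t" and g = "\<lambda>r t. N r (\<lambda>i. x i t) - N r (\<lambda>i. y i t)" and \<psi> = \<psi>, OF I \<psi> _ _ _ _ L'0 _ _ r t])
    fix r t assume rt: "r \<in> I" "t \<in> {0..T}"
    show "smoothw (x r t - y r t)" by (rule smoothw_diff[OF sm(1)[OF rt] sm(2)[OF rt]])
    have "gen (\<psi> r) (x r t - y r t) = gen (\<psi> r) (x r t) - gen (\<psi> r) (y r t)"
      unfolding gen_def by (rule mulop_diff[OF pbdd_i[OF \<psi>[OF rt(1)]] sm(1)[OF rt] sm(2)[OF rt]])
    then have e: "gen (\<psi> r) (x r t - y r t) + (N r (\<lambda>i. x i t) - N r (\<lambda>i. y i t)) =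
        (gen (\<psi> r) (x r t) + N r (\<lambda>i. x i t)) - (gen (\<psi> r) (y r t) + N r (\<lambda>i. y i t))" by simp
    show "((\<lambda>t. x r t - y r t) has_vector_derivative gen (\<psi> r) (x r t - y r t) + (N r (\<lambda>i. x i t) - N r (\<lambda>i. y i t))) (at t within {0..T})"
      unfolding e by (rule has_vector_derivative_diff[OF d(1)[OF rt] d(2)[OF rt]])
    show "norm (N r (\<lambda>i. x i t) - N r (\<lambda>i. y i t)) \<le> L' * V + 0" if V: "\<And>j. j \<in> I ==> norm (x j t - y j t) \<le> V" for V
    proof -
      have V0: "0 \<le> V" using order_trans[OF norm_ge_zero V[OF rt(1)]] .
      obtain B C where "tame_with {()} I (\<lambda>_ u. N r (\<lambda>i. rho m (u i))) B (L r) C" using L[OF rt(1)] by blast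
      from tame_withD(4)[OF this, of "()" V "\<lambda>i. x i t" "\<lambda>i. y i t"] V V0
      have "norm (N r (\<lambda>i. x i t) - N r (\<lambda>i. y i t)) \<le> L r * V" by (simp add: Nrho[OF rt])
      also have "\<dots> \<le> L' * V" by (rule mult_right_mono[OF L'[OF rt(1)] V0])
      finally show ?thesis by simp
    qed
  qed (use init in simp_all)
  then show ?thesis by simp
qed

lemma tame_nlx_rho:
  assumes "\<And>eps. eps \<in> E ==> \<bar>eps\<bar> \<le> 1" "0 < m"
  shows "tame E {1..R} (\<lambda>eps x. nlx lam kp R r eps (\<lambda>i. rho m (x i)))"
  by (rule tame_nlx[where P = "\<lambda>i eps x. rho m (x i)"]) (use assms in \<open>auto intro: tame_rho\<close>)

lemma nlx_unique:
  fixes x y :: "nat \<Rightarrow> real \<Rightarrow> 'd::finite wien"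
  assumes eps: "0 < eps" "eps \<le> 1"
    and sm: "\<And>r t. r \<in> {1..R} ==> t \<in> {0..T} ==> smoothw (x r t)" "\<And>r t. r \<in> {1..R} ==> t \<in> {0..T} ==> smoothw (y r t)"
    and d: "\<And>r t. r \<in> {1..R} ==> t \<in> {0..T} ==> (x r has_vector_derivative gen (psi (kp r) eps) (x r t) + nlx lam kp R r eps (\<lambda>i. x i t)) (at t within {0..T})"
      "\<And>r t. r \<in> {1..R} ==> t \<in> {0..T} ==> (y r has_vector_derivative gen (psi (kp r) eps) (y r t) + nlx lam kp R r eps (\<lambda>i. y i t)) (at t within {0..T})"
    and init: "\<And>r. r \<in> {1..R} ==> x r 0 = y r 0" and r: "r \<in> {1..R}" and t: "t \<in> {0..T}"
  shows "x r t = y r t"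
proof (rule poly_unique[where N = "\<lambda>r u. nlx lam kp R r eps u" and \<psi> = "\<lambda>r. psi (kp r) eps", OF _ _ _ _ sm d init r t])
  show "tame {()} {1..R} (\<lambda>_ u. nlx lam kp R r eps (\<lambda>i. rho m (u i)))" if "0 < m" for m r
    using tame_nlx_rho[of "{eps}" m R lam kp r] eps that unfolding tame_def tame_with_def by simp
  show "pbdd (\<lambda>n. of_real (psi (kp r) eps n))" for r by (rule psi_pbdd[OF eps(1)])
qed (auto intro: nlx_cong)

lemma truncated_solution:
  fixes x0 :: "real \<Rightarrow> nat \<Rightarrow> 'd::finite wien"
  assumes E: "\<And>eps. eps \<in> E ==> 0 < eps \<and> eps \<le> 1" and m: "0 < m"
    and init: "\<And>eps r s. eps \<in> E ==> r \<in> {1..R} ==> wle s (x0 eps r) (A s)"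
  shows "\<exists>B\<ge>0. \<forall>T\<ge>0. \<exists>W x. \<forall>eps\<in>E. \<forall>r\<in>{1..R}. (\<forall>y. norm (nlx lam kp R r eps (\<lambda>i. rho m (y i))) \<le> B) \<and> x eps r 0 = x0 eps r \<and>
     (\<forall>t\<in>{0..T}. (\<forall>s. wle s (x eps r t) (W s)) \<and>
      (x eps r has_vector_derivative gen (psi (kp r) eps) (x eps r t) + nlx lam kp R r eps (\<lambda>i. rho m (x eps i t))) (at t within {0..T}))"
proof (rule tame_system[where P = "\<lambda>r eps x. nlx lam kp R r eps (\<lambda>i. rho m (x i))" and \<psi> = "\<lambda>eps r. psi (kp r) eps"])
  show "tame E {1..R} (\<lambda>eps x. nlx lam kp R r eps (\<lambda>i. rho m (x i)))" for r
    by (rule tame_nlx_rho[OF _ m]) (use E in fastforce)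
  show "pbdd (\<lambda>n. of_real (psi (kp r) eps n))" if "eps \<in> E" for eps r using psi_pbdd E[OF that] by blast
qed (use init in auto)

lemma solution_smf:
  assumes E: "\<And>eps. eps \<in> E ==> 0 < eps \<and> eps \<le> 1"
    and W: "\<And>eps r s t. eps \<in> E ==> r \<in> {1..R} ==> t \<in> {0..T} ==> wle s (x eps r t) (W s)"
    and d: "\<And>eps r t. eps \<in> E ==> r \<in> {1..R} ==> t \<in> {0..T} ==>
      (x eps r has_vector_derivative gen (psi (kp r) eps) (x eps r t) + nlx lam kp R r eps (\<lambda>i. x eps i t)) (at t within {0..T})"
    and r: "r \<in> {1..R}"
  shows "smf E T (\<lambda>eps. x eps r)"
proof (rule smf_bootstrap[where I = "{1..R}" and x = "\<lambda>r eps. x eps r" and g = "\<lambda>r eps t. nlx lam kp R r eps (\<lambda>i. x eps i t)" and \<psi> = "\<lambda>r eps. psi (kp r) eps", OF _ d _ _ r])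
  show "rd E T (\<lambda>eps. x eps r)" if "r \<in> {1..R}" for r
    by (rule rdI) (use W[OF _ that] in blast)
  show "\<exists>c\<ge>0. \<exists>m. \<forall>eps\<in>E. \<forall>n. \<bar>psi (kp r) eps n\<bar> \<le> c * wt n ^ m" for r
    by (rule exI[of _ "psic (kp r)"], intro conjI psic_nonneg exI[of _ 2] ballI allI psi_le) (use E in fastforce)+
  show "csm k E T (\<lambda>eps t. nlx lam kp R r eps (\<lambda>i. x eps i t))" if "\<And>i. i \<in> {1..R} ==> csm k E T (\<lambda>eps. x eps i)" for k r
    by (rule csm_nlx[where x = "\<lambda>i eps. x eps i", OF that]) (use E in fastforce)+
qed

text \<open>Within a short time the solution does not leave the region where the nonlinearity is untruncated.\<close>

lemma local_existence:
  fixes x0 :: "real \<Rightarrow> nat \<Rightarrow> 'd::finite wien"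
  assumes E: "\<And>eps. eps \<in> E ==> 0 < eps \<and> eps \<le> 1"
    and init: "\<And>eps r s. eps \<in> E ==> r \<in> {1..R} ==> wle s (x0 eps r) (A s)" and A: "0 \<le> A 0"
  shows "\<exists>T>0. \<exists>m x. \<forall>eps\<in>E. \<forall>r\<in>{1..R}. smf {eps} T (\<lambda>_. x eps r) \<and> x eps r 0 = x0 eps r \<and>
     (\<forall>t\<in>{0..T}. norm (x eps r t) \<le> m \<and>
      (x eps r has_vector_derivative gen (psi (kp r) eps) (x eps r t) + nlx lam kp R r eps (\<lambda>i. x eps i t)) (at t within {0..T}))"
proof -
  \<comment> \<open>The energy estimate gives at most \<open>2 * (A 0 + B * T) * exp t\<close>. With
    \<open>B * T\<close> and \<open>T\<close> at most 1 and \<open>exp 1\<close> at most 3 this is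
    at most \<open>m\<close>. The bound \<open>B\<close> depends on \<open>m\<close> but not on
    \<open>T\<close>, so \<open>T\<close> may be chosen last.\<close>
  define m where "m = 6 * (A 0 + 1)"
  have m: "0 < m" using A by (simp add: m_def)
  obtain B where B: "0 \<le> B" "\<forall>T\<ge>0. \<exists>W x. \<forall>eps\<in>E. \<forall>r\<in>{1..R}. (\<forall>y. norm (nlx lam kp R r eps (\<lambda>i. rho m (y i))) \<le> B) \<and> x eps r 0 = x0 eps r \<and>
     (\<forall>t\<in>{0..T}. (\<forall>s. wle s (x eps r t) (W s)) \<and>
      (x eps r has_vector_derivative gen (psi (kp r) eps) (x eps r t) + nlx lam kp R r eps (\<lambda>i. rho m (x eps i t))) (at t within {0..T}))"
    using truncated_solution[of E m R x0 A lam kp, OF E m init] by blast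
  define T where "T = 1 / (B + 1)"
  have T: "0 < T" "T \<le> 1" "B * T \<le> 1" using B by (simp_all add: T_def)
  from B(2)[rule_format, OF less_imp_le[OF T(1)]] obtain W x where Wx0: "\<forall>eps\<in>E. \<forall>r\<in>{1..R}. (\<forall>y. norm (nlx lam kp R r eps (\<lambda>i. rho m (y i))) \<le> B) \<and> x eps r 0 = x0 eps r \<and>
     (\<forall>t\<in>{0..T}. (\<forall>s. wle s (x eps r t) (W s)) \<and>
      (x eps r has_vector_derivative gen (psi (kp r) eps) (x eps r t) + nlx lam kp R r eps (\<lambda>i. rho m (x eps i t))) (at t within {0..T}))"
    by (elim exE)
  note Wx = Wx0[THEN bspec, THEN bspec]
  have xm: "norm (x eps r t) \<le> m" if eps: "eps \<in> E" and r: "r \<in> {1..R}" and t: "t \<in> {0..T}" for eps r t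
  proof -
    have "norm (x eps r t) \<le> 2 * (A 0 + B * T) * exp ((2 * 0 + 1) * t)"
    proof (rule energy_estimate[where I = "{r}" and x = "\<lambda>r t. x eps r t" and \<psi> = "\<lambda>r. psi (kp r) eps" and g = "\<lambda>r t. nlx lam kp R r eps (\<lambda>i. rho m (x eps i t))", OF _ _ _ _ _ _ _ B(1) A _ t])
      show "smoothw (x eps i t)" if "i \<in> {r}" "t \<in> {0..T}" for i t
        by (rule wle_imp_smoothw[of _ W]) (use Wx[OF eps r] that in simp)
      show "norm (x eps i 0) \<le> A 0" if "i \<in> {r}" for i
        using wle_norm[OF init[OF eps r, of 0]] Wx[OF eps r] that by simp
    qed (use Wx[OF eps r] psi_pbdd E[OF eps] in auto)
    also have "\<dots> \<le> 2 * (A 0 + 1) * exp 1"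
      using T t A B by (intro mult_mono) auto
    also have "\<dots> \<le> 2 * (A 0 + 1) * 3" using exp_le A by (intro mult_left_mono) auto
    finally show ?thesis by (simp add: m_def)
  qed
  have d: "(x eps r has_vector_derivative gen (psi (kp r) eps) (x eps r t) + nlx lam kp R r eps (\<lambda>i. x eps i t)) (at t within {0..T})"
    if "eps \<in> E" "r \<in> {1..R}" "t \<in> {0..T}" for eps r t
  proof -
    have "nlx lam kp R r eps (\<lambda>i. rho m (x eps i t)) = nlx lam kp R r eps (\<lambda>i. x eps i t)"
      by (rule nlx_cong, rule rho_id, rule xm[OF that(1) _ that(3)])
    then show ?thesis using Wx[OF that(1,2)] that(3) by metis
  qed
  have "smf E T (\<lambda>eps. x eps r)" if "r \<in> {1..R}" for r
  proof (rule solution_smf[where W = W, OF E _ d that])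
    show "wle s (x eps r t) (W s)" if "eps \<in> E" "r \<in> {1..R}" "t \<in> {0..T}" for eps r s t
      using Wx[OF that(1,2)] that(3) by blast
  qed
  then have "smf {eps} T (\<lambda>_. x eps r)" if "r \<in> {1..R}" "eps \<in> E" for r eps
    using smf_subset[of E T "\<lambda>eps. x eps r" "{eps}"] smf_cong[of "{eps}" T "\<lambda>eps. x eps r" "\<lambda>_. x eps r"] that by simp
  then show ?thesis using T(1) xm d Wx by (intro exI[of _ T] conjI exI[of _ m] exI[of _ x]) simp_all
qed

section \<open>Uniform bounds on the existence interval\<close>

definition dk :: "'d \<Rightarrow> nat \<Rightarrow> 'd::finite wien \<Rightarrow> 'd wien" where
  "dk j k = mulop (\<lambda>n. ddx j n ^ k)"

lemma ddx_power_bound: "norm (ddx j n ^ k) \<le> 1 * wt n ^ k"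
  using power_mono[OF ddx_bound norm_ge_zero, of j n k] by (simp add: norm_power)

lemma ddx_power_pbdd: "pbdd (\<lambda>n. ddx j n ^ k)"
  using pbddI[of "\<lambda>n. ddx j n ^ k" 1 k] ddx_power_bound by auto

lemma coef_dk: "smoothw x ==> coef (dk j k x) n = ddx j n ^ k * coef x n"
  unfolding dk_def by (rule coef_mulop[OF ddx_power_pbdd])

lemma smoothw_dk: "smoothw x ==> smoothw (dk j k x)"
  unfolding dk_def by (rule smoothw_mulop[OF ddx_power_pbdd])

lemma wle_dk: "wle (s + k) x B ==> wle s (dk j k x) B"
  unfolding dk_def using wle_mulop[of "\<lambda>n. ddx j n ^ k" 1 k s x B] ddx_power_bound by auto

lemma norm_dk_le: "wle k x B ==> norm (dk j k x) \<le> B"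
  using wle_dk[of 0 k x B j] by (simp add: wle_0_iff)

lemma dk_0 [simp]: "smoothw x ==> dk j 0 x = x"
  by (rule wien_eqI) (simp add: coef_dk)

lemma dk_add: "smoothw x ==> smoothw y ==> dk j k (x + y) = dk j k x + dk j k y"
  unfolding dk_def by (rule mulop_add[OF ddx_power_pbdd])

lemma smoothw_cst: "smoothw (cst c)"
  unfolding cst_def by (rule smoothw_single)

lemma dk_cst_mult: "smoothw x ==> dk j k (cst c * x) = cst c * dk j k x"
  by (rule wien_eqI) (simp add: coef_dk smoothw_mult smoothw_cst)

lemma smoothw_sum: "(\<And>a. a \<in> A ==> smoothw (f a)) ==> smoothw (\<Sum>a\<in>A. f a)"
  by (induction A rule: infinite_finite_induct) (simp_all add: smoothw_add)

lemma dk_sum: "(\<And>a. a \<in> A ==> smoothw (f a)) ==> dk j k (\<Sum>a\<in>A. f a) = (\<Sum>a\<in>A. dk j k (f a))"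
proof (induction A rule: infinite_finite_induct)
  case (insert a A)
  then show ?case by (simp add: dk_add smoothw_sum)
qed (auto intro!: wien_eqI simp: coef_dk)

lemma dk_Suc: "smoothw x ==> dk j (Suc k) x = dk j 1 (dk j k x)"
  by (rule wien_eqI) (simp add: coef_dk smoothw_dk)

lemma dk_star: "smoothw x ==> dk j k (star x) = star (dk j k x)"
  by (rule wien_eqI) (simp add: coef_dk coef_star smoothw_star smoothw_dk ddx_def)

lemma phase_shift_mult:
  "phase (\<lambda>n. of_int (n $ j)) h (x * y) = phase (\<lambda>n. of_int (n $ j)) h x * phase (\<lambda>n. of_int (n $ j)) h y"
  by (rule synth_inject, rule ext) (simp add: synth_mult synth_phase_shift[symmetric])

lemma dk_1_eq: "dk j 1 = mulop (\<lambda>n. \<i> * of_real (of_int (n $ j)))"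
  by (simp add: dk_def ddx_def[abs_def])

text \<open>Translations are multiplicative, and the first derivative is the derivative of the
  translates at shift zero; hence it obeys the product rule.\<close>

lemma dk_1_mult:
  assumes x: "smoothw x" and y: "smoothw y"
  shows "dk j 1 (x * y) = dk j 1 x * y + x * dk j 1 y"
proof -
  let ?P = "phase (\<lambda>n. of_int (n $ j))"
  note P = phase_has_vector_derivative_0[OF pbdd_component, of _ j UNIV, folded dk_1_eq]
  have 1: "((\<lambda>h. ?P h (x * y)) has_vector_derivative dk j 1 (x * y)) (at 0)"
    by (rule P[OF smoothw_mult[OF x y]])
  have "((\<lambda>h. ?P h x * ?P h y) has_vector_derivative ?P 0 x * dk j 1 y + dk j 1 x * ?P 0 y) (at 0)"
    by (rule has_vector_derivative_mult[OF P[OF x] P[OF y]])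
  then have 2: "((\<lambda>h. ?P h (x * y)) has_vector_derivative dk j 1 x * y + x * dk j 1 y) (at 0)"
    by (simp add: phase_shift_mult add.commute)
  show ?thesis by (rule vector_derivative_unique_at[OF 1 2])
qed

text \<open>The Leibniz rule, summed over the sets of derivatives that fall on the first factor
  instead of with binomial coefficients. An additional derivative falls on either factor, in
  accordance with the splitting of the larger power set.\<close>

lemma dk_mult:
  assumes x: "smoothw x" and y: "smoothw y"
  shows "dk j k (x * y) = (\<Sum>S\<in>Pow {..<k}. dk j (card S) x * dk j (k - card S) y)"
proof (induction k)
  case 0
  then show ?case by (simp add: x y smoothw_mult)
next
  case (Suc k)
  have sm: "smoothw (dk j a x * dk j b y)" for a b by (intro smoothw_mult smoothw_dk x y)
  have fin: "finite S" if "S \<in> Pow {..<k}" for S using that finite_subset by blast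
  have card: "card S \<le> k" if "S \<in> Pow {..<k}" for S using that card_mono[of "{..<k}" S] by simp
  have "dk j (Suc k) (x * y) = dk j 1 (\<Sum>S\<in>Pow {..<k}. dk j (card S) x * dk j (k - card S) y)"
    by (simp add: dk_Suc smoothw_mult x y Suc del: One_nat_def)
  also have "\<dots> = (\<Sum>S\<in>Pow {..<k}. dk j 1 (dk j (card S) x * dk j (k - card S) y))"
    by (rule dk_sum[OF sm])
  also have "\<dots> = (\<Sum>S\<in>Pow {..<k}. dk j (card (insert k S)) x * dk j (Suc k - card (insert k S)) y + dk j (card S) x * dk j (Suc k - card S) y)"
  proof (rule sum.cong[OF refl])
    fix S assume S: "S \<in> Pow {..<k}"
    then have "k \<notin> S" by auto
    then have c: "card (insert k S) = Suc (card S)" using fin[OF S] by simp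
    have "dk j 1 (dk j (card S) x * dk j (k - card S) y) = dk j 1 (dk j (card S) x) * dk j (k - card S) y + dk j (card S) x * dk j 1 (dk j (k - card S) y)"
      by (intro dk_1_mult smoothw_dk x y)
    then show "dk j 1 (dk j (card S) x * dk j (k - card S) y) =
      dk j (card (insert k S)) x * dk j (Suc k - card (insert k S)) y + dk j (card S) x * dk j (Suc k - card S) y"
      unfolding c using card[OF S] by (simp add: dk_Suc[symmetric] x y Suc_diff_le del: One_nat_def)
  qed
  also have "\<dots> = (\<Sum>S\<in>insert k ` Pow {..<k}. dk j (card S) x * dk j (Suc k - card S) y) + (\<Sum>S\<in>Pow {..<k}. dk j (card S) x * dk j (Suc k - card S) y)"
  proof -
    have "inj_on (insert k) (Pow {..<k})" by (rule inj_onI) (metis PowD insert_ident lessThan_iff less_irrefl subsetD)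
    then show ?thesis by (subst sum.reindex) (simp_all add: sum.distrib)
  qed
  also have "\<dots> = (\<Sum>S\<in>Pow {..<Suc k}. dk j (card S) x * dk j (Suc k - card S) y)"
  proof -
    have "Pow {..<Suc k} = insert k ` Pow {..<k} \<union> Pow {..<k}" by (simp add: lessThan_Suc Pow_insert Un_commute)
    moreover have "insert k ` Pow {..<k} \<inter> Pow {..<k} = {}" by auto
    ultimately show ?thesis by (simp add: sum.union_disjoint)
  qed
  finally show ?case .
qed

lemma synth_dk_mult_low:
  assumes x: "smoothw x" and y: "smoothw y"
    and Q: "\<And>i p. i \<le> k ==> norm (synth (dk j i x) p) \<le> Qx" "\<And>i p. i \<le> k ==> norm (synth (dk j i y) p) \<le> Qy"
  shows "norm (synth (dk j k (x * y)) p) \<le> 2 ^ k * (Qx * Qy)"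
proof -
  have "norm (synth (dk j k (x * y)) p) \<le> (\<Sum>S\<in>Pow {..<k}. norm (synth (dk j (card S) x * dk j (k - card S) y) p))"
    unfolding dk_mult[OF x y] synth_sum by (rule norm_sum)
  also have "\<dots> \<le> of_nat (card (Pow {..<k})) * (Qx * Qy)"
  proof (rule sum_bounded_above)
    fix S assume "S \<in> Pow {..<k}"
    then have "card S \<le> k" using card_mono[of "{..<k}" S] by simp
    then show "norm (synth (dk j (card S) x * dk j (k - card S) y) p) \<le> Qx * Qy"
      unfolding synth_mult norm_mult
      by (intro mult_mono Q order_trans[OF norm_ge_zero Q(1)[of 0 p]]) auto
  qed
  finally show ?thesis by (simp add: card_Pow)
qed

text \<open>Only the empty and the full set put all \<open>k\<close> derivatives on one factor, so
  the top order bounds enter linearly and with lower order coefficients. This linearity keeps the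
  bound for order \<open>k\<close> from blowing up.\<close>

lemma synth_dk_mult_top:
  assumes x: "smoothw x" and y: "smoothw y" and k: "0 < k"
    and Q: "\<And>i p. i < k ==> norm (synth (dk j i x) p) \<le> Qx" "\<And>i p. i < k ==> norm (synth (dk j i y) p) \<le> Qy"
    and V: "\<And>p. norm (synth (dk j k x) p) \<le> Vx" "\<And>p. norm (synth (dk j k y) p) \<le> Vy"
  shows "norm (synth (dk j k (x * y)) p) \<le> Qx * Vy + Vx * Qy + 2 ^ k * (Qx * Qy)"
proof -
  have Q0: "0 \<le> Qx" "0 \<le> Qy" using order_trans[OF norm_ge_zero Q(1)[OF k]] order_trans[OF norm_ge_zero Q(2)[OF k]] by auto
  have V0: "0 \<le> Vx" "0 \<le> Vy" using order_trans[OF norm_ge_zero V(1)] order_trans[OF norm_ge_zero V(2)] by auto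
  let ?t = "\<lambda>S :: nat set. norm (synth (dk j (card S) x * dk j (k - card S) y) p)"
  let ?P = "Pow {..<k} - {{}} - {{..<k}}"
  have fin: "finite (Pow {..<k})" by simp
  have "norm (synth (dk j k (x * y)) p) \<le> (\<Sum>S\<in>Pow {..<k}. ?t S)"
    unfolding dk_mult[OF x y] synth_sum by (rule norm_sum)
  also have "\<dots> = ?t {} + (?t {..<k} + (\<Sum>S\<in>?P. ?t S))"
  proof -
    have "(\<Sum>S\<in>Pow {..<k}. ?t S) = ?t {} + (\<Sum>S\<in>Pow {..<k} - {{}}. ?t S)"
      by (rule sum.remove) auto
    also have "(\<Sum>S\<in>Pow {..<k} - {{}}. ?t S) = ?t {..<k} + (\<Sum>S\<in>?P. ?t S)"
      by (rule sum.remove) (use k in auto)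
    finally show ?thesis .
  qed
  also have "?t {} \<le> Qx * Vy"
    using Q(1)[OF k, of p] V(2)[of p] Q0 V0 by (simp add: x synth_mult norm_mult mult_mono)
  also have "?t {..<k} \<le> Vx * Qy"
    using Q(2)[OF k, of p] V(1)[of p] Q0 V0 by (simp add: y synth_mult norm_mult mult_mono)
  also have "(\<Sum>S\<in>?P. ?t S) \<le> of_nat (card ?P) * (Qx * Qy)"
  proof (rule sum_bounded_above)
    fix S assume S: "S \<in> ?P"
    then have "S \<subset> {..<k}" "S \<noteq> {}" by auto
    then have "card S < k" "card S \<noteq> 0" using psubset_card_mono[of "{..<k}" S] finite_subset[of S "{..<k}"] by auto
    then show "?t S \<le> Qx * Qy"
      unfolding synth_mult norm_mult by (intro mult_mono Q Q0) auto
  qed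
  also have "of_nat (card ?P) * (Qx * Qy) \<le> 2 ^ k * (Qx * Qy)"
  proof (rule mult_right_mono)
    have "card ?P \<le> card (Pow {..<k})" by (intro card_mono) auto
    then have "real (card ?P) \<le> real (2 ^ k)" unfolding card_Pow[OF finite_lessThan] card_lessThan by (rule of_nat_mono)
    then show "real (card ?P) \<le> 2 ^ k" by simp
  qed (use Q0 in simp)
  finally show ?thesis by simp
qed

lemma synth_phase_dotp: "synth (phase (\<lambda>n. dotp n v) t x) p = synth x (p + t *\<^sub>R v)"
  by (simp add: synth_def dotp_add_right dotp_scaleR_right cis_mult[symmetric] mult_ac)

lemma synth_dk_cubx:
  assumes sm: "\<And>i. i \<in> {1..R} ==> smoothw (x i)" and k: "0 < k" and \<mu>: "\<mu> \<in> T3 R"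
    and Q: "\<And>r i p. r \<in> {1..R} ==> i < k ==> norm (synth (dk j i (x r)) p) \<le> Q"
    and V: "\<And>r p. r \<in> {1..R} ==> norm (synth (dk j k (x r)) p) \<le> V"
  shows "norm (synth (dk j k (cubx x \<mu>)) p) \<le> (2 ^ k * Q\<^sup>2 + 2 * Q\<^sup>2) * V + (2 ^ k * Q ^ 3 + 4 ^ k * Q ^ 3)"
proof -
  obtain a b c where \<mu>': "\<mu> = (a, b, c)" and abc: "a \<in> {1..R}" "b \<in> {1..R}" "c \<in> {1..R}" using \<mu> by (auto simp: T3_def)
  have Q0: "0 \<le> Q" using order_trans[OF norm_ge_zero Q[OF abc(1) k]] .
  have s: "smoothw (x a)" "smoothw (star (x b))" "smoothw (x c)" using sm abc smoothw_star by auto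
  have sQ: "norm (synth (dk j i (star (x b))) p) \<le> Q" if "i < k" for i p
    using Q[OF abc(2) that, of p] by (simp add: dk_star sm[OF abc(2)] synth_star)
  have sV: "norm (synth (dk j k (star (x b))) p) \<le> V" for p
    using V[OF abc(2), of p] by (simp add: dk_star sm[OF abc(2)] synth_star)
  have low: "norm (synth (dk j i (x a * star (x b))) p) \<le> 2 ^ k * (Q * Q)" if "i < k" for i p
  proof -
    have "norm (synth (dk j i (x a * star (x b))) p) \<le> 2 ^ i * (Q * Q)"
      by (rule synth_dk_mult_low[OF s(1,2)]) (use Q[OF abc(1)] sQ that in auto)
    also have "\<dots> \<le> 2 ^ k * (Q * Q)" using that Q0 by (intro mult_right_mono power_increasing) auto
    finally show ?thesis .
  qed
  have top: "norm (synth (dk j k (x a * star (x b))) p) \<le> Q * V + V * Q + 2 ^ k * (Q * Q)" for p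
    by (rule synth_dk_mult_top[OF s(1,2) k Q[OF abc(1)] sQ V[OF abc(1)] sV])
  have "norm (synth (dk j k (x a * star (x b) * x c)) p) \<le> (2 ^ k * (Q * Q)) * V + (Q * V + V * Q + 2 ^ k * (Q * Q)) * Q + 2 ^ k * ((2 ^ k * (Q * Q)) * Q)"
    by (rule synth_dk_mult_top[OF smoothw_mult[OF s(1,2)] s(3) k low Q[OF abc(3)] top V[OF abc(3)]])
  also have "\<dots> = (2 ^ k * Q\<^sup>2 + 2 * Q\<^sup>2) * V + (2 ^ k * Q ^ 3 + (2 ^ k * 2 ^ k) * Q ^ 3)"
    by (simp add: algebra_simps power2_eq_square power3_eq_cube)
  also have "(2::real) ^ k * 2 ^ k = 4 ^ k" by (simp add: power_mult_distrib[symmetric])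
  finally show ?thesis by (simp add: \<mu>' cubx_def)
qed

text \<open>Bounds for the differentiated cubic terms when \<open>Q\<close> bounds the derivatives
  of order below \<open>k\<close>: \<open>c1\<close> is the factor of the top order bound and
  \<open>c2\<close> the contribution of the lower orders.\<close>

definition c1 where "c1 lam R k Q = \<bar>lam\<bar> * (real (card (T3 R)) * (2 ^ k * Q\<^sup>2 + 2 * Q\<^sup>2))"
definition c2 where "c2 lam R k Q = \<bar>lam\<bar> * (real (card (T3 R)) * (2 ^ k * Q ^ 3 + 4 ^ k * Q ^ 3))"

lemma smoothw_cubx: "(\<And>i. i \<in> {1..R} ==> smoothw (x i)) ==> \<mu> \<in> T3 R ==> smoothw (cubx x \<mu>)"
  by (auto simp: T3_def cubx_def intro!: smoothw_mult smoothw_star)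

lemma smoothw_cubic_part: "(\<And>i. i \<in> {1..R} ==> smoothw (x i)) ==> smoothw (cubic_part lam kp R r x)"
proof -
  assume sm: "\<And>i. i \<in> {1..R} ==> smoothw (x i)"
  have "smoothw (\<Sum>\<mu>\<in>cubic_set kp R r. cubx x \<mu>)"
    by (rule smoothw_sum, rule smoothw_cubx[OF sm]) (use cubic_set_T3 in blast)+
  then have "smoothw (0 - cst (\<i> * of_real lam) * (\<Sum>\<mu>\<in>cubic_set kp R r. cubx x \<mu>))"
    by (intro smoothw_diff smoothw_mult smoothw_cst smoothw_0)
  then show ?thesis by (simp add: cubic_part_def)
qed

lemma synth_dk_cubic_part:
  assumes sm: "\<And>i. i \<in> {1..R} ==> smoothw (x i)" and k: "0 < k" and r: "r \<in> {1..R}"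
    and Q: "\<And>r i p. r \<in> {1..R} ==> i < k ==> norm (synth (dk j i (x r)) p) \<le> Q"
    and V: "\<And>r p. r \<in> {1..R} ==> norm (synth (dk j k (x r)) p) \<le> V"
  shows "norm (synth (dk j k (cubic_part lam kp R r x)) p) \<le> c1 lam R k Q * V + c2 lam R k Q"
proof -
  have Q0: "0 \<le> Q" using order_trans[OF norm_ge_zero Q[OF r k]] .
  have V0: "0 \<le> V" using order_trans[OF norm_ge_zero V[OF r]] .
  have smc: "smoothw (cubx x \<mu>)" if "\<mu> \<in> cubic_set kp R r" for \<mu>
    by (rule smoothw_cubx[OF sm]) (use that cubic_set_T3 in blast)+
  let ?b = "(2 ^ k * Q\<^sup>2 + 2 * Q\<^sup>2) * V + (2 ^ k * Q ^ 3 + 4 ^ k * Q ^ 3)"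
  have b0: "0 \<le> ?b" using Q0 V0 by simp
  have eq: "cubic_part lam kp R r x = cst (- (\<i> * of_real lam)) * (\<Sum>\<mu>\<in>cubic_set kp R r. cubx x \<mu>)"
    by (simp add: cubic_part_def cst_uminus)
  have "norm (synth (dk j k (cubic_part lam kp R r x)) p) = \<bar>lam\<bar> * norm (\<Sum>\<mu>\<in>cubic_set kp R r. synth (dk j k (cubx x \<mu>)) p)"
    unfolding eq by (simp add: dk_cst_mult smoothw_sum smc dk_sum synth_mult synth_sum norm_mult)
  also have "norm (\<Sum>\<mu>\<in>cubic_set kp R r. synth (dk j k (cubx x \<mu>)) p) \<le> (\<Sum>\<mu>\<in>cubic_set kp R r. norm (synth (dk j k (cubx x \<mu>)) p))"
    by (rule norm_sum)
  also have "\<dots> \<le> of_nat (card (cubic_set kp R r)) * ?b"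
    by (rule sum_bounded_above, rule synth_dk_cubx[OF sm k _ Q V]) (use cubic_set_T3 in blast)+
  also have "\<dots> \<le> of_nat (card (T3 R)) * ?b"
    by (intro mult_right_mono b0 of_nat_mono card_mono finite_T3 cubic_set_T3)
  finally have "norm (synth (dk j k (cubic_part lam kp R r x)) p) \<le> \<bar>lam\<bar> * (of_nat (card (T3 R)) * ?b)"
    by (simp add: mult_left_mono)
  also have "\<dots> = c1 lam R k Q * V + c2 lam R k Q" by (simp add: c1_def c2_def algebra_simps)
  finally show ?thesis .
qed

lemma rd_dk: "rd E T x ==> rd E T (\<lambda>eps t. dk j k (x eps t))"
  unfolding dk_def by (rule rd_mulop[where c = 1 and r = k]) (use ddx_power_bound in auto)

lemma dotp_pbdd: "pbdd (\<lambda>n. of_real (dotp n k))"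
  by (rule pbddI[of _ "\<Sum>j\<in>UNIV. \<bar>k $ j\<bar>" 1]) (use dotp_le in \<open>auto intro: sum_nonneg\<close>)

text \<open>Along the characteristics the transport term disappears; the top order derivative enters the
  differentiated cubic term only linearly, with a coefficient controlled by lower orders.\<close>

lemma characteristic_bound:
  fixes z e :: "nat \<Rightarrow> real \<Rightarrow> 'd::finite wien"
  assumes T: "0 < T" and sm: "\<And>r. r \<in> {1..R} ==> smf {eps} T (\<lambda>_. z r)"
    and e: "\<And>r t. r \<in> {1..R} ==> t \<in> {0..T} ==> smoothw (e r t)"
    and d: "\<And>r t. r \<in> {1..R} ==> t \<in> {0..T} ==> (z r has_vector_derivative
      gen (\<lambda>n. - dotp n (kp r)) (z r t) + (cubic_part lam kp R r (\<lambda>i. z i t) + e r t)) (at t within {0..T})"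
    and k: "0 < k"
    and Q: "\<And>r t i p. r \<in> {1..R} ==> t \<in> {0..T} ==> i < k ==> norm (synth (dk j i (z r t)) p) \<le> Q"
    and e1: "\<And>r t. r \<in> {1..R} ==> t \<in> {0..T} ==> norm (dk j k (e r t)) \<le> 1"
    and init: "\<And>r. r \<in> {1..R} ==> norm (dk j k (z r 0)) \<le> A" and A: "0 \<le> A"
    and r: "r \<in> {1..R}" and t: "t \<in> {0..T}"
  shows "norm (synth (dk j k (z r t)) p) \<le> 2 * (A + (c2 lam R k Q + 1) * T) * exp ((2 * c1 lam R k Q + 1) * t)"
proof -
  \<comment> \<open>For every index \<open>r\<close> and starting point \<open>p\<close>, the
    derivative is followed along the characteristic with velocity \<open>kp r\<close>. The family is
    infinite, which the Gronwall lemma permits.\<close>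
  let ?y = "\<lambda>(r, p) t. synth (phase (\<lambda>n. dotp n (kp r)) t (dk j k (z r t))) p"
  let ?G = "\<lambda>r t. cubic_part lam kp R r (\<lambda>i. z i t) + e r t"
  let ?y' = "\<lambda>(r, p) t. synth (phase (\<lambda>n. dotp n (kp r)) t (dk j k (?G r t))) p"
  have smw: "smoothw (z r t)" if "r \<in> {1..R}" "t \<in> {0..T}" for r t
    using rd_smoothw[OF smf_rd[OF sm[OF that(1)]] _ that(2)] by simp
  have smG: "smoothw (?G r t)" if "r \<in> {1..R}" "t \<in> {0..T}" for r t
    by (intro smoothw_add smoothw_cubic_part e that smw)
  have nd: "pbdd (\<lambda>n. of_real (- dotp n v))" for v using dotp_pbdd[of v] by (simp add: pbdd_def)
  have dz: "((\<lambda>t. dk j k (z r t)) has_vector_derivative dk j k (gen (\<lambda>n. - dotp n (kp r)) (z r t) + ?G r t)) (at t within {0..T})"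
    if r: "r \<in> {1..R}" and t: "t \<in> {0..T}" for r t
  proof -
    obtain z' where z': "smf {eps} T z'" "\<And>eps' t. eps' \<in> {eps} ==> t \<in> {0..T} ==> (z r has_vector_derivative z' eps' t) (at t within {0..T})"
      using smf_derivative[OF sm[OF r] T] by blast
    have eq: "gen (\<lambda>n. - dotp n (kp r)) (z r t) + ?G r t = z' eps t" if "t \<in> {0..T}" for t
      using vector_derivative_unique_within_closed_interval[OF T, of t] that d[OF r that] z'(2)[of eps t] by auto
    obtain C where C: "\<forall>eps\<in>{eps}. \<forall>t\<in>{0..T}. wle (k + 2 * CARD('d)) (z' eps t) C"
      using rd_bound[OF smf_rd[OF z'(1)], of "k + 2 * CARD('d)"] by blast
    show ?thesis unfolding dk_def eq[OF t]
    proof (rule mulop_has_vector_derivative[where c = 1 and r = k and C = C and x = "z r" and x' = "z' eps"])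
      show "smoothw (z' eps t)" if "t \<in> {0..T}" for t using rd_smoothw[OF smf_rd[OF z'(1)] _ that] by simp
      show "norm (ddx j n ^ k) \<le> 1 * wt n ^ k" for n by (rule ddx_power_bound)
    qed (use C z'(2) t smw[OF r] in auto)
  qed
  have "norm (?y (r, p - t *\<^sub>R kp r) t) \<le> 2 * (A + (c2 lam R k Q + 1) * T) * exp ((2 * c1 lam R k Q + 1) * t)"
  \<comment> \<open>The required common bound of the family is purely qualitative: any bound of the
    algebra norms over time will do, since \<open>H\<close> does not occur in the resulting
    estimate.\<close>
  proof (rule gronwall_family[where I = "{1..R} \<times> UNIV" and y = ?y and y' = ?y' and H = "\<Sum>r\<in>{1..R}. \<bar>SOME C. \<forall>t\<in>{0..T}. wle 0 (dk j k (z r t)) C\<bar>"])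
    fix i :: "nat \<times> (real^'d)" and t assume i: "i \<in> {1..R} \<times> UNIV" and t: "t \<in> {0..T}"
    obtain r p where ip: "i = (r, p)" by (cases i)
    have r: "r \<in> {1..R}" using i ip by simp
    have "dk j k (gen (\<lambda>n. - dotp n (kp r)) (z r t) + ?G r t) + mulop (\<lambda>n. \<i> * of_real (dotp n (kp r))) (dk j k (z r t)) = dk j k (?G r t)"
    proof (rule wien_eqI)
      fix n
      have s1: "smoothw (gen (\<lambda>n. - dotp n (kp r)) (z r t))"
        unfolding gen_def by (rule smoothw_mulop[OF pbdd_i[OF nd] smw[OF r t]])
      have "coef (gen (\<lambda>n. - dotp n (kp r)) (z r t)) n = \<i> * of_real (- dotp n (kp r)) * coef (z r t) n"
        by (rule coef_gen[OF nd smw[OF r t]])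
      then show "coef (dk j k (gen (\<lambda>n. - dotp n (kp r)) (z r t) + ?G r t) + mulop (\<lambda>n. \<i> * of_real (dotp n (kp r))) (dk j k (z r t))) n = coef (dk j k (?G r t)) n"
        by (simp only: coef_plus coef_dk[OF smoothw_add[OF s1 smG[OF r t]]] coef_dk[OF smG[OF r t]]
            coef_mulop[OF pbdd_i[OF dotp_pbdd] smoothw_dk[OF smw[OF r t]]] coef_dk[OF smw[OF r t]])
           (simp add: algebra_simps)
    qed
    from bounded_linear.has_vector_derivative[OF bounded_linear_synth[of p]
        phase_has_vector_derivative[where z = "\<lambda>t. dk j k (z r t)", OF dotp_pbdd[of "kp r"] smoothw_dk[OF smw[OF r t]] dz[OF r t], unfolded this]]
    show "(?y i has_vector_derivative ?y' i t) (at t within {0..T})" by (simp add: ip)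
    have "\<exists>C. \<forall>t\<in>{0..T}. wle 0 (dk j k (z r t)) C"
      using rd_bound[OF rd_dk[OF smf_rd[OF sm[OF r]]], of 0 j k] by auto
    from someI_ex[OF this] have "wle 0 (dk j k (z r t)) (SOME C. \<forall>t\<in>{0..T}. wle 0 (dk j k (z r t)) C)" using t by blast
    then have "norm (dk j k (z r t)) \<le> \<bar>SOME C. \<forall>t\<in>{0..T}. wle 0 (dk j k (z r t)) C\<bar>" by (simp add: wle_0_iff)
    also have "\<dots> \<le> (\<Sum>r\<in>{1..R}. \<bar>SOME C. \<forall>t\<in>{0..T}. wle 0 (dk j k (z r t)) C\<bar>)"
      using r by (intro member_le_sum) auto
    finally show "norm (?y i t) \<le> (\<Sum>r\<in>{1..R}. \<bar>SOME C. \<forall>t\<in>{0..T}. wle 0 (dk j k (z r t)) C\<bar>)"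
      using norm_synth_le[of "phase (\<lambda>n. dotp n (kp r)) t (dk j k (z r t))" p] by (simp add: ip)
    fix V assume V: "\<And>l. l \<in> {1..R} \<times> UNIV ==> norm (?y l t) \<le> V"
    have V': "norm (synth (dk j k (z i t)) q) \<le> V" if "i \<in> {1..R}" for i q
      using V[of "(i, q - t *\<^sub>R kp i)"] that by (simp add: synth_phase_dotp)
    have "norm (?y' i t) = norm (synth (dk j k (?G r t)) (p + t *\<^sub>R kp r))"
      by (simp add: ip synth_phase_dotp)
    also have "\<dots> \<le> norm (synth (dk j k (cubic_part lam kp R r (\<lambda>i. z i t))) (p + t *\<^sub>R kp r)) + norm (synth (dk j k (e r t)) (p + t *\<^sub>R kp r))"
      by (subst dk_add[OF smoothw_cubic_part[OF smw[OF _ t]] e[OF r t]]; simp only: synth_add norm_triangle_ineq)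
    also have "norm (synth (dk j k (cubic_part lam kp R r (\<lambda>i. z i t))) (p + t *\<^sub>R kp r)) \<le> c1 lam R k Q * V + c2 lam R k Q"
      by (rule synth_dk_cubic_part[OF smw[OF _ t] k r Q[OF _ t] V'])
    also have "norm (synth (dk j k (e r t)) (p + t *\<^sub>R kp r)) \<le> 1"
      by (rule order_trans[OF norm_synth_le e1[OF r t]])
    finally show "norm (?y' i t) \<le> c1 lam R k Q * V + (c2 lam R k Q + 1)" by simp
  next
    show "norm (?y i 0) \<le> A" if "i \<in> {1..R} \<times> UNIV" for i
      using that init norm_synth_le[of "dk j k (z (fst i) 0)" "snd i"] by (auto intro: order_trans)
    have Q0: "0 \<le> Q" using order_trans[OF norm_ge_zero Q[OF r t k]] .
    then show "0 \<le> c1 lam R k Q" "0 \<le> c2 lam R k Q + 1" by (simp_all add: c1_def c2_def)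
  qed (use A r t in auto)
  then show ?thesis by (simp add: synth_phase_dotp)
qed

section \<open>Closing the estimate by continuity\<close>

text \<open>At the first time when some \<open>g i\<close> reaches \<open>m\<close>, all of them
  have been at most \<open>m\<close> up to and including that time, so \<open>step\<close> gives the
  smaller bound \<open>b\<close>, a contradiction.\<close>

lemma continuity_bootstrap:
  fixes g :: "'i \<Rightarrow> real \<Rightarrow> real"
  assumes I: "finite I" and c: "\<And>i. i \<in> I ==> continuous_on {0..T} (g i)" and b: "b < m"
    and 0: "\<And>i. i \<in> I ==> g i 0 \<le> b"
    and step: "\<And>t i. t \<in> {0..T} ==> (\<And>s j. s \<in> {0..t} ==> j \<in> I ==> g j s \<le> m) ==> i \<in> I ==> g i t \<le> b"
    and i: "i \<in> I" and t: "t \<in> {0..T}"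
  shows "g i t \<le> m"
proof (rule ccontr)
  assume contra: "\<not> g i t \<le> m"
  define S where "S = (\<Union>i\<in>I. {s \<in> {0..T}. m \<le> g i s})"
  have "compact {s \<in> {0..T}. m \<le> g i s}" if "i \<in> I" for i
  proof -
    have "closed {s \<in> {0..T}. m \<le> g i s}"
      using continuous_on_closed_Collect_le[OF continuous_on_const c[OF that] closed_atLeastAtMost] .
    moreover have "bounded {s \<in> {0..T}. m \<le> g i s}" by (rule bounded_subset[OF bounded_closed_interval[of 0 T]]) auto
    ultimately show ?thesis by (simp add: compact_eq_bounded_closed)
  qed
  then have "compact S" unfolding S_def by (intro compact_UN I)
  moreover have "t \<in> S" using contra i t by (auto simp: S_def intro!: bexI[of _ i])
  then have "S \<noteq> {}" by auto
  ultimately obtain t1 where t1: "t1 \<in> S" "\<And>s. s \<in> S ==> t1 \<le> s" using compact_attains_inf by metis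
  obtain i1 where i1: "i1 \<in> I" "t1 \<in> {0..T}" "m \<le> g i1 t1" using t1(1) by (auto simp: S_def)
  have t10: "0 < t1" using i1 0[OF i1(1)] b by (cases "t1 = 0") auto
  have lt: "g j s \<le> m" if "j \<in> I" "s \<in> {0..<t1}" for j s
  proof (rule ccontr)
    assume "\<not> g j s \<le> m"
    then have "s \<in> S" using that i1(2) by (auto simp: S_def intro!: bexI[of _ j])
    then show False using t1(2)[of s] that(2) by auto
  qed
  have "g j s \<le> m" if j: "j \<in> I" and s: "s \<in> {0..t1}" for j s
  proof -
    have cl: "closure {0..<t1} = {0..t1}" using t10 by (simp add: closure_atLeastLessThan)
    show ?thesis
    proof (rule continuous_le_on_closure[of "{0..<t1}" "g j"])
      show "continuous_on (closure {0..<t1}) (g j)"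
        unfolding cl by (rule continuous_on_subset[OF c[OF j]]) (use i1(2) in auto)
      show "s \<in> closure {0..<t1}" unfolding cl by (rule s)
    qed (use lt[OF j] in auto)
  qed
  then have "g i1 t1 \<le> b" by (rule step[OF i1(2) _ i1(1)])
  then show False using i1(3) b by linarith
qed

text \<open>The way back from sup norms to the algebra norm. Sup bounds on a function and on its
  pure derivatives of order \<open>2 * CARD('d)\<close> bound its Fourier coefficients by a summable
  power of the weight.\<close>

lemma norm_le_of_synth_dk:
  obtains K where "0 < K"
    "\<And>(x :: 'd::finite wien) Q. smoothw x ==> (\<And>p. norm (synth x p) \<le> Q) ==>
       (\<And>j p. norm (synth (dk j (2 * CARD('d)) x) p) \<le> Q) ==> norm x \<le> K * Q"
proof -
  let ?m = "2 * CARD('d)"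
  obtain K where K: "0 < K"
    "\<And>s (x :: 'd wien) B. 0 \<le> B ==> (\<And>n. wt n ^ (s + 2 * CARD('d)) * norm (coef x n) \<le> B) ==> wle s x (K * B)"
    using wle_of_coef_bound[where 'd = 'd] by blast
  define L where "L = real (1 + CARD('d)) ^ ?m"
  have "norm x \<le> K * L * Q"
    if sm: "smoothw x" and Q: "\<And>p. norm (synth x p) \<le> Q" "\<And>j p. norm (synth (dk j ?m x) p) \<le> Q" for x :: "'d wien" and Q
  proof -
    have Q0: "0 \<le> Q" using order_trans[OF norm_ge_zero Q(1)] .
    have c: "continuous_on UNIV (synth y)" for y :: "'d wien"
      using continuous_on_synth[OF continuous_on_const continuous_on_id, of UNIV y] by simp
    have 1: "norm (coef x n) \<le> Q" for n
      using norm_hat_le[OF c Q(1), of n] by (simp add: hat_synth)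
    have 2: "\<bar>of_int (n $ j)\<bar> ^ ?m * norm (coef x n) \<le> Q" for n j
      using norm_hat_le[OF c Q(2)[of j], of n] by (simp add: hat_synth coef_dk[OF sm] norm_mult norm_power ddx_def)
    have "wt n ^ ?m * norm (coef x n) \<le> L * Q" for n
    proof -
      obtain j where j: "wt n \<le> real (1 + CARD('d)) * max 1 \<bar>of_int (n $ j)\<bar>" using wt_le_max by blast
      have "wt n ^ ?m \<le> L * max 1 \<bar>of_int (n $ j)\<bar> ^ ?m"
        using power_mono[OF j wt_nonneg, of ?m] unfolding L_def power_mult_distrib .
      then have "wt n ^ ?m * norm (coef x n) \<le> L * max 1 \<bar>of_int (n $ j)\<bar> ^ ?m * norm (coef x n)"
        by (rule mult_right_mono) simp
      also have "\<dots> = L * (max 1 \<bar>of_int (n $ j)\<bar> ^ ?m * norm (coef x n))" by simp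
      also have "\<dots> \<le> L * Q"
        using 1[of n] 2[of n j] by (intro mult_left_mono) (auto simp: max_def L_def)
      finally show ?thesis .
    qed
    then have "wle 0 x (K * (L * Q))" by (intro K(2)) (use Q0 in \<open>auto simp: L_def\<close>)
    then show ?thesis by (simp add: wle_0_iff mult.assoc)
  qed
  moreover have "0 < K * L" using K(1) by (simp add: L_def)
  ultimately show thesis using that by blast
qed

text \<open>The recursive sup bound for derivatives up to order \<open>k\<close>, each step being
  the outcome of \<open>characteristic_bound\<close>. It is built from the sup bound
  \<open>B\<close>, the data and the time alone, and so is available before the truncation radius
  and \<open>eps\<close> are chosen.\<close>

primrec qb :: "real \<Rightarrow> nat \<Rightarrow> real \<Rightarrow> real \<Rightarrow> (nat \<Rightarrow> real) \<Rightarrow> nat \<Rightarrow> real" where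
  "qb lam R T B A 0 = \<bar>B\<bar>"
| "qb lam R T B A (Suc k) = max (qb lam R T B A k)
     (2 * (\<bar>A (Suc k)\<bar> + (c2 lam R (Suc k) (qb lam R T B A k) + 1) * T) *
       exp ((2 * c1 lam R (Suc k) (qb lam R T B A k) + 1) * T))"

lemma qb_nonneg: "0 \<le> qb lam R T B A k"
  by (induction k) (auto simp: max_def)

text \<open>The interval up to \<open>T\<close> is the one reached so far, while the constants are
  formed with the larger \<open>T'\<close> and hence do not change as the continuity argument
  advances. The forcing enters only through the bound 1.\<close>

lemma chain_bound:
  fixes z e :: "nat \<Rightarrow> real \<Rightarrow> 'd::finite wien"
  assumes T: "0 < T" "T \<le> T'" and sm: "\<And>r. r \<in> {1..R} ==> smf {eps} T (\<lambda>_. z r)"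
    and e: "\<And>r t. r \<in> {1..R} ==> t \<in> {0..T} ==> smoothw (e r t)"
    and d: "\<And>r t. r \<in> {1..R} ==> t \<in> {0..T} ==> (z r has_vector_derivative
      gen (\<lambda>n. - dotp n (kp r)) (z r t) + (cubic_part lam kp R r (\<lambda>i. z i t) + e r t)) (at t within {0..T})"
    and B: "\<And>r t p. r \<in> {1..R} ==> t \<in> {0..T} ==> norm (synth (z r t) p) \<le> B"
    and e1: "\<And>r t k. r \<in> {1..R} ==> t \<in> {0..T} ==> k \<le> m ==> norm (dk j k (e r t)) \<le> 1"
    and init: "\<And>r s. r \<in> {1..R} ==> wle s (z r 0) (A s)"
  shows "k \<le> m ==> i \<le> k ==> r \<in> {1..R} ==> t \<in> {0..T} ==> norm (synth (dk j i (z r t)) p) \<le> qb lam R T' B A k"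
proof (induction k arbitrary: i r t p)
  case 0
  have "smoothw (z r t)" using rd_smoothw[OF smf_rd[OF sm[OF 0(3)]] _ 0(4)] by simp
  then show ?case using B[OF 0(3,4), of p] 0(2) by simp
next
  case (Suc k)
  show ?case
  proof (cases "i \<le> k")
    case True
    have "norm (synth (dk j i (z r t)) p) \<le> qb lam R T' B A k" by (rule Suc.IH) (use Suc.prems True in auto)
    then show ?thesis by simp
  next
    case False
    then have i: "i = Suc k" using Suc.prems by simp
    let ?Q = "qb lam R T' B A k"
    have nn: "0 \<le> c1 lam R (Suc k) ?Q" "0 \<le> c2 lam R (Suc k) ?Q" using qb_nonneg[of lam R T' B A k] by (simp_all add: c1_def c2_def)
    have "norm (synth (dk j (Suc k) (z r t)) p) \<le> 2 * (\<bar>A (Suc k)\<bar> + (c2 lam R (Suc k) ?Q + 1) * T) * exp ((2 * c1 lam R (Suc k) ?Q + 1) * t)"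
    proof (rule characteristic_bound[OF T(1) sm e d])
      show "norm (synth (dk j i (z r t)) p) \<le> ?Q" if "r \<in> {1..R}" "t \<in> {0..T}" "i < Suc k" for r t i p
        by (rule Suc.IH) (use Suc.prems that in auto)
      show "norm (dk j (Suc k) (e r t)) \<le> 1" if "r \<in> {1..R}" "t \<in> {0..T}" for r t
        by (rule e1[OF that Suc.prems(1)])
      show "norm (dk j (Suc k) (z r 0)) \<le> \<bar>A (Suc k)\<bar>" if "r \<in> {1..R}" for r
        using norm_dk_le[OF init[OF that]] by (rule order_trans) simp
    qed (use Suc.prems in auto)
    also have "\<dots> \<le> 2 * (\<bar>A (Suc k)\<bar> + (c2 lam R (Suc k) ?Q + 1) * T') * exp ((2 * c1 lam R (Suc k) ?Q + 1) * T')"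
      using nn T Suc.prems(4) by (intro mult_mono add_mono mult_left_mono) auto
    finally show ?thesis unfolding i by simp
  qed
qed

text \<open>The assumed solutions carry no uniform control beyond \<open>B\<close>. They are
  compared with the solutions of a truncated system, for which all bounds are uniform: as long as
  the truncation is inactive the two agree by uniqueness, so the sup bound carries over, and the
  chain of derivative bounds then keeps the truncation inactive.\<close>

theorem uniform_bounds:
  fixes x0 :: "real \<Rightarrow> nat \<Rightarrow> 'd::finite wien"
  assumes E: "\<And>eps. eps \<in> E ==> 0 < eps \<and> eps \<le> 1" and T: "0 < T"
    and init: "\<And>eps r s. eps \<in> E ==> r \<in> {1..R} ==> wle s (x0 eps r) (A s)"
    and ex: "\<And>eps. eps \<in> E ==> \<exists>y. \<forall>r\<in>{1..R}. y r 0 = x0 eps r \<and> (\<forall>t\<in>{0..T}. smoothw (y r t) \<and>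
      (y r has_vector_derivative gen (psi (kp r) eps) (y r t) + nlx lam kp R r eps (\<lambda>i. y i t)) (at t within {0..T}) \<and>
      (\<forall>p. norm (synth (y r t) p) \<le> B))"
  shows "\<exists>eps1>0. \<exists>W x. \<forall>eps\<in>E. eps < eps1 \<longrightarrow> (\<forall>r\<in>{1..R}. x eps r 0 = x0 eps r \<and> (\<forall>t\<in>{0..T}. (\<forall>s. wle s (x eps r t) (W s)) \<and>
      (x eps r has_vector_derivative gen (psi (kp r) eps) (x eps r t) + nlx lam kp R r eps (\<lambda>i. x eps i t)) (at t within {0..T})))"
proof -
  let ?m = "2 * CARD('d)"
  obtain K where K: "0 < K"
    "\<And>(x :: 'd wien) Q. smoothw x ==> (\<And>p. norm (synth x p) \<le> Q) ==>
       (\<And>j p. norm (synth (dk j ?m x) p) \<le> Q) ==> norm x \<le> K * Q"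
    using norm_le_of_synth_dk[where 'd = 'd] by blast
  \<comment> \<open>\<open>K\<close> converts sup bounds of derivatives into the algebra norm. The
    summand with \<open>A 0\<close> covers time zero, and \<open>M = b + 1\<close> leaves the gap
    required by the continuity argument.\<close>
  define b where "b = K * qb lam R T B A ?m + \<bar>A 0\<bar>"
  define M where "M = b + 1"
  have b0: "0 \<le> b" unfolding b_def using K(1) qb_nonneg[of lam R T B A ?m] by simp
  have M0: "0 < M" "b < M" using b0 by (auto simp: M_def)
  obtain W x where x: "\<And>eps r. eps \<in> E ==> r \<in> {1..R} ==> x eps r 0 = x0 eps r"
    and W: "\<And>eps r s t. eps \<in> E ==> r \<in> {1..R} ==> t \<in> {0..T} ==> wle s (x eps r t) (W s)"
    and d: "\<And>eps r t. eps \<in> E ==> r \<in> {1..R} ==> t \<in> {0..T} ==>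
      (x eps r has_vector_derivative gen (psi (kp r) eps) (x eps r t) + nlx lam kp R r eps (\<lambda>i. rho M (x eps i t))) (at t within {0..T})"
  proof -
    obtain B' where "0 \<le> B'" and *: "\<And>T. 0 \<le> T ==> \<exists>W x. \<forall>eps\<in>E. \<forall>r\<in>{1..R}. (\<forall>y. norm (nlx lam kp R r eps (\<lambda>i. rho M (y i))) \<le> B') \<and> x eps r 0 = x0 eps r \<and>
     (\<forall>t\<in>{0..T}. (\<forall>s. wle s (x eps r t) (W s)) \<and>
      (x eps r has_vector_derivative gen (psi (kp r) eps) (x eps r t) + nlx lam kp R r eps (\<lambda>i. rho M (x eps i t))) (at t within {0..T}))"
      using truncated_solution[of E M R x0 A lam kp, OF E M0(1) init] by blast
    from *[of T] T obtain W x where **: "\<forall>eps\<in>E. \<forall>r\<in>{1..R}. (\<forall>y. norm (nlx lam kp R r eps (\<lambda>i. rho M (y i))) \<le> B') \<and> x eps r 0 = x0 eps r \<and>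
     (\<forall>t\<in>{0..T}. (\<forall>s. wle s (x eps r t) (W s)) \<and>
      (x eps r has_vector_derivative gen (psi (kp r) eps) (x eps r t) + nlx lam kp R r eps (\<lambda>i. rho M (x eps i t))) (at t within {0..T}))"
      by auto
    show thesis by (rule that[of x W]) (use ** in auto)
  qed
  have sm: "smoothw (x eps r t)" if "eps \<in> E" "r \<in> {1..R}" "t \<in> {0..T}" for eps r t
    by (rule wle_imp_smoothw[OF W[OF that]])
  \<comment> \<open>The part of the right-hand side that carries a factor \<open>eps\<close>, with
    this factor removed: the Laplacian with factor \<open>i / 2\<close> and the quintic terms. The
    bounds \<open>W\<close> of the truncated solutions are uniform in \<open>eps\<close>, hence so
    are those of \<open>q\<close>.\<close>
  define q where "q r eps t = mulop (\<lambda>n. - (\<i> * of_real (sq n / 2))) (x eps r t) + quintic_part lam kp R r (\<lambda>i. x eps i t)" for r eps t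
  have rdx: "rd E T (\<lambda>eps. x eps r)" if "r \<in> {1..R}" for r
    by (rule rdI) (use W[OF _ that] in blast)
  have sqb: "norm (- (\<i> * of_real (sq n / 2))) \<le> real CARD('d) * wt n ^ 2" for n :: "int^'d"
    using sq_le[of n] sq_nonneg[of n] by (simp add: norm_mult)
  have rdq: "rd E T (q r)" if r: "r \<in> {1..R}" for r
    unfolding q_def
  proof (rule rd_add)
    show "rd E T (\<lambda>eps t. mulop (\<lambda>n. - (\<i> * of_real (sq n / 2))) (x eps r t))"
      by (rule rd_mulop[OF sqb _ rdx[OF r]]) simp
    have "csm 0 E T (\<lambda>eps t. quintic_part lam kp R r (\<lambda>i. x eps i t))"
      by (rule csm_parts(2)[where x = "\<lambda>i eps. x eps i"]) (use rdx in simp)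
    then show "rd E T (\<lambda>eps t. quintic_part lam kp R r (\<lambda>i. x eps i t))" by simp
  qed
  have "\<forall>r\<in>{1..R}. \<exists>C\<ge>0. \<forall>eps\<in>E. \<forall>t\<in>{0..T}. wle ?m (q r eps t) C"
    using rd_bound[OF rdq] by blast
  then obtain C where C: "\<And>r. r \<in> {1..R} ==> 0 \<le> C r" "\<And>r eps t. r \<in> {1..R} ==> eps \<in> E ==> t \<in> {0..T} ==> wle ?m (q r eps t) (C r)"
    unfolding bchoice_iff by blast
  \<comment> \<open>Below this value \<open>eps * q\<close> has norm at most 1 together with the
    derivatives occurring in the chain, which is the normalization of the forcing there.\<close>
  define eps1 where "eps1 = 1 / (1 + (\<Sum>r\<in>{1..R}. C r))"
  have C0: "0 \<le> (\<Sum>r\<in>{1..R}. C r)" by (intro sum_nonneg C)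
  have eps1: "0 < eps1" unfolding eps1_def using C0 by simp
  have small: "eps * C r \<le> 1" if "0 < eps" "eps < eps1" "r \<in> {1..R}" for eps r
  proof -
    have "C r \<le> (\<Sum>r\<in>{1..R}. C r)" using that C by (intro member_le_sum) auto
    then have "eps * C r \<le> eps * (1 + (\<Sum>r\<in>{1..R}. C r))" using that(1) by simp
    also have "\<dots> \<le> 1" using that(2) C0 by (simp add: eps1_def field_simps)
    finally show ?thesis .
  qed
  have bound: "norm (x eps r t) \<le> M" if eps: "eps \<in> E" "eps < eps1" and r: "r \<in> {1..R}" and t: "t \<in> {0..T}" for eps r t
  proof (rule continuity_bootstrap[where I = "{1..R}" and g = "\<lambda>r t. norm (x eps r t)" and b = b and T = T])
    have e01: "0 < eps" "eps \<le> 1" using E[OF eps(1)] by auto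
    show "continuous_on {0..T} (\<lambda>t. norm (x eps r t))" if "r \<in> {1..R}" for r
      by (intro continuous_on_norm has_vector_derivative_imp_continuous_on[OF d[OF eps(1) that]])
    have n0: "norm (x eps r 0) \<le> b" if "r \<in> {1..R}" for r
    proof -
      have "norm (x eps r 0) \<le> A 0" using init[OF eps(1) that, of 0] x[OF eps(1) that] by (simp add: wle_0_iff)
      also have "A 0 \<le> b"
        unfolding b_def using mult_nonneg_nonneg[OF less_imp_le[OF K(1)] qb_nonneg[of lam R T B A ?m]] abs_ge_self[of "A 0"] by linarith
      finally show ?thesis .
    qed
    then show "norm (x eps r 0) \<le> b" if "r \<in> {1..R}" for r using that .
    fix t r assume t: "t \<in> {0..T}" and r: "r \<in> {1..R}"
      and le: "\<And>s j. s \<in> {0..t} ==> j \<in> {1..R} ==> norm (x eps j s) \<le> M"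
    show "norm (x eps r t) \<le> b"
    proof (cases "t = 0")
      case True
      then show ?thesis using n0[OF r] by simp
    next
      case False
      then have t0: "0 < t" using t by auto
      have sub: "{0..t} \<subseteq> {0..T}" using t by auto
      have d': "(x eps r has_vector_derivative gen (psi (kp r) eps) (x eps r s) + nlx lam kp R r eps (\<lambda>i. x eps i s)) (at s within {0..t})"
        if r: "r \<in> {1..R}" and s: "s \<in> {0..t}" for r s
      proof -
        have "nlx lam kp R r eps (\<lambda>i. rho M (x eps i s)) = nlx lam kp R r eps (\<lambda>i. x eps i s)"
          by (rule nlx_cong) (use le[OF s] rho_id in auto)
        with has_vector_derivative_within_subset[OF d[OF eps(1) r subsetD[OF sub s]] sub] show ?thesis by simp
      qed
      obtain y where y: "\<And>r. r \<in> {1..R} ==> y r 0 = x0 eps r"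
        "\<And>r t. r \<in> {1..R} ==> t \<in> {0..T} ==> smoothw (y r t)"
        "\<And>r t. r \<in> {1..R} ==> t \<in> {0..T} ==> (y r has_vector_derivative gen (psi (kp r) eps) (y r t) + nlx lam kp R r eps (\<lambda>i. y i t)) (at t within {0..T})"
        "\<And>r t p. r \<in> {1..R} ==> t \<in> {0..T} ==> norm (synth (y r t) p) \<le> B"
      proof -
        from ex[OF eps(1)] obtain y where "\<forall>r\<in>{1..R}. y r 0 = x0 eps r \<and> (\<forall>t\<in>{0..T}. smoothw (y r t) \<and>
      (y r has_vector_derivative gen (psi (kp r) eps) (y r t) + nlx lam kp R r eps (\<lambda>i. y i t)) (at t within {0..T}) \<and>
      (\<forall>p. norm (synth (y r t) p) \<le> B))" by blast
        then show thesis using that[of y] by auto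
      qed
      \<comment> \<open>Up to time \<open>t\<close> the truncated solution solves the original
        system, so uniqueness identifies it with the assumed solution and it inherits the sup bound
        \<open>B\<close>.\<close>
      have eq: "x eps r s = y r s" if "r \<in> {1..R}" "s \<in> {0..t}" for r s
      proof (rule nlx_unique[where x = "x eps" and T = t, OF e01])
        show "smoothw (x eps r s)" if "r \<in> {1..R}" "s \<in> {0..t}" for r s by (rule sm[OF eps(1) that(1) subsetD[OF sub that(2)]])
        show "smoothw (y r s)" if "r \<in> {1..R}" "s \<in> {0..t}" for r s by (rule y(2)[OF that(1) subsetD[OF sub that(2)]])
        show "(y r has_vector_derivative gen (psi (kp r) eps) (y r s) + nlx lam kp R r eps (\<lambda>i. y i s)) (at s within {0..t})" if "r \<in> {1..R}" "s \<in> {0..t}" for r s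
          by (rule has_vector_derivative_within_subset[OF y(3)[OF that(1) subsetD[OF sub that(2)]] sub])
        show "x eps r 0 = y r 0" if "r \<in> {1..R}" for r using x[OF eps(1) that] y(1)[OF that] by simp
      qed (use d' that in auto)
      have smx: "smf {eps} t (\<lambda>_. x eps r)" if "r \<in> {1..R}" for r
        by (rule solution_smf[where x = "\<lambda>_. x eps" and W = W and R = R and kp = kp and lam = lam])
           (use e01 W[OF eps(1)] sub d' that in auto)
      let ?e = "\<lambda>r s. cst (of_real eps) * q r eps s"
      have smq: "smoothw (q r eps s)" if "r \<in> {1..R}" "s \<in> {0..T}" for r s
        by (rule rd_smoothw[OF rdq[OF that(1)] eps(1) that(2)])
      have de: "gen (psi (kp r) eps) (x eps r s) + nlx lam kp R r eps (\<lambda>i. x eps i s) =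
          gen (\<lambda>n. - dotp n (kp r)) (x eps r s) + (cubic_part lam kp R r (\<lambda>i. x eps i s) + ?e r s)"
        if "r \<in> {1..R}" "s \<in> {0..T}" for r s
      proof -
        have s1: "smoothw (x eps r s)" by (rule sm[OF eps(1) that])
        have nd: "pbdd (\<lambda>n. of_real (- dotp n (kp r)))" using dotp_pbdd[of "kp r"] by (simp add: pbdd_def)
        have "gen (psi (kp r) eps) (x eps r s) = gen (\<lambda>n. - dotp n (kp r)) (x eps r s) + cst (of_real eps) * mulop (\<lambda>n. - (\<i> * of_real (sq n / 2))) (x eps r s)"
        proof (rule wien_eqI)
          fix n
          have sqp: "pbdd (\<lambda>n :: int^'d. - (\<i> * of_real (sq n / 2)))" by (rule pbddI[OF sqb]) simp
          show "coef (gen (psi (kp r) eps) (x eps r s)) n = coef (gen (\<lambda>n. - dotp n (kp r)) (x eps r s) + cst (of_real eps) * mulop (\<lambda>n. - (\<i> * of_real (sq n / 2))) (x eps r s)) n"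
            by (simp only: coef_plus coef_cst_mult coef_gen[OF psi_pbdd[OF e01(1)] s1] coef_gen[OF nd s1] coef_mulop[OF sqp s1])
               (simp add: psi_def algebra_simps)
        qed
        then show ?thesis by (simp add: nlx_def q_def algebra_simps)
      qed
      have chain: "norm (synth (dk j i (x eps r t)) p) \<le> qb lam R T B A ?m" if "i \<le> ?m" for i j p
      proof (rule chain_bound[where T = t and e = ?e and z = "x eps" and m = ?m and eps = eps and k = ?m and kp = kp])
        show "smoothw (?e r s)" if "r \<in> {1..R}" "s \<in> {0..t}" for r s
          by (intro smoothw_mult smoothw_cst smq that(1) subsetD[OF sub that(2)])
        show "(x eps r has_vector_derivative gen (\<lambda>n. - dotp n (kp r)) (x eps r s) + (cubic_part lam kp R r (\<lambda>i. x eps i s) + ?e r s)) (at s within {0..t})"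
          if "r \<in> {1..R}" "s \<in> {0..t}" for r s
          using d'[OF that] unfolding de[OF that(1) subsetD[OF sub that(2)]] .
        show "norm (synth (x eps r s) p) \<le> B" if "r \<in> {1..R}" "s \<in> {0..t}" for r s p
          using y(4)[OF that(1) subsetD[OF sub that(2)]] eq[OF that] by simp
        show "norm (dk j k (?e r s)) \<le> 1" if "r \<in> {1..R}" "s \<in> {0..t}" "k \<le> ?m" for r s k
        proof -
          note s = subsetD[OF sub that(2)]
          have "norm (dk j k (?e r s)) \<le> eps * norm (dk j k (q r eps s))"
            unfolding dk_cst_mult[OF smq[OF that(1) s]] using e01 by (simp add: scaleR_eq_cst[symmetric])
          also have "\<dots> \<le> eps * C r"
            by (intro mult_left_mono norm_dk_le wle_antimono[OF C(2)[OF that(1) eps(1) s] that(3)]) (use e01 in auto)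
          also have "\<dots> \<le> 1" by (rule small[OF e01(1) eps(2) that(1)])
          finally show ?thesis .
        qed
        show "wle s (x eps r 0) (A s)" if "r \<in> {1..R}" for r s using init[OF eps(1) that] x[OF eps(1) that] by simp
      qed (use t t0 r that smx in auto)
      have "norm (x eps r t) \<le> K * qb lam R T B A ?m"
      proof (rule K(2)[OF sm[OF eps(1) r t]])
        show "norm (synth (x eps r t) p) \<le> qb lam R T B A ?m" for p
          using chain[of 0 _ p] by (simp add: sm[OF eps(1) r t])
        show "norm (synth (dk j ?m (x eps r t)) p) \<le> qb lam R T B A ?m" for j p by (rule chain) simp
      qed
      then show ?thesis by (simp add: b_def)
    qed
  qed (use M0 r t in auto)
  have "(x eps r has_vector_derivative gen (psi (kp r) eps) (x eps r t) + nlx lam kp R r eps (\<lambda>i. x eps i t)) (at t within {0..T})"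
    if "eps \<in> E" "eps < eps1" "r \<in> {1..R}" "t \<in> {0..T}" for eps r t
  proof -
    have "nlx lam kp R r eps (\<lambda>i. rho M (x eps i t)) = nlx lam kp R r eps (\<lambda>i. x eps i t)"
      by (rule nlx_cong) (use bound[OF that(1,2) _ that(4)] rho_id in auto)
    with d[OF that(1,3,4)] show ?thesis by simp
  qed
  then show ?thesis using eps1 x W by blast
qed

section \<open>The functions \<open>b\<^sub>\<nu>\<close> and \<open>b\<^sub>\<nu>\<^sup>\<star>\<close>\<close>

text \<open>A uniformly smooth family, whatever its origin, satisfies the advected equation up to a
  residual of order one that is again uniformly smooth. Being explicit functions of the amplitudes,
  \<open>b\<close> and the correctors are treated this way.\<close>

lemma smf_residual:
  assumes b: "smf E T b" and T: "0 < T" and \<psi>: "\<exists>c\<ge>0. \<exists>m. \<forall>eps\<in>E. \<forall>n. \<bar>\<psi> eps n\<bar> \<le> c * wt n ^ m"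
  obtains g where "smf E T g" "\<And>eps t. eps \<in> E ==> t \<in> {0..T} ==>
    (b eps has_vector_derivative gen (\<psi> eps) (b eps t) + g eps t) (at t within {0..T})"
proof -
  obtain b' where b': "smf E T b'" "\<And>eps t. eps \<in> E ==> t \<in> {0..T} ==> (b eps has_vector_derivative b' eps t) (at t within {0..T})"
    using smf_derivative[OF b T] by blast
  obtain c m where c: "0 \<le> c" "\<forall>eps\<in>E. \<forall>n. \<bar>\<psi> eps n\<bar> \<le> c * wt n ^ m" using \<psi> by blast
  have "smf E T (\<lambda>eps t. gen (\<psi> eps) (b eps t))"
    unfolding gen_def by (rule smf_mulop[OF _ c(1) b, where r = m]) (use c(2) in \<open>auto simp: norm_mult\<close>)
  then have "smf E T (\<lambda>eps t. b' eps t - gen (\<psi> eps) (b eps t))" by (rule smf_diff[OF b'(1)])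
  then show thesis by (rule that) (use b'(2) in simp)
qed

text \<open>The right-hand side is affine in the unknown, so its Lipschitz and growth constants are
  those of \<open>h\<close> and \<open>g\<close>. They are uniform in \<open>eps\<close>, and the
  Picard scheme directly yields a uniformly smooth family.\<close>

lemma linear_existence:
  fixes h g :: "real \<Rightarrow> real \<Rightarrow> 'd::finite wien"
  assumes T: "0 < T" and h: "smf E T h" and g: "smf E T g" and \<psi>: "\<exists>c\<ge>0. \<exists>m. \<forall>eps\<in>E. \<forall>n. \<bar>\<psi> eps n\<bar> \<le> c * wt n ^ m"
    and init: "\<And>s. \<exists>C. \<forall>eps\<in>E. wle s (y0 eps) C"
  shows "\<exists>y. smf E T y \<and> (\<forall>eps\<in>E. y eps 0 = y0 eps \<and> (\<forall>t\<in>{0..T}.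
     (y eps has_vector_derivative gen (\<psi> eps) (y eps t) + (h eps t * y eps t + g eps t)) (at t within {0..T})))"
proof -
  have "\<forall>s. \<exists>C. 0 \<le> C \<and> (\<forall>eps\<in>E. \<forall>t\<in>{0..T}. wle s (h eps t) C)" using rd_bound[OF smf_rd[OF h]] by blast
  then obtain H where H: "\<And>s. 0 \<le> H s" "\<And>s eps t. eps \<in> E ==> t \<in> {0..T} ==> wle s (h eps t) (H s)" by metis
  have "\<forall>s. \<exists>C. 0 \<le> C \<and> (\<forall>eps\<in>E. \<forall>t\<in>{0..T}. wle s (g eps t) C)" using rd_bound[OF smf_rd[OF g]] by blast
  then obtain G where G: "\<And>s. 0 \<le> G s" "\<And>s eps t. eps \<in> E ==> t \<in> {0..T} ==> wle s (g eps t) (G s)" by metis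
  obtain A where A: "\<And>s eps. eps \<in> E ==> wle s (y0 eps) (A s)" using init by metis
  define C where "C s = 2 ^ s * (2 * H s) + G s" for s :: nat
  have C0: "0 \<le> C s" for s using H(1) G(1) by (simp add: C_def)
  obtain c m where c: "0 \<le> c" "\<forall>eps\<in>E. \<forall>n. \<bar>\<psi> eps n\<bar> \<le> c * wt n ^ m" using \<psi> by blast
  have "\<exists>y. \<forall>r\<in>{()}. y r 0 = y0 eps \<and> (\<forall>t\<in>{0..T}. (\<forall>s. wle s (y r t) ((1 + A s) * exp (C s * t))) \<and>
      (y r has_vector_derivative gen (\<psi> eps) (y r t) + (h eps t * y () t + g eps t)) (at t within {0..T}))" if eps: "eps \<in> E" for eps
  proof (rule system_existence[where F = "\<lambda>t z r. h eps t * z () + g eps t" and \<psi> = "\<lambda>r. \<psi> eps" and ?x0.0 = "\<lambda>r. y0 eps" and L = "H 0"])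
    show "pbdd (\<lambda>n. of_real (\<psi> eps n))" for r :: unit by (rule pbddI[of _ c m]) (use c eps in auto)
    fix t :: real and z w :: "unit \<Rightarrow> 'd wien" and r :: unit and B :: real
    assume t: "t \<in> {0..T}" and le: "\<And>i. i \<in> {()} ==> norm (z i - w i) \<le> B"
    have "norm (h eps t * z () + g eps t - (h eps t * w () + g eps t)) = norm (h eps t * (z () - w ()))" by (simp add: algebra_simps)
    also have "\<dots> \<le> norm (h eps t) * norm (z () - w ())" by (rule norm_mult_ineq)
    also have "\<dots> \<le> H 0 * B" by (intro mult_mono le) (use H(2)[OF eps t, of 0] H(1)[of 0] in \<open>auto simp: wle_0_iff\<close>)
    finally show "norm (h eps t * z () + g eps t - (h eps t * w () + g eps t)) \<le> H 0 * B" .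
  next
    fix z :: "unit \<Rightarrow> real \<Rightarrow> 'd wien"
    assume "\<And>i. i \<in> {()} ==> continuous_on {0..T} (z i)"
    then show "continuous_on {0..T} (\<lambda>t. h eps t * z () t + g eps t)"
      by (intro continuous_intros smf_continuous_on[OF h eps] smf_continuous_on[OF g eps]) auto
  next
    fix s V t and z :: "unit \<Rightarrow> 'd wien"
    assume V: "0 \<le> V" and t: "t \<in> {0..T}" and z: "\<And>i. i \<in> {()} ==> wle s (z i) V"
    have "wle s (h eps t * z () + g eps t) (2 ^ s * (2 * H s * V) + G s)"
      by (intro wle_add wle_mult' H(2) G(2) eps t z) simp
    moreover have "2 ^ s * (2 * H s * V) + G s \<le> C s * (1 + V)"
    proof -
      have "C s * (1 + V) = (2 ^ s * (2 * H s * V) + G s) + (2 ^ s * (2 * H s) + G s * V)" by (simp add: C_def algebra_simps)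
      moreover have "0 \<le> 2 ^ s * (2 * H s) + G s * V" using H(1)[of s] G(1)[of s] V by simp
      ultimately show ?thesis by linarith
    qed
    ultimately show "wle s (h eps t * z () + g eps t) (C s * (1 + V))" by (rule wle_mono)
  qed (use T C0 A[OF eps] H(1) in auto)
  then have "\<forall>eps\<in>E. \<exists>y. y 0 = y0 eps \<and> (\<forall>t\<in>{0..T}. (\<forall>s. wle s (y t) ((1 + A s) * exp (C s * t))) \<and>
      (y has_vector_derivative gen (\<psi> eps) (y t) + (h eps t * y t + g eps t)) (at t within {0..T}))" by blast
  then obtain y where y: "\<And>eps. eps \<in> E ==> y eps 0 = y0 eps"
    "\<And>eps t s. eps \<in> E ==> t \<in> {0..T} ==> wle s (y eps t) ((1 + A s) * exp (C s * t))"
    "\<And>eps t. eps \<in> E ==> t \<in> {0..T} ==> (y eps has_vector_derivative gen (\<psi> eps) (y eps t) + (h eps t * y eps t + g eps t)) (at t within {0..T})"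
    unfolding bchoice_iff by blast
  have "rd E T y"
  proof (rule rdI)
    fix s
    have "wle s (y eps t) ((1 + A s) * exp (C s * T))" if "eps \<in> E" "t \<in> {0..T}" for eps t
    proof (rule wle_mono[OF y(2)[OF that]])
      have "0 \<le> A s" by (rule wle_nonneg[OF A[OF that(1)]])
      then show "(1 + A s) * exp (C s * t) \<le> (1 + A s) * exp (C s * T)"
        using C0[of s] that by (intro mult_left_mono) (auto intro: mult_left_mono)
    qed
    then show "\<exists>C. \<forall>eps\<in>E. \<forall>t\<in>{0..T}. wle s (y eps t) C" by blast
  qed
  note rdy = this
  have "smf E T y"
  proof (rule smf_bootstrap[where I = "{()}" and x = "\<lambda>_. y" and \<psi> = "\<lambda>_. \<psi>" and g = "\<lambda>_ eps t. h eps t * y eps t + g eps t"])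
    show "csm k E T (\<lambda>eps t. h eps t * y eps t + g eps t)" if "\<And>i. i \<in> {()} ==> csm k E T y" for k
      by (rule csm_add[OF csm_mult[OF h[unfolded smf_def, rule_format] that] g[unfolded smf_def, rule_format]]) simp
  qed (use y(3) \<psi> rdy in auto)
  then show ?thesis using y by blast
qed

lemma linear_unique:
  fixes y z :: "real \<Rightarrow> 'd::finite wien"
  assumes \<psi>: "pbdd (\<lambda>n. of_real (\<psi> n))" and h: "continuous_on {0..T} h"
    and sm: "\<And>t. t \<in> {0..T} ==> smoothw (y t)" "\<And>t. t \<in> {0..T} ==> smoothw (z t)"
    and d: "\<And>t. t \<in> {0..T} ==> (y has_vector_derivative gen \<psi> (y t) + (h t * y t + g t)) (at t within {0..T})"
      "\<And>t. t \<in> {0..T} ==> (z has_vector_derivative gen \<psi> (z t) + (h t * z t + g t)) (at t within {0..T})"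
    and init: "y 0 = z 0" and t: "t \<in> {0..T}"
  shows "y t = z t"
proof -
  have "compact (h ` {0..T})" by (rule compact_continuous_image[OF h compact_Icc])
  then have "bounded (h ` {0..T})" by (rule compact_imp_bounded)
  then obtain c where c: "\<And>t. t \<in> {0..T} ==> norm (h t) \<le> c" unfolding bounded_iff by blast
  have "norm ((\<lambda>t. y t - z t) t) \<le> 2 * (0 + 0 * T) * exp ((2 * c + 1) * t)"
  proof (rule energy_estimate[where I = "{()}" and x = "\<lambda>_ t. y t - z t" and \<psi> = "\<lambda>_. \<psi>" and g = "\<lambda>_ t. h t * (y t - z t)"])
    show "((\<lambda>t. y t - z t) has_vector_derivative gen \<psi> (y t - z t) + h t * (y t - z t)) (at t within {0..T})"
      if "t \<in> {0..T}" for t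
    proof -
      have "gen \<psi> (y t - z t) = gen \<psi> (y t) - gen \<psi> (z t)"
        unfolding gen_def by (rule mulop_diff[OF pbdd_i[OF \<psi>] sm(1)[OF that] sm(2)[OF that]])
      then have "gen \<psi> (y t - z t) + h t * (y t - z t) = gen \<psi> (y t) + (h t * y t + g t) - (gen \<psi> (z t) + (h t * z t + g t))"
        by (simp add: algebra_simps)
      then show ?thesis using has_vector_derivative_diff[OF d(1)[OF that] d(2)[OF that]] by simp
    qed
    show "norm (h t * (y t - z t)) \<le> c * V + 0" if "t \<in> {0..T}" "\<And>j. j \<in> {()} ==> norm (y t - z t) \<le> V" for t V
    proof -
      have "norm (h t * (y t - z t)) \<le> norm (h t) * norm (y t - z t)" by (rule norm_mult_ineq)
      also have "\<dots> \<le> c * V" by (rule mult_mono) (use c[OF that(1)] that(2) order_trans[OF norm_ge_zero c[OF that(1)]] in auto)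
      finally show ?thesis by simp
    qed
    show "0 \<le> c" using order_trans[OF norm_ge_zero c[OF t]] .
  qed (use \<psi> init t smoothw_diff sm in auto)
  then show ?thesis by simp
qed

lemma synth_uminus: "synth (- x) p = - synth x p"
  using synth_diff[of 0 x p] by simp

lemma psi_bound_ex:
  assumes "\<And>eps. eps \<in> E ==> 0 < eps \<and> eps \<le> 1"
  shows "\<exists>c\<ge>0. \<exists>m. \<forall>eps\<in>E. \<forall>n. \<bar>psi k eps n\<bar> \<le> c * wt n ^ m"
  by (rule exI[of _ "psic k"], rule conjI[OF psic_nonneg], rule exI[of _ 2], intro ballI allI psi_le)
     (use assms in force)+

text \<open>The amplitudes are given as a family that is already uniformly smooth in
  \<open>eps\<close>, so that expressions formed from them are uniformly smooth by closure.\<close>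

locale modulation =
  fixes lam :: real and kp :: "nat \<Rightarrow> real^'d::finite" and R :: nat and T :: real and E :: "real set"
    and x :: "real \<Rightarrow> nat \<Rightarrow> real \<Rightarrow> 'd wien"
  assumes E: "\<And>eps. eps \<in> E ==> 0 < eps \<and> eps \<le> 1" and T: "0 < T"
    and smx: "\<And>r. r \<in> {1..R} ==> smf E T (\<lambda>eps. x eps r)"
    and eqx: "\<And>eps r t. eps \<in> E ==> r \<in> {1..R} ==> t \<in> {0..T} ==>
      (x eps r has_vector_derivative gen (psi (kp r) eps) (x eps r t) + nlx lam kp R r eps (\<lambda>i. x eps i t)) (at t within {0..T})"
begin

definition b where "b \<nu> eps t = bx kp (\<lambda>i. x eps i t) \<nu>"
definition cub where "cub \<nu> eps t = cubx (\<lambda>i. x eps i t) \<nu>"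
definition dens where "dens eps t = cst (- (2 * \<i> * of_real lam)) * (\<Sum>r\<in>{1..R}. x eps r t * star (x eps r t))"
definition a where "a eps r = syn (x eps r)"

lemma smf_b: "\<nu> \<in> T3 R ==> smf E T (b \<nu>)"
  unfolding b_def[abs_def] smf_def
  by (intro allI csm_parts(3)[where x = "\<lambda>i eps. x eps i"] smx[unfolded smf_def, rule_format])

lemma smf_cub: "\<nu> \<in> T3 R ==> smf E T (cub \<nu>)"
  unfolding cub_def[abs_def] smf_def
  by (intro allI csm_parts(4)[where x = "\<lambda>i eps. x eps i"] smx[unfolded smf_def, rule_format])

lemma smf_dens: "smf E T dens"
  unfolding dens_def[abs_def] by (intro smf_mult smf_sum smf_star smx smf_cst[where B = "2 * \<bar>lam\<bar>"]) (simp_all add: norm_mult)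

lemma b_mod_eq: "\<nu> \<in> T3 R ==> b_mod kp (a eps) \<nu> z = syn (b \<nu> eps) z"
  unfolding syn_def b_def by (rule synth_bx) (simp_all add: a_def syn_def)

lemma cubic_eq: "\<nu> \<in> T3 R ==> cubic (a eps) \<nu> z = syn (cub \<nu> eps) z"
  unfolding syn_def cub_def by (rule synth_cubx) (simp_all add: a_def syn_def)

lemma dens_eq: "- 2 * \<i> * of_real lam * (\<Sum>r\<in>{1..R}. of_real ((cmod (a eps r z))\<^sup>2)) * synth y (snd z)
     = synth (dens eps (fst z) * y) (snd z)"
  by (simp add: dens_def a_def syn_def synth_mult synth_sum synth_star complex_norm_square del: of_real_power)

lemma smf_single: "smf E T y ==> eps \<in> E ==> smf {eps} T (\<lambda>_. y eps)"
  using smf_subset[of E T y "{eps}"] smf_cong[of "{eps}" T y "\<lambda>_. y eps"] by simp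

lemma smf_smoothw: "smf E T y ==> eps \<in> E ==> t \<in> {0..T} ==> smoothw (y eps t)"
  using rd_smoothw[OF smf_rd] .

text \<open>The predicate \<open>P\<close> is described by an equivalence so that the problems for
  \<open>b_star\<close> and for the linear approximation of \<open>b\<close> both fit. A competitor
  is passed to its coefficients, where linear uniqueness decides.\<close>

lemma linear_pde_unique:
  fixes k :: "real^'d" and h g y :: "real \<Rightarrow> 'd wien"
  assumes eps: "eps \<in> E" and h: "continuous_on {0..T} h"
    and y: "smf {eps} T (\<lambda>_. y)" "\<And>t. t \<in> {0..T} ==> (y has_vector_derivative gen (psi k eps) (y t) + (h t * y t + g t)) (at t within {0..T})"
    and P: "\<And>v. P v \<longleftrightarrow> smooth_periodic T v \<and> (\<forall>p. v (0, p) = synth (y 0) p) \<and>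
      (\<forall>z\<in>slab T. advected T eps k v z = synth (h (fst z)) (snd z) * v z + synth (g (fst z)) (snd z))"
  shows "unique_solution T P (syn y)"
  unfolding unique_solution_def
proof (intro conjI allI impI ballI)
  have eps0: "0 < eps" using E[OF eps] by simp
  have smy: "smoothw (y t)" if "t \<in> {0..T}" for t using rd_smoothw[OF smf_rd[OF y(1)] _ that] by simp
  show "P (syn y)"
    unfolding P
  proof (intro conjI ballI allI)
    show "smooth_periodic T (syn y)" by (rule smf_smooth_periodic[OF y(1) T])
    show "syn y (0, p) = synth (y 0) p" for p by (simp add: syn_def)
    fix z :: "real \<times> (real^'d)" assume z: "z \<in> slab T"
    have "advected T eps k (syn y) z = synth (h (fst z) * y (fst z) + g (fst z)) (snd z)"
      by (rule coef_to_pde[OF smy T eps0 y(2) z])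
    then show "advected T eps k (syn y) z = synth (h (fst z)) (snd z) * syn y z + synth (g (fst z)) (snd z)"
      by (simp add: synth_add synth_mult syn_def)
  qed
  fix v and z :: "real \<times> (real^'d)" assume v: "P v" and z: "z \<in> slab T"
  then have v: "smooth_periodic T v" "\<And>p. v (0, p) = synth (y 0) p"
    "\<And>z. z \<in> slab T ==> advected T eps k v z = synth (h (fst z)) (snd z) * v z + synth (g (fst z)) (snd z)"
    unfolding P by auto
  have t: "fst z \<in> {0..T}" using z by (auto simp: slab_def)
  have "fc v (fst z) = y (fst z)"
  proof (rule linear_unique[OF psi_pbdd[OF eps0] h _ smy _ y(2) _ t])
    show "smoothw (fc v t)" if "t \<in> {0..T}" for t
      using rd_smoothw[OF smf_rd[OF smooth_periodic_smf[OF v(1), of "{eps}"]] _ that] by simp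
    show "(fc v has_vector_derivative gen (psi k eps) (fc v t) + (h t * fc v t + g t)) (at t within {0..T})" if "t \<in> {0..T}" for t
    proof (rule pde_to_coef[OF v(1) T eps0 _ that])
      fix z :: "real \<times> (real^'d)" assume z: "z \<in> slab T"
      show "advected T eps k v z = synth (h (fst z) * fc v (fst z) + g (fst z)) (snd z)"
        using v(3)[OF z] syn_fc[OF v(1) z] by (simp add: synth_add synth_mult syn_def)
    qed
    show "fc v 0 = y 0"
    proof (rule synth_inject, rule ext)
      fix p
      have "(0, p) \<in> (slab T :: (real \<times> (real^'d)) set)" using T by (simp add: slab_def)
      from syn_fc[OF v(1) this] show "synth (fc v 0) p = synth (y 0) p" by (simp add: syn_def v(2))
    qed
  qed
  then show "v z = syn y z" using syn_fc[OF v(1) z] by (simp add: syn_def)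
qed

lemma b_star_exists:
  assumes \<nu>: "\<nu> \<in> T3 R"
  shows "\<exists>y. smf E T y \<and> (\<forall>eps\<in>E. y eps 0 = - b \<nu> eps 0 \<and> (\<forall>t\<in>{0..T}.
       (y eps has_vector_derivative gen (psi (kap kp \<nu>) eps) (y eps t) + dens eps t * y eps t) (at t within {0..T})) \<and>
     unique_solution T (b_star_solution lam kp R eps T (a eps) \<nu>) (syn (y eps)))"
proof -
  have "\<exists>y. smf E T y \<and> (\<forall>eps\<in>E. y eps 0 = - b \<nu> eps 0 \<and> (\<forall>t\<in>{0..T}.
     (y eps has_vector_derivative gen (psi (kap kp \<nu>) eps) (y eps t) + (dens eps t * y eps t + 0)) (at t within {0..T})))"
  proof (rule linear_existence[OF T smf_dens smf_0 psi_bound_ex[OF E]])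
    show "\<exists>C. \<forall>eps\<in>E. wle s (- b \<nu> eps 0) C" for s
      using rd_bound[OF smf_rd[OF smf_b[OF \<nu>]], of s] T wle_uminus by fastforce
  qed
  then obtain y where y: "smf E T y" "\<And>eps. eps \<in> E ==> y eps 0 = - b \<nu> eps 0"
    "\<And>eps t. eps \<in> E ==> t \<in> {0..T} ==> (y eps has_vector_derivative gen (psi (kap kp \<nu>) eps) (y eps t) + (dens eps t * y eps t + 0)) (at t within {0..T})"
    by blast
  have "unique_solution T (b_star_solution lam kp R eps T (a eps) \<nu>) (syn (y eps))" if eps: "eps \<in> E" for eps
  proof (rule linear_pde_unique[OF eps smf_continuous_on[OF smf_dens eps] smf_single[OF y(1) eps] y(3)[OF eps]])
    fix v
    have "- 2 * \<i> * of_real lam * (\<Sum>r\<in>{1..R}. of_real ((cmod (a eps r z))\<^sup>2)) = synth (dens eps (fst z)) (snd z)" for z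
      using dens_eq[of eps z "cst 1", unfolded synth_cst] by simp
    then show "b_star_solution lam kp R eps T (a eps) \<nu> v \<longleftrightarrow> smooth_periodic T v \<and> (\<forall>p. v (0, p) = synth (y eps 0) p) \<and>
      (\<forall>z\<in>slab T. advected T eps (kap kp \<nu>) v z = synth (dens eps (fst z)) (snd z) * v z + synth 0 (snd z))"
      unfolding b_star_solution_def y(2)[OF eps] b_mod_eq[OF \<nu>] by (simp add: synth_uminus syn_def)
  qed
  then show ?thesis using y by (intro exI[of _ y]) auto
qed

text \<open>Inserted into the singular linear equation, \<open>b\<close> leaves a residual
  \<open>g\<close> of order one, which is not small. Adding \<open>eps * c\<close> with
  \<open>c = g / (i delta)\<close> balances it against the singular term and leaves a residual of
  order \<open>eps\<close>; at time zero the error is \<open>eps * c\<close> as well.\<close>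

lemma b_linear_exists:
  assumes \<nu>: "\<nu> \<in> T3 R" and \<delta>: "delta kp \<nu> \<noteq> 0"
  shows "\<exists>y C. \<forall>eps\<in>E. unique_solution T (b_linear_solution kp eps T (a eps) \<nu>) (syn (y eps)) \<and>
    (\<forall>z\<in>slab T. cmod (b_mod kp (a eps) \<nu> z - syn (y eps) z) \<le> C * eps)"
proof -
  let ?d = "delta kp \<nu>" and ?k = "kap kp \<nu>"
  have bcub: "cub \<nu> eps t = cst (of_real ?d) * b \<nu> eps t" for eps t
    using \<delta> by (simp add: b_def cub_def bx_def mult.assoc[symmetric] cst_mult[symmetric] cst_1)
  \<comment> \<open>The coefficient \<open>delta / eps\<close> is not bounded in \<open>eps\<close>,
    so this problem is solved for one \<open>eps\<close> at a time. Uniformity enters only in the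
    distance to \<open>b\<close>.\<close>
  have "\<exists>y. smf {eps} T y \<and> (\<forall>eps'\<in>{eps}. y eps' 0 = b \<nu> eps 0 \<and> (\<forall>t\<in>{0..T}.
     (y eps' has_vector_derivative gen (psi ?k eps) (y eps' t) + (cst (\<i> * of_real (?d / eps)) * y eps' t + cst (- \<i> / of_real eps) * cub \<nu> eps t)) (at t within {0..T})))"
    if eps: "eps \<in> E" for eps
  proof (rule linear_existence[OF T])
    show "smf {eps} T (\<lambda>_ t. cst (\<i> * of_real (?d / eps)))" by (rule smf_cst[OF order_refl])
    show "smf {eps} T (\<lambda>_ t. cst (- \<i> / of_real eps) * cub \<nu> eps t)"
      by (intro smf_mult smf_single smf_cub \<nu> eps smf_cst[OF order_refl])
    show "\<exists>c\<ge>0. \<exists>m. \<forall>eps'\<in>{eps}. \<forall>n. \<bar>psi ?k eps n\<bar> \<le> c * wt n ^ m" using psi_bound_ex[of "{eps}" ?k] E[OF eps] by simp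
    show "\<exists>C. \<forall>eps'\<in>{eps}. wle s (b \<nu> eps 0) C" for s
      using rd_bound[OF smf_rd[OF smf_b[OF \<nu>]], of s] T eps by fastforce
  qed
  then have "\<forall>eps\<in>E. \<exists>y. smf {eps} T (\<lambda>_. y) \<and> y 0 = b \<nu> eps 0 \<and> (\<forall>t\<in>{0..T}.
     (y has_vector_derivative gen (psi ?k eps) (y t) + (cst (\<i> * of_real (?d / eps)) * y t + cst (- \<i> / of_real eps) * cub \<nu> eps t)) (at t within {0..T}))"
    using smf_cong[of "{_}" T _ "\<lambda>_. _"] by (metis singletonI singletonD)
  then obtain y where y: "\<And>eps. eps \<in> E ==> smf {eps} T (\<lambda>_. y eps)" "\<And>eps. eps \<in> E ==> y eps 0 = b \<nu> eps 0"
    "\<And>eps t. eps \<in> E ==> t \<in> {0..T} ==> (y eps has_vector_derivative gen (psi ?k eps) (y eps t) + (cst (\<i> * of_real (?d / eps)) * y eps t + cst (- \<i> / of_real eps) * cub \<nu> eps t)) (at t within {0..T})"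
    unfolding bchoice_iff by blast
  have uniq: "unique_solution T (b_linear_solution kp eps T (a eps) \<nu>) (syn (y eps))" if eps: "eps \<in> E" for eps
  proof (rule linear_pde_unique[OF eps continuous_on_const y(1)[OF eps] y(3)[OF eps]])
    fix v
    have *: "b_mod kp (a eps) \<nu> z = of_real (1 / ?d) * cubic (a eps) \<nu> z" for z by (simp add: b_mod_def)
    show "b_linear_solution kp eps T (a eps) \<nu> v \<longleftrightarrow> smooth_periodic T v \<and> (\<forall>p. v (0, p) = synth (y eps 0) p) \<and>
      (\<forall>z\<in>slab T. advected T eps ?k v z = synth (cst (\<i> * of_real (?d / eps))) (snd z) * v z + synth (cst (- \<i> / of_real eps) * cub \<nu> eps (fst z)) (snd z))"
      unfolding b_linear_solution_def y(2)[OF eps] *[symmetric] b_mod_eq[OF \<nu>] cubic_eq[OF \<nu>] using \<delta> by (auto simp: synth_mult syn_def bcub algebra_simps)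
  qed
  obtain g where g: "smf E T g" "\<And>eps t. eps \<in> E ==> t \<in> {0..T} ==>
    (b \<nu> eps has_vector_derivative gen (psi ?k eps) (b \<nu> eps t) + g eps t) (at t within {0..T})"
    using smf_residual[OF smf_b[OF \<nu>] T psi_bound_ex[OF E]] by blast
  \<comment> \<open>The first-order corrector: \<open>i delta c = g\<close>, so the singular term
    acting on \<open>eps * c\<close> cancels the residual of \<open>b\<close>.\<close>
  define c where "c eps t = cst (1 / (\<i> * of_real ?d)) * g eps t" for eps t
  have smc: "smf E T c" unfolding c_def[abs_def] by (intro smf_mult smf_cst[OF order_refl] g)
  obtain g2 where g2: "smf E T g2" "\<And>eps t. eps \<in> E ==> t \<in> {0..T} ==>
    (c eps has_vector_derivative gen (psi ?k eps) (c eps t) + g2 eps t) (at t within {0..T})"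
    using smf_residual[OF smc T psi_bound_ex[OF E]] by blast
  obtain C1 where C1: "0 \<le> C1" "\<And>eps t. eps \<in> E ==> t \<in> {0..T} ==> norm (c eps t) \<le> C1"
    using rd_bound[OF smf_rd[OF smc], of 0] by (auto simp: wle_0_iff)
  obtain C2 where C2: "0 \<le> C2" "\<And>eps t. eps \<in> E ==> t \<in> {0..T} ==> norm (g2 eps t) \<le> C2"
    using rd_bound[OF smf_rd[OF g2(1)], of 0] by (auto simp: wle_0_iff)
  have est: "norm (b \<nu> eps t + cst (of_real eps) * c eps t - y eps t) \<le> 2 * (eps * C1 + (eps * C2) * T) * exp ((2 * 0 + 1) * t)"
    if eps: "eps \<in> E" and t: "t \<in> {0..T}" for eps t
  proof -
    have eps0: "0 < eps" using E[OF eps] by simp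
    let ?q = "\<lambda>t. b \<nu> eps t + cst (of_real eps) * c eps t - y eps t"
    have smy: "smoothw (y eps t)" if "t \<in> {0..T}" for t using rd_smoothw[OF smf_rd[OF y(1)[OF eps]] _ that] by simp
    \<comment> \<open>The singular term is included in the real symbol of the flow, where it affects
      no norm. Treated as a forcing it would produce an exponential of
      \<open>1 / eps\<close>.\<close>
    have pb: "pbdd (\<lambda>n. of_real (psi ?k eps n + ?d / eps))"
    proof -
      have "\<bar>psi ?k eps n + ?d / eps\<bar> \<le> (psic ?k + \<bar>?d / eps\<bar>) * wt n ^ 2" for n
      proof -
        have "\<bar>psi ?k eps n + ?d / eps\<bar> \<le> \<bar>psi ?k eps n\<bar> + \<bar>?d / eps\<bar>" by (rule abs_triangle_ineq)
        also have "\<bar>psi ?k eps n\<bar> \<le> psic ?k * wt n ^ 2" using psi_le[of eps ?k n] E[OF eps] by simp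
        also have "\<bar>?d / eps\<bar> \<le> \<bar>?d / eps\<bar> * wt n ^ 2" using one_le_power[OF wt_ge_1[of n], of 2] mult_left_mono[of 1 "wt n ^ 2" "\<bar>?d / eps\<bar>"] by simp
        finally show ?thesis by (simp add: algebra_simps)
      qed
      then show ?thesis by (intro pbddI[of _ "psic ?k + \<bar>?d / eps\<bar>" 2]) (auto simp del: of_real_add simp: psic_nonneg)
    qed
    show ?thesis
    proof (rule energy_estimate[where I = "{()}" and x = "\<lambda>_. ?q" and \<psi> = "\<lambda>_ n. psi ?k eps n + ?d / eps" and g = "\<lambda>_ t. cst (of_real eps) * g2 eps t"])
      fix t assume t: "t \<in> {0..T}"
      note sms = smf_smoothw[OF smf_b[OF \<nu>] eps t] smf_smoothw[OF smc eps t] smy[OF t]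
      show smq: "smoothw (?q t)"
        by (intro smoothw_diff smoothw_add smoothw_mult smoothw_cst sms)
      have eq: "gen (\<lambda>n. psi ?k eps n + ?d / eps) (?q t) + cst (of_real eps) * g2 eps t =
        (gen (psi ?k eps) (b \<nu> eps t) + g eps t) + cst (of_real eps) * (gen (psi ?k eps) (c eps t) + g2 eps t)
         - (gen (psi ?k eps) (y eps t) + (cst (\<i> * of_real (?d / eps)) * y eps t + cst (- \<i> / of_real eps) * cub \<nu> eps t))"
      proof (rule wien_eqI)
        fix n
        have cg: "coef (g eps t) n = \<i> * of_real ?d * coef (c eps t) n" using \<delta> by (simp add: c_def)
        show "coef (gen (\<lambda>n. psi ?k eps n + ?d / eps) (?q t) + cst (of_real eps) * g2 eps t) n = coef ((gen (psi ?k eps) (b \<nu> eps t) + g eps t) + cst (of_real eps) * (gen (psi ?k eps) (c eps t) + g2 eps t)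
         - (gen (psi ?k eps) (y eps t) + (cst (\<i> * of_real (?d / eps)) * y eps t + cst (- \<i> / of_real eps) * cub \<nu> eps t))) n"
          unfolding bcub
          by (simp only: coef_plus coef_minus coef_cst_mult coef_gen[OF pb smq] coef_gen[OF psi_pbdd[OF eps0] sms(1)]
              coef_gen[OF psi_pbdd[OF eps0] sms(2)] coef_gen[OF psi_pbdd[OF eps0] sms(3)] cg)
             (use eps0 in \<open>simp add: field_simps\<close>)
      qed
      show "(?q has_vector_derivative gen (\<lambda>n. psi ?k eps n + ?d / eps) (?q t) + cst (of_real eps) * g2 eps t) (at t within {0..T})"
        unfolding eq unfolding scaleR_eq_cst[symmetric]
        by (intro has_vector_derivative_diff has_vector_derivative_add g(2) y(3)[unfolded scaleR_eq_cst[symmetric]] eps t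
            bounded_linear.has_vector_derivative[OF bounded_linear_scaleR_right g2(2)])
      show "norm (cst (of_real eps) * g2 eps t) \<le> 0 * V + eps * C2" for V
        using C2(2)[OF eps t] eps0 by (simp add: scaleR_eq_cst[symmetric])
    next
      show "norm (?q 0) \<le> eps * C1"
        using C1(2)[OF eps, of 0] eps0 T y(2)[OF eps] by (simp add: scaleR_eq_cst[symmetric])
    qed (use pb C1 C2 eps0 t in auto)
  qed
  have "cmod (b_mod kp (a eps) \<nu> z - syn (y eps) z) \<le> (2 * (C1 + C2 * T) * exp T + C1) * eps" if eps: "eps \<in> E" and z: "z \<in> slab T" for eps z
  proof -
    have eps0: "0 < eps" using E[OF eps] by simp
    have t: "fst z \<in> {0..T}" using z by (auto simp: slab_def)
    have "cmod (b_mod kp (a eps) \<nu> z - syn (y eps) z) \<le> norm (b \<nu> eps (fst z) - y eps (fst z))"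
      unfolding b_mod_eq[OF \<nu>] syn_def synth_diff[symmetric] by (rule norm_synth_le)
    also have "\<dots> = norm ((b \<nu> eps (fst z) + cst (of_real eps) * c eps (fst z) - y eps (fst z)) - eps *\<^sub>R c eps (fst z))"
      by (simp add: scaleR_eq_cst)
    also have "\<dots> \<le> norm (b \<nu> eps (fst z) + cst (of_real eps) * c eps (fst z) - y eps (fst z)) + norm (eps *\<^sub>R c eps (fst z))"
      by (rule norm_triangle_ineq4)
    also have "norm (eps *\<^sub>R c eps (fst z)) \<le> eps * C1" using C1(2)[OF eps t] eps0 by simp
    also have "norm (b \<nu> eps (fst z) + cst (of_real eps) * c eps (fst z) - y eps (fst z)) \<le> 2 * (eps * C1 + (eps * C2) * T) * exp ((2 * 0 + 1) * fst z)"
      by (rule est[OF eps t])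
    also have "\<dots> \<le> 2 * (eps * C1 + (eps * C2) * T) * exp T"
      using t C1(1) C2(1) eps0 T by (intro mult_left_mono) auto
    finally show ?thesis by (simp add: algebra_simps)
  qed
  then show ?thesis using uniq by blast
qed

end

section \<open>Plane waves\<close>

text \<open>For \<open>k\<close> in \<open>lat eps\<close> the carrier wave with wave vector
  \<open>k / eps\<close> is periodic and hence a single Fourier mode. The floor in
  \<open>carr\<close> is then exact and only serves to make the definition total.\<close>

definition lat :: "real \<Rightarrow> (real^'d) set" where "lat eps = {k. \<forall>j. k $ j / eps \<in> \<int>}"
definition carr :: "real \<Rightarrow> real^'d \<Rightarrow> int^'d" where "carr eps k = (\<chi> j. \<lfloor>k $ j / eps\<rfloor>)"
definition wv :: "real^'d \<Rightarrow> real \<Rightarrow> real \<Rightarrow> real \<Rightarrow> 'd::finite wien" where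
  "wv k w eps t = single (carr eps k) (cis (- (w * t / eps)))"

lemma lat_add: "k \<in> lat eps ==> l \<in> lat eps ==> k + l \<in> lat eps"
  and lat_diff: "k \<in> lat eps ==> l \<in> lat eps ==> k - l \<in> lat eps"
  by (simp_all add: lat_def add_divide_distrib diff_divide_distrib)

lemma of_int_carr: "k \<in> lat eps ==> of_int (carr eps k $ j) = k $ j / eps"
  by (simp add: lat_def carr_def)

lemma carr_add: "k \<in> lat eps ==> l \<in> lat eps ==> carr eps (k + l) = carr eps k + carr eps l"
  and carr_diff: "k \<in> lat eps ==> l \<in> lat eps ==> carr eps (k - l) = carr eps k - carr eps l"
proof -
  assume k: "k \<in> lat eps" and l: "l \<in> lat eps"
  have "(of_int (carr eps (k + l) $ j) :: real) = of_int ((carr eps k + carr eps l) $ j)"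
    "(of_int (carr eps (k - l) $ j) :: real) = of_int ((carr eps k - carr eps l) $ j)" for j
    by (simp_all add: of_int_carr k l lat_add lat_diff add_divide_distrib diff_divide_distrib)
  then show "carr eps (k + l) = carr eps k + carr eps l" "carr eps (k - l) = carr eps k - carr eps l"
    unfolding of_int_eq_iff vec_eq_iff by auto
qed

lemma dotp_carr: "k \<in> lat eps ==> dotp (carr eps k) p = (k \<bullet> p) / eps"
  by (simp add: dotp_def of_int_carr inner_vec_def sum_divide_distrib)

lemma synth_wv: "k \<in> lat eps ==> synth (wv k w eps t) p = wave eps k w (t, p)"
  by (simp add: wv_def synth_single dotp_carr wave_def cis_mult diff_divide_distrib)

lemma norm_wv [simp]: "norm (wv k w eps t) = 1" by (simp add: wv_def)

lemma smoothw_wv: "smoothw (wv k w eps t)" unfolding wv_def by (rule smoothw_single)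

lemma wv_combine:
  assumes "k \<in> lat eps" "p \<in> lat eps" "q \<in> lat eps"
  shows "star (wv p wp eps t) * wv q wq eps t * wv k w eps t = wv (k - p + q) (w - wp + wq) eps t"
proof -
  have "carr eps (k - p + q) = - carr eps p + carr eps q + carr eps k"
    using assms by (simp add: carr_add carr_diff lat_diff)
  moreover have "cis (wp * t / eps) * cis (- (wq * t / eps)) * cis (- (w * t / eps)) = cis (- ((w - wp + wq) * t / eps))"
    unfolding cis_mult by (rule arg_cong[where f = cis]) (simp add: algebra_simps add_divide_distrib diff_divide_distrib)
  ultimately show ?thesis
    by (simp only: wv_def star_single single_mult cis_cnj minus_minus)
qed

lemma psi_0: "psi 0 eps n = - (eps * sq n / 2)" by (simp add: psi_def dotp_def)

text \<open>Expanding the square of \<open>n + k / eps\<close> gives the free dispersion of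
  \<open>n\<close>, the transport term with velocity \<open>k\<close>, and the constant
  \<open>omega k / eps\<close>. Thus a carrier wave turns the free Schroedinger operator into the
  advected one.\<close>

lemma psi_shift:
  assumes k: "k \<in> lat eps" and eps: "0 < eps"
  shows "psi 0 eps (n + carr eps k) = psi k eps n - omega k / eps"
proof -
  have "sq (n + carr eps k) = (\<Sum>j\<in>UNIV. (of_int (n $ j))\<^sup>2 + 2 * (of_int (n $ j) * k $ j) / eps + (k $ j)\<^sup>2 / eps\<^sup>2)"
    unfolding sq_def by (rule sum.cong) (use eps in \<open>simp_all add: of_int_carr[OF k] power2_eq_square field_simps\<close>)
  also have "\<dots> = sq n + 2 * dotp n k / eps + (norm k)\<^sup>2 / eps\<^sup>2"
  proof -
    have "(norm k)\<^sup>2 = (\<Sum>j\<in>UNIV. (k $ j)\<^sup>2)" using power2_norm_eq_inner[of k] by (simp add: inner_vec_def power2_eq_square)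
    then show ?thesis by (simp add: sum.distrib sq_def dotp_def sum_distrib_left sum_divide_distrib)
  qed
  finally show ?thesis unfolding psi_0 unfolding psi_def omega_def using eps by (simp add: power2_eq_square field_simps)
qed

lemma coef_mult_wv: "coef (x * wv k w eps t) n = cis (- (w * t / eps)) * coef x (n - carr eps k)"
  by (simp add: wv_def mult.commute[of x] coef_single_mult)

lemma gen_wv:
  assumes k: "k \<in> lat eps" and eps: "0 < eps" and x: "smoothw x"
  shows "gen (psi 0 eps) (x * wv k w eps t) = (gen (psi k eps) x - cst (\<i> * of_real (omega k / eps)) * x) * wv k w eps t"
proof (rule wien_eqI)
  fix n
  have sm: "smoothw (x * wv k w eps t)" by (intro smoothw_mult x smoothw_wv)
  have "psi 0 eps n = psi k eps (n - carr eps k) - omega k / eps" using psi_shift[OF k eps, of "n - carr eps k"] by simp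
  then show "coef (gen (psi 0 eps) (x * wv k w eps t)) n = coef ((gen (psi k eps) x - cst (\<i> * of_real (omega k / eps)) * x) * wv k w eps t) n"
    by (simp only: coef_gen[OF psi_pbdd[OF eps] sm] coef_mult_wv coef_minus coef_cst_mult coef_gen[OF psi_pbdd[OF eps] x])
       (simp add: algebra_simps)
qed

lemma wv_has_vector_derivative:
  "((\<lambda>t. wv k w eps t) has_vector_derivative cst (- (\<i> * of_real (w / eps))) * wv k w eps t) (at t within S)"
proof -
  have bl: "bounded_linear (single (carr eps k) :: complex \<Rightarrow> 'a wien)"
    by (rule bounded_linear_intro[where K = 1]) (simp_all add: single_add, rule wien_eqI, simp add: coef_single)
  have "((\<lambda>t. cis (- (w * t / eps))) has_vector_derivative - (\<i> * of_real (w / eps)) * cis (- (w * t / eps))) (at t within S)"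
  proof -
    have "((\<lambda>z. exp (c * z)) has_field_derivative c * exp (c * of_real t)) (at (of_real t))" for c :: complex
      by (auto intro!: derivative_eq_intros)
    from has_vector_derivative_real_field[OF this[of "- (\<i> * of_real (w / eps))"], of S] show ?thesis by (simp add: cis_conv_exp mult_ac)
  qed
  from bounded_linear.has_vector_derivative[OF bl this] show ?thesis
    by (simp add: wv_def cst_def single_mult)
qed

text \<open>A modulated wave on the dispersion relation, \<open>w = omega k\<close>, evolves freely
  up to the source of its amplitude. Otherwise the frequency defect divided by \<open>eps\<close>
  appears as an additional source; this is what correctors make use of.\<close>

lemma mode_derivative:
  assumes k: "k \<in> lat eps" and eps: "0 < eps" and y: "smoothw (y t)"
    and d: "(y has_vector_derivative gen (psi k eps) (y t) + g) (at t within S)"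
  shows "((\<lambda>t. y t * wv k w eps t) has_vector_derivative
     gen (psi 0 eps) (y t * wv k w eps t) + (g + cst (\<i> * of_real ((omega k - w) / eps)) * y t) * wv k w eps t) (at t within S)"
proof -
  have "y t * (cst (- (\<i> * of_real (w / eps))) * wv k w eps t) + (gen (psi k eps) (y t) + g) * wv k w eps t =
    gen (psi 0 eps) (y t * wv k w eps t) + (g + cst (\<i> * of_real ((omega k - w) / eps)) * y t) * wv k w eps t"
    unfolding gen_wv[OF k eps y] by (simp add: algebra_simps diff_divide_distrib cst_diff cst_uminus of_real_diff)
  then show ?thesis using has_vector_derivative_mult[OF d wv_has_vector_derivative[of k w eps t S]] by simp
qed

lemma gen_add: "pbdd (\<lambda>n. of_real (\<psi> n)) ==> smoothw x ==> smoothw y ==> gen \<psi> (x + y) = gen \<psi> x + gen \<psi> y"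
  unfolding gen_def by (rule mulop_add[OF pbdd_i])

lemma gen_cst_mult: "pbdd (\<lambda>n. of_real (\<psi> n)) ==> smoothw x ==> gen \<psi> (cst c * x) = cst c * gen \<psi> x"
  by (rule wien_eqI) (simp add: coef_gen smoothw_mult smoothw_cst)

section \<open>Oscillating terms of order one\<close>

context modulation
begin

text \<open>Only the unweighted norm is bounded uniformly. The weighted norms of a carrier wave grow
  with \<open>1 / eps\<close>, so smoothness is asked for each \<open>eps\<close>
  separately.\<close>

definition ok :: "(real \<Rightarrow> real \<Rightarrow> 'd wien) \<Rightarrow> bool" where
  "ok F \<longleftrightarrow> (\<forall>eps\<in>E. \<forall>t\<in>{0..T}. smoothw (F eps t)) \<and> (\<exists>c. \<forall>eps\<in>E. \<forall>t\<in>{0..T}. norm (F eps t) \<le> c)"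

text \<open>The free Schroedinger equation with source \<open>G\<close>.\<close>

definition dd :: "(real \<Rightarrow> real \<Rightarrow> 'd wien) \<Rightarrow> (real \<Rightarrow> real \<Rightarrow> 'd wien) \<Rightarrow> bool" where
  "dd F G \<longleftrightarrow> (\<forall>eps\<in>E. \<forall>t\<in>{0..T}. smoothw (F eps t) \<and>
     (F eps has_vector_derivative gen (psi 0 eps) (F eps t) + G eps t) (at t within {0..T}))"

text \<open>A term of order one in the residual that oscillates off the dispersion relation is removed by a
  corrector \<open>C\<close> of relative size \<open>eps\<close>.\<close>

definition osc :: "(real \<Rightarrow> real \<Rightarrow> 'd wien) \<Rightarrow> bool" where
  "osc F \<longleftrightarrow> (\<exists>C G. ok C \<and> ok G \<and> dd C (\<lambda>eps t. G eps t - cst (1 / of_real eps) * F eps t))"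

lemma ok_smoothw: "ok F ==> eps \<in> E ==> t \<in> {0..T} ==> smoothw (F eps t)" by (simp add: ok_def)

lemma ok_bound: assumes "ok F" obtains c where "0 \<le> c" "\<And>eps t. eps \<in> E ==> t \<in> {0..T} ==> norm (F eps t) \<le> c"
proof -
  obtain c where "\<forall>eps\<in>E. \<forall>t\<in>{0..T}. norm (F eps t) \<le> c" using assms by (auto simp: ok_def)
  then show thesis by (intro that[of "\<bar>c\<bar>"]) (auto intro: order_trans[OF _ abs_ge_self])
qed

lemma okI: "(\<And>eps t. eps \<in> E ==> t \<in> {0..T} ==> smoothw (F eps t)) ==> (\<And>eps t. eps \<in> E ==> t \<in> {0..T} ==> norm (F eps t) \<le> c) ==> ok F"
  unfolding ok_def by blast

lemma ok_add: assumes F: "ok F" and G: "ok G" shows "ok (\<lambda>eps t. F eps t + G eps t)"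
proof -
  obtain c where c: "0 \<le> c" "\<And>eps t. eps \<in> E ==> t \<in> {0..T} ==> norm (F eps t) \<le> c" using ok_bound[OF F] by blast
  obtain d where d: "0 \<le> d" "\<And>eps t. eps \<in> E ==> t \<in> {0..T} ==> norm (G eps t) \<le> d" using ok_bound[OF G] by blast
  show ?thesis by (rule okI[where c = "c + d"]) (simp_all add: smoothw_add ok_smoothw[OF F] ok_smoothw[OF G] norm_triangle_mono c d)
qed

lemma ok_mult: assumes F: "ok F" and G: "ok G" shows "ok (\<lambda>eps t. F eps t * G eps t)"
proof -
  obtain c where c: "0 \<le> c" "\<And>eps t. eps \<in> E ==> t \<in> {0..T} ==> norm (F eps t) \<le> c" using ok_bound[OF F] by blast
  obtain d where d: "0 \<le> d" "\<And>eps t. eps \<in> E ==> t \<in> {0..T} ==> norm (G eps t) \<le> d" using ok_bound[OF G] by blast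
  show ?thesis
  proof (rule okI[where c = "c * d"])
    fix eps t assume *: "eps \<in> E" "t \<in> {0..T}"
    show "smoothw (F eps t * G eps t)" by (rule smoothw_mult[OF ok_smoothw[OF F *] ok_smoothw[OF G *]])
    have "norm (F eps t * G eps t) \<le> norm (F eps t) * norm (G eps t)" by (rule norm_mult_ineq)
    also have "\<dots> \<le> c * d" by (intro mult_mono c d *) simp
    finally show "norm (F eps t * G eps t) \<le> c * d" .
  qed
qed

lemma ok_star: assumes F: "ok F" shows "ok (\<lambda>eps t. star (F eps t))"
  using F by (auto simp: ok_def smoothw_star)

lemma ok_cst: "(\<And>eps. eps \<in> E ==> norm (c eps) \<le> B) ==> ok (\<lambda>eps t. cst (c eps))"
  by (rule okI[where c = B]) (auto simp: smoothw_cst)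

lemma ok_eps: "ok (\<lambda>eps t. cst (of_real eps))"
  by (rule ok_cst[where B = 1]) (use E in force)

lemma ok_wv: "ok (wv k w)" by (rule okI[where c = 1]) (simp_all add: smoothw_wv)

lemma ok_smf: assumes "smf E T F" shows "ok F"
  using rd_bound[OF smf_rd[OF assms], of 0] smf_smoothw[OF assms] by (auto simp: ok_def wle_0_iff)

lemma ok_sum: "(\<And>a. a \<in> A ==> ok (F a)) ==> ok (\<lambda>eps t. \<Sum>a\<in>A. F a eps t)"
proof (induction A rule: infinite_finite_induct)
  case (insert a A)
  have "ok (\<lambda>eps t. F a eps t + (\<Sum>a\<in>A. F a eps t))" by (rule ok_add) (use insert in auto)
  then show ?case using insert.hyps by simp
qed (simp_all add: okI[where c = 0])

lemma dd_cong: "dd F G ==> (\<And>eps t. eps \<in> E ==> t \<in> {0..T} ==> G eps t = G' eps t) ==> dd F G'"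
  by (simp add: dd_def)

lemma dd_add: "dd F G ==> dd F' G' ==> dd (\<lambda>eps t. F eps t + F' eps t) (\<lambda>eps t. G eps t + G' eps t)"
  unfolding dd_def
proof (intro ballI conjI)
  fix eps t assume *: "\<forall>eps\<in>E. \<forall>t\<in>{0..T}. smoothw (F eps t) \<and> (F eps has_vector_derivative gen (psi 0 eps) (F eps t) + G eps t) (at t within {0..T})"
    "\<forall>eps\<in>E. \<forall>t\<in>{0..T}. smoothw (F' eps t) \<and> (F' eps has_vector_derivative gen (psi 0 eps) (F' eps t) + G' eps t) (at t within {0..T})"
    and eps: "eps \<in> E" and t: "t \<in> {0..T}"
  have s: "smoothw (F eps t)" "smoothw (F' eps t)" using * eps t by auto
  then show "smoothw (F eps t + F' eps t)" by (rule smoothw_add)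
  have "gen (psi 0 eps) (F eps t + F' eps t) = gen (psi 0 eps) (F eps t) + gen (psi 0 eps) (F' eps t)"
    by (rule gen_add[OF psi_pbdd s]) (use E[OF eps] in simp)
  then have "gen (psi 0 eps) (F eps t + F' eps t) + (G eps t + G' eps t) = (gen (psi 0 eps) (F eps t) + G eps t) + (gen (psi 0 eps) (F' eps t) + G' eps t)" by simp
  then show "((\<lambda>t. F eps t + F' eps t) has_vector_derivative gen (psi 0 eps) (F eps t + F' eps t) + (G eps t + G' eps t)) (at t within {0..T})"
    using * eps t by (simp only:) (rule has_vector_derivative_add; blast)
qed

lemma dd_0: "dd (\<lambda>_ _. 0) (\<lambda>_ _. 0)"
proof -
  have "gen (psi 0 eps) 0 = (0 :: 'd wien)" if "eps \<in> E" for eps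
    using E[OF that] by (intro wien_eqI) (simp add: coef_gen psi_pbdd)
  then show ?thesis by (simp add: dd_def)
qed

lemma dd_sum: "(\<And>a. a \<in> A ==> dd (F a) (G a)) ==> dd (\<lambda>eps t. \<Sum>a\<in>A. F a eps t) (\<lambda>eps t. \<Sum>a\<in>A. G a eps t)"
proof (induction A rule: infinite_finite_induct)
  case (insert a A)
  have "dd (\<lambda>eps t. F a eps t + (\<Sum>a\<in>A. F a eps t)) (\<lambda>eps t. G a eps t + (\<Sum>a\<in>A. G a eps t))"
    by (rule dd_add) (use insert in auto)
  then show ?case using insert.hyps by simp
qed (simp_all add: dd_0)

lemma dd_scale: "dd F G ==> dd (\<lambda>eps t. cst (c eps) * F eps t) (\<lambda>eps t. cst (c eps) * G eps t)"
  unfolding dd_def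
proof (intro ballI conjI)
  fix eps t assume *: "\<forall>eps\<in>E. \<forall>t\<in>{0..T}. smoothw (F eps t) \<and> (F eps has_vector_derivative gen (psi 0 eps) (F eps t) + G eps t) (at t within {0..T})"
    and eps: "eps \<in> E" and t: "t \<in> {0..T}"
  have s: "smoothw (F eps t)" using * eps t by auto
  then show "smoothw (cst (c eps) * F eps t)" by (intro smoothw_mult smoothw_cst)
  have "gen (psi 0 eps) (cst (c eps) * F eps t) = cst (c eps) * gen (psi 0 eps) (F eps t)"
    by (rule gen_cst_mult[OF psi_pbdd s]) (use E[OF eps] in simp)
  then have "gen (psi 0 eps) (cst (c eps) * F eps t) + cst (c eps) * G eps t = cst (c eps) * (gen (psi 0 eps) (F eps t) + G eps t)"
    by (simp add: distrib_left)
  then show "((\<lambda>t. cst (c eps) * F eps t) has_vector_derivative gen (psi 0 eps) (cst (c eps) * F eps t) + cst (c eps) * G eps t) (at t within {0..T})"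
    using * eps t by (simp only:) (rule has_vector_derivative_mult_right; blast)
qed

lemma dd_mode:
  assumes k: "\<And>eps. eps \<in> E ==> k \<in> lat eps" and y: "smf E T y"
    and d: "\<And>eps t. eps \<in> E ==> t \<in> {0..T} ==> (y eps has_vector_derivative gen (psi k eps) (y eps t) + g eps t) (at t within {0..T})"
  shows "dd (\<lambda>eps t. y eps t * wv k w eps t) (\<lambda>eps t. (g eps t + cst (\<i> * of_real ((omega k - w) / eps)) * y eps t) * wv k w eps t)"
  unfolding dd_def
  by (intro ballI conjI mode_derivative smoothw_mult smoothw_wv smf_smoothw[OF y] k d) (use E in auto)

lemma osc_cong: "osc F ==> (\<And>eps t. eps \<in> E ==> t \<in> {0..T} ==> F eps t = F' eps t) ==> osc F'"
  unfolding osc_def by (elim exE conjE) (intro exI conjI, assumption, assumption, erule dd_cong, simp)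

lemma osc_0: "osc (\<lambda>_ _. 0)"
  unfolding osc_def by (rule exI[of _ "\<lambda>_ _. 0"], rule exI[of _ "\<lambda>_ _. 0"]) (simp add: dd_0 okI[where c = 0])

lemma osc_add: assumes "osc F" "osc F'" shows "osc (\<lambda>eps t. F eps t + F' eps t)"
proof -
  obtain C G C' G' where *: "ok C" "ok G" "dd C (\<lambda>eps t. G eps t - cst (1 / of_real eps) * F eps t)"
    "ok C'" "ok G'" "dd C' (\<lambda>eps t. G' eps t - cst (1 / of_real eps) * F' eps t)" using assms unfolding osc_def by blast
  have "dd (\<lambda>eps t. C eps t + C' eps t) (\<lambda>eps t. (G eps t + G' eps t) - cst (1 / of_real eps) * (F eps t + F' eps t))"
    by (rule dd_cong[OF dd_add[OF *(3,6)]]) (simp add: algebra_simps)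
  then show ?thesis unfolding osc_def using ok_add[OF *(1,4)] ok_add[OF *(2,5)] by blast
qed

lemma osc_scale: assumes "osc F" shows "osc (\<lambda>eps t. cst c * F eps t)"
proof -
  obtain C G where *: "ok C" "ok G" "dd C (\<lambda>eps t. G eps t - cst (1 / of_real eps) * F eps t)" using assms unfolding osc_def by blast
  have "dd (\<lambda>eps t. cst c * C eps t) (\<lambda>eps t. cst c * G eps t - cst (1 / of_real eps) * (cst c * F eps t))"
    by (rule dd_cong[OF dd_scale[OF *(3)]]) (simp add: algebra_simps)
  moreover have "ok (\<lambda>eps t. cst c * C eps t)" "ok (\<lambda>eps t. cst c * G eps t)"
    by (rule ok_mult[OF ok_cst[OF order_refl]], rule *)+
  ultimately show ?thesis unfolding osc_def by blast
qed

lemma osc_sum: "(\<And>a. a \<in> A ==> osc (F a)) ==> osc (\<lambda>eps t. \<Sum>a\<in>A. F a eps t)"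
proof (induction A rule: infinite_finite_induct)
  case (insert a A)
  have "osc (\<lambda>eps t. F a eps t + (\<Sum>a\<in>A. F a eps t))" by (rule osc_add) (use insert in auto)
  then show ?case using insert.hyps by simp
qed (simp_all add: osc_0)

text \<open>An integration by parts in time: dividing the amplitude by
  \<open>i (w - omega k)\<close> gives a wave whose frequency defect produces exactly
  \<open>- 1 / eps\<close> times the term, up to the bounded residual of the new amplitude.\<close>

lemma osc_mode:
  assumes k: "\<And>eps. eps \<in> E ==> k \<in> lat eps" and f: "smf E T f" and w: "w \<noteq> omega k"
  shows "osc (\<lambda>eps t. f eps t * wv k w eps t)"
proof -
  define c where "c eps t = cst (1 / (\<i> * of_real (w - omega k))) * f eps t" for eps t
  have smc: "smf E T c" unfolding c_def[abs_def] by (intro smf_mult smf_cst[OF order_refl] f)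
  obtain g where g: "smf E T g" "\<And>eps t. eps \<in> E ==> t \<in> {0..T} ==>
    (c eps has_vector_derivative gen (psi k eps) (c eps t) + g eps t) (at t within {0..T})"
    using smf_residual[OF smc T psi_bound_ex[OF E]] by blast
  have "dd (\<lambda>eps t. c eps t * wv k w eps t) (\<lambda>eps t. g eps t * wv k w eps t - cst (1 / of_real eps) * (f eps t * wv k w eps t))"
  proof (rule dd_cong[OF dd_mode[OF k smc g(2)]])
    fix eps t assume "eps \<in> E"
    then have "eps \<noteq> 0" using E by force
    then have "\<i> * of_real ((omega k - w) / eps) * (1 / (\<i> * of_real (w - omega k))) = - (1 / of_real eps :: complex)"
      using w by (simp add: field_simps flip: of_real_diff)
    then have "cst (\<i> * of_real ((omega k - w) / eps)) * c eps t = - (cst (1 / of_real eps) * f eps t)"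
      unfolding c_def mult.assoc[symmetric] cst_mult[symmetric] by (simp only: cst_uminus mult_minus_left)
    then show "(g eps t + cst (\<i> * of_real ((omega k - w) / eps)) * c eps t) * wv k w eps t = g eps t * wv k w eps t - cst (1 / of_real eps) * (f eps t * wv k w eps t)"
      by (simp add: algebra_simps)
  qed
  then show ?thesis unfolding osc_def using ok_mult[OF ok_smf[OF smc] ok_wv[of k w]] ok_mult[OF ok_smf[OF g(1)] ok_wv[of k w]] by blast
qed

end

section \<open>The modulated Fourier expansion as an approximate solution\<close>

lemma kap_eq: "kap kp (i, j, k) = kp i - kp j + kp k"
  and omeg_eq: "omeg kp (i, j, k) = omega (kp i) - omega (kp j) + omega (kp k)"
  by (simp_all add: kap_def omeg_def wave_sum_def freq_sum_def)

lemma resonant_waves_iff: "resonant (waves kp \<nu>) \<longleftrightarrow> omeg kp \<nu> = omega (kap kp \<nu>)"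
  by (simp add: resonant_def omeg_def kap_def)

lemma sum_waves1:
  "wave_sum (waves kp \<nu> @ [p, q]) = kap kp \<nu> - p + q"
  "freq_sum (waves kp \<nu> @ [p, q]) = omeg kp \<nu> - omega p + omega q"
  by (cases \<nu>; simp add: kap_def omeg_def wave_sum_def freq_sum_def)+

lemma sum_waves2:
  "wave_sum ([p] @ waves kp \<nu> @ [q]) = p - kap kp \<nu> + q"
  "freq_sum ([p] @ waves kp \<nu> @ [q]) = omega p - omeg kp \<nu> + omega q"
  by (cases \<nu>; simp add: kap_def omeg_def wave_sum_def freq_sum_def)+

lemma nonres_iff: "\<nu> \<in> nonres kp R \<longleftrightarrow> \<nu> \<in> T3 R \<and> \<not> resonant (waves kp \<nu>)"
  by (cases \<nu>) (auto simp: nonres_def T3_def)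

lemma delta_nonzero: "\<nu> \<in> nonres kp R ==> delta kp \<nu> \<noteq> 0"
  by (simp add: nonres_iff resonant_waves_iff delta_def omeg_star_def)

lemma augmentI:
  assumes "{x, y, z} \<subseteq> K"
  shows "resonant [x, y, z] ==> wave_sum [x, y, z] \<in> augment K"
    "p \<in> K ==> q \<in> K ==> \<not> resonant [x, y, z] ==> resonant [x, y, z, p, q] ==> wave_sum [x, y, z, p, q] \<in> augment K"
    "p \<in> K ==> q \<in> K ==> \<not> resonant [x, y, z] ==> resonant [p, x, y, z, q] ==> wave_sum [p, x, y, z, q] \<in> augment K"
  using assms unfolding augment_def by blast+

section \<open>Consequences of saturation and nonresonance\<close>

locale wkb = modulation lam kp R T E x
  for lam :: real and kp :: "nat \<Rightarrow> real^'d::finite" and R T E and x :: "real \<Rightarrow> nat \<Rightarrow> real \<Rightarrow> 'd wien" +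
  assumes lat: "\<And>eps r. eps \<in> E ==> r \<in> {1..R} ==> kp r \<in> lat eps"
    and inj: "inj_on kp {1..R}" and sat: "augment (kp ` {1..R}) \<subseteq> kp ` {1..R}" and nonr: "nonresonance kp R"
begin

abbreviation "N \<equiv> nonres kp R"
abbreviation "\<omega> r \<equiv> omega (kp r)"
abbreviation "I \<equiv> N \<times> {1..R} \<times> {1..R}"
abbreviation "k1 s \<equiv> kap kp (fst s) - kp (fst (snd s)) + kp (snd (snd s))"
abbreviation "k2 s \<equiv> kp (fst (snd s)) - kap kp (fst s) + kp (snd (snd s))"
abbreviation "w1 z s \<equiv> z (fst s) - \<omega> (fst (snd s)) + \<omega> (snd (snd s))"
abbreviation "w2 z s \<equiv> \<omega> (fst (snd s)) - z (fst s) + \<omega> (snd (snd s))"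
abbreviation "F1 y s eps t \<equiv> y (fst s) eps t * star (x eps (fst (snd s)) t) * x eps (snd (snd s)) t"
abbreviation "F2 y s eps t \<equiv> x eps (fst (snd s)) t * star (y (fst s) eps t) * x eps (snd (snd s)) t"

definition A where "A eps t = (\<Sum>r\<in>{1..R}. x eps r t * wv (kp r) (\<omega> r) eps t)"

lemma finite_N: "finite N" using finite_subset[OF nonres_T3 finite_T3] .

text \<open>A triple with equal first two indices is resonant, its wave vector and frequency being
  those of the third. Nonresonant triples thus force at least two indices, which the condition
  \<open>q\<close> different from \<open>r\<close> in the nonresonance assumption calls for.\<close>

lemma nonres_other_index:
  assumes "\<nu> \<in> N"
  shows "\<exists>r'\<in>{1..R}. r' \<noteq> r"
proof -
  obtain i j k where \<nu>: "\<nu> = (i, j, k)" "i \<in> {1..R}" "j \<in> {1..R}" "\<not> resonant [kp i, kp j, kp k]" using assms by (auto simp: nonres_def)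
  have "i \<noteq> j"
  proof
    assume "i = j"
    then have "resonant [kp i, kp j, kp k]" by (simp add: resonant_def freq_sum_def wave_sum_def)
    then show False using \<nu>(4) by simp
  qed
  then show ?thesis using \<nu>(2,3) by metis
qed

text \<open>If \<open>kap kp nu\<close> were \<open>kp r\<close>, the first nonresonance inequality,
  with this \<open>r\<close> subtracted and another index added, would compare the frequency of that
  other index with itself.\<close>

lemma kap_ne: "\<nu> \<in> N ==> r \<in> {1..R} ==> kap kp \<nu> \<noteq> kp r"
proof
  assume \<nu>: "\<nu> \<in> N" and r: "r \<in> {1..R}" and eq: "kap kp \<nu> = kp r"
  obtain r' where r': "r' \<in> {1..R}" "r' \<noteq> r" using nonres_other_index[OF \<nu>] by blast
  have "omeg_star kp \<nu> - \<omega> r + \<omega> r' \<noteq> omega (kap kp \<nu> - kp r + kp r')"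
    using nonr \<nu> r r' unfolding nonresonance_def by metis
  then show False by (simp add: eq omeg_star_def)
qed

lemma star1: "\<nu> \<in> N ==> p \<in> {1..R} ==> q \<in> {1..R} ==> p \<noteq> q ==> omeg_star kp \<nu> - \<omega> p + \<omega> q \<noteq> omega (kap kp \<nu> - kp p + kp q)"
  using nonr unfolding nonresonance_def by metis

text \<open>In the second nonresonance inequality the index that must differ from the last one does
  not appear, so any other index can be inserted and the inequality holds for all pairs, equal ones
  included.\<close>

lemma star2: "\<nu> \<in> N ==> p \<in> {1..R} ==> q \<in> {1..R} ==> \<omega> p - omeg_star kp \<nu> + \<omega> q \<noteq> omega (kp p - kap kp \<nu> + kp q)"
  using nonr nonres_other_index[of \<nu> q] unfolding nonresonance_def by metis

lemma waves_subset: "\<nu> \<in> T3 R ==> \<exists>i j k. i \<in> {1..R} \<and> j \<in> {1..R} \<and> k \<in> {1..R} \<and> waves kp \<nu> = [kp i, kp j, kp k]"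
  by (rule exI[of _ "fst \<nu>"], rule exI[of _ "fst (snd \<nu>)"], rule exI[of _ "snd (snd \<nu>)"]) (cases \<nu>, simp add: T3_def)

lemma closed0: "\<nu> \<in> T3 R ==> resonant (waves kp \<nu>) ==> \<exists>r\<in>{1..R}. kap kp \<nu> = kp r \<and> omeg kp \<nu> = \<omega> r"
proof -
  assume \<nu>: "\<nu> \<in> T3 R" and r: "resonant (waves kp \<nu>)"
  obtain i j k where *: "i \<in> {1..R}" "j \<in> {1..R}" "k \<in> {1..R}" "waves kp \<nu> = [kp i, kp j, kp k]" using waves_subset[OF \<nu>] by blast
  have "wave_sum (waves kp \<nu>) \<in> augment (kp ` {1..R})"
    unfolding *(4) by (rule augmentI(1)) (use * r in auto)
  then obtain r' where "r' \<in> {1..R}" "kap kp \<nu> = kp r'" using sat by (auto simp: kap_def)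
  then show ?thesis using r by (auto simp: resonant_waves_iff)
qed

lemma closed1:
  assumes s: "s \<in> I" and r: "resonant (waves kp (fst s) @ [kp (fst (snd s)), kp (snd (snd s))])"
  shows "\<exists>r\<in>{1..R}. k1 s = kp r \<and> w1 (omeg kp) s = \<omega> r"
proof -
  obtain \<nu> p q where s': "s = (\<nu>, p, q)" by (cases s)
  have \<nu>: "\<nu> \<in> T3 R" "\<not> resonant (waves kp \<nu>)" "p \<in> {1..R}" "q \<in> {1..R}" using s by (auto simp: s' nonres_iff)
  obtain i j k where *: "i \<in> {1..R}" "j \<in> {1..R}" "k \<in> {1..R}" "waves kp \<nu> = [kp i, kp j, kp k]" using waves_subset[OF \<nu>(1)] by blast
  have "wave_sum (waves kp \<nu> @ [kp p, kp q]) \<in> augment (kp ` {1..R})"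
    unfolding *(4) append.simps by (rule augmentI(2)) (use * \<nu> r s' in auto)
  then obtain r' where "r' \<in> {1..R}" "kap kp \<nu> - kp p + kp q = kp r'" using sat by (auto simp: sum_waves1)
  then show ?thesis using r unfolding s' resonant_def by (auto simp: sum_waves1[simplified])
qed

lemma closed2:
  assumes s: "s \<in> I" and r: "resonant ([kp (fst (snd s))] @ waves kp (fst s) @ [kp (snd (snd s))])"
  shows "\<exists>r\<in>{1..R}. k2 s = kp r \<and> w2 (omeg kp) s = \<omega> r"
proof -
  obtain \<nu> p q where s': "s = (\<nu>, p, q)" by (cases s)
  have \<nu>: "\<nu> \<in> T3 R" "\<not> resonant (waves kp \<nu>)" "p \<in> {1..R}" "q \<in> {1..R}" using s by (auto simp: s' nonres_iff)
  obtain i j k where *: "i \<in> {1..R}" "j \<in> {1..R}" "k \<in> {1..R}" "waves kp \<nu> = [kp i, kp j, kp k]" using waves_subset[OF \<nu>(1)] by blast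
  have "wave_sum ([kp p] @ waves kp \<nu> @ [kp q]) \<in> augment (kp ` {1..R})"
    unfolding *(4) append.simps by (rule augmentI(3)) (use * \<nu> r s' in auto)
  then obtain r' where "r' \<in> {1..R}" "kp p - kap kp \<nu> + kp q = kp r'" using sat unfolding sum_waves2 by auto
  then show ?thesis using r unfolding s' resonant_def sum_waves2 by auto
qed

lemma kap_lat: "eps \<in> E ==> \<nu> \<in> T3 R ==> kap kp \<nu> \<in> lat eps"
  by (cases \<nu>) (auto simp: kap_eq T3_def intro!: lat_add lat_diff lat)

text \<open>Resonance together with closure puts each contributing wave on the dispersion relation
  of some \<open>kp r\<close>. Injectivity of \<open>kp\<close> makes the groups for different
  \<open>r\<close> disjoint, so summing over \<open>r\<close> counts every term once.\<close>

lemma resonant_sum: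
  assumes S: "finite S" and P: "\<And>s. s \<in> S ==> P s ==> \<exists>r\<in>{1..R}. kk s = kp r \<and> ww s = \<omega> r"
    and Q: "\<And>r. r \<in> {1..R} ==> Q r = {s \<in> S. kk s = kp r \<and> P s}"
  shows "(\<Sum>r\<in>{1..R}. (\<Sum>s\<in>Q r. f s) * wv (kp r) (\<omega> r) eps t) = (\<Sum>s\<in>S. if P s then f s * wv (kk s) (ww s) eps t else 0)"
proof -
  have "(\<Sum>r\<in>{1..R}. (\<Sum>s\<in>Q r. f s) * wv (kp r) (\<omega> r) eps t) = (\<Sum>r\<in>{1..R}. \<Sum>s\<in>Q r. f s * wv (kk s) (ww s) eps t)"
  proof (rule sum.cong[OF refl])
    fix r assume r: "r \<in> {1..R}"
    have "ww s = \<omega> r" if "s \<in> Q r" for s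
    proof -
      have s: "s \<in> S" "P s" "kk s = kp r" using that Q[OF r] by auto
      obtain r' where "r' \<in> {1..R}" "kk s = kp r'" "ww s = \<omega> r'" using P[OF s(1,2)] by blast
      then show ?thesis using s(3) by simp
    qed
    then show "(\<Sum>s\<in>Q r. f s) * wv (kp r) (\<omega> r) eps t = (\<Sum>s\<in>Q r. f s * wv (kk s) (ww s) eps t)"
      unfolding sum_distrib_right by (intro sum.cong refl) (use Q[OF r] in auto)
  qed
  also have "\<dots> = (\<Sum>s\<in>(\<Union>r\<in>{1..R}. Q r). f s * wv (kk s) (ww s) eps t)"
  proof (rule sum.UNION_disjoint[symmetric])
    show "\<forall>r\<in>{1..R}. finite (Q r)" using Q S by simp
    show "\<forall>r\<in>{1..R}. \<forall>r'\<in>{1..R}. r \<noteq> r' \<longrightarrow> Q r \<inter> Q r' = {}"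
    proof (intro ballI impI)
      fix r r' assume r: "r \<in> {1..R}" "r' \<in> {1..R}" "r \<noteq> r'"
      then have "kp r \<noteq> kp r'" using inj_onD[OF inj _ r(1,2)] by blast
      then show "Q r \<inter> Q r' = {}" unfolding Q[OF r(1)] Q[OF r(2)] by auto
    qed
  qed simp
  also have "(\<Union>r\<in>{1..R}. Q r) = {s \<in> S. P s}"
  proof (rule set_eqI)
    fix s
    have "s \<in> (\<Union>r\<in>{1..R}. Q r) \<longleftrightarrow> (\<exists>r\<in>{1..R}. s \<in> S \<and> kk s = kp r \<and> P s)"
      unfolding UN_iff by (rule bex_cong[OF refl]) (simp add: Q)
    then show "s \<in> (\<Union>r\<in>{1..R}. Q r) \<longleftrightarrow> s \<in> {s \<in> S. P s}" using P[of s] by blast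
  qed
  also have "(\<Sum>s\<in>{s \<in> S. P s}. f s * wv (kk s) (ww s) eps t) = (\<Sum>s\<in>S. if P s then f s * wv (kk s) (ww s) eps t else 0)"
    by (rule sum.inter_filter[OF S])
  finally show ?thesis .
qed

section \<open>Expansion of the cubic nonlinearity into plane waves\<close>

lemma expand1:
  assumes eps: "eps \<in> E" and k: "k \<in> lat eps"
  shows "A eps t * star (A eps t) * (f * wv k w eps t) = (\<Sum>p\<in>{1..R}. \<Sum>q\<in>{1..R}.
     (f * star (x eps p t) * x eps q t) * wv (k - kp p + kp q) (w - \<omega> p + \<omega> q) eps t)"
proof -
  have "star (A eps t) * A eps t * (f * wv k w eps t) = (\<Sum>p\<in>{1..R}. \<Sum>q\<in>{1..R}.
     (star (x eps p t * wv (kp p) (\<omega> p) eps t) * (x eps q t * wv (kp q) (\<omega> q) eps t)) * (f * wv k w eps t))"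
    unfolding A_def star_sum unfolding sum_product unfolding sum_distrib_right ..
  also have "\<dots> = (\<Sum>p\<in>{1..R}. \<Sum>q\<in>{1..R}. (f * star (x eps p t) * x eps q t) * wv (k - kp p + kp q) (w - \<omega> p + \<omega> q) eps t)"
    by (intro sum.cong refl) (simp add: wv_combine[OF k lat[OF eps] lat[OF eps], symmetric] star_mult mult_ac)
  finally show ?thesis by (simp only: mult.commute[of "A eps t" "star (A eps t)"])
qed

lemma expand2:
  assumes eps: "eps \<in> E" and k: "k \<in> lat eps"
  shows "A eps t * star (f * wv k w eps t) * A eps t = (\<Sum>p\<in>{1..R}. \<Sum>q\<in>{1..R}.
     (x eps p t * star f * x eps q t) * wv (kp p - k + kp q) (\<omega> p - w + \<omega> q) eps t)"
proof -
  have "A eps t * A eps t * star (f * wv k w eps t) = (\<Sum>p\<in>{1..R}. \<Sum>q\<in>{1..R}.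
     ((x eps p t * wv (kp p) (\<omega> p) eps t) * (x eps q t * wv (kp q) (\<omega> q) eps t)) * star (f * wv k w eps t))"
    unfolding A_def unfolding sum_product unfolding sum_distrib_right ..
  also have "\<dots> = (\<Sum>p\<in>{1..R}. \<Sum>q\<in>{1..R}. (x eps p t * star f * x eps q t) * wv (kp p - k + kp q) (\<omega> p - w + \<omega> q) eps t)"
    by (intro sum.cong refl) (simp add: wv_combine[OF lat[OF eps] k lat[OF eps], symmetric] star_mult mult_ac)
  finally show ?thesis by (simp add: mult_ac)
qed

lemma expand1_sum:
  assumes eps: "eps \<in> E"
  shows "A eps t * star (A eps t) * (\<Sum>\<nu>\<in>N. y \<nu> eps t * wv (kap kp \<nu>) (z \<nu>) eps t) = (\<Sum>s\<in>I. F1 y s eps t * wv (k1 s) (w1 z s) eps t)"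
proof -
  have "A eps t * star (A eps t) * (\<Sum>\<nu>\<in>N. y \<nu> eps t * wv (kap kp \<nu>) (z \<nu>) eps t) = (\<Sum>\<nu>\<in>N. \<Sum>p\<in>{1..R}. \<Sum>q\<in>{1..R}.
     (y \<nu> eps t * star (x eps p t) * x eps q t) * wv (kap kp \<nu> - kp p + kp q) (z \<nu> - \<omega> p + \<omega> q) eps t)"
    unfolding sum_distrib_left by (intro sum.cong refl expand1 eps kap_lat) (simp add: nonres_iff)
  then show ?thesis unfolding sum.cartesian_product by (simp add: case_prod_unfold)
qed

lemma expand2_sum:
  assumes eps: "eps \<in> E"
  shows "A eps t * star (\<Sum>\<nu>\<in>N. y \<nu> eps t * wv (kap kp \<nu>) (z \<nu>) eps t) * A eps t = (\<Sum>s\<in>I. F2 y s eps t * wv (k2 s) (w2 z s) eps t)"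
proof -
  have "A eps t * star (\<Sum>\<nu>\<in>N. y \<nu> eps t * wv (kap kp \<nu>) (z \<nu>) eps t) * A eps t = (\<Sum>\<nu>\<in>N. \<Sum>p\<in>{1..R}. \<Sum>q\<in>{1..R}.
     (x eps p t * star (y \<nu> eps t) * x eps q t) * wv (kp p - kap kp \<nu> + kp q) (\<omega> p - z \<nu> + \<omega> q) eps t)"
    unfolding star_sum sum_distrib_left sum_distrib_right by (intro sum.cong refl expand2 eps kap_lat) (simp add: nonres_iff)
  then show ?thesis unfolding sum.cartesian_product by (simp add: case_prod_unfold)
qed

text \<open>By \<open>kap_ne\<close> every triple whose wave vector is some \<open>kp r\<close> is
  resonant, and by saturation every resonant triple has such a wave vector. The sets
  \<open>cubic_set\<close> and the nonresonant triples therefore partition all triples.\<close>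

lemma cubic_identity:
  assumes eps: "eps \<in> E"
  shows "A eps t * star (A eps t) * A eps t =
    (\<Sum>r\<in>{1..R}. (\<Sum>\<mu>\<in>cubic_set kp R r. cub \<mu> eps t) * wv (kp r) (\<omega> r) eps t) + (\<Sum>\<nu>\<in>N. cub \<nu> eps t * wv (kap kp \<nu>) (omeg kp \<nu>) eps t)"
proof -
  have "A eps t * star (A eps t) * A eps t = (\<Sum>r\<in>{1..R}. A eps t * star (A eps t) * (x eps r t * wv (kp r) (\<omega> r) eps t))"
    by (subst (3) A_def) (simp add: sum_distrib_left)
  also have "\<dots> = (\<Sum>r\<in>{1..R}. \<Sum>p\<in>{1..R}. \<Sum>q\<in>{1..R}. (x eps r t * star (x eps p t) * x eps q t) * wv (kp r - kp p + kp q) (\<omega> r - \<omega> p + \<omega> q) eps t)"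
    by (intro sum.cong refl expand1 eps lat)
  also have "\<dots> = (\<Sum>\<mu>\<in>T3 R. cub \<mu> eps t * wv (kap kp \<mu>) (omeg kp \<mu>) eps t)"
    unfolding sum.cartesian_product T3_def
    by (rule sum.cong) (auto simp: cub_def cubx_def kap_eq omeg_eq)
  also have "\<dots> = (\<Sum>\<mu>\<in>T3 R. (if resonant (waves kp \<mu>) then cub \<mu> eps t * wv (kap kp \<mu>) (omeg kp \<mu>) eps t else 0)
      + (if \<not> resonant (waves kp \<mu>) then cub \<mu> eps t * wv (kap kp \<mu>) (omeg kp \<mu>) eps t else 0))"
    by (rule sum.cong) auto
  also have "\<dots> = (\<Sum>r\<in>{1..R}. (\<Sum>\<mu>\<in>cubic_set kp R r. cub \<mu> eps t) * wv (kp r) (\<omega> r) eps t) + (\<Sum>\<nu>\<in>N. cub \<nu> eps t * wv (kap kp \<nu>) (omeg kp \<nu>) eps t)"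
  proof -
    have N: "N = {\<mu> \<in> T3 R. \<not> resonant (waves kp \<mu>)}" by (auto simp: nonres_iff)
    have "cubic_set kp R r = {\<mu> \<in> T3 R. kap kp \<mu> = kp r \<and> resonant (waves kp \<mu>)}" if r: "r \<in> {1..R}" for r
    proof -
      have "cubic_set kp R r = {\<mu> \<in> T3 R. kap kp \<mu> = kp r}" by (auto simp: cubic_set_def T3_def kap_eq)
      moreover have "resonant (waves kp \<mu>)" if "\<mu> \<in> T3 R" "kap kp \<mu> = kp r" for \<mu>
        using kap_ne[of \<mu> r] that r by (auto simp: nonres_iff)
      ultimately show ?thesis by blast
    qed
    from resonant_sum[OF finite_T3 closed0 this] show ?thesis
      unfolding sum.distrib N sum.inter_filter[OF finite_T3] by simp
  qed
  finally show ?thesis .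
qed

lemma quintic_identity:
  assumes eps: "eps \<in> E"
  shows "(\<Sum>r\<in>{1..R}. quintic_part lam kp R r (\<lambda>i. x eps i t) * wv (kp r) (\<omega> r) eps t) =
    - (cst (2 * \<i> * of_real (lam\<^sup>2)) * (\<Sum>s\<in>I. if resonant (waves kp (fst s) @ [kp (fst (snd s)), kp (snd (snd s))]) then F1 b s eps t * wv (k1 s) (w1 (omeg kp) s) eps t else 0))
    - cst (\<i> * of_real (lam\<^sup>2)) * (\<Sum>s\<in>I. if resonant ([kp (fst (snd s))] @ waves kp (fst s) @ [kp (snd (snd s))]) then F2 b s eps t * wv (k2 s) (w2 (omeg kp) s) eps t else 0)"
proof -
  have fin: "finite I" using finite_N by simp
  have 1: "(\<Sum>r\<in>{1..R}. (\<Sum>s\<in>quintic_set1 kp R r. F1 b s eps t) * wv (kp r) (\<omega> r) eps t) =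
     (\<Sum>s\<in>I. if resonant (waves kp (fst s) @ [kp (fst (snd s)), kp (snd (snd s))]) then F1 b s eps t * wv (k1 s) (w1 (omeg kp) s) eps t else 0)"
    by (rule resonant_sum[OF fin closed1]) (auto simp: quintic_set1_def)
  have 2: "(\<Sum>r\<in>{1..R}. (\<Sum>s\<in>quintic_set2 kp R r. F2 b s eps t) * wv (kp r) (\<omega> r) eps t) =
     (\<Sum>s\<in>I. if resonant ([kp (fst (snd s))] @ waves kp (fst s) @ [kp (snd (snd s))]) then F2 b s eps t * wv (k2 s) (w2 (omeg kp) s) eps t else 0)"
    by (rule resonant_sum[OF fin closed2]) (auto simp: quintic_set2_def)
  have "quintic_part lam kp R r (\<lambda>i. x eps i t) * wv (kp r) (\<omega> r) eps t =
     - (cst (2 * \<i> * of_real (lam\<^sup>2)) * ((\<Sum>s\<in>quintic_set1 kp R r. F1 b s eps t) * wv (kp r) (\<omega> r) eps t))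
     - cst (\<i> * of_real (lam\<^sup>2)) * ((\<Sum>s\<in>quintic_set2 kp R r. F2 b s eps t) * wv (kp r) (\<omega> r) eps t)" for r
    unfolding quintic_part_def b_def by (simp add: algebra_simps)
  then have "(\<Sum>r\<in>{1..R}. quintic_part lam kp R r (\<lambda>i. x eps i t) * wv (kp r) (\<omega> r) eps t) =
     - (cst (2 * \<i> * of_real (lam\<^sup>2)) * (\<Sum>r\<in>{1..R}. (\<Sum>s\<in>quintic_set1 kp R r. F1 b s eps t) * wv (kp r) (\<omega> r) eps t))
     - cst (\<i> * of_real (lam\<^sup>2)) * (\<Sum>r\<in>{1..R}. (\<Sum>s\<in>quintic_set2 kp R r. F2 b s eps t) * wv (kp r) (\<omega> r) eps t)"
    by (simp only: sum_subtractf sum_negf sum_distrib_left)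
  then show ?thesis unfolding 1 2 .
qed

text \<open>The terms with equal indices \<open>p\<close> and \<open>q\<close> reproduce the wave of
  the triple itself. For the starred frequencies they lie on the dispersion relation and are what
  the equation for \<open>b_star\<close> must absorb.\<close>

lemma dens_identity:
  "dens eps t * (\<Sum>\<nu>\<in>N. y \<nu> eps t * wv (kap kp \<nu>) (z \<nu>) eps t) =
    - (cst (2 * \<i> * of_real lam) * (\<Sum>s\<in>I. if fst (snd s) = snd (snd s) then F1 y s eps t * wv (k1 s) (w1 z s) eps t else 0))"
proof -
  have "(\<Sum>s\<in>I. if fst (snd s) = snd (snd s) then F1 y s eps t * wv (k1 s) (w1 z s) eps t else 0)
     = (\<Sum>\<nu>\<in>N. \<Sum>p\<in>{1..R}. \<Sum>q\<in>{1..R}. if p = q then (y \<nu> eps t * star (x eps p t) * x eps q t) * wv (kap kp \<nu> - kp p + kp q) (z \<nu> - \<omega> p + \<omega> q) eps t else 0)"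
    unfolding sum.cartesian_product by (simp add: case_prod_unfold)
  also have "\<dots> = (\<Sum>\<nu>\<in>N. \<Sum>p\<in>{1..R}. (y \<nu> eps t * star (x eps p t) * x eps p t) * wv (kap kp \<nu>) (z \<nu>) eps t)"
    by (intro sum.cong refl) (simp add: sum.delta)
  also have "\<dots> = (\<Sum>p\<in>{1..R}. x eps p t * star (x eps p t)) * (\<Sum>\<nu>\<in>N. y \<nu> eps t * wv (kap kp \<nu>) (z \<nu>) eps t)"
    by (simp add: sum_distrib_left sum_distrib_right mult_ac)
  finally show ?thesis by (simp add: dens_def cst_uminus mult.assoc)
qed

lemma smf_F1: "s \<in> I ==> smf E T (y (fst s)) ==> smf E T (F1 y s)"
  and smf_F2: "s \<in> I ==> smf E T (y (fst s)) ==> smf E T (F2 y s)"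
  by (auto intro!: smf_mult smf_star smx)

lemma k_lat: "eps \<in> E ==> s \<in> I ==> k1 s \<in> lat eps" "eps \<in> E ==> s \<in> I ==> k2 s \<in> lat eps"
  by (auto simp: nonres_iff intro!: lat_add lat_diff lat kap_lat)

lemma sum_if_split:
  fixes f :: "'s \<Rightarrow> 'c::comm_monoid_add"
  shows "sum f S = (\<Sum>s\<in>S. if P s then f s else 0) + (\<Sum>s\<in>S. if P s then 0 else f s)"
  unfolding sum.distrib[symmetric] by (rule sum.cong) auto

text \<open>The expansion itself is \<open>A + eps * Bq\<close>. Adding \<open>eps^2 * C\<close>,
  which is within the allowed error, lowers the residual from order \<open>eps\<close> to order
  \<open>eps^2\<close>.\<close>

lemma ansatz:
  assumes bs: "\<And>\<nu>. \<nu> \<in> N ==> smf E T (bs \<nu>)"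
    and dbs: "\<And>\<nu> eps t. \<nu> \<in> N ==> eps \<in> E ==> t \<in> {0..T} ==>
      (bs \<nu> eps has_vector_derivative gen (psi (kap kp \<nu>) eps) (bs \<nu> eps t) + dens eps t * bs \<nu> eps t) (at t within {0..T})"
  defines "Bq \<equiv> \<lambda>eps t. cst (of_real lam) * ((\<Sum>\<nu>\<in>N. bs \<nu> eps t * wv (kap kp \<nu>) (omeg_star kp \<nu>) eps t)
     + (\<Sum>\<nu>\<in>N. b \<nu> eps t * wv (kap kp \<nu>) (omeg kp \<nu>) eps t))"
  shows "\<exists>u C D. ok u \<and> ok C \<and> ok D \<and> (\<forall>eps t. u eps t = A eps t + cst (of_real eps) * Bq eps t + cst (of_real (eps\<^sup>2)) * C eps t) \<and>
     dd u (\<lambda>eps t. - (cst (\<i> * of_real lam) * (u eps t * star (u eps t) * u eps t)) + cst (of_real (eps\<^sup>2)) * D eps t)"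
proof -
  have T3: "\<nu> \<in> T3 R" if "\<nu> \<in> N" for \<nu> using that by (simp add: nonres_iff)
  have "\<forall>\<nu>\<in>N. \<exists>g. smf E T g \<and> (\<forall>eps\<in>E. \<forall>t\<in>{0..T}.
    (b \<nu> eps has_vector_derivative gen (psi (kap kp \<nu>) eps) (b \<nu> eps t) + g eps t) (at t within {0..T}))"
  proof
    fix \<nu> assume "\<nu> \<in> N"
    obtain g where "smf E T g" "\<And>eps t. eps \<in> E ==> t \<in> {0..T} ==>
      (b \<nu> eps has_vector_derivative gen (psi (kap kp \<nu>) eps) (b \<nu> eps t) + g eps t) (at t within {0..T})"
      using smf_residual[OF smf_b[OF T3[OF \<open>\<nu> \<in> N\<close>]] T psi_bound_ex[OF E]] by blast
    then show "\<exists>g. smf E T g \<and> (\<forall>eps\<in>E. \<forall>t\<in>{0..T}.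
      (b \<nu> eps has_vector_derivative gen (psi (kap kp \<nu>) eps) (b \<nu> eps t) + g eps t) (at t within {0..T}))" by blast
  qed
  then obtain g where g: "\<And>\<nu>. \<nu> \<in> N ==> smf E T (g \<nu>)" "\<And>\<nu> eps t. \<nu> \<in> N ==> eps \<in> E ==> t \<in> {0..T} ==>
    (b \<nu> eps has_vector_derivative gen (psi (kap kp \<nu>) eps) (b \<nu> eps t) + g \<nu> eps t) (at t within {0..T})"
    unfolding bchoice_iff by blast
  define Sbs where "Sbs eps t = (\<Sum>\<nu>\<in>N. bs \<nu> eps t * wv (kap kp \<nu>) (omeg_star kp \<nu>) eps t)" for eps t
  define Sb where "Sb eps t = (\<Sum>\<nu>\<in>N. b \<nu> eps t * wv (kap kp \<nu>) (omeg kp \<nu>) eps t)" for eps t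
  define Sg where "Sg eps t = (\<Sum>\<nu>\<in>N. g \<nu> eps t * wv (kap kp \<nu>) (omeg kp \<nu>) eps t)" for eps t
  define Sc where "Sc eps t = (\<Sum>\<nu>\<in>N. cub \<nu> eps t * wv (kap kp \<nu>) (omeg kp \<nu>) eps t)" for eps t
  define Q3 where "Q3 eps t = (\<Sum>r\<in>{1..R}. (\<Sum>\<mu>\<in>cubic_set kp R r. cub \<mu> eps t) * wv (kp r) (\<omega> r) eps t)" for eps t
  define Q5 where "Q5 eps t = (\<Sum>r\<in>{1..R}. quintic_part lam kp R r (\<lambda>i. x eps i t) * wv (kp r) (\<omega> r) eps t)" for eps t
  define c where "c = (cst (\<i> * of_real lam) :: 'd wien)"
  define L where "L = (cst (of_real lam) :: 'd wien)"
  have Bq: "Bq eps t = L * (Sbs eps t + Sb eps t)" for eps t by (simp add: Bq_def L_def Sbs_def Sb_def)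
  have two: "cst 2 = (2 :: 'd wien)" using cst_add[of 1 1] by simp
  have c2: "cst (2 * \<i> * of_real (lam\<^sup>2)) = 2 * c * L" "cst (\<i> * of_real (lam\<^sup>2)) = c * L" "cst (2 * \<i> * of_real lam) = 2 * c"
    by (simp_all add: c_def L_def cst_mult[symmetric] two[symmetric] power2_eq_square mult_ac)
  \<comment> \<open>The coefficient of \<open>eps\<close> in the residual of
    \<open>A + eps * Bq\<close>, after the cubic terms of order one have cancelled.\<close>
  define Rem where "Rem eps t = Q5 eps t + L * (dens eps t * Sbs eps t + Sg eps t)
     + c * (2 * (A eps t * star (A eps t) * Bq eps t) + A eps t * star (Bq eps t) * A eps t)" for eps t
  let ?P1 = "\<lambda>s. resonant (waves kp (fst s) @ [kp (fst (snd s)), kp (snd (snd s))])"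
  let ?P2 = "\<lambda>s. resonant ([kp (fst (snd s))] @ waves kp (fst s) @ [kp (snd (snd s))])"
  let ?P0 = "\<lambda>s :: triple \<times> nat \<times> nat. fst (snd s) = snd (snd s)"
  have osc_if: "osc (\<lambda>eps t. \<Sum>s\<in>I. if P s then 0 else f s eps t * wv (kk s) (ww s) eps t)"
    if "\<And>s. s \<in> I ==> \<not> P s ==> smf E T (f s)" "\<And>s eps. s \<in> I ==> eps \<in> E ==> kk s \<in> lat eps" "\<And>s. s \<in> I ==> \<not> P s ==> ww s \<noteq> omega (kk s)" for P f kk ww
  proof (rule osc_sum)
    fix s assume s: "s \<in> I"
    show "osc (\<lambda>eps t. if P s then 0 else f s eps t * wv (kk s) (ww s) eps t)"
      by (cases "P s") (simp_all add: osc_0 osc_mode[OF that(2)[OF s] that(1)[OF s] that(3)[OF s]])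
  qed
  define O1 where "O1 eps t = (\<Sum>s\<in>I. if ?P0 s then 0 else F1 bs s eps t * wv (k1 s) (w1 (omeg_star kp) s) eps t)" for eps t
  define O2 where "O2 eps t = (\<Sum>s\<in>I. if ?P1 s then 0 else F1 b s eps t * wv (k1 s) (w1 (omeg kp) s) eps t)" for eps t
  \<comment> \<open>The second nonresonance inequality holds for all index pairs, so the conjugated
    \<open>b_star\<close> waves have no part on the dispersion relation. The condition
    \<open>False\<close> gives this sum the shape of the other three, which \<open>osc_if\<close>
    expects.\<close>
  define O3 where "O3 eps t = (\<Sum>s\<in>I. if False then 0 else F2 bs s eps t * wv (k2 s) (w2 (omeg_star kp) s) eps t)" for eps t
  define O4 where "O4 eps t = (\<Sum>s\<in>I. if ?P2 s then 0 else F2 b s eps t * wv (k2 s) (w2 (omeg kp) s) eps t)" for eps t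
  have sm_fst: "smf E T (bs (fst s))" "smf E T (b (fst s))" if "s \<in> I" for s using that bs smf_b T3 by auto
  have smF: "smf E T (F1 bs s)" "smf E T (F1 b s)" "smf E T (F2 bs s)" "smf E T (F2 b s)" if "s \<in> I" for s
    by (rule smf_F1[OF that, of bs, OF sm_fst(1)[OF that]] smf_F1[OF that, of b, OF sm_fst(2)[OF that]]
        smf_F2[OF that, of bs, OF sm_fst(1)[OF that]] smf_F2[OF that, of b, OF sm_fst(2)[OF that]])+
  have st: "\<not> ?P0 s ==> w1 (omeg_star kp) s \<noteq> omega (k1 s)" "w2 (omeg_star kp) s \<noteq> omega (k2 s)" if "s \<in> I" for s
    using that unfolding mem_Times_iff by (metis star1, metis star2)
  have O: "osc O1" "osc O2" "osc O3" "osc O4" "osc Sg"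
  proof -
    show "osc O1" unfolding O1_def[abs_def]
      by (rule osc_if[OF smF(1) k_lat(1)]) (use st(1) in auto)
    show "osc O2" unfolding O2_def[abs_def]
      by (rule osc_if[OF smF(2) k_lat(1)]) (auto simp: resonant_def sum_waves1)
    show "osc O3" unfolding O3_def[abs_def]
      by (rule osc_if[OF smF(3) k_lat(2)]) (use st(2) in auto)
    show "osc O4" unfolding O4_def[abs_def]
      by (rule osc_if[OF smF(4) k_lat(2)]) (auto simp: resonant_def sum_waves2[simplified])
    show "osc Sg" unfolding Sg_def[abs_def]
      by (intro osc_sum osc_mode kap_lat T3 g) (auto simp: nonres_iff resonant_waves_iff)
  qed
  have Rem_eq: "Rem eps t = cst (2 * \<i> * of_real (lam\<^sup>2)) * (O1 eps t + O2 eps t) + cst (\<i> * of_real (lam\<^sup>2)) * (O3 eps t + O4 eps t) + L * Sg eps t"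
    if eps: "eps \<in> E" for eps t
  proof -
    have sL: "star L = L" by (simp add: L_def)
    \<comment> \<open>The parts on the dispersion relation: \<open>R0\<close> cancels against the
      term with \<open>dens\<close>, and \<open>R1\<close> and \<open>R2\<close> against the two
      quintic sums.\<close>
    define R0 where "R0 = (\<Sum>s\<in>I. if ?P0 s then F1 bs s eps t * wv (k1 s) (w1 (omeg_star kp) s) eps t else 0)"
    define R1 where "R1 = (\<Sum>s\<in>I. if ?P1 s then F1 b s eps t * wv (k1 s) (w1 (omeg kp) s) eps t else 0)"
    define R2 where "R2 = (\<Sum>s\<in>I. if ?P2 s then F2 b s eps t * wv (k2 s) (w2 (omeg kp) s) eps t else 0)"
    have 1: "A eps t * star (A eps t) * Sbs eps t = R0 + O1 eps t"
      unfolding Sbs_def expand1_sum[OF eps] R0_def O1_def by (rule sum_if_split)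
    have 2: "A eps t * star (A eps t) * Sb eps t = R1 + O2 eps t"
      unfolding Sb_def expand1_sum[OF eps] R1_def O2_def by (rule sum_if_split)
    have 3: "A eps t * star (Sbs eps t) * A eps t = O3 eps t"
      unfolding Sbs_def expand2_sum[OF eps] O3_def by simp
    have 4: "A eps t * star (Sb eps t) * A eps t = R2 + O4 eps t"
      unfolding Sb_def expand2_sum[OF eps] R2_def O4_def by (rule sum_if_split)
    have 5: "Q5 eps t = - (2 * c * L * R1) - c * L * R2"
      unfolding Q5_def quintic_identity[OF eps] R1_def R2_def c2 ..
    have 6: "dens eps t * Sbs eps t = - (2 * c * R0)"
      unfolding Sbs_def dens_identity R0_def c2 ..
    have 7: "A eps t * star (A eps t) * Bq eps t = L * (A eps t * star (A eps t) * Sbs eps t + A eps t * star (A eps t) * Sb eps t)"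
      unfolding Bq by (simp only: algebra_simps)
    have 8: "A eps t * star (Bq eps t) * A eps t = L * (A eps t * star (Sbs eps t) * A eps t + A eps t * star (Sb eps t) * A eps t)"
      unfolding Bq star_mult star_add sL by (simp only: algebra_simps)
    show ?thesis unfolding Rem_def 5 6 7 8 1 2 3 4 c2 by (simp add: algebra_simps)
  qed
  have "osc (\<lambda>eps t. cst (2 * \<i> * of_real (lam\<^sup>2)) * (O1 eps t + O2 eps t))" "osc (\<lambda>eps t. cst (\<i> * of_real (lam\<^sup>2)) * (O3 eps t + O4 eps t))" "osc (\<lambda>eps t. L * Sg eps t)"
    unfolding L_def by (rule osc_scale[OF osc_add[OF O(1,2)]], rule osc_scale[OF osc_add[OF O(3,4)]], rule osc_scale[OF O(5)])
  note osc_add[OF osc_add[OF this(1,2)] this(3)]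
  then have "osc Rem" by (rule osc_cong) (rule Rem_eq[symmetric])
  then obtain C G where CG: "ok C" "ok G" "dd C (\<lambda>eps t. G eps t - cst (1 / of_real eps) * Rem eps t)" unfolding osc_def by blast
  have okA: "ok A" unfolding A_def[abs_def] by (intro ok_sum ok_mult ok_wv ok_smf smx)
  have okS: "ok Sbs" "ok Sb"
    unfolding Sbs_def[abs_def] Sb_def[abs_def] by (intro ok_sum ok_mult ok_wv ok_smf bs smf_b T3; assumption)+
  have okB: "ok Bq" unfolding Bq[abs_def] L_def by (intro ok_mult ok_add okS ok_cst[OF order_refl])
  define W where "W eps t = Bq eps t + cst (of_real eps) * C eps t" for eps t
  define u where "u eps t = A eps t + cst (of_real eps) * W eps t" for eps t
  have okW: "ok W" unfolding W_def[abs_def] by (intro ok_mult ok_add okB CG ok_eps)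
  have oku: "ok u" unfolding u_def[abs_def] by (intro ok_mult ok_add okA okW ok_eps)
  \<comment> \<open>All terms of order \<open>eps^2\<close> and higher in the cube of
    \<open>A + eps * W\<close>, divided by \<open>eps^2\<close>. The bound on \<open>Z\<close> uses
    that \<open>eps\<close> is at most 1.\<close>
  define Z where "Z eps t = 2 * (A eps t * star (A eps t) * C eps t) + A eps t * star (C eps t) * A eps t
     + (2 * (A eps t * star (W eps t) * W eps t) + W eps t * star (A eps t) * W eps t) + cst (of_real eps) * (W eps t * star (W eps t) * W eps t)" for eps t
  have okZ: "ok Z" unfolding Z_def[abs_def] two[symmetric] by (intro ok_mult ok_add ok_star okA okW CG ok_eps ok_cst[OF order_refl])
  define D where "D eps t = c * Z eps t + G eps t" for eps t
  have okD: "ok D" unfolding D_def[abs_def] c_def by (intro ok_mult ok_add okZ CG ok_cst[OF order_refl])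
  have e2: "cst (of_real (eps\<^sup>2)) = cst (of_real eps) * (cst (of_real eps) :: 'd wien)" for eps :: real
    by (simp add: cst_mult[symmetric] power2_eq_square)
  have cube: "u eps t * star (u eps t) * u eps t = A eps t * star (A eps t) * A eps t
     + cst (of_real eps) * (2 * (A eps t * star (A eps t) * Bq eps t) + A eps t * star (Bq eps t) * A eps t) + cst (of_real (eps\<^sup>2)) * Z eps t" for eps t
  proof -
    have ring0: "(A + e * W) * (A' + e * W') * (A + e * W) = A * A' * A + e * (2 * (A * A' * W) + A * W' * A)
       + e * e * ((2 * (A * W' * W) + W * A' * W) + e * (W * W' * W))"
      for A W A' W' e :: "'d wien" by (simp add: algebra_simps)
    have ring1: "2 * (A * A' * (B + e * C)) + A * (B' + e * C') * A = 2 * (A * A' * B) + A * B' * A + e * (2 * (A * A' * C) + A * C' * A)"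
      for A B C A' B' C' e :: "'d wien" by (simp add: algebra_simps)
    have ring: "(A + e * (B + e * C)) * (A' + e * (B' + e * C')) * (A + e * (B + e * C)) = A * A' * A + e * (2 * (A * A' * B) + A * B' * A)
       + e * e * (2 * (A * A' * C) + A * C' * A + (2 * (A * (B' + e * C') * (B + e * C)) + (B + e * C) * A' * (B + e * C)) + e * ((B + e * C) * (B' + e * C') * (B + e * C)))"
      for A B C A' B' C' e :: "'d wien"
      unfolding ring0 ring1 by (simp only: distrib_left mult.assoc add.assoc)
    show ?thesis unfolding e2 u_def Z_def W_def star_add star_mult star_cst complex_cnj_complex_of_real by (rule ring)
  qed
  have ddA: "dd A (\<lambda>eps t. - (c * Q3 eps t) + cst (of_real eps) * Q5 eps t)"
    unfolding A_def[abs_def]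
  proof (rule dd_cong[OF dd_sum[OF dd_mode[OF lat smx eqx]]])
    fix eps t
    have "(nlx lam kp R r eps (\<lambda>i. x eps i t) + cst (\<i> * of_real ((\<omega> r - \<omega> r) / eps)) * x eps r t) * wv (kp r) (\<omega> r) eps t =
       - (c * ((\<Sum>\<mu>\<in>cubic_set kp R r. cub \<mu> eps t) * wv (kp r) (\<omega> r) eps t)) + cst (of_real eps) * (quintic_part lam kp R r (\<lambda>i. x eps i t) * wv (kp r) (\<omega> r) eps t)" for r
      by (simp add: nlx_def cubic_part_def cub_def c_def algebra_simps)
    then show "(\<Sum>r\<in>{1..R}. (nlx lam kp R r eps (\<lambda>i. x eps i t) + cst (\<i> * of_real ((\<omega> r - \<omega> r) / eps)) * x eps r t) * wv (kp r) (\<omega> r) eps t) = - (c * Q3 eps t) + cst (of_real eps) * Q5 eps t"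
      unfolding Q3_def Q5_def by (simp only: sum.distrib sum_negf sum_distrib_left)
  qed
  have ddbs: "dd Sbs (\<lambda>eps t. dens eps t * Sbs eps t)"
    unfolding Sbs_def[abs_def]
  proof (rule dd_cong[OF dd_sum[OF dd_mode[OF kap_lat[OF _ T3] bs dbs]]])
    show "(\<Sum>\<nu>\<in>N. (dens eps t * bs \<nu> eps t + cst (\<i> * of_real ((omega (kap kp \<nu>) - omeg_star kp \<nu>) / eps)) * bs \<nu> eps t) * wv (kap kp \<nu>) (omeg_star kp \<nu>) eps t)
       = dens eps t * (\<Sum>\<nu>\<in>N. bs \<nu> eps t * wv (kap kp \<nu>) (omeg_star kp \<nu>) eps t)" for eps t
      by (simp add: omeg_star_def sum_distrib_left mult.assoc)
  qed
  have ddb: "dd Sb (\<lambda>eps t. Sg eps t - cst (\<i> / of_real eps) * Sc eps t)"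
    unfolding Sb_def[abs_def]
  proof (rule dd_cong[OF dd_sum[OF dd_mode[OF kap_lat[OF _ T3] smf_b[OF T3] g(2)]]])
    fix eps t assume "eps \<in> E"
    then have eps: "eps \<noteq> 0" using E by force
    have "(g \<nu> eps t + cst (\<i> * of_real ((omega (kap kp \<nu>) - omeg kp \<nu>) / eps)) * b \<nu> eps t) * wv (kap kp \<nu>) (omeg kp \<nu>) eps t =
       g \<nu> eps t * wv (kap kp \<nu>) (omeg kp \<nu>) eps t - cst (\<i> / of_real eps) * (cub \<nu> eps t * wv (kap kp \<nu>) (omeg kp \<nu>) eps t)" if \<nu>: "\<nu> \<in> N" for \<nu>
    proof -
      \<comment> \<open>The frequency defect of this wave is \<open>- delta\<close>. The denominator
        in \<open>b_mod\<close> turns the singular source into \<open>- i / eps\<close> times the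
        cubic term, which after the prefactor \<open>eps * lam\<close> cancels the nonresonant cubic
        terms.\<close>
      have "\<i> * of_real ((omega (kap kp \<nu>) - omeg kp \<nu>) / eps) * of_real (1 / delta kp \<nu>) = (- (\<i> / of_real eps) :: complex)"
      proof -
        have "omega (kap kp \<nu>) - omeg kp \<nu> = - delta kp \<nu>" by (simp add: delta_def omeg_star_def)
        then show ?thesis using delta_nonzero[OF \<nu>] eps by simp
      qed
      then have "cst (\<i> * of_real ((omega (kap kp \<nu>) - omeg kp \<nu>) / eps)) * b \<nu> eps t = - (cst (\<i> / of_real eps) * cub \<nu> eps t)"
        unfolding b_def bx_def cub_def mult.assoc[symmetric] cst_mult[symmetric] by (simp only: cst_uminus mult_minus_left)
      then show ?thesis by (simp add: algebra_simps)
    qed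
    then show "(\<Sum>\<nu>\<in>N. (g \<nu> eps t + cst (\<i> * of_real ((omega (kap kp \<nu>) - omeg kp \<nu>) / eps)) * b \<nu> eps t) * wv (kap kp \<nu>) (omeg kp \<nu>) eps t) = Sg eps t - cst (\<i> / of_real eps) * Sc eps t"
      unfolding Sg_def Sc_def by (simp only: sum_subtractf sum_distrib_left cong: sum.cong)
  qed
  have ddu: "dd u (\<lambda>eps t. - (c * Q3 eps t) + cst (of_real eps) * Q5 eps t + cst (of_real eps) *
     (cst (of_real lam) * (dens eps t * Sbs eps t + (Sg eps t - cst (\<i> / of_real eps) * Sc eps t)) + cst (of_real eps) * (G eps t - cst (1 / of_real eps) * Rem eps t)))"
    unfolding u_def[abs_def] W_def[abs_def] Bq[abs_def] L_def
    by (rule dd_add[OF ddA dd_scale[OF dd_add[OF dd_scale[OF dd_add[OF ddbs ddb]] dd_scale[OF CG(3)]]]])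
  have "dd u (\<lambda>eps t. - (c * (u eps t * star (u eps t) * u eps t)) + cst (of_real (eps\<^sup>2)) * D eps t)"
  proof (rule dd_cong[OF ddu])
    fix eps t assume eps: "eps \<in> E"
    then have eps0: "eps \<noteq> 0" using E by force
    define e where "e = (cst (of_real eps) :: 'd wien)"
    have i1: "e * cst (1 / of_real eps) = 1" "e * (L * cst (\<i> / of_real eps)) = c"
      using eps0 by (simp_all add: e_def L_def c_def cst_mult[symmetric] mult.commute[of "of_real lam" "\<i>"])
    have A3: "A eps t * star (A eps t) * A eps t = Q3 eps t + Sc eps t" unfolding Q3_def Sc_def by (rule cubic_identity[OF eps])
    have "e * (L * (dens eps t * Sbs eps t + (Sg eps t - cst (\<i> / of_real eps) * Sc eps t)) + e * (G eps t - cst (1 / of_real eps) * Rem eps t))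
      = e * (L * (dens eps t * Sbs eps t + Sg eps t)) - (e * (L * cst (\<i> / of_real eps))) * Sc eps t + e * e * G eps t - (e * cst (1 / of_real eps)) * (e * Rem eps t)"
      by (simp add: algebra_simps)
    also have "\<dots> = e * (L * (dens eps t * Sbs eps t + Sg eps t)) - c * Sc eps t + e * e * G eps t - e * Rem eps t" by (simp only: i1 mult_1_left)
    finally show "- (c * Q3 eps t) + cst (of_real eps) * Q5 eps t + cst (of_real eps) *
     (cst (of_real lam) * (dens eps t * Sbs eps t + (Sg eps t - cst (\<i> / of_real eps) * Sc eps t)) + cst (of_real eps) * (G eps t - cst (1 / of_real eps) * Rem eps t))
      = - (c * (u eps t * star (u eps t) * u eps t)) + cst (of_real (eps\<^sup>2)) * D eps t"
      unfolding L_def[symmetric] e_def[symmetric] cube e2 A3 D_def Rem_def by (simp add: algebra_simps)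
  qed
  moreover have "\<forall>eps t. u eps t = A eps t + cst (of_real eps) * Bq eps t + cst (of_real (eps\<^sup>2)) * C eps t"
    unfolding u_def W_def e2 by (simp add: algebra_simps)
  ultimately show ?thesis using oku CG(1) okD unfolding c_def by blast
qed

end

section \<open>The nonlinear Schroedinger equation\<close>

definition nl :: "real \<Rightarrow> 'd::finite wien \<Rightarrow> 'd wien" where
  "nl lam u = cst (- (\<i> * of_real lam)) * (u * star u * u)"

lemma tame_nl: "0 < m ==> i \<in> I ==> tame E I (\<lambda>_ w. nl lam (rho m (w i)))"
  unfolding nl_def by (intro tame_mult tame_star tame_rho tame_cst[OF order_refl])

lemma synth_nl: "synth (nl lam y) p = - \<i> * of_real lam * of_real ((cmod (synth y p))\<^sup>2) * synth y p"
  by (simp add: nl_def synth_mult synth_star complex_norm_square del: of_real_power)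

text \<open>Division by \<open>i eps\<close> puts the equation into the form of the advected
  operator with zero velocity, so that the passage between functions and coefficients applies to
  it.\<close>

lemma nls_iff_advected:
  assumes "0 < eps"
  shows "\<i> * of_real eps * dt T u z + of_real (eps\<^sup>2 / 2) * laplace T u z = of_real (eps * lam * (cmod (u z))\<^sup>2) * u z
    \<longleftrightarrow> advected T eps 0 u z = - \<i> * of_real lam * of_real ((cmod (u z))\<^sup>2) * u z"
proof -
  have 1: "\<i> * of_real eps * advected T eps 0 u z = \<i> * of_real eps * dt T u z + of_real (eps\<^sup>2 / 2) * laplace T u z"
    by (simp add: advected_def algebra_simps power2_eq_square)
  have 2: "\<i> * of_real eps * (- \<i> * of_real lam * of_real ((cmod (u z))\<^sup>2) * u z) = of_real (eps * lam * (cmod (u z))\<^sup>2) * u z"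
    by (simp add: algebra_simps)
  have 3: "\<i> * of_real eps \<noteq> (0 :: complex)" using assms by simp
  show ?thesis unfolding 1[symmetric] 2[symmetric] by (rule mult_left_cancel[OF 3])
qed

lemma nls_unique:
  fixes v :: "real \<Rightarrow> 'd::finite wien"
  assumes T: "0 < T" and eps: "0 < eps" and v: "smf {eps} T (\<lambda>_. v)"
    and d: "\<And>t. t \<in> {0..T} ==> (v has_vector_derivative gen (psi 0 eps) (v t) + nl lam (v t)) (at t within {0..T})"
    and init: "synth (v 0) = u0"
  shows "unique_solution T (nls_solution lam eps T u0) (syn v)"
  unfolding unique_solution_def
proof (intro conjI allI impI ballI)
  have smv: "smoothw (v t)" if "t \<in> {0..T}" for t using rd_smoothw[OF smf_rd[OF v] _ that] by simp
  show "nls_solution lam eps T u0 (syn v)"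
    unfolding nls_solution_def nls_iff_advected[OF eps]
  proof (intro conjI ballI allI)
    show "smooth_periodic T (syn v)" by (rule smf_smooth_periodic[OF v T])
    show "syn v (0, p) = u0 p" for p using init by (simp add: syn_def)
    fix z :: "real \<times> (real^'d)" assume z: "z \<in> slab T"
    show "advected T eps 0 (syn v) z = - \<i> * of_real lam * of_real ((cmod (syn v z))\<^sup>2) * syn v z"
    proof -
      have "advected T eps 0 (syn v) z = synth (nl lam (v (fst z))) (snd z)" by (rule coef_to_pde[OF smv T eps d z])
      then show ?thesis unfolding synth_nl by (simp add: syn_def)
    qed
  qed
  fix w and z :: "real \<times> (real^'d)" assume w: "nls_solution lam eps T u0 w" and z: "z \<in> slab T"
  then have w: "smooth_periodic T w" "\<And>p. w (0, p) = u0 p"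
    "\<And>z. z \<in> slab T ==> advected T eps 0 w z = - \<i> * of_real lam * of_real ((cmod (w z))\<^sup>2) * w z"
    unfolding nls_solution_def nls_iff_advected[OF eps] by auto
  have t: "fst z \<in> {0..T}" using z by (auto simp: slab_def)
  have "(\<lambda>_::unit. fc w) () (fst z) = (\<lambda>_::unit. v) () (fst z)"
  proof (rule poly_unique[where I = "{()}" and N = "\<lambda>_ w. nl lam (w ())" and \<psi> = "\<lambda>_. psi 0 eps" and T = T])
    show "tame {()} {()} (\<lambda>_ u. nl lam (rho m (u ())))" if "0 < m" for m by (rule tame_nl[OF that]) simp
    show "pbdd (\<lambda>n. of_real (psi 0 eps n))" by (rule psi_pbdd[OF eps])
    show "smoothw (fc w t)" if "t \<in> {0..T}" for t
      using rd_smoothw[OF smf_rd[OF smooth_periodic_smf[OF w(1), of "{eps}"]] _ that] by simp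
    show "(fc w has_vector_derivative gen (psi 0 eps) (fc w t) + nl lam (fc w t)) (at t within {0..T})" if "t \<in> {0..T}" for t
    proof (rule pde_to_coef[OF w(1) T eps _ that])
      fix z :: "real \<times> (real^'d)" assume z: "z \<in> slab T"
      show "advected T eps 0 w z = synth (nl lam (fc w (fst z))) (snd z)"
        unfolding w(3)[OF z] synth_nl using syn_fc[OF w(1) z] by (simp add: syn_def)
    qed
    show "fc w 0 = v 0"
    proof (rule synth_inject, rule ext)
      fix p
      have "(0, p) \<in> (slab T :: (real \<times> (real^'d)) set)" using T by (simp add: slab_def)
      from syn_fc[OF w(1) this] show "synth (fc w 0) p = synth (v 0) p" using init w(2) by (simp add: syn_def)
    qed
  qed (use smv d t in auto)
  then show "w z = syn v z" using syn_fc[OF w(1) z] by (simp add: syn_def)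
qed

context modulation
begin

text \<open>The equation is truncated at a radius exceeding the bound of \<open>u\<close> by one. On
  \<open>u\<close> the truncation is inactive, so the energy estimate bounds the difference by
  \<open>C * eps^2\<close>; for small \<open>eps\<close> this is at most one, so it is inactive on
  the exact solution too, which gives existence and error bound together.\<close>

lemma nls_approx:
  assumes u: "ok u" and D: "ok D" and dd: "dd u (\<lambda>eps t. nl lam (u eps t) + cst (of_real (eps\<^sup>2)) * D eps t)"
    and init: "\<And>eps. eps \<in> E ==> smoothw (u0 eps)" "\<And>eps. eps \<in> E ==> norm (u0 eps - u eps 0) \<le> c0 * eps\<^sup>2" and c0: "0 \<le> c0"
  shows "\<exists>eps1>0. \<exists>C v. \<forall>eps\<in>E. eps < eps1 \<longrightarrow> smf {eps} T (\<lambda>_. v eps) \<and> v eps 0 = u0 eps \<and> (\<forall>t\<in>{0..T}.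
    (v eps has_vector_derivative gen (psi 0 eps) (v eps t) + nl lam (v eps t)) (at t within {0..T}) \<and> norm (v eps t - u eps t) \<le> C * eps\<^sup>2)"
proof -
  obtain U where U: "0 \<le> U" "\<And>eps t. eps \<in> E ==> t \<in> {0..T} ==> norm (u eps t) \<le> U" using ok_bound[OF u] by blast
  obtain d where d: "0 \<le> d" "\<And>eps t. eps \<in> E ==> t \<in> {0..T} ==> norm (D eps t) \<le> d" using ok_bound[OF D] by blast
  define M where "M = U + 1"
  have M: "0 < M" using U by (simp add: M_def)
  let ?P = "\<lambda>(_::unit) (w :: unit \<Rightarrow> 'd wien). nl lam (rho M (w ()))"
  have tame: "tame {()} {()} ?P" by (rule tame_nl[OF M]) simp
  obtain B L K where LK: "tame_with {()} {()} ?P B L K" using tame unfolding tame_def by blast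
  note L0 = tame_withD(3)[OF LK]
  have lip: "norm (nl lam (rho M w) - nl lam (rho M z)) \<le> L * V" if "norm (w - z) \<le> V" for w z :: "'d wien" and V
    using tame_withD(4)[OF LK, of "()" V "\<lambda>_. w" "\<lambda>_. z"] that order_trans[OF norm_ge_zero that] by simp
  define C where "C = 2 * (c0 + d * T) * exp ((2 * L + 1) * T)"
  have C0: "0 \<le> C" using c0 d T by (simp add: C_def)
  have ddu: "smoothw (u eps t)" "(u eps has_vector_derivative gen (psi 0 eps) (u eps t) + (nl lam (u eps t) + cst (of_real (eps\<^sup>2)) * D eps t)) (at t within {0..T})"
    if "eps \<in> E" "t \<in> {0..T}" for eps t using dd that unfolding dd_def by auto
  define P where "P eps v \<longleftrightarrow> smf {eps} T (\<lambda>_. v) \<and> v 0 = u0 eps \<and> (\<forall>t\<in>{0..T}.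
    (v has_vector_derivative gen (psi 0 eps) (v t) + nl lam (v t)) (at t within {0..T}) \<and> norm (v t - u eps t) \<le> C * eps\<^sup>2)" for eps v
  have "\<exists>v. P eps v" if eps: "eps \<in> E" "eps < 1 / (1 + C)" for eps
  proof -
    have e01: "0 < eps" "eps \<le> 1" using E[OF eps(1)] by auto
    have pb: "pbdd (\<lambda>n. of_real (psi 0 eps n))" by (rule psi_pbdd[OF e01(1)])
    obtain A where A: "\<And>s. wle s (u0 eps) (A s)" using init(1)[OF eps(1)] unfolding smoothw_def by metis
    obtain W v where v: "v 0 = u0 eps" "\<And>t s. t \<in> {0..T} ==> wle s (v t) (W s)"
      "\<And>t. t \<in> {0..T} ==> (v has_vector_derivative gen (psi 0 eps) (v t) + nl lam (rho M (v t))) (at t within {0..T})"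
    proof -
      have "\<exists>B'\<ge>0. \<forall>T\<ge>0. \<exists>W y. \<forall>p\<in>{()}. \<forall>r\<in>{()}. (\<forall>y. norm (?P p y) \<le> B') \<and> y p r 0 = u0 eps \<and> (\<forall>t\<in>{0..T}. (\<forall>s. wle s (y p r t) (W s)) \<and>
        (y p r has_vector_derivative gen (psi 0 eps) (y p r t) + ?P p (\<lambda>i. y p i t)) (at t within {0..T}))"
        by (rule tame_system) (use tame pb A in auto)
      then obtain B' where B': "\<And>T. 0 \<le> T ==> \<exists>W y. \<forall>p\<in>{()}. \<forall>r\<in>{()}. (\<forall>y. norm (?P p y) \<le> B') \<and> y p r 0 = u0 eps \<and> (\<forall>t\<in>{0..T}. (\<forall>s. wle s (y p r t) (W s)) \<and>
        (y p r has_vector_derivative gen (psi 0 eps) (y p r t) + ?P p (\<lambda>i. y p i t)) (at t within {0..T}))"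
        by (elim exE conjE) (rule that, drule spec, erule (1) mp)
      obtain W y where "\<forall>p\<in>{()}. \<forall>r\<in>{()}. (\<forall>y. norm (?P p y) \<le> B') \<and> y p r 0 = u0 eps \<and> (\<forall>t\<in>{0..T}. (\<forall>s. wle s (y p r t) (W s)) \<and>
        (y p r has_vector_derivative gen (psi 0 eps) (y p r t) + ?P p (\<lambda>i. y p i t)) (at t within {0..T}))"
        using B'[OF less_imp_le[OF T]] by (elim exE) (rule that)
      then show thesis using that[of "y () ()" W] by auto
    qed
    have smv: "smoothw (v t)" if "t \<in> {0..T}" for t by (rule wle_imp_smoothw[OF v(2)[OF that]])
    have rho_u: "rho M (u eps t) = u eps t" if "t \<in> {0..T}" for t using U(2)[OF eps(1) that] by (intro rho_id) (simp add: M_def)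
    have est: "norm (v t - u eps t) \<le> C * eps\<^sup>2" if t: "t \<in> {0..T}" for t
    proof -
      have "norm ((\<lambda>t. v t - u eps t) t) \<le> 2 * (c0 * eps\<^sup>2 + (eps\<^sup>2 * d) * T) * exp ((2 * L + 1) * t)"
      proof (rule energy_estimate[where I = "{()}" and x = "\<lambda>_ t. v t - u eps t" and \<psi> = "\<lambda>_. psi 0 eps"
            and g = "\<lambda>_ t. (nl lam (rho M (v t)) - nl lam (rho M (u eps t))) - cst (of_real (eps\<^sup>2)) * D eps t"])
        fix t assume t: "t \<in> {0..T}"
        have "gen (psi 0 eps) (v t - u eps t) = gen (psi 0 eps) (v t) - gen (psi 0 eps) (u eps t)"
          unfolding gen_def by (rule mulop_diff[OF pbdd_i[OF pb] smv[OF t] ddu(1)[OF eps(1) t]])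
        then have eq: "gen (psi 0 eps) (v t - u eps t) + ((nl lam (rho M (v t)) - nl lam (rho M (u eps t))) - cst (of_real (eps\<^sup>2)) * D eps t)
          = (gen (psi 0 eps) (v t) + nl lam (rho M (v t))) - (gen (psi 0 eps) (u eps t) + (nl lam (u eps t) + cst (of_real (eps\<^sup>2)) * D eps t))"
          unfolding rho_u[OF t] by simp
        show "((\<lambda>t. v t - u eps t) has_vector_derivative gen (psi 0 eps) (v t - u eps t) +
            ((nl lam (rho M (v t)) - nl lam (rho M (u eps t))) - cst (of_real (eps\<^sup>2)) * D eps t)) (at t within {0..T})"
          unfolding eq by (rule has_vector_derivative_diff[OF v(3)[OF t] ddu(2)[OF eps(1) t]])
        show "smoothw (v t - u eps t)" by (rule smoothw_diff[OF smv[OF t] ddu(1)[OF eps(1) t]])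
        fix V assume "\<And>j. j \<in> {()} ==> norm (v t - u eps t) \<le> V"
        then have "norm (nl lam (rho M (v t)) - nl lam (rho M (u eps t))) \<le> L * V" by (intro lip) simp
        moreover have "norm (cst (of_real (eps\<^sup>2)) * D eps t) \<le> eps\<^sup>2 * d"
          unfolding scaleR_eq_cst[symmetric] using d(2)[OF eps(1) t] by (simp add: mult_left_mono)
        ultimately show "norm ((nl lam (rho M (v t)) - nl lam (rho M (u eps t))) - cst (of_real (eps\<^sup>2)) * D eps t) \<le> L * V + eps\<^sup>2 * d"
          using norm_triangle_ineq4[of "nl lam (rho M (v t)) - nl lam (rho M (u eps t))" "cst (of_real (eps\<^sup>2)) * D eps t"] by linarith
      next
        show "norm (v 0 - u eps 0) \<le> c0 * eps\<^sup>2" using init(2)[OF eps(1)] v(1) by simp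
      qed (use pb L0 c0 d t in auto)
      also have "\<dots> \<le> 2 * (c0 * eps\<^sup>2 + (eps\<^sup>2 * d) * T) * exp ((2 * L + 1) * T)"
        using t c0 d T L0 by (intro mult_left_mono) (auto intro: mult_left_mono)
      also have "\<dots> = C * eps\<^sup>2" by (simp add: C_def algebra_simps)
      finally show ?thesis by simp
    qed
    have "C * eps\<^sup>2 \<le> 1"
    proof -
      have "C * eps\<^sup>2 \<le> C * eps" using e01 C0 by (intro mult_left_mono) (auto simp: power2_eq_square)
      also have "\<dots> \<le> (1 + C) * eps" using e01 by (simp add: algebra_simps)
      also have "\<dots> \<le> 1" using eps(2) C0 by (simp add: field_simps)
      finally show ?thesis .
    qed
    then have "norm (v t) \<le> M" if t: "t \<in> {0..T}" for t
      using est[OF t] U(2)[OF eps(1) t] norm_triangle_ineq[of "v t - u eps t" "u eps t"] by (simp add: M_def)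
    then have dv: "(v has_vector_derivative gen (psi 0 eps) (v t) + nl lam (v t)) (at t within {0..T})" if t: "t \<in> {0..T}" for t
      using v(3)[OF t] rho_id[of "v t" M] t by simp
    have "smf {eps} T (\<lambda>_. v)"
    proof (rule smf_bootstrap[where I = "{()}" and x = "\<lambda>_ _. v" and \<psi> = "\<lambda>_ _. psi 0 eps" and g = "\<lambda>_ _ t. nl lam (v t)"])
      show "rd {eps} T (\<lambda>_. v)" by (rule rdI) (use v(2) in blast)
      show "csm k {eps} T (\<lambda>_ t. nl lam (v t))" if "\<And>i. i \<in> {()} ==> csm k {eps} T (\<lambda>_. v)" for k
        unfolding nl_def by (intro csm_mult csm_star csm_cst[OF order_refl] that) auto
      show "\<exists>c\<ge>0. \<exists>m. \<forall>eps'\<in>{eps}. \<forall>n. \<bar>psi 0 eps n\<bar> \<le> c * wt n ^ m" using psi_bound_ex[of "{eps}" 0] e01 by simp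
    qed (use dv in auto)
    then have "P eps v" unfolding P_def using v(1) dv est by simp
    then show ?thesis by (rule exI[of _ v])
  qed
  note main = this
  define v where "v eps = (SOME v. P eps v)" for eps
  have v: "P eps (v eps)" if "eps \<in> E" "eps < 1 / (1 + C)" for eps
    unfolding v_def by (rule someI_ex[OF main[OF that]])
  have C1: "0 < 1 / (1 + C)" using C0 by simp
  show ?thesis
    by (rule exI[of _ "1 / (1 + C)"], rule conjI[OF C1], rule exI[of _ C], rule exI[of _ v], intro ballI impI)
       (rule v[unfolded P_def])
qed

end

lemma eps_set_mono: "eps0 \<le> eps1 ==> eps_set kp M eps0 \<subseteq> eps_set kp M eps1"
  by (auto simp: eps_set_def)

lemma augment_lat: "K \<subseteq> lat eps ==> augment K \<subseteq> lat eps"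
  unfolding augment_def wave_sum_def by (auto intro!: lat_add lat_diff)

text \<open>Periodicity is demanded of the given wave vectors only. All others arise from them by
  signed sums, which stay in the lattice.\<close>

lemma saturated_lat:
  assumes sat: "saturated kp M R" and eps: "eps \<in> eps_set kp M eps0" and r: "r \<in> {1..R}"
  shows "kp r \<in> lat eps"
proof -
  have "(augment ^^ k) (kp ` {1..M}) \<subseteq> lat eps" for k
  proof (induction k)
    case 0
    then show ?case using eps by (auto simp: eps_set_def lat_def)
  next
    case (Suc k)
    then show ?case by (simp add: augment_lat)
  qed
  then show ?thesis using sat r unfolding saturated_def by blast
qed

lemma saturated_augment: "saturated kp M R ==> augment (kp ` {1..R}) \<subseteq> kp ` {1..R}"
  unfolding saturated_def by auto

context wkb
begin

lemma u_mfe_eq: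
  assumes eps: "eps \<in> E"
  shows "u_mfe lam kp R eps (a eps) (\<lambda>\<nu>. syn (bs \<nu> eps)) z = synth (A eps (fst z) + cst (of_real eps) * (cst (of_real lam) *
     ((\<Sum>\<nu>\<in>N. bs \<nu> eps (fst z) * wv (kap kp \<nu>) (omeg_star kp \<nu>) eps (fst z)) + (\<Sum>\<nu>\<in>N. b \<nu> eps (fst z) * wv (kap kp \<nu>) (omeg kp \<nu>) eps (fst z))))) (snd z)"
proof -
  have kl: "kap kp \<nu> \<in> lat eps" if "\<nu> \<in> N" for \<nu> using kap_lat[OF eps] that by (simp add: nonres_iff)
  have 1: "(\<Sum>r\<in>{1..R}. a eps r z * wave eps (kp r) (\<omega> r) z) = synth (A eps (fst z)) (snd z)"
    unfolding A_def synth_sum by (rule sum.cong) (simp_all add: synth_mult synth_wv[OF lat[OF eps]] a_def syn_def)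
  have 2: "(\<Sum>\<nu>\<in>N. syn (bs \<nu> eps) z * wave eps (kap kp \<nu>) (omeg_star kp \<nu>) z) = synth (\<Sum>\<nu>\<in>N. bs \<nu> eps (fst z) * wv (kap kp \<nu>) (omeg_star kp \<nu>) eps (fst z)) (snd z)"
    unfolding synth_sum by (rule sum.cong) (simp_all add: synth_mult synth_wv[OF kl] syn_def)
  have 3: "(\<Sum>\<nu>\<in>N. b_mod kp (a eps) \<nu> z * wave eps (kap kp \<nu>) (omeg kp \<nu>) z) = synth (\<Sum>\<nu>\<in>N. b \<nu> eps (fst z) * wv (kap kp \<nu>) (omeg kp \<nu>) eps (fst z)) (snd z)"
    unfolding synth_sum by (rule sum.cong) (simp_all add: synth_mult synth_wv[OF kl] b_mod_eq nonres_iff syn_def)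
  show ?thesis unfolding u_mfe_def 1 2 3 by (simp add: synth_add synth_mult distrib_left mult.assoc)
qed

lemma nls_exists:
  assumes bs: "\<And>\<nu>. \<nu> \<in> N ==> smf E T (bs \<nu>)"
    and dbs: "\<And>\<nu> eps t. \<nu> \<in> N ==> eps \<in> E ==> t \<in> {0..T} ==>
      (bs \<nu> eps has_vector_derivative gen (psi (kap kp \<nu>) eps) (bs \<nu> eps t) + dens eps t * bs \<nu> eps t) (at t within {0..T})"
    and init: "\<And>\<nu> eps. \<nu> \<in> N ==> eps \<in> E ==> bs \<nu> eps 0 = - b \<nu> eps 0"
  shows "\<exists>eps1>0. \<exists>C v. \<forall>eps\<in>E. eps < eps1 \<longrightarrow>
    unique_solution T (nls_solution lam eps T (\<lambda>p. \<Sum>r\<in>{1..R}. a eps r (0, p) * cis ((kp r \<bullet> p) / eps))) (v eps) \<and>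
    (\<forall>z\<in>slab T. cmod (v eps z - u_mfe lam kp R eps (a eps) (\<lambda>\<nu>. syn (bs \<nu> eps)) z) \<le> C * eps\<^sup>2)"
proof -
  define Bq where "Bq eps t = cst (of_real lam) * ((\<Sum>\<nu>\<in>N. bs \<nu> eps t * wv (kap kp \<nu>) (omeg_star kp \<nu>) eps t)
     + (\<Sum>\<nu>\<in>N. b \<nu> eps t * wv (kap kp \<nu>) (omeg kp \<nu>) eps t))" for eps t
  obtain u C D where u: "ok u" "ok C" "ok D" "\<And>eps t. u eps t = A eps t + cst (of_real eps) * Bq eps t + cst (of_real (eps\<^sup>2)) * C eps t"
     "dd u (\<lambda>eps t. - (cst (\<i> * of_real lam) * (u eps t * star (u eps t) * u eps t)) + cst (of_real (eps\<^sup>2)) * D eps t)"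
    using ansatz[OF bs dbs] unfolding Bq_def by blast
  obtain c where c: "0 \<le> c" "\<And>eps t. eps \<in> E ==> t \<in> {0..T} ==> norm (C eps t) \<le> c" using ok_bound[OF u(2)] by blast
  have T0: "0 \<in> {0..T}" using T by simp
  \<comment> \<open>At time zero a plane wave does not depend on its frequency, so
    \<open>b_star = - b\<close> cancels the terms of order \<open>eps\<close>. What remains of the
    initial error is the corrector, of order \<open>eps^2\<close>.\<close>
  have Bq0: "Bq eps 0 = 0" if "eps \<in> E" for eps
  proof -
    have "(\<Sum>\<nu>\<in>N. bs \<nu> eps 0 * wv (kap kp \<nu>) (omeg_star kp \<nu>) eps 0) = (\<Sum>\<nu>\<in>N. - (b \<nu> eps 0 * wv (kap kp \<nu>) (omeg kp \<nu>) eps 0))"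
      by (rule sum.cong) (simp_all add: init that wv_def)
    then show ?thesis by (simp add: Bq_def sum_negf)
  qed
  have normC: "norm (cst (of_real (eps\<^sup>2)) * C eps t) \<le> c * eps\<^sup>2" if "eps \<in> E" "t \<in> {0..T}" for eps t
    unfolding scaleR_eq_cst[symmetric] using c(2)[OF that] by (simp add: mult.commute mult_right_mono)
  have "\<exists>eps1>0. \<exists>C v. \<forall>eps\<in>E. eps < eps1 \<longrightarrow> smf {eps} T (\<lambda>_. v eps) \<and> v eps 0 = A eps 0 \<and> (\<forall>t\<in>{0..T}.
    (v eps has_vector_derivative gen (psi 0 eps) (v eps t) + nl lam (v eps t)) (at t within {0..T}) \<and> norm (v eps t - u eps t) \<le> C * eps\<^sup>2)"
  proof (rule nls_approx[OF u(1,3) _ _ _ c(1)])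
    show "dd u (\<lambda>eps t. nl lam (u eps t) + cst (of_real (eps\<^sup>2)) * D eps t)"
      by (rule dd_cong[OF u(5)]) (simp add: nl_def cst_uminus)
    show "smoothw (A eps 0)" if "eps \<in> E" for eps
      unfolding A_def by (intro smoothw_sum smoothw_mult smoothw_wv smf_smoothw[OF smx] that T0)
    show "norm (A eps 0 - u eps 0) \<le> c * eps\<^sup>2" if "eps \<in> E" for eps
      using normC[OF that T0] by (simp add: u(4) Bq0[OF that])
  qed
  then obtain eps1 Cv v where v: "0 < eps1" "\<And>eps. eps \<in> E ==> eps < eps1 ==> smf {eps} T (\<lambda>_. v eps)" "\<And>eps. eps \<in> E ==> eps < eps1 ==> v eps 0 = A eps 0"
    "\<And>eps t. eps \<in> E ==> eps < eps1 ==> t \<in> {0..T} ==> (v eps has_vector_derivative gen (psi 0 eps) (v eps t) + nl lam (v eps t)) (at t within {0..T})"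
    "\<And>eps t. eps \<in> E ==> eps < eps1 ==> t \<in> {0..T} ==> norm (v eps t - u eps t) \<le> Cv * eps\<^sup>2"
    by blast
  have 1: "unique_solution T (nls_solution lam eps T (\<lambda>p. \<Sum>r\<in>{1..R}. a eps r (0, p) * cis ((kp r \<bullet> p) / eps))) (syn (v eps))"
    if eps: "eps \<in> E" "eps < eps1" for eps
  proof (rule nls_unique[OF T _ v(2)[OF eps] v(4)[OF eps]])
    show "0 < eps" using E[OF eps(1)] by simp
    show "synth (v eps 0) = (\<lambda>p. \<Sum>r\<in>{1..R}. a eps r (0, p) * cis ((kp r \<bullet> p) / eps))"
      unfolding v(3)[OF eps] A_def synth_sum
      by (rule ext, rule sum.cong) (simp_all add: synth_mult synth_wv[OF lat[OF eps(1)]] wave_def a_def syn_def)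
  qed
  have 2: "cmod (syn (v eps) z - u_mfe lam kp R eps (a eps) (\<lambda>\<nu>. syn (bs \<nu> eps)) z) \<le> (Cv + c) * eps\<^sup>2"
    if eps: "eps \<in> E" "eps < eps1" and z: "z \<in> slab T" for eps z
  proof -
    have t: "fst z \<in> {0..T}" using z by (auto simp: slab_def)
    have "syn (v eps) z - u_mfe lam kp R eps (a eps) (\<lambda>\<nu>. syn (bs \<nu> eps)) z =
      synth (v eps (fst z) - (A eps (fst z) + cst (of_real eps) * Bq eps (fst z))) (snd z)"
      unfolding u_mfe_eq[OF eps(1)] syn_def synth_diff Bq_def ..
    then have "cmod (syn (v eps) z - u_mfe lam kp R eps (a eps) (\<lambda>\<nu>. syn (bs \<nu> eps)) z) \<le>
      norm (v eps (fst z) - (A eps (fst z) + cst (of_real eps) * Bq eps (fst z)))" by (simp add: norm_synth_le)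
    also have "v eps (fst z) - (A eps (fst z) + cst (of_real eps) * Bq eps (fst z)) = (v eps (fst z) - u eps (fst z)) + cst (of_real (eps\<^sup>2)) * C eps (fst z)"
      unfolding u(4) by (simp add: algebra_simps)
    also have "norm \<dots> \<le> norm (v eps (fst z) - u eps (fst z)) + norm (cst (of_real (eps\<^sup>2)) * C eps (fst z))" by (rule norm_triangle_ineq)
    also have "\<dots> \<le> (Cv + c) * eps\<^sup>2" using v(5)[OF eps t] normC[OF eps(1) t] by (simp add: distrib_right)
    finally show ?thesis .
  qed
  show ?thesis
    by (rule exI[of _ eps1], rule conjI[OF v(1)], rule exI[of _ "Cv + c"], rule exI[of _ "\<lambda>eps. syn (v eps)"]) (use 1 2 in blast)
qed

end

section \<open>Initial data and uniqueness\<close>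

lemma initial_data:
  fixes a0 :: "real \<Rightarrow> nat \<Rightarrow> real^'d \<Rightarrow> complex"
  assumes "\<forall>m\<in>{1..M}. uniformly_smooth E UNIV (\<lambda>eps. a0 eps m)" "\<forall>m\<in>{1..M}. \<forall>eps\<in>E. periodic (a0 eps m)"
  obtains x0 :: "real \<Rightarrow> nat \<Rightarrow> 'd wien" and A where "0 \<le> A 0"
    "\<And>eps r s. eps \<in> E ==> r \<in> {1..R} ==> wle s (x0 eps r) (A s)"
    "\<And>eps r. eps \<in> E ==> r \<in> {1..R} ==> synth (x0 eps r) = (\<lambda>p. if r \<le> M then a0 eps r p else 0)"
proof -
  have "\<forall>m\<in>{1..M}. \<exists>d :: real \<Rightarrow> 'd wien. (\<forall>eps\<in>E. synth (d eps) = a0 eps m) \<and> (\<forall>s. \<exists>C. \<forall>eps\<in>E. wle s (d eps) C)"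
  proof
    fix m assume m: "m \<in> {1..M}"
    obtain d :: "real \<Rightarrow> 'd wien" where "\<And>eps. eps \<in> E ==> synth (d eps) = a0 eps m" "\<And>s. \<exists>C. \<forall>eps\<in>E. wle s (d eps) C"
      using uniformly_smooth_data[of E "\<lambda>eps. a0 eps m"] assms m by blast
    then show "\<exists>d :: real \<Rightarrow> 'd wien. (\<forall>eps\<in>E. synth (d eps) = a0 eps m) \<and> (\<forall>s. \<exists>C. \<forall>eps\<in>E. wle s (d eps) C)" by blast
  qed
  then obtain d :: "nat \<Rightarrow> real \<Rightarrow> 'd wien" where d: "\<forall>m\<in>{1..M}. (\<forall>eps\<in>E. synth (d m eps) = a0 eps m) \<and> (\<forall>s. \<exists>C. \<forall>eps\<in>E. wle s (d m eps) C)"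
    unfolding bchoice_iff by blast
  then have "\<forall>m\<in>{1..M}. \<exists>C. \<forall>s. \<forall>eps\<in>E. wle s (d m eps) (C s)" by metis
  then obtain C where C: "\<And>m s eps. m \<in> {1..M} ==> eps \<in> E ==> wle s (d m eps) (C m s)"
    unfolding bchoice_iff by blast
  let ?x0 = "\<lambda>eps r. if r \<le> M then d r eps else 0"
  let ?A = "\<lambda>s. \<Sum>m\<in>{1..M}. \<bar>C m s\<bar>"
  show thesis
  proof (rule that[of ?A ?x0])
    fix eps r assume eps: "eps \<in> E" and r: "r \<in> {1..R}"
    show "synth (?x0 eps r) = (\<lambda>p. if r \<le> M then a0 eps r p else 0)" using d eps r by (auto simp: fun_eq_iff)
    fix s
    show "wle s (?x0 eps r) (?A s)"
    proof (cases "r \<le> M")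
      case True
      then have r: "r \<in> {1..M}" using r by simp
      have "C r s \<le> \<bar>C r s\<bar>" by simp
      also have "\<dots> \<le> ?A s" using r by (intro member_le_sum) auto
      finally show ?thesis using wle_mono[OF C[OF r eps]] True by simp
    qed (simp add: sum_nonneg)
  qed (simp add: sum_nonneg)
qed

lemma a_solution_unique:
  fixes a a' :: "nat \<Rightarrow> real \<times> (real^'d) \<Rightarrow> complex"
  assumes a: "a_solution lam kp M R eps T a0 a" and a': "a_solution lam kp M R eps T a0 a'"
    and T: "0 < T" and eps: "0 < eps" "eps \<le> 1" and r: "r \<in> {1..R}" and z: "z \<in> slab T"
  shows "a' r z = a r z"
proof -
  have sm: "smoothw (fc (f r) t)" if "smooth_periodic T (f r)" "t \<in> {0..T}" for r t and f :: "nat \<Rightarrow> real \<times> (real^'d) \<Rightarrow> complex"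
    using rd_smoothw[OF smf_rd[OF smooth_periodic_smf[OF that(1), of "{eps}"]] _ that(2)] by simp
  note s = a_solution_to_coef[OF a T eps(1)] and s' = a_solution_to_coef[OF a' T eps(1)]
  have t: "fst z \<in> {0..T}" using z by (auto simp: slab_def)
  have "fc (a' r) (fst z) = fc (a r) (fst z)"
  proof (rule nlx_unique[where x = "\<lambda>r. fc (a' r)" and y = "\<lambda>r. fc (a r)" and T = T and R = R and kp = kp and lam = lam, OF eps])
    show "fc (a' r) 0 = fc (a r) 0" if "r \<in> {1..R}" for r
      by (rule synth_inject) (simp only: s(2)[OF that] s'(2)[OF that])
  qed (use s s' r t in \<open>auto intro: sm\<close>)
  then show ?thesis using syn_fc[OF s(1)[OF r] z] syn_fc[OF s'(1)[OF r] z] by (simp add: syn_def)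
qed

theorem theorem7p1:
  fixes lam :: real and M R :: nat
    and \<kappa> :: "nat \<Rightarrow> real^'d"
    and a0 :: "real \<Rightarrow> nat \<Rightarrow> real^'d \<Rightarrow> complex"
  assumes "lam \<noteq> 0"
    and "M \<le> R" and "inj_on \<kappa> {1..R}" and "\<forall>m\<in>{1..M}. \<kappa> m \<noteq> 0"
    and "saturated \<kappa> M R"
    and "nonresonance \<kappa> R"
    and "\<forall>m\<in>{1..M}. uniformly_smooth (eps_set \<kappa> M 1) UNIV (\<lambda>\<epsilon>. a0 \<epsilon> m)"
    and "\<forall>m\<in>{1..M}. \<forall>\<epsilon>\<in>eps_set \<kappa> M 1. periodic (a0 \<epsilon> m)"
  shows "(\<exists>T. existence_time lam \<kappa> M R a0 T) \<and>
    (\<forall>T. existence_time lam \<kappa> M R a0 T \<longrightarrow>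
      (\<exists>\<epsilon>0>0. \<exists>u a bs bl.
        (\<forall>\<epsilon>\<in>eps_set \<kappa> M \<epsilon>0.
           unique_solution T (nls_solution lam \<epsilon> T (initial_wave \<kappa> M \<epsilon> (a0 \<epsilon>))) (u \<epsilon>) \<and>
           a_solution lam \<kappa> M R \<epsilon> T (a0 \<epsilon>) (a \<epsilon>) \<and>
           (\<forall>a'. a_solution lam \<kappa> M R \<epsilon> T (a0 \<epsilon>) a' \<longrightarrow>
              (\<forall>r\<in>{1..R}. \<forall>z\<in>slab T. a' r z = a \<epsilon> r z)) \<and>
           (\<forall>\<nu>\<in>nonres \<kappa> R.
              unique_solution T (b_star_solution lam \<kappa> R \<epsilon> T (a \<epsilon>) \<nu>) (bs \<epsilon> \<nu>) \<and>
              unique_solution T (b_linear_solution \<kappa> \<epsilon> T (a \<epsilon>) \<nu>) (bl \<epsilon> \<nu>))) \<and>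
        (\<forall>r\<in>{1..R}. uniformly_smooth (eps_set \<kappa> M \<epsilon>0) (slab T) (\<lambda>\<epsilon>. a \<epsilon> r)) \<and>
        (\<forall>\<nu>\<in>nonres \<kappa> R.
           uniformly_smooth (eps_set \<kappa> M \<epsilon>0) (slab T) (\<lambda>\<epsilon>. b_mod \<kappa> (a \<epsilon>) \<nu>) \<and>
           uniformly_smooth (eps_set \<kappa> M \<epsilon>0) (slab T) (\<lambda>\<epsilon>. bs \<epsilon> \<nu>)) \<and>
        (\<forall>\<nu>\<in>nonres \<kappa> R. \<exists>C. \<forall>\<epsilon>\<in>eps_set \<kappa> M \<epsilon>0. \<forall>z\<in>slab T.
           cmod (b_mod \<kappa> (a \<epsilon>) \<nu> z - bl \<epsilon> \<nu> z) \<le> C * \<epsilon>) \<and>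
        (\<exists>C. \<forall>\<epsilon>\<in>eps_set \<kappa> M \<epsilon>0. \<forall>z\<in>slab T.
           cmod (u \<epsilon> z - u_mfe lam \<kappa> R \<epsilon> (a \<epsilon>) (bs \<epsilon>) z) \<le> C * \<epsilon>\<^sup>2)))"
proof -
  note inj = assms(3) and sat = assms(5) and nonr = assms(6)
  obtain A and x0 :: "real \<Rightarrow> nat \<Rightarrow> 'd wien" where x0: "0 \<le> A 0"
    "\<And>eps r s. eps \<in> eps_set \<kappa> M 1 ==> r \<in> {1..R} ==> wle s (x0 eps r) (A s)"
    "\<And>eps r. eps \<in> eps_set \<kappa> M 1 ==> r \<in> {1..R} ==> synth (x0 eps r) = (\<lambda>p. if r \<le> M then a0 eps r p else 0)"
    by (rule initial_data[OF assms(7,8), of R]) (rule that, assumption, blast, blast)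
  have E1: "0 < eps \<and> eps \<le> 1" if "eps \<in> eps_set \<kappa> M 1" for eps using that by (simp add: eps_set_def)
  show ?thesis
  proof (intro conjI allI impI, goal_cases)
    \<comment> \<open>A first existence time comes from the truncated system. The common bound
      \<open>m\<close> of the algebra norms supplies the bound on absolute values that is part of
      \<open>existence_time\<close>.\<close>
    case 1
    have "\<exists>T>0. \<exists>m x. \<forall>eps\<in>eps_set \<kappa> M 1. \<forall>r\<in>{1..R}. smf {eps} T (\<lambda>_. x eps r) \<and> x eps r 0 = x0 eps r \<and>
     (\<forall>t\<in>{0..T}. norm (x eps r t) \<le> m \<and>
      (x eps r has_vector_derivative gen (psi (\<kappa> r) eps) (x eps r t) + nlx lam \<kappa> R r eps (\<lambda>i. x eps i t)) (at t within {0..T}))"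
      by (rule local_existence[OF E1 x0(2,1)])
    then obtain T m x where T: "0 < T" and x: "\<forall>eps\<in>eps_set \<kappa> M 1. \<forall>r\<in>{1..R}. smf {eps} T (\<lambda>_. x eps r) \<and> x eps r 0 = x0 eps r \<and>
     (\<forall>t\<in>{0..T}. norm (x eps r t) \<le> m \<and>
      (x eps r has_vector_derivative gen (psi (\<kappa> r) eps) (x eps r t) + nlx lam \<kappa> R r eps (\<lambda>i. x eps i t)) (at t within {0..T}))"
      by (elim exE conjE) (rule that)
    have "\<exists>a. a_solution lam \<kappa> M R eps T (a0 eps) a \<and> (\<forall>r\<in>{1..R}. \<forall>z\<in>slab T. cmod (a r z) \<le> m)" if eps: "eps \<in> eps_set \<kappa> M 1" for eps
    proof (intro exI[of _ "\<lambda>r. syn (x eps r)"] conjI ballI)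
      show "a_solution lam \<kappa> M R eps T (a0 eps) (\<lambda>r. syn (x eps r))"
        by (rule coef_to_a_solution[where y = "x eps"]) (use x eps T E1[OF eps] x0(3)[OF eps] in auto)
      fix r and z :: "real \<times> (real^'d)" assume r: "r \<in> {1..R}" and z: "z \<in> slab T"
      have "norm (x eps r (fst z)) \<le> m" using x eps r z by (auto simp: slab_def)
      then show "cmod (syn (x eps r) z) \<le> m" unfolding syn_def by (rule order_trans[OF norm_synth_le])
    qed
    then have "existence_time lam \<kappa> M R a0 T" unfolding existence_time_def using T zero_less_one by blast
    then show ?case ..
  next
    case (2 T)
    then obtain epsa B where T: "0 < T" and epsa: "0 < epsa" and ex: "\<And>eps. eps \<in> eps_set \<kappa> M epsa ==>
       \<exists>a. a_solution lam \<kappa> M R eps T (a0 eps) a \<and> (\<forall>r\<in>{1..R}. \<forall>z\<in>slab T. cmod (a r z) \<le> B)"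
      unfolding existence_time_def by blast
    \<comment> \<open>Restricting to \<open>eps\<close> below 1 gives access to the uniform bounds
      on the data, restricting below \<open>epsa\<close> to the solutions in the hypothesis on
      \<open>T\<close>.\<close>
    define E2 where "E2 = eps_set \<kappa> M (min 1 epsa)"
    have E2: "E2 \<subseteq> eps_set \<kappa> M 1" "E2 \<subseteq> eps_set \<kappa> M epsa" unfolding E2_def by (rule eps_set_mono; simp)+
    have "\<exists>y. \<forall>r\<in>{1..R}. y r 0 = x0 eps r \<and> (\<forall>t\<in>{0..T}. smoothw (y r t) \<and>
      (y r has_vector_derivative gen (psi (\<kappa> r) eps) (y r t) + nlx lam \<kappa> R r eps (\<lambda>i. y i t)) (at t within {0..T}) \<and>
      (\<forall>p. norm (synth (y r t) p) \<le> B))" if eps: "eps \<in> E2" for eps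
    proof -
      have eps1: "eps \<in> eps_set \<kappa> M 1" using E2 eps by blast
      have eps0: "0 < eps" using E1[OF eps1] by simp
      obtain a where a: "a_solution lam \<kappa> M R eps T (a0 eps) a" "\<And>r z. r \<in> {1..R} ==> z \<in> slab T ==> cmod (a r z) \<le> B"
        using ex[of eps] E2 eps by blast
      note s = a_solution_to_coef[OF a(1) T eps0]
      show ?thesis
      proof (rule exI[of _ "\<lambda>r. fc (a r)"], intro ballI conjI allI)
        fix r assume r: "r \<in> {1..R}"
        show "fc (a r) 0 = x0 eps r" by (rule synth_inject) (simp add: s(2)[OF r] x0(3)[OF eps1 r])
        fix t assume t: "t \<in> {0..T}"
        show "smoothw (fc (a r) t)" using rd_smoothw[OF smf_rd[OF smooth_periodic_smf[OF s(1)[OF r], of "{eps}"]] _ t] by simp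
        show "(fc (a r) has_vector_derivative gen (psi (\<kappa> r) eps) (fc (a r) t) + nlx lam \<kappa> R r eps (\<lambda>i. fc (a i) t)) (at t within {0..T})"
          by (rule s(3)[OF r t])
        fix p :: "real^'d"
        have z: "(t, p) \<in> slab T" using t by (simp add: slab_def)
        show "norm (synth (fc (a r) t) p) \<le> B" using a(2)[OF r z] syn_fc[OF s(1)[OF r] z] by (simp add: syn_def)
      qed
    qed
    then have "\<exists>eps1>0. \<exists>W x. \<forall>eps\<in>E2. eps < eps1 \<longrightarrow> (\<forall>r\<in>{1..R}. x eps r 0 = x0 eps r \<and> (\<forall>t\<in>{0..T}. (\<forall>s. wle s (x eps r t) (W s)) \<and>
      (x eps r has_vector_derivative gen (psi (\<kappa> r) eps) (x eps r t) + nlx lam \<kappa> R r eps (\<lambda>i. x eps i t)) (at t within {0..T})))"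
      by (intro uniform_bounds[OF _ T]) (use E1 E2 x0(2) in blast)+
    then obtain epsb W x where epsb: "0 < epsb" and x: "\<forall>eps\<in>E2. eps < epsb \<longrightarrow> (\<forall>r\<in>{1..R}. x eps r 0 = x0 eps r \<and> (\<forall>t\<in>{0..T}. (\<forall>s. wle s (x eps r t) (W s)) \<and>
      (x eps r has_vector_derivative gen (psi (\<kappa> r) eps) (x eps r t) + nlx lam \<kappa> R r eps (\<lambda>i. x eps i t)) (at t within {0..T})))"
      by (elim exE conjE) (rule that)
    define E3 where "E3 = eps_set \<kappa> M (min (min 1 epsa) epsb)"
    have E32: "E3 \<subseteq> E2" unfolding E3_def E2_def by (rule eps_set_mono[OF min.cobounded1])
    have E3: "0 < eps \<and> eps \<le> 1" if "eps \<in> E3" for eps using E1 E32 E2(1) that by blast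
    have E3b: "eps \<in> E2" "eps < epsb" if "eps \<in> E3" for eps using that E32 by (auto simp: E3_def eps_set_def)
    have x3: "x eps r 0 = x0 eps r" "\<And>t s. t \<in> {0..T} ==> wle s (x eps r t) (W s)"
      "\<And>t. t \<in> {0..T} ==> (x eps r has_vector_derivative gen (psi (\<kappa> r) eps) (x eps r t) + nlx lam \<kappa> R r eps (\<lambda>i. x eps i t)) (at t within {0..T})"
      if "eps \<in> E3" "r \<in> {1..R}" for eps r
      using x E3b[OF that(1)] that(2) by auto
    have smx: "smf E3 T (\<lambda>eps. x eps r)" if "r \<in> {1..R}" for r
      by (rule solution_smf[OF E3 x3(2) x3(3) that])
    interpret wkb lam \<kappa> R T E3 x
    proof
      show "\<kappa> r \<in> lat eps" if "eps \<in> E3" "r \<in> {1..R}" for eps r using saturated_lat[OF sat _ that(2)] that(1) unfolding E3_def by blast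
    qed (use E3 T smx x3(3) inj saturated_augment[OF sat] nonr in auto)
    have T3: "\<nu> \<in> T3 R" if "\<nu> \<in> N" for \<nu> using that by (simp add: nonres_iff)
    \<comment> \<open>The families for \<open>b_star\<close> are selected together with their
      coefficient equations, because the residual computation works with these equations.\<close>
    define P where "P \<nu> y \<longleftrightarrow> smf E3 T y \<and> (\<forall>eps\<in>E3. y eps 0 = - b \<nu> eps 0 \<and> (\<forall>t\<in>{0..T}.
       (y eps has_vector_derivative gen (psi (kap \<kappa> \<nu>) eps) (y eps t) + dens eps t * y eps t) (at t within {0..T})) \<and>
     unique_solution T (b_star_solution lam \<kappa> R eps T (a eps) \<nu>) (syn (y eps)))" for \<nu> y
    define bs where "bs \<nu> = (SOME y. P \<nu> y)" for \<nu>
    have "P \<nu> (bs \<nu>)" if "\<nu> \<in> N" for \<nu>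
      unfolding bs_def by (rule someI_ex[where P = "P \<nu>"]) (use b_star_exists[OF T3[OF that]] in \<open>simp only: P_def\<close>)
    then have bs: "\<And>\<nu>. \<nu> \<in> N ==> smf E3 T (bs \<nu>)" "\<And>\<nu> eps. \<nu> \<in> N ==> eps \<in> E3 ==> bs \<nu> eps 0 = - b \<nu> eps 0"
      "\<And>\<nu> eps t. \<nu> \<in> N ==> eps \<in> E3 ==> t \<in> {0..T} ==> (bs \<nu> eps has_vector_derivative gen (psi (kap \<kappa> \<nu>) eps) (bs \<nu> eps t) + dens eps t * bs \<nu> eps t) (at t within {0..T})"
      "\<And>\<nu> eps. \<nu> \<in> N ==> eps \<in> E3 ==> unique_solution T (b_star_solution lam \<kappa> R eps T (a eps) \<nu>) (syn (bs \<nu> eps))"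
      unfolding P_def by auto
    define Q where "Q \<nu> y \<longleftrightarrow> (\<exists>C. \<forall>eps\<in>E3. unique_solution T (b_linear_solution \<kappa> eps T (a eps) \<nu>) (syn (y eps)) \<and>
      (\<forall>z\<in>slab T. cmod (b_mod \<kappa> (a eps) \<nu> z - syn (y eps) z) \<le> C * eps))" for \<nu> y
    define bl where "bl \<nu> = (SOME y. Q \<nu> y)" for \<nu>
    have "Q \<nu> (bl \<nu>)" if "\<nu> \<in> N" for \<nu>
      unfolding bl_def by (rule someI_ex[where P = "Q \<nu>"]) (use b_linear_exists[OF T3[OF that] delta_nonzero[OF that]] in \<open>simp only: Q_def\<close>)
    then have "\<forall>\<nu>\<in>N. \<exists>C. \<forall>eps\<in>E3. unique_solution T (b_linear_solution \<kappa> eps T (a eps) \<nu>) (syn (bl \<nu> eps)) \<and>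
      (\<forall>z\<in>slab T. cmod (b_mod \<kappa> (a eps) \<nu> z - syn (bl \<nu> eps) z) \<le> C * eps)" unfolding Q_def by blast
    then obtain Cl where bl: "\<And>\<nu> eps. \<nu> \<in> N ==> eps \<in> E3 ==> unique_solution T (b_linear_solution \<kappa> eps T (a eps) \<nu>) (syn (bl \<nu> eps))"
      "\<And>\<nu> eps z. \<nu> \<in> N ==> eps \<in> E3 ==> z \<in> slab T ==> cmod (b_mod \<kappa> (a eps) \<nu> z - syn (bl \<nu> eps) z) \<le> Cl \<nu> * eps"
      unfolding bchoice_iff by blast
    have "\<exists>epsc>0. \<exists>C v. \<forall>eps\<in>E3. eps < epsc \<longrightarrow>
      unique_solution T (nls_solution lam eps T (\<lambda>p. \<Sum>r\<in>{1..R}. a eps r (0, p) * cis ((\<kappa> r \<bullet> p) / eps))) (v eps) \<and>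
      (\<forall>z\<in>slab T. cmod (v eps z - u_mfe lam \<kappa> R eps (a eps) (\<lambda>\<nu>. syn (bs \<nu> eps)) z) \<le> C * eps\<^sup>2)"
      by (rule nls_exists[of bs, OF bs(1) bs(3) bs(2)])
    then obtain epsc C v where epsc: "0 < epsc" and v: "\<forall>eps\<in>E3. eps < epsc \<longrightarrow>
      unique_solution T (nls_solution lam eps T (\<lambda>p. \<Sum>r\<in>{1..R}. a eps r (0, p) * cis ((\<kappa> r \<bullet> p) / eps))) (v eps) \<and>
      (\<forall>z\<in>slab T. cmod (v eps z - u_mfe lam \<kappa> R eps (a eps) (\<lambda>\<nu>. syn (bs \<nu> eps)) z) \<le> C * eps\<^sup>2)"
      by (elim exE conjE) (rule that)
    define eps0 where "eps0 = min (min (min 1 epsa) epsb) epsc"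
    let ?E = "eps_set \<kappa> M eps0"
    have E: "?E \<subseteq> E3" unfolding eps0_def E3_def by (rule eps_set_mono[OF min.cobounded1])
    have Ec: "eps < epsc" if "eps \<in> ?E" for eps using that by (simp add: eps_set_def eps0_def)
    have sub1: "eps \<in> eps_set \<kappa> M 1" if "eps \<in> E3" for eps using that E32 E2(1) by blast
    have asol: "a_solution lam \<kappa> M R eps T (a0 eps) (a eps)" if eps: "eps \<in> E3" for eps
    proof -
      have "a_solution lam \<kappa> M R eps T (a0 eps) (\<lambda>r. syn (x eps r))"
      proof (rule coef_to_a_solution[where y = "x eps"])
        show "smf {eps} T (\<lambda>_. x eps r)" if "r \<in> {1..R}" for r by (rule smf_single[OF smx[OF that] eps])
        show "synth (x eps r 0) = (\<lambda>p. if r \<le> M then a0 eps r p else 0)" if "r \<in> {1..R}" for r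
          unfolding x3(1)[OF eps that] by (rule x0(3)[OF sub1[OF eps] that])
      qed (use T E3[OF eps] x3(3)[OF eps] in auto)
      then show ?thesis unfolding a_def[abs_def] .
    qed
    \<comment> \<open>Amplitudes with index above \<open>M\<close> vanish at time zero, so the sum
      over all amplitudes is the given initial function.\<close>
    have init: "(\<lambda>p. \<Sum>r\<in>{1..R}. a eps r (0, p) * cis ((\<kappa> r \<bullet> p) / eps)) = initial_wave \<kappa> M eps (a0 eps)" if eps: "eps \<in> E3" for eps
    proof
      fix p
      have a0: "a eps r (0, p) = (if r \<le> M then a0 eps r p else 0)" if "r \<in> {1..R}" for r
        using asol[OF eps] that unfolding a_solution_def by blast
      show "(\<Sum>r\<in>{1..R}. a eps r (0, p) * cis ((\<kappa> r \<bullet> p) / eps)) = initial_wave \<kappa> M eps (a0 eps) p"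
        unfolding initial_wave_def
        by (rule sum.mono_neutral_cong_right) (use assms(2) a0 in auto)
    qed
    have b_mod: "(\<lambda>eps. b_mod \<kappa> (a eps) \<nu>) = (\<lambda>eps. syn (b \<nu> eps))" if "\<nu> \<in> N" for \<nu>
      by (rule ext, rule ext, rule b_mod_eq[OF T3[OF that]])
    show ?case
    proof (rule exI[of _ eps0], rule conjI, goal_cases)
      case 1
      show ?case using epsa epsb epsc by (simp add: eps0_def)
    next
      case 2
      show ?case
      proof (rule exI[of _ v], rule exI[of _ a], rule exI[of _ "\<lambda>eps \<nu>. syn (bs \<nu> eps)"], rule exI[of _ "\<lambda>eps \<nu>. syn (bl \<nu> eps)"],
          intro conjI ballI allI impI)
        fix eps assume "eps \<in> ?E"
        then have eps: "eps \<in> E3" "eps < epsc" using E Ec by auto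
        have "unique_solution T (nls_solution lam eps T (\<lambda>p. \<Sum>r\<in>{1..R}. a eps r (0, p) * cis ((\<kappa> r \<bullet> p) / eps))) (v eps)" using v eps by blast
        then show "unique_solution T (nls_solution lam eps T (initial_wave \<kappa> M eps (a0 eps))) (v eps)" unfolding init[OF eps(1)] .
        show "a_solution lam \<kappa> M R eps T (a0 eps) (a eps)" by (rule asol[OF eps(1)])
        show "a' r z = a eps r z" if "a_solution lam \<kappa> M R eps T (a0 eps) a'" "r \<in> {1..R}" "z \<in> slab T" for a' r z
          by (rule a_solution_unique[OF asol[OF eps(1)] that(1) T _ _ that(2,3)]) (use E3[OF eps(1)] in auto)
        show "unique_solution T (b_star_solution lam \<kappa> R eps T (a eps) \<nu>) (syn (bs \<nu> eps))" if "\<nu> \<in> N" for \<nu> by (rule bs(4)[OF that eps(1)])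
        show "unique_solution T (b_linear_solution \<kappa> eps T (a eps) \<nu>) (syn (bl \<nu> eps))" if "\<nu> \<in> N" for \<nu> by (rule bl(1)[OF that eps(1)])
      next
        fix r assume "r \<in> {1..R}"
        then show "uniformly_smooth ?E (slab T) (\<lambda>eps. a eps r)"
          unfolding a_def by (intro smf_uniformly_smooth[OF smf_subset[OF smx E] T])
      next
        fix \<nu> assume \<nu>: "\<nu> \<in> N"
        show "uniformly_smooth ?E (slab T) (\<lambda>eps. b_mod \<kappa> (a eps) \<nu>)"
          unfolding b_mod[OF \<nu>] by (rule smf_uniformly_smooth[OF smf_subset[OF smf_b[OF T3[OF \<nu>]] E] T])
        show "uniformly_smooth ?E (slab T) (\<lambda>eps. syn (bs \<nu> eps))"
          by (rule smf_uniformly_smooth[OF smf_subset[OF bs(1)[OF \<nu>] E] T])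
        show "\<exists>C. \<forall>eps\<in>?E. \<forall>z\<in>slab T. cmod (b_mod \<kappa> (a eps) \<nu> z - syn (bl \<nu> eps) z) \<le> C * eps"
          using bl(2)[OF \<nu>] E by (intro exI[of _ "Cl \<nu>"]) blast
      next
        show "\<exists>C. \<forall>eps\<in>?E. \<forall>z\<in>slab T. cmod (v eps z - u_mfe lam \<kappa> R eps (a eps) (\<lambda>\<nu>. syn (bs \<nu> eps)) z) \<le> C * eps\<^sup>2"
          using v E Ec by (intro exI[of _ C]) blast
      qed
    qed
  qed
qed

end
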